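(* Let $q\in(0,1)$, $t\in[0,1]$. Let $D$ be an equivariant self-adjoint operator on the Hilbert space of spinors $\mathcal H$ such that $D$ and the closure of the Casimir operator $C_q$ strongly commute. Then each $\mathcal W^l_m=\mathrm{span}\{v^l_{m,-},v^l_{m,+}\}$ ($l=\tfrac12,\tfrac32,\dots$, $m=-l,\dots,l$) is invariant under $D$ and, in the basis $\{v^l_{m,-},v^l_{m,+}\}$, the restriction of $D$ to $\mathcal W^l_m$ is given, independently of $m$, by $$D_l=U_l^*\begin{pmatrix}d_l^\uparrow&0\\0&d_l^\downarrow\end{pmatrix}U_l$$ with $U_l$ a unitary operator on $\mathbb C^2$ and real numbers $d_l^\downarrow\le d_l^\uparrow$. Moreover, $(\mathcal A(S^2_{qt}),\mathcal H,D)$ defines a $\mathcal U_q(\mathrm{su}(2))$-equivariant spectral triple in each of the following cases: (i) $t\neq1$, $\lim_{l\to\infty}|d_l^\uparrow|=\lim_{l\to\infty}|d_l^\downarrow|=\infty$, and there exists $C\in\mathbb R$ such that $$\left\|U_{l+1}^*\begin{pmatrix}d_{l+1}^\uparrow&0\\0&d_{l+1}^\downarrow\end{pmatrix}U_{l+1}-U_l^*\begin{pmatrix}d_l^\uparrow&0\\0&d_l^\downarrow\end{pmatrix}U_l\right\|<C\quad\text{for all }l=\tfrac12,\tfrac32,\dots;$$ (ii) $t=1$, $\lim_{l\to\infty}|d_l^\uparrow|=\lim_{l\to\infty}|d_l^\downarrow|=\infty$, and there exists $C\in\mathbb R$ such that $|d_l^\downarrow|<Cq^{-l}$ and $|d_l^\uparrow|<Cq^{-l}$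 for all $l=\tfrac12,\tfrac32,\dots$.
   Context: Let $[n]=(q^n-q^{-n})/(q-q^{-1})$ for $n\in\mathbb R$. Algebra. $\mathcal A(S^2_{qt})$ is the unital complex $*$-algebra generated by $x_{-1},x_0,x_1$ with relations $x_{-1}(x_0-t)=q^2(x_0-t)x_{-1}$, $x_1(x_0-t)=q^{-2}(x_0-t)x_1$, $-[2]x_{-1}x_1+(q^2x_0+t)(x_0-t)=[2]^2(1-t)$, $-[2]x_1x_{-1}+(q^{-2}x_0+t)(x_0-t)=[2]^2(1-t)$, and involution $x_{-1}^*=-q^{-1}x_1$, $x_0^*=x_0$. Symmetry. $\mathcal U=\mathcal U_q(\mathrm{su}(2))$ is the Hopf $*$-algebra generated by $e,f,k,k^{-1}$ with relations $kk^{-1}=k^{-1}k=1$, $k^2-k^{-2}=(q-q^{-1})(fe-ef)$, $kf=qfk$, $ke=q^{-1}ek$; coproduct $\Delta k=k\otimes k$, $\Delta f=f\otimes k+k^{-1}\otimes f$, $\Delta e=e\otimes k+k^{-1}\otimes e$; counit $\varepsilon(k)=1$, $\varepsilon(e)=\varepsilon(f)=0$; antipode $S(k)=k^{-1}$, $S(f)=-qf$, $S(e)=-q^{-1}e$; involution $k^*=k$, $f^*=e$. $\mathcal A(S^2_{qt})$ is a left $\mathcal U$-module $*$-algebra via $k\triangleright x_i=q^ix_i$; $f\triangleright x_{-1}=[2]^{1/2}x_0$, $f\triangleright x_0=[2]^{1/2}x_1$, $f\triangleright x_1=0$; $e\triangleright x_{-1}=0$, $e\triangleright x_0=[2]^{1/2}x_{-1}$,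 $e\triangleright x_1=[2]^{1/2}x_0$. The Casimir operator is $C_q=qk^2+q^{-1}k^{-2}+(q-q^{-1})^2ef$. Spinors. $\mathcal H$ is the Hilbert space with orthonormal basis $v^l_{m,\pm}$ ($l\in\tfrac12+\mathbb N_0$, $m=-l,\dots,l$); $\mathcal W$ is the (algebraic) linear span of the basis. $\mathcal U$ acts on $\mathcal W$ by $kv^l_{m,\pm}=q^mv^l_{m,\pm}$, $fv^l_{m,\pm}=[l-m]^{1/2}[l+m+1]^{1/2}v^l_{m+1,\pm}$, $ev^l_{m,\pm}=[l-m+1]^{1/2}[l+m]^{1/2}v^l_{m-1,\pm}$. Then $C_qv^l_{m,\pm}=(q^{2l+1}+q^{-2l-1})v^l_{m,\pm}$, and the closure of $C_q$ is self-adjoint. The spinor representation $\pi$ of $\mathcal A(S^2_{qt})$ by bounded operators on $\mathcal H$ is $$\pi(x_i)v^l_{m,\pm}=\alpha_i^-(l,m;\pm\tfrac12)v^{l-1}_{m+i,\pm}+\alpha_i^0(l,m;\pm\tfrac12)v^l_{m+i,\pm}+\alpha_i^+(l,m;\pm\tfrac12)v^{l+1}_{m+i,\pm},$$ where a term is $0$ if the vector in it does not exist (i.e. $l-1<\tfrac12$ or $|m+i|$ exceeds the spin), and $\alpha^+_1(l,m;N)=q^{-l+m}[l+m+1]^{1/2}[l+m+2]^{1/2}[2l+1]^{-1/2}[2l+2]^{-1/2}\alpha_N(l+1)$, $\alpha^0_1(l,m;N)=-q^{m+2}[l-m]^{1/2}[l+m+1]^{1/2}[2]^{1/2}[2l]^{-1}\beta_N(l)$,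 $\alpha^-_1(l,m;N)=-q^{l+m+1}[l-m-1]^{1/2}[l-m]^{1/2}[2l-1]^{-1/2}[2l]^{-1/2}\alpha_N(l)$, $\alpha^+_0(l,m;N)=q^m[l-m+1]^{1/2}[l+m+1]^{1/2}[2]^{1/2}[2l+1]^{-1/2}[2l+2]^{-1/2}\alpha_N(l+1)$, $\alpha^0_0(l,m;N)=[2l]^{-1}\big([l-m+1][l+m]-q^2[l-m][l+m+1]\big)\beta_N(l)$, $\alpha^-_0(l,m;N)=q^m[l-m]^{1/2}[l+m]^{1/2}[2]^{1/2}[2l-1]^{-1/2}[2l]^{-1/2}\alpha_N(l)$, $\alpha^+_{-1}(l,m;N)=q^{l+m}[l-m+1]^{1/2}[l-m+2]^{1/2}[2l+1]^{-1/2}[2l+2]^{-1/2}\alpha_N(l+1)$, $\alpha^0_{-1}(l,m;N)=q^m[l-m+1]^{1/2}[l+m]^{1/2}[2]^{1/2}[2l]^{-1}\beta_N(l)$, $\alpha^-_{-1}(l,m;N)=-q^{-l+m-1}[l+m-1]^{1/2}[l+m]^{1/2}[2l-1]^{-1/2}[2l]^{-1/2}\alpha_N(l)$, with, for $\epsilon=\mathrm{sign}(N)$, $$\alpha_N(l)=\frac{[2]^{1/2}[l+N]^{1/2}[l-N]^{1/2}[2l]^{1/2}}{[2l+1]^{1/2}[l]}\Big(1-t+q^{-2N}[2l]^{-2}[l]^2(t-1+q^{2N})^2\Big)^{1/2},$$ $$\beta_N(l)=\frac{\epsilon[2|N|](q^{-1}+q-q^{\epsilon}t)+t(q-q^{-1})\{[|N|][|N|+1]-[l][l+1]\}}{q[2l+2]}.$$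 $\pi$ is $\mathcal U$-equivariant on $\mathcal W$: $h\,\pi(x)\xi=\pi(h_{(1)}\triangleright x)h_{(2)}\xi$ for $h\in\mathcal U$, $x\in\mathcal A(S^2_{qt})$, $\xi\in\mathcal W$. Definitions. $D$ is equivariant if $D h\xi=hD\xi$ for all $h\in\mathcal U$, $\xi\in\mathcal W$ (strong commutation with the closure of $C_q$ guarantees that $\mathcal W$ lies in the domain of $D$ and is $D$-invariant). A spectral triple $(\mathcal A,\mathcal H,D)$: a complex unital $*$-algebra $\mathcal A$, a faithful $*$-representation $\pi$ by bounded operators on $\mathcal H$, and a self-adjoint $D$ with $(D+\mathrm i)^{-1}$ compact and $[D,\pi(a)]$ bounded for all $a\in\mathcal A$. It is $\mathcal U$-equivariant if $\pi$ is $\mathcal U$-equivariant on $\mathcal W$ and $D$ is equivariant. *)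

theory Defs
  imports
    "HOL-Analysis.Analysis"
    "HOL-Algebra.Algebraic_Closure_Type"
    "HOL-Library.Poly_Mapping"
    "HOL-Library.Product_Plus"
begin

section \<open>Complex Hilbert spaces\<close>

text \<open>
  The complex inner product is conjugate-linear in the first argument; its real part is the
  inner product of the underlying real Hilbert space, which fixes norm and topology.
\<close>

class complex_hilbert_space = real_inner + complete_space +
  fixes scaleC :: "complex \<Rightarrow> 'a \<Rightarrow> 'a"  (infixr \<open>*\<^sub>C\<close> 75)
    and cinner :: "'a \<Rightarrow> 'a \<Rightarrow> complex"
  assumes scaleC_add_right: "c *\<^sub>C (x + y) = c *\<^sub>C x + c *\<^sub>C y"
    and scaleC_add_left: "(c + d) *\<^sub>C x = c *\<^sub>C x + d *\<^sub>C x"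
    and scaleC_scaleC: "c *\<^sub>C (d *\<^sub>C x) = (c * d) *\<^sub>C x"
    and scaleR_scaleC: "r *\<^sub>R x = complex_of_real r *\<^sub>C x"
    and cinner_commute: "cinner x y = cnj (cinner y x)"
    and cinner_add_right: "cinner x (y + z) = cinner x y + cinner x z"
    and cinner_scaleC_right: "cinner x (c *\<^sub>C y) = c * cinner x y"
    and inner_eq_Re_cinner: "x \<bullet> y = Re (cinner x y)"

definition bounded_clinear :: "('h::complex_hilbert_space \<Rightarrow> 'h) \<Rightarrow> bool" where
  "bounded_clinear T \<longleftrightarrow> bounded_linear T \<and> (\<forall>c x. T (c *\<^sub>C x) = c *\<^sub>C T x)"

definition compact_operator :: "('h::complex_hilbert_space \<Rightarrow> 'h) \<Rightarrow> bool" where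
  "compact_operator T \<longleftrightarrow> bounded_clinear T \<and> compact (closure (T ` ball 0 1))"


section \<open>Unbounded operators\<close>

text \<open>
  An unbounded operator is given by its graph, so that its domain is the relational
  \<^const>\<open>Domain\<close>, its inverse is \<^const>\<open>converse\<close>, and the closure of an operator is the topological
  \<^const>\<open>closure\<close> of its graph.
\<close>

definition linear_operator :: "('h::complex_hilbert_space \<times> 'h) set \<Rightarrow> bool" where
  "linear_operator G \<longleftrightarrow> single_valued G \<and> (0, 0) \<in> G \<and>
    (\<forall>x y x' y'. (x, y) \<in> G \<longrightarrow> (x', y') \<in> G \<longrightarrow> (x + x', y + y') \<in> G) \<and>
    (\<forall>c x y. (x, y) \<in> G \<longrightarrow> (c *\<^sub>C x, c *\<^sub>C y) \<in> G)"

definition adjoint_operator ::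
    "('h::complex_hilbert_space \<times> 'h) set \<Rightarrow> ('h \<times> 'h) set" where
  "adjoint_operator G = {(y, z). \<forall>(x, w) \<in> G. cinner y w = cinner z x}"

definition self_adjoint :: "('h::complex_hilbert_space \<times> 'h) set \<Rightarrow> bool" where
  "self_adjoint G \<longleftrightarrow>
    linear_operator G \<and> closure (Domain G) = UNIV \<and> adjoint_operator G = G"

definition plus_i :: "('h::complex_hilbert_space \<times> 'h) set \<Rightarrow> ('h \<times> 'h) set" where
  "plus_i G = {(x, y + \<i> *\<^sub>C x) | x y. (x, y) \<in> G}"

definition compact_resolvent :: "('h::complex_hilbert_space \<times> 'h) set \<Rightarrow> bool" where
  "compact_resolvent G \<longleftrightarrow>
    (\<exists>T. compact_operator T \<and> converse (plus_i G) = {(x, T x) | x. True})"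

text \<open>\<open>T\<close> maps the domain of \<open>G\<close> into itself and \<open>[G, T]\<close> is bounded there.\<close>

definition bounded_commutator ::
    "('h::complex_hilbert_space \<times> 'h) set \<Rightarrow> ('h \<Rightarrow> 'h) \<Rightarrow> bool" where
  "bounded_commutator G T \<longleftrightarrow>
    (\<exists>C. \<forall>(x, y) \<in> G. \<exists>z. (T x, z) \<in> G \<and> norm (z - T y) \<le> C * norm x)"

definition projection_valued_measure ::
    "(real set \<Rightarrow> 'h::complex_hilbert_space \<Rightarrow> 'h) \<Rightarrow> bool" where
  "projection_valued_measure P \<longleftrightarrow>
    (\<forall>M \<in> sets borel. bounded_clinear (P M) \<and> P M \<circ> P M = P M \<and>
        (\<forall>x y. cinner (P M x) y = cinner x (P M y))) \<and>
    P UNIV = id \<and>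
    (\<forall>M :: nat \<Rightarrow> real set. range M \<subseteq> sets borel \<longrightarrow> disjoint_family M \<longrightarrow>
        (\<forall>x. (\<lambda>n. P (M n) x) sums P (\<Union>n. M n) x))"

text \<open>The Borel measure \<open>M \<mapsto> \<langle>x, P(M) x\<rangle> = \<parallel>P(M) x\<parallel>\<^sup>2\<close>.\<close>

definition spectral_distribution ::
    "(real set \<Rightarrow> 'h::complex_hilbert_space \<Rightarrow> 'h) \<Rightarrow> 'h \<Rightarrow> real measure" where
  "spectral_distribution P x =
    measure_of UNIV (sets borel) (\<lambda>M. ennreal ((norm (P M x))\<^sup>2))"

text \<open>
  \<open>G = \<integral> s dP(s)\<close>; by polarization the quadratic form \<open>\<langle>x, G x\<rangle>\<close> on the domain
  determines \<open>G\<close>.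
\<close>

definition spectral_measure ::
    "(real set \<Rightarrow> 'h::complex_hilbert_space \<Rightarrow> 'h) \<Rightarrow> ('h \<times> 'h) set \<Rightarrow> bool" where
  "spectral_measure P G \<longleftrightarrow>
    projection_valued_measure P \<and> linear_operator G \<and>
    Domain G = {x. integrable (spectral_distribution P x) (\<lambda>s. s\<^sup>2)} \<and>
    (\<forall>(x, y) \<in> G. cinner x y = of_real (integral\<^sup>L (spectral_distribution P x) (\<lambda>s. s)))"

definition strongly_commute ::
    "('h::complex_hilbert_space \<times> 'h) set \<Rightarrow> ('h \<times> 'h) set \<Rightarrow> bool" where
  "strongly_commute A B \<longleftrightarrow>
    (\<exists>P Q. spectral_measure P A \<and> spectral_measure Q B \<and>
      (\<forall>M \<in> sets borel. \<forall>N \<in> sets borel. P M \<circ> Q N = Q N \<circ> P M))"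


section \<open>Star algebras and spectral triples\<close>

record 'a star_alg = "(complex, 'a) module" +
  star :: "'a \<Rightarrow> 'a"

definition star_algebra :: "'a star_alg \<Rightarrow> bool" where
  "star_algebra A \<longleftrightarrow>
    ring A \<and> module (ring_of_type_algebra :: complex ring) A \<and>
    (\<forall>c. \<forall>a \<in> carrier A. \<forall>b \<in> carrier A.
        (c \<odot>\<^bsub>A\<^esub> a) \<otimes>\<^bsub>A\<^esub> b = c \<odot>\<^bsub>A\<^esub> (a \<otimes>\<^bsub>A\<^esub> b) \<and> a \<otimes>\<^bsub>A\<^esub> (c \<odot>\<^bsub>A\<^esub> b) = c \<odot>\<^bsub>A\<^esub> (a \<otimes>\<^bsub>A\<^esub> b)) \<and>
    (\<forall>a \<in> carrier A. star A a \<in> carrier A \<and> star A (star A a) = a \<and>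
        (\<forall>c. star A (c \<odot>\<^bsub>A\<^esub> a) = cnj c \<odot>\<^bsub>A\<^esub> star A a)) \<and>
    (\<forall>a \<in> carrier A. \<forall>b \<in> carrier A.
        star A (a \<oplus>\<^bsub>A\<^esub> b) = star A a \<oplus>\<^bsub>A\<^esub> star A b \<and>
        star A (a \<otimes>\<^bsub>A\<^esub> b) = star A b \<otimes>\<^bsub>A\<^esub> star A a)"

definition star_representation ::
    "'a star_alg \<Rightarrow> ('a \<Rightarrow> 'h::complex_hilbert_space \<Rightarrow> 'h) \<Rightarrow> bool" where
  "star_representation A \<pi> \<longleftrightarrow>
    (\<forall>a \<in> carrier A. bounded_clinear (\<pi> a)) \<and>
    \<pi> \<one>\<^bsub>A\<^esub> = id \<and>
    (\<forall>a \<in> carrier A. \<forall>b \<in> carrier A.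
        \<pi> (a \<oplus>\<^bsub>A\<^esub> b) = (\<lambda>\<xi>. \<pi> a \<xi> + \<pi> b \<xi>) \<and> \<pi> (a \<otimes>\<^bsub>A\<^esub> b) = \<pi> a \<circ> \<pi> b) \<and>
    (\<forall>c. \<forall>a \<in> carrier A. \<pi> (c \<odot>\<^bsub>A\<^esub> a) = (\<lambda>\<xi>. c *\<^sub>C \<pi> a \<xi>)) \<and>
    (\<forall>a \<in> carrier A. \<forall>\<xi> \<eta>. cinner (\<pi> (star A a) \<xi>) \<eta> = cinner \<xi> (\<pi> a \<eta>))"

definition spectral_triple ::
    "'a star_alg \<Rightarrow> ('a \<Rightarrow> 'h::complex_hilbert_space \<Rightarrow> 'h) \<Rightarrow> ('h \<times> 'h) set \<Rightarrow> bool" where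
  "spectral_triple A \<pi> D \<longleftrightarrow>
    star_algebra A \<and> star_representation A \<pi> \<and> inj_on \<pi> (carrier A) \<and>
    self_adjoint D \<and> compact_resolvent D \<and>
    (\<forall>a \<in> carrier A. bounded_commutator D (\<pi> a))"


section \<open>Free algebras and quotients\<close>

text \<open>
  The free monoid is written additively, so that finitely supported complex functions on it form,
  with the convolution product of \<^theory>\<open>HOL-Library.Poly_Mapping\<close>, the free unital algebra.
  Finitely supported functions on pairs of words form the tensor square of the free algebra.
\<close>

datatype 'g word = Word (letters: "'g list")

instantiation word :: (type) monoid_add
begin
definition zero_word :: "'a word" where "zero_word = Word []"
definition plus_word :: "'a word \<Rightarrow> 'a word \<Rightarrow> 'a word" where
  "plus_word u v = Word (letters u @ letters v)"
instance
  by standard (simp_all add: zero_word_def plus_word_def)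
end

type_synonym 'g free_alg = "('g word, complex) poly_mapping"

definition gen :: "'g \<Rightarrow> 'g free_alg" where
  "gen g = Poly_Mapping.single (Word [g]) 1"

definition cst :: "complex \<Rightarrow> ('k::monoid_add, complex) poly_mapping" where
  "cst c = Poly_Mapping.single 0 c"

definition two_sided_ideal :: "'r::ring_1 set \<Rightarrow> 'r set" where
  "two_sided_ideal R = Idl\<^bsub>ring_of_type_algebra\<^esub> R"

definition residue_class :: "'r::ring_1 set \<Rightarrow> 'r \<Rightarrow> 'r set" where
  "residue_class R a = two_sided_ideal R +>\<^bsub>ring_of_type_algebra\<^esub> a"

definition quotient_ring :: "'r::ring_1 set \<Rightarrow> 'r set ring" where
  "quotient_ring R = ring_of_type_algebra Quot two_sided_ideal R"

text \<open>
  The common value of \<open>f\<close> on all representatives; it is only used where \<open>f\<close> is constant on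
  residue classes.
\<close>

definition descend :: "('a \<Rightarrow> 'b) \<Rightarrow> 'a set \<Rightarrow> 'b" where
  "descend f Y = the_elem (f ` Y)"


section \<open>The quantum sphere\<close>

definition qnum :: "real \<Rightarrow> real \<Rightarrow> real" where
  "qnum q n = (q powr n - q powr (- n)) / (q - 1 / q)"

datatype sphere_gen = Xm | X0 | Xp

text \<open>The index \<open>i\<close> of the generator \<open>x\<^sub>i\<close>.\<close>

fun idx :: "sphere_gen \<Rightarrow> real" where
  "idx Xm = - 1" | "idx X0 = 0" | "idx Xp = 1"

definition sphere_relations :: "real \<Rightarrow> real \<Rightarrow> sphere_gen free_alg set" where
  "sphere_relations q t =
    (let c = (\<lambda>r::real. cst (of_real r)); y = gen X0 - c t in
     {gen Xm * y - c (q\<^sup>2) * y * gen Xm,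
      gen Xp * y - c (1 / q\<^sup>2) * y * gen Xp,
      - c (qnum q 2) * gen Xm * gen Xp + (c (q\<^sup>2) * gen X0 + c t) * y
        - c ((qnum q 2)\<^sup>2 * (1 - t)),
      - c (qnum q 2) * gen Xp * gen Xm + (c (1 / q\<^sup>2) * gen X0 + c t) * y
        - c ((qnum q 2)\<^sup>2 * (1 - t))})"

fun star_gen :: "real \<Rightarrow> sphere_gen \<Rightarrow> sphere_gen free_alg" where
  "star_gen q Xm = cst (of_real (- 1 / q)) * gen Xp"
| "star_gen q X0 = gen X0"
| "star_gen q Xp = cst (of_real (- q)) * gen Xm"

definition star_free :: "real \<Rightarrow> sphere_gen free_alg \<Rightarrow> sphere_gen free_alg" where
  "star_free q a = (\<Sum>w \<in> Poly_Mapping.keys a.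
     cst (cnj (Poly_Mapping.lookup a w)) * prod_list (map (star_gen q) (rev (letters w))))"

definition quantum_sphere :: "real \<Rightarrow> real \<Rightarrow> sphere_gen free_alg set star_alg" where
  "quantum_sphere q t = (let R = sphere_relations q t; Q = quotient_ring R in
    \<lparr>carrier = carrier Q, mult = mult Q, one = one Q, zero = zero Q, add = add Q,
     smult = (\<lambda>c. descend (\<lambda>a. residue_class R (cst c * a))),
     star = descend (\<lambda>a. residue_class R (star_free q a))\<rparr>)"


section \<open>The quantized enveloping algebra\<close>

datatype u_gen = Ue | Uf | Uk | Uk_inv

definition u_relations :: "real \<Rightarrow> u_gen free_alg set" where
  "u_relations q =
    (let c = (\<lambda>r::real. cst (of_real r));
         e = gen Ue; f = gen Uf; k = gen Uk; k' = gen Uk_inv in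
     {k * k' - 1, k' * k - 1,
      k * k - k' * k' - c (q - 1 / q) * (f * e - e * f),
      k * f - c q * f * k,
      k * e - c (1 / q) * e * k})"

definition U\<^sub>q :: "real \<Rightarrow> u_gen free_alg set ring" where
  "U\<^sub>q q = quotient_ring (u_relations q)"

text \<open>
  Counit and coproduct on generators; the latter is the list of the pairs \<open>(a, b)\<close> of generators
  such that the coproduct is the sum of the \<open>a \<otimes> b\<close>.
\<close>

fun counit_gen :: "u_gen \<Rightarrow> complex" where
  "counit_gen Uk = 1" | "counit_gen Uk_inv = 1" | "counit_gen Ue = 0" | "counit_gen Uf = 0"

fun coprod_gen :: "u_gen \<Rightarrow> (u_gen \<times> u_gen) list" where
  "coprod_gen Uk = [(Uk, Uk)]"
| "coprod_gen Uk_inv = [(Uk_inv, Uk_inv)]"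
| "coprod_gen Uf = [(Uf, Uk), (Uk_inv, Uf)]"
| "coprod_gen Ue = [(Ue, Uk), (Uk_inv, Ue)]"

type_synonym u_tensor = "(u_gen word \<times> u_gen word, complex) poly_mapping"

definition tensor :: "u_gen free_alg \<Rightarrow> u_gen free_alg \<Rightarrow> u_tensor" where
  "tensor a b = (\<Sum>u \<in> Poly_Mapping.keys a. \<Sum>v \<in> Poly_Mapping.keys b.
     Poly_Mapping.single (u, v) (Poly_Mapping.lookup a u * Poly_Mapping.lookup b v))"

text \<open>
  \<open>U\<^sub>q \<otimes> U\<^sub>q\<close> is the quotient of the tensor square of the free algebra by the ideal generated by
  \<open>r \<otimes> 1\<close> and \<open>1 \<otimes> r\<close> for the defining relations \<open>r\<close>.
\<close>

definition u_tensor_relations :: "real \<Rightarrow> u_tensor set" where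
  "u_tensor_relations q =
    (\<lambda>r. tensor r 1) ` u_relations q \<union> (\<lambda>r. tensor 1 r) ` u_relations q"

definition coprod_free :: "u_gen free_alg \<Rightarrow> u_tensor" where
  "coprod_free h = (\<Sum>w \<in> Poly_Mapping.keys h. cst (Poly_Mapping.lookup h w) *
     prod_list (map (\<lambda>g. \<Sum>(a, b) \<leftarrow> coprod_gen g. tensor (gen a) (gen b)) (letters w)))"

definition coprod :: "real \<Rightarrow> u_gen free_alg set \<Rightarrow> u_tensor set" where
  "coprod q = descend (\<lambda>h. residue_class (u_tensor_relations q) (coprod_free h))"

text \<open>
  The sum \<open>B h\<^sub>(\<^sub>1\<^sub>) h\<^sub>(\<^sub>2\<^sub>)\<close> in Sweedler notation, for \<open>Z\<close> the coproduct of \<open>h\<close>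
  and \<open>B\<close> bilinear on \<open>U\<^sub>q\<close>.
\<close>

definition sweedler :: "real \<Rightarrow>
    (u_gen free_alg set \<Rightarrow> u_gen free_alg set \<Rightarrow> 'h::complex_hilbert_space) \<Rightarrow>
    u_tensor set \<Rightarrow> 'h" where
  "sweedler q B = descend (\<lambda>z. \<Sum>(u, v) \<in> Poly_Mapping.keys z. Poly_Mapping.lookup z (u, v) *\<^sub>C
     B (residue_class (u_relations q) (Poly_Mapping.single u 1))
       (residue_class (u_relations q) (Poly_Mapping.single v 1)))"

definition casimir_element :: "real \<Rightarrow> u_gen free_alg set" where
  "casimir_element q =
    (let c = (\<lambda>r::real. cst (of_real r)) in
     residue_class (u_relations q)
       (c q * gen Uk * gen Uk + c (1 / q) * gen Uk_inv * gen Uk_inv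
          + c ((q - 1 / q)\<^sup>2) * gen Ue * gen Uf))"

text \<open>
  The action of \<open>U\<^sub>q\<close> on the sphere. On products it is forced by
  \<open>h \<triangleright> (x y) = (h\<^sub>(\<^sub>1\<^sub>) \<triangleright> x) (h\<^sub>(\<^sub>2\<^sub>) \<triangleright> y)\<close> and \<open>h \<triangleright> 1 = \<epsilon>(h) 1\<close>, which
  is used here for generators \<open>h\<close>.
\<close>

fun act_gen_gen :: "real \<Rightarrow> u_gen \<Rightarrow> sphere_gen \<Rightarrow> sphere_gen free_alg" where
  "act_gen_gen q Uk x = cst (of_real (q powr idx x)) * gen x"
| "act_gen_gen q Uk_inv x = cst (of_real (q powr (- idx x))) * gen x"
| "act_gen_gen q Uf Xm = cst (of_real (sqrt (qnum q 2))) * gen X0"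
| "act_gen_gen q Uf X0 = cst (of_real (sqrt (qnum q 2))) * gen Xp"
| "act_gen_gen q Uf Xp = 0"
| "act_gen_gen q Ue Xm = 0"
| "act_gen_gen q Ue X0 = cst (of_real (sqrt (qnum q 2))) * gen Xm"
| "act_gen_gen q Ue Xp = cst (of_real (sqrt (qnum q 2))) * gen X0"

fun act_gen_letters :: "real \<Rightarrow> u_gen \<Rightarrow> sphere_gen list \<Rightarrow> sphere_gen free_alg" where
  "act_gen_letters q g [] = cst (counit_gen g)"
| "act_gen_letters q g (x # xs) =
    (\<Sum>(a, b) \<leftarrow> coprod_gen g. act_gen_gen q a x * act_gen_letters q b xs)"

definition act_gen_free ::
    "real \<Rightarrow> u_gen \<Rightarrow> sphere_gen free_alg \<Rightarrow> sphere_gen free_alg" where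
  "act_gen_free q g x =
    (\<Sum>w \<in> Poly_Mapping.keys x. cst (Poly_Mapping.lookup x w) * act_gen_letters q g (letters w))"

definition act_free ::
    "real \<Rightarrow> u_gen free_alg \<Rightarrow> sphere_gen free_alg \<Rightarrow> sphere_gen free_alg" where
  "act_free q h x =
    (\<Sum>w \<in> Poly_Mapping.keys h. cst (Poly_Mapping.lookup h w) * foldr (act_gen_free q) (letters w) x)"

definition sphere_act :: "real \<Rightarrow> real \<Rightarrow> u_gen free_alg set \<Rightarrow>
    sphere_gen free_alg set \<Rightarrow> sphere_gen free_alg set" where
  "sphere_act q t H Y =
    descend (\<lambda>(h, x). residue_class (sphere_relations q t) (act_free q h x)) (H \<times> Y)"


section \<open>The Hilbert space of spinors\<close>

definition half_spins :: "real set" where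
  "half_spins = {real n + 1 / 2 | n :: nat. True}"

definition weights :: "real \<Rightarrow> real set" where
  "weights l = {- l + real j | j :: nat. real j \<le> 2 * l}"

text \<open>
  The basis vector \<open>v\<^sup>l\<^sub>m\<^sub>,\<^sub>\<plusminus>\<close> has the index \<open>(l, m, N)\<close> with \<open>N = \<plusminus>1/2\<close>; the space is the
  square-summable sequences on the set of indices.
\<close>

definition spinor_index :: "(real \<times> real \<times> real) set" where
  "spinor_index = {(l, m, N). l \<in> half_spins \<and> m \<in> weights l \<and> N \<in> {- 1 / 2, 1 / 2}}"

typedef spinor = "{f :: real \<times> real \<times> real \<Rightarrow> complex.
    (\<forall>i. i \<notin> spinor_index \<longrightarrow> f i = 0) \<and> (\<lambda>i. (cmod (f i))\<^sup>2) summable_on UNIV}"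
  morphisms coeff Abs_spinor
  by (rule exI[of _ "\<lambda>_. 0"]) simp

setup_lifting type_definition_spinor

lemma sq_summable_add:
  fixes f g :: "'i \<Rightarrow> complex"
  assumes "(\<lambda>i. (cmod (f i))\<^sup>2) summable_on UNIV" "(\<lambda>i. (cmod (g i))\<^sup>2) summable_on UNIV"
  shows "(\<lambda>i. (cmod (f i + g i))\<^sup>2) summable_on UNIV"
proof (rule summable_on_comparison_test)
  show "(\<lambda>i. 2 * (cmod (f i))\<^sup>2 + 2 * (cmod (g i))\<^sup>2) summable_on UNIV"
    by (intro summable_on_add summable_on_cmult_right assms)
  fix i
  have "(cmod (f i + g i))\<^sup>2 \<le> (cmod (f i) + cmod (g i))\<^sup>2"
    by (intro power_mono norm_triangle_ineq) simp
  also have "\<dots> \<le> 2 * (cmod (f i))\<^sup>2 + 2 * (cmod (g i))\<^sup>2"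
    using sum_squares_bound[of "cmod (f i)" "cmod (g i)"] by (simp add: power2_sum)
  finally show "(cmod (f i + g i))\<^sup>2 \<le> 2 * (cmod (f i))\<^sup>2 + 2 * (cmod (g i))\<^sup>2" .
qed simp

lemma sq_summable_mult:
  fixes f :: "'i \<Rightarrow> complex"
  assumes "(\<lambda>i. (cmod (f i))\<^sup>2) summable_on UNIV"
  shows "(\<lambda>i. (cmod (c * f i))\<^sup>2) summable_on UNIV"
  using summable_on_cmult_right[OF assms, of "(cmod c)\<^sup>2"]
  by (simp add: norm_mult power_mult_distrib)

lemma coeff_outside: "i \<notin> spinor_index \<Longrightarrow> coeff x i = 0"
  using coeff[of x] by blast

lemma spinor_eqI: "(\<And>i. coeff x i = coeff y i) \<Longrightarrow> x = y"
  by (metis coeff_inject ext)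

lemma coeff_sq_summable: "(\<lambda>i. (cmod (coeff x i))\<^sup>2) summable_on UNIV"
  using coeff[of x] by auto

lemma coeff_prod_summable: "(\<lambda>i. cnj (coeff x i) * coeff y i) summable_on UNIV"
proof (rule abs_summable_summable, rule summable_on_comparison_test)
  show "(\<lambda>i. (cmod (coeff x i))\<^sup>2 + (cmod (coeff y i))\<^sup>2) summable_on UNIV"
    by (intro summable_on_add coeff_sq_summable)
  fix i
  have "2 * (cmod (coeff x i) * cmod (coeff y i)) \<le> (cmod (coeff x i))\<^sup>2 + (cmod (coeff y i))\<^sup>2"
    using sum_squares_bound[of "cmod (coeff x i)" "cmod (coeff y i)"] by (simp only: mult.assoc)
  moreover have "0 \<le> cmod (coeff x i) * cmod (coeff y i)" by simp
  ultimately have "cmod (coeff x i) * cmod (coeff y i)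
      \<le> (cmod (coeff x i))\<^sup>2 + (cmod (coeff y i))\<^sup>2"
    by linarith
  then show "norm (cnj (coeff x i) * coeff y i)
      \<le> (cmod (coeff x i))\<^sup>2 + (cmod (coeff y i))\<^sup>2"
    by (simp only: norm_mult complex_mod_cnj)
qed simp

instantiation spinor :: real_vector
begin

lift_definition zero_spinor :: spinor is "\<lambda>_. 0" by simp

lift_definition plus_spinor :: "spinor \<Rightarrow> spinor \<Rightarrow> spinor" is "\<lambda>f g i. f i + g i"
  by (auto intro: sq_summable_add)

lift_definition uminus_spinor :: "spinor \<Rightarrow> spinor" is "\<lambda>f i. - f i" by simp

definition minus_spinor :: "spinor \<Rightarrow> spinor \<Rightarrow> spinor" where
  "minus_spinor x y = x + - y"

lift_definition scaleR_spinor :: "real \<Rightarrow> spinor \<Rightarrow> spinor" is "\<lambda>r f i. complex_of_real r * f i"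
  by (auto intro: sq_summable_mult)

lemma coeff_zero [simp]: "coeff (0::spinor) i = 0"
  by transfer simp

lemma coeff_plus [simp]: "coeff (x + y) i = coeff x i + coeff y i"
  by transfer simp

lemma coeff_uminus [simp]: "coeff (- x) i = - coeff x i"
  by transfer simp

lemma coeff_minus [simp]: "coeff (x - y) i = coeff x i - coeff y i"
  by (simp add: minus_spinor_def)

lemma coeff_scaleR [simp]: "coeff (r *\<^sub>R x) i = of_real r * coeff x i"
  by transfer simp

instance
  by standard (rule spinor_eqI; simp add: algebra_simps)+

end

lift_definition scaleC_spinor :: "complex \<Rightarrow> spinor \<Rightarrow> spinor" is "\<lambda>c f i. c * f i"
  by (auto intro: sq_summable_mult)

definition cinner_spinor :: "spinor \<Rightarrow> spinor \<Rightarrow> complex" where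
  "cinner_spinor x y = (\<Sum>\<^sub>\<infinity>i. cnj (coeff x i) * coeff y i)"

lemma coeff_scaleC_spinor [simp]: "coeff (scaleC_spinor c x) i = c * coeff x i"
  by transfer simp

lemma cinner_spinor_commute: "cinner_spinor x y = cnj (cinner_spinor y x)"
  unfolding cinner_spinor_def by (subst infsum_cnj[symmetric]) (simp add: mult.commute)

lemma cinner_spinor_add_right: "cinner_spinor x (y + z) = cinner_spinor x y + cinner_spinor x z"
  unfolding cinner_spinor_def
  by (simp add: distrib_left infsum_add coeff_prod_summable)

lemma cinner_spinor_scaleC_right: "cinner_spinor x (scaleC_spinor c y) = c * cinner_spinor x y"
  unfolding cinner_spinor_def
  by (simp add: infsum_cmult_right' mult.left_commute)

lemma cinner_spinor_self:
  "cinner_spinor x x = of_real (\<Sum>\<^sub>\<infinity>i. (cmod (coeff x i))\<^sup>2)"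
proof -
  have "(\<lambda>i. cnj (coeff x i) * coeff x i) = (\<lambda>i. complex_of_real ((cmod (coeff x i))\<^sup>2))"
    by (rule ext) (simp only: complex_norm_square mult.commute)
  then show ?thesis
    unfolding cinner_spinor_def
    using infsumI[OF has_sum_of_real[OF has_sum_infsum[OF coeff_sq_summable]]] by (simp only:)
qed

lemma scaleR_eq_scaleC_spinor: "r *\<^sub>R x = scaleC_spinor (complex_of_real r) x"
  by (rule spinor_eqI) simp

instantiation spinor :: real_inner
begin

definition inner_spinor :: "spinor \<Rightarrow> spinor \<Rightarrow> real" where
  "inner_spinor x y = Re (cinner_spinor x y)"

definition norm_spinor :: "spinor \<Rightarrow> real" where
  "norm_spinor x = sqrt (inner x x)"

definition dist_spinor :: "spinor \<Rightarrow> spinor \<Rightarrow> real" where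
  "dist_spinor x y = norm (x - y)"

definition sgn_spinor :: "spinor \<Rightarrow> spinor" where
  "sgn_spinor x = inverse (norm x) *\<^sub>R x"

definition uniformity_spinor :: "(spinor \<times> spinor) filter" where
  "uniformity_spinor = (INF e\<in>{0<..}. principal {(x, y). dist x y < e})"

definition open_spinor :: "spinor set \<Rightarrow> bool" where
  "open_spinor U \<longleftrightarrow> (\<forall>x\<in>U. \<forall>\<^sub>F (x', y) in uniformity. x' = x \<longrightarrow> y \<in> U)"

instance
proof
  fix x y z :: spinor and r :: real
  show "x \<bullet> y = y \<bullet> x"
    unfolding inner_spinor_def by (subst cinner_spinor_commute) simp
  show "(x + y) \<bullet> z = x \<bullet> z + y \<bullet> z"
    unfolding inner_spinor_def
    by (subst (1 2 3) cinner_spinor_commute) (simp add: cinner_spinor_add_right)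
  show "r *\<^sub>R x \<bullet> y = r * (x \<bullet> y)"
    unfolding inner_spinor_def scaleR_eq_scaleC_spinor
    by (subst (1 2) cinner_spinor_commute) (simp add: cinner_spinor_scaleC_right)
  show "0 \<le> x \<bullet> x"
    unfolding inner_spinor_def cinner_spinor_self by (simp add: infsum_nonneg)
  show "(x \<bullet> x = 0) = (x = 0)"
  proof
    assume "x \<bullet> x = 0"
    then have z: "(\<Sum>\<^sub>\<infinity>i. (cmod (coeff x i))\<^sup>2) = 0"
      unfolding inner_spinor_def cinner_spinor_self by simp
    have "(cmod (coeff x i))\<^sup>2 = 0" for i
      by (rule nonneg_infsum_le_0D[OF _ coeff_sq_summable]) (use z in auto)
    then show "x = 0" by (intro spinor_eqI) simp
  next
    assume "x = 0"
    then show "x \<bullet> x = 0" by (simp add: inner_spinor_def cinner_spinor_def)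
  qed
qed (rule dist_spinor_def sgn_spinor_def uniformity_spinor_def open_spinor_def norm_spinor_def)+

end

lemma norm_spinor_sq: "(norm (x::spinor))\<^sup>2 = (\<Sum>\<^sub>\<infinity>i. (cmod (coeff x i))\<^sup>2)"
  unfolding power2_norm_eq_inner inner_spinor_def cinner_spinor_self by simp

lemma sum_coeff_le_norm:
  assumes "finite F"
  shows "(\<Sum>i\<in>F. (cmod (coeff x i))\<^sup>2) \<le> (norm x)\<^sup>2"
  unfolding norm_spinor_sq by (rule finite_sum_le_infsum) (use assms coeff_sq_summable in auto)

lemma cmod_coeff_le_norm: "cmod (coeff x i) \<le> norm x"
  using sum_coeff_le_norm[of "{i}" x] by (simp add: power2_le_iff_abs_le)

instance spinor :: complete_space
proof
  fix Y :: "nat \<Rightarrow> spinor"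
  assume Y: "Cauchy Y"
  have "Cauchy (\<lambda>n. coeff (Y n) i)" for i
  proof (rule metric_CauchyI)
    fix e :: real assume "0 < e"
    then obtain M where M: "\<forall>m\<ge>M. \<forall>n\<ge>M. dist (Y m) (Y n) < e"
      using metric_CauchyD[OF Y] by blast
    have "dist (coeff (Y m) i) (coeff (Y n) i) \<le> dist (Y m) (Y n)" for m n
      using cmod_coeff_le_norm[of "Y m - Y n" i] by (simp add: dist_norm)
    with M have "\<forall>m\<ge>M. \<forall>n\<ge>M. dist (coeff (Y m) i) (coeff (Y n) i) < e"
      using le_less_trans by blast
    then show "\<exists>M. \<forall>m\<ge>M. \<forall>n\<ge>M. dist (coeff (Y m) i) (coeff (Y n) i) < e" ..
  qed
  then have "convergent (\<lambda>n. coeff (Y n) i)" for i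
    by (rule Cauchy_convergent)
  then obtain f where f: "\<And>i. (\<lambda>n. coeff (Y n) i) \<longlonglongrightarrow> f i"
    unfolding convergent_LIMSEQ_iff by (rule that)
  have f0: "f i = 0" if "i \<notin> spinor_index" for i
    using f[of i] by (simp add: coeff_outside[OF that] LIMSEQ_const_iff)
  have tail: "(\<Sum>i\<in>F. (cmod (f i - coeff (Y n) i))\<^sup>2) \<le> e\<^sup>2"
    if "\<And>m. m \<ge> n \<Longrightarrow> dist (Y m) (Y n) \<le> e" "0 \<le> e" "finite F" for n e F
  proof (rule tendsto_upperbound)
    show "(\<lambda>m. \<Sum>i\<in>F. (cmod (coeff (Y m) i - coeff (Y n) i))\<^sup>2)
        \<longlonglongrightarrow> (\<Sum>i\<in>F. (cmod (f i - coeff (Y n) i))\<^sup>2)"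
      by (intro tendsto_intros f)
    have "(\<Sum>i\<in>F. (cmod (coeff (Y m) i - coeff (Y n) i))\<^sup>2) \<le> e\<^sup>2" if "m \<ge> n" for m
    proof -
      have "(\<Sum>i\<in>F. (cmod (coeff (Y m) i - coeff (Y n) i))\<^sup>2) \<le> (norm (Y m - Y n))\<^sup>2"
        using sum_coeff_le_norm[OF \<open>finite F\<close>, of "Y m - Y n"] by simp
      also have "\<dots> \<le> e\<^sup>2"
        using \<open>\<And>m. m \<ge> n \<Longrightarrow> dist (Y m) (Y n) \<le> e\<close>[OF that] \<open>0 \<le> e\<close>
        by (intro power_mono) (auto simp: dist_norm)
      finally show ?thesis .
    qed
    then show "\<forall>\<^sub>F m in sequentially. (\<Sum>i\<in>F. (cmod (coeff (Y m) i - coeff (Y n) i))\<^sup>2) \<le> e\<^sup>2"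
      by (rule eventually_sequentiallyI)
  qed simp
  have ev: "\<exists>M. \<forall>n\<ge>M. \<forall>m\<ge>n. dist (Y m) (Y n) \<le> e" if e: "0 < e" for e
  proof -
    obtain M where "\<forall>m\<ge>M. \<forall>n\<ge>M. dist (Y m) (Y n) < e"
      using metric_CauchyD[OF Y e] by blast
    then have "\<forall>n\<ge>M. \<forall>m\<ge>n. dist (Y m) (Y n) \<le> e"
      using le_trans less_imp_le by blast
    then show ?thesis ..
  qed
  have diff_summable: "(\<lambda>i. (cmod (f i - coeff (Y n) i))\<^sup>2) summable_on UNIV"
    if "\<And>m. m \<ge> n \<Longrightarrow> dist (Y m) (Y n) \<le> e" "0 \<le> e" for n e
    by (rule nonneg_bdd_above_summable_on) (use tail[OF that] in \<open>auto simp: bdd_above_def\<close>)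
  obtain M1 where M1: "\<And>m. m \<ge> M1 \<Longrightarrow> dist (Y m) (Y M1) \<le> 1"
    using ev[of 1] by auto
  have fs: "(\<lambda>i. (cmod (f i))\<^sup>2) summable_on UNIV"
    using sq_summable_add[OF diff_summable[OF M1] coeff_sq_summable[of "Y M1"]] by simp
  define L where "L = Abs_spinor f"
  have L: "coeff L i = f i" for i
    unfolding L_def using f0 fs by (subst Abs_spinor_inverse) auto
  have "Y \<longlonglongrightarrow> L"
  proof (rule metric_LIMSEQ_I)
    fix e :: real assume "0 < e"
    then obtain M where M: "\<forall>n\<ge>M. \<forall>m\<ge>n. dist (Y m) (Y n) \<le> e / 2"
      using ev[of "e / 2"] by auto
    have "dist (Y n) L < e" if "n \<ge> M" for n
    proof -
      have c: "\<And>m. m \<ge> n \<Longrightarrow> dist (Y m) (Y n) \<le> e / 2" using M that by blast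
      have "(norm (L - Y n))\<^sup>2 \<le> (e / 2)\<^sup>2"
        unfolding norm_spinor_sq using \<open>0 < e\<close>
        by (intro infsum_le_finite_sums) (use tail[OF c] diff_summable[OF c] in \<open>auto simp: L\<close>)
      then have "norm (L - Y n) \<le> e / 2"
        using \<open>0 < e\<close> by (simp add: power2_le_iff_abs_le)
      then show ?thesis using \<open>0 < e\<close> by (simp add: dist_norm norm_minus_commute)
    qed
    then show "\<exists>M. \<forall>n\<ge>M. dist (Y n) L < e" by blast
  qed
  then show "convergent Y" by (rule convergentI)
qed

instantiation spinor :: complex_hilbert_space
begin

definition scaleC_spinor_inst: "scaleC = scaleC_spinor"

definition cinner_spinor_inst: "cinner = cinner_spinor"

instance
proof
  fix x y z :: spinor and c d :: complex and r :: real
  show "c *\<^sub>C (x + y) = c *\<^sub>C x + c *\<^sub>C y" "(c + d) *\<^sub>C x = c *\<^sub>C x + d *\<^sub>C x"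
    "c *\<^sub>C (d *\<^sub>C x) = (c * d) *\<^sub>C x" "r *\<^sub>R x = complex_of_real r *\<^sub>C x"
    unfolding scaleC_spinor_inst by (rule spinor_eqI; simp add: algebra_simps)+
  show "cinner x y = cnj (cinner y x)"
    unfolding cinner_spinor_inst by (rule cinner_spinor_commute)
  show "cinner x (y + z) = cinner x y + cinner x z"
    unfolding cinner_spinor_inst by (rule cinner_spinor_add_right)
  show "cinner x (c *\<^sub>C y) = c * cinner x y"
    unfolding cinner_spinor_inst scaleC_spinor_inst by (rule cinner_spinor_scaleC_right)
  show "x \<bullet> y = Re (cinner x y)"
    unfolding cinner_spinor_inst by (rule inner_spinor_def)
qed

end

text \<open>
  \<open>basis_v l m N\<close> is \<open>0\<close> unless \<open>(l, m, N)\<close> is an index, which implements the convention that terms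
  containing a non-existing basis vector are \<open>0\<close>.
\<close>

definition basis_v :: "real \<Rightarrow> real \<Rightarrow> real \<Rightarrow> spinor" where
  "basis_v l m N = Abs_spinor (\<lambda>i. if i = (l, m, N) \<and> i \<in> spinor_index then 1 else 0)"

lemma coeff_basis_v: "coeff (basis_v l m N) i = (if i = (l, m, N) \<and> i \<in> spinor_index then 1 else 0)"
proof -
  have "(\<lambda>i. (cmod (if i = (l, m, N) \<and> i \<in> spinor_index then 1 else 0))\<^sup>2) summable_on UNIV"
    by (rule summable_on_cong_neutral[THEN iffD1, OF _ _ _ summable_on_finite[of "{(l, m, N)}"]])
      auto
  then show ?thesis
    unfolding basis_v_def by (subst Abs_spinor_inverse) auto
qed

definition \<W> :: "spinor set" where
  "\<W> = {\<xi>. finite {i. coeff \<xi> i \<noteq> 0}}"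

fun u_gen_vector :: "real \<Rightarrow> u_gen \<Rightarrow> real \<times> real \<times> real \<Rightarrow> spinor" where
  "u_gen_vector q Uk (l, m, N) = of_real (q powr m) *\<^sub>C basis_v l m N"
| "u_gen_vector q Uk_inv (l, m, N) = of_real (q powr (- m)) *\<^sub>C basis_v l m N"
| "u_gen_vector q Uf (l, m, N) =
    of_real (sqrt (qnum q (l - m)) * sqrt (qnum q (l + m + 1))) *\<^sub>C basis_v l (m + 1) N"
| "u_gen_vector q Ue (l, m, N) =
    of_real (sqrt (qnum q (l - m + 1)) * sqrt (qnum q (l + m))) *\<^sub>C basis_v l (m - 1) N"

text \<open>The action of \<open>U\<^sub>q\<close> on \<open>\<W>\<close>; values at spinors outside \<open>\<W>\<close> are irrelevant.\<close>

definition spinor_act_gen :: "real \<Rightarrow> u_gen \<Rightarrow> spinor \<Rightarrow> spinor" where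
  "spinor_act_gen q g \<xi> = (\<Sum>i | coeff \<xi> i \<noteq> 0. coeff \<xi> i *\<^sub>C u_gen_vector q g i)"

definition spinor_act_free :: "real \<Rightarrow> u_gen free_alg \<Rightarrow> spinor \<Rightarrow> spinor" where
  "spinor_act_free q h \<xi> =
    (\<Sum>w \<in> Poly_Mapping.keys h. Poly_Mapping.lookup h w *\<^sub>C foldr (spinor_act_gen q) (letters w) \<xi>)"

definition spinor_act :: "real \<Rightarrow> u_gen free_alg set \<Rightarrow> spinor \<Rightarrow> spinor" where
  "spinor_act q H \<xi> = descend (\<lambda>h. spinor_act_free q h \<xi>) H"

definition casimir_operator :: "real \<Rightarrow> (spinor \<times> spinor) set" where
  "casimir_operator q = {(\<xi>, spinor_act q (casimir_element q) \<xi>) | \<xi>. \<xi> \<in> \<W>}"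


section \<open>The spinor representation\<close>

definition alphaN :: "real \<Rightarrow> real \<Rightarrow> real \<Rightarrow> real \<Rightarrow> real" where
  "alphaN q t N l =
    sqrt (qnum q 2) * sqrt (qnum q (l + N)) * sqrt (qnum q (l - N)) * sqrt (qnum q (2 * l))
      / (sqrt (qnum q (2 * l + 1)) * qnum q l)
    * sqrt (1 - t + q powr (- 2 * N) / (qnum q (2 * l))\<^sup>2 * (qnum q l)\<^sup>2
              * (t - 1 + q powr (2 * N))\<^sup>2)"

definition betaN :: "real \<Rightarrow> real \<Rightarrow> real \<Rightarrow> real \<Rightarrow> real" where
  "betaN q t N l =
    (sgn N * qnum q (2 * \<bar>N\<bar>) * (1 / q + q - q powr (sgn N) * t)
      + t * (q - 1 / q) * (qnum q \<bar>N\<bar> * qnum q (\<bar>N\<bar> + 1) - qnum q l * qnum q (l + 1)))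
    / (q * qnum q (2 * l + 2))"

fun alpha_plus :: "real \<Rightarrow> real \<Rightarrow> sphere_gen \<Rightarrow> real \<Rightarrow> real \<Rightarrow> real \<Rightarrow> real" where
  "alpha_plus q t Xp l m N =
    q powr (- l + m) * sqrt (qnum q (l + m + 1)) * sqrt (qnum q (l + m + 2))
      / (sqrt (qnum q (2 * l + 1)) * sqrt (qnum q (2 * l + 2))) * alphaN q t N (l + 1)"
| "alpha_plus q t X0 l m N =
    q powr m * sqrt (qnum q (l - m + 1)) * sqrt (qnum q (l + m + 1)) * sqrt (qnum q 2)
      / (sqrt (qnum q (2 * l + 1)) * sqrt (qnum q (2 * l + 2))) * alphaN q t N (l + 1)"
| "alpha_plus q t Xm l m N =
    q powr (l + m) * sqrt (qnum q (l - m + 1)) * sqrt (qnum q (l - m + 2))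
      / (sqrt (qnum q (2 * l + 1)) * sqrt (qnum q (2 * l + 2))) * alphaN q t N (l + 1)"

fun alpha_zero :: "real \<Rightarrow> real \<Rightarrow> sphere_gen \<Rightarrow> real \<Rightarrow> real \<Rightarrow> real \<Rightarrow> real" where
  "alpha_zero q t Xp l m N =
    - (q powr (m + 2)) * sqrt (qnum q (l - m)) * sqrt (qnum q (l + m + 1)) * sqrt (qnum q 2)
      / qnum q (2 * l) * betaN q t N l"
| "alpha_zero q t X0 l m N =
    (qnum q (l - m + 1) * qnum q (l + m) - q\<^sup>2 * qnum q (l - m) * qnum q (l + m + 1))
      / qnum q (2 * l) * betaN q t N l"
| "alpha_zero q t Xm l m N =
    q powr m * sqrt (qnum q (l - m + 1)) * sqrt (qnum q (l + m)) * sqrt (qnum q 2)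
      / qnum q (2 * l) * betaN q t N l"

fun alpha_minus :: "real \<Rightarrow> real \<Rightarrow> sphere_gen \<Rightarrow> real \<Rightarrow> real \<Rightarrow> real \<Rightarrow> real" where
  "alpha_minus q t Xp l m N =
    - (q powr (l + m + 1)) * sqrt (qnum q (l - m - 1)) * sqrt (qnum q (l - m))
      / (sqrt (qnum q (2 * l - 1)) * sqrt (qnum q (2 * l))) * alphaN q t N l"
| "alpha_minus q t X0 l m N =
    q powr m * sqrt (qnum q (l - m)) * sqrt (qnum q (l + m)) * sqrt (qnum q 2)
      / (sqrt (qnum q (2 * l - 1)) * sqrt (qnum q (2 * l))) * alphaN q t N l"
| "alpha_minus q t Xm l m N =
    - (q powr (- l + m - 1)) * sqrt (qnum q (l + m - 1)) * sqrt (qnum q (l + m))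
      / (sqrt (qnum q (2 * l - 1)) * sqrt (qnum q (2 * l))) * alphaN q t N l"

text \<open>
  The bounded operators \<open>\<pi>(x\<^sub>i)\<close>, determined by their values on the orthonormal basis, and their
  extension to the algebra.
\<close>

definition spinor_rep_gen :: "real \<Rightarrow> real \<Rightarrow> sphere_gen \<Rightarrow> spinor \<Rightarrow> spinor" where
  "spinor_rep_gen q t x = (THE T. bounded_clinear T \<and>
    (\<forall>(l, m, N) \<in> spinor_index. T (basis_v l m N) =
        of_real (alpha_minus q t x l m N) *\<^sub>C basis_v (l - 1) (m + idx x) N
      + of_real (alpha_zero q t x l m N) *\<^sub>C basis_v l (m + idx x) N
      + of_real (alpha_plus q t x l m N) *\<^sub>C basis_v (l + 1) (m + idx x) N))"

definition spinor_rep ::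
    "real \<Rightarrow> real \<Rightarrow> sphere_gen free_alg set \<Rightarrow> spinor \<Rightarrow> spinor" where
  "spinor_rep q t Y \<xi> = descend (\<lambda>a. \<Sum>w \<in> Poly_Mapping.keys a.
     Poly_Mapping.lookup a w *\<^sub>C foldr (spinor_rep_gen q t) (letters w) \<xi>) Y"


section \<open>Equivariance\<close>

definition equivariant_representation :: "real \<Rightarrow> real \<Rightarrow>
    (sphere_gen free_alg set \<Rightarrow> spinor \<Rightarrow> spinor) \<Rightarrow> bool" where
  "equivariant_representation q t \<pi> \<longleftrightarrow>
    (\<forall>a \<in> carrier (quantum_sphere q t). \<forall>\<xi> \<in> \<W>. \<pi> a \<xi> \<in> \<W> \<and>
      (\<forall>h \<in> carrier (U\<^sub>q q). spinor_act q h (\<pi> a \<xi>) =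
        sweedler q (\<lambda>h1 h2. \<pi> (sphere_act q t h1 a) (spinor_act q h2 \<xi>)) (coprod q h)))"

text \<open>
  \<open>D h \<xi> = h D \<xi>\<close> for \<open>\<xi> \<in> \<W>\<close>. Since \<open>h\<close> only acts on \<open>\<W>\<close>, this is required whenever
  \<open>\<xi>\<close> is in the domain of \<open>D\<close> and \<open>D \<xi> \<in> \<W>\<close>; that this is always the case is not
  part of the definition.
\<close>

definition equivariant_operator :: "real \<Rightarrow> (spinor \<times> spinor) set \<Rightarrow> bool" where
  "equivariant_operator q D \<longleftrightarrow>
    (\<forall>h \<in> carrier (U\<^sub>q q). \<forall>\<xi> \<in> \<W>. \<forall>\<eta> \<in> \<W>.
      (\<xi>, \<eta>) \<in> D \<longrightarrow> (spinor_act q h \<xi>, spinor_act q h \<eta>) \<in> D)"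

definition equivariant_spectral_triple :: "real \<Rightarrow> real \<Rightarrow> (spinor \<times> spinor) set \<Rightarrow> bool" where
  "equivariant_spectral_triple q t D \<longleftrightarrow>
    spectral_triple (quantum_sphere q t) (spinor_rep q t) D \<and>
    equivariant_representation q t (spinor_rep q t) \<and>
    \<W> \<subseteq> Domain D \<and> D `` \<W> \<subseteq> \<W> \<and> equivariant_operator q D"


section \<open>Restriction of the Dirac operator\<close>

definition conj_transpose :: "complex^'n^'m \<Rightarrow> complex^'m^'n" where
  "conj_transpose A = (\<chi> i j. cnj (A $ j $ i))"

definition unitary_matrix :: "complex^'n^'n \<Rightarrow> bool" where
  "unitary_matrix A \<longleftrightarrow> conj_transpose A ** A = mat 1 \<and> A ** conj_transpose A = mat 1"

definition diag2 :: "real \<Rightarrow> real \<Rightarrow> complex^2^2" where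
  "diag2 a b = (\<chi> i j. if i = j then of_real (if i = 1 then a else b) else 0)"

definition dirac_matrix ::
    "(real \<Rightarrow> complex^2^2) \<Rightarrow> (real \<Rightarrow> real) \<Rightarrow> (real \<Rightarrow> real) \<Rightarrow> real \<Rightarrow> complex^2^2" where
  "dirac_matrix U d_up d_down l = conj_transpose (U l) ** diag2 (d_up l) (d_down l) ** U l"

text \<open>The vector of \<open>\<W>\<^sup>l\<^sub>m\<close> with coordinates \<open>a\<close> in the ordered basis \<open>v\<^sup>l\<^sub>m\<^sub>,\<^sub>-\<close>, \<open>v\<^sup>l\<^sub>m\<^sub>,\<^sub>+\<close>.\<close>

definition spinor_pair :: "real \<Rightarrow> real \<Rightarrow> complex^2 \<Rightarrow> spinor" where
  "spinor_pair l m a = (a $ 1) *\<^sub>C basis_v l m (- 1 / 2) + (a $ 2) *\<^sub>C basis_v l m (1 / 2)"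

definition \<W>\<^sub>l\<^sub>m :: "real \<Rightarrow> real \<Rightarrow> spinor set" where
  "\<W>\<^sub>l\<^sub>m l m = range (spinor_pair l m)"

definition block_form :: "(spinor \<times> spinor) set \<Rightarrow>
    (real \<Rightarrow> complex^2^2) \<Rightarrow> (real \<Rightarrow> real) \<Rightarrow> (real \<Rightarrow> real) \<Rightarrow> bool" where
  "block_form D U d_up d_down \<longleftrightarrow>
    (\<forall>l \<in> half_spins. unitary_matrix (U l) \<and> d_down l \<le> d_up l \<and>
      (\<forall>m \<in> weights l. \<forall>a.
        (spinor_pair l m a, spinor_pair l m (dirac_matrix U d_up d_down l *v a)) \<in> D))"

end

theory Submission imports Defs begin

text \<open>
  Every operator involved is a finite sum of weighted shifts of the orthonormal basis. The
  generators satisfy the equivariance identities of a tensor operator, so the relations of the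
  sphere form a spin-one multiplet together with a scalar, and only one of them has to be checked
  on coefficients. Comparing components of highest spin shows that the representation of the
  sphere is faithful on the algebraic span; hence identities in the algebra, including that
  the action of \<open>U\<^sub>q\<close> and the involution are well defined, can be verified on spinors.

  The Casimir operator separates the spins, so strong commutation makes the spectral projections
  of \<open>D\<close> preserve the finite-dimensional spaces of fixed spin. On these, \<open>D\<close> is bounded and
  invariant, and equivariance under \<open>k\<close> and \<open>f\<close> reduces it to a Hermitian matrix of size two
  for each spin, independent of \<open>m\<close>. The commutators with the generators have coefficients
  \<open>(D\<^sub>l\<^sub>+\<^sub>1 - D\<^sub>l) \<alpha>\<close> and \<open>D\<^sub>l (\<alpha>\<^sub>N - \<alpha>\<^sub>N\<^sub>')\<close>. In case (i) the blocks grow at most linearly while the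
  differences \<open>\<alpha>\<^sub>N - \<alpha>\<^sub>N\<^sub>'\<close> decay like \<open>q\<^bsup>2l\<^esup>\<close>; in case (ii) the \<open>\<alpha>\<^sub>N\<close> themselves decay
  like \<open>q\<^bsup>l\<^esup>\<close> and compensate the growth of the blocks.
\<close>

section \<open>Complex Hilbert spaces\<close>

text \<open>The operations on the sphere algebra and the coproduct are obtained by
  \<open>descend\<close> from free algebras, which is meaningful only after constancy on residue
  classes is shown. The kernel identity \<open>IS_iff\<close> turns this question on the sphere into
  operator identities: the star becomes the adjoint, and the action of \<open>h\<close> becomes
  \<open>h_(1) x S(h_(2))\<close>. Faithfulness rests on a spanning set modulo the ideal, the
  monomials \<open>y^i x_1^j\<close> and \<open>y^i x_{-1}^j\<close> with
  \<open>y = x_0 - t\<close>. The relation checked on coefficients is the third one: up to nonzero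
  factors, \<open>e\<close> sends it to the first, \<open>f\<close> sends the first to the
  difference of the third and the fourth, and the fourth to the second. For \<open>D\<close> the
  obstacle is the domain, since equivariance speaks only about vectors of \<open>\<W>\<close> in the
  domain with image in \<open>\<W>\<close>. The spin spaces enter the domain through the spectral
  measure: a projection of norm below one is zero. Once the blocks are known, self-adjointness fixes
  the whole graph, so that the resolvent and the commutators can be computed on
  coefficients.\<close>

lemma scaleC_one [simp]: "1 *\<^sub>C x = (x :: 'h::complex_hilbert_space)"
  using scaleR_scaleC[of 1 x] by simp

interpretation scaleC: Modules.module "scaleC :: complex \<Rightarrow> 'h \<Rightarrow> 'h::complex_hilbert_space"
  by unfold_locales (simp_all add: scaleC_add_right scaleC_add_left scaleC_scaleC)

declare scaleC.scale_zero_left [simp] scaleC.scale_zero_right [simp]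

lemma cinner_add_left: "cinner (x + y) z = cinner x z + cinner (y :: 'h::complex_hilbert_space) z"
  by (metis cinner_add_right cinner_commute complex_cnj_add)

lemma cinner_scaleC_left: "cinner (c *\<^sub>C x) y = cnj c * cinner (x :: 'h::complex_hilbert_space) y"
  by (metis cinner_commute cinner_scaleC_right complex_cnj_mult)

lemma cinner_zero_right [simp]: "cinner x (0 :: 'h::complex_hilbert_space) = 0"
  using cinner_scaleC_right[of x 0 0] by simp

lemma cinner_zero_left [simp]: "cinner (0 :: 'h::complex_hilbert_space) x = 0"
  using cinner_scaleC_left[of 0 0 x] by simp

lemma cinner_minus_right: "cinner x (- y) = - cinner x (y :: 'h::complex_hilbert_space)"
  using cinner_scaleC_right[of x "-1" y] by (simp add: scaleC.scale_minus_left)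

lemma cinner_diff_right: "cinner x (y - z) = cinner x y - cinner x (z :: 'h::complex_hilbert_space)"
  using cinner_add_right[of x y "- z"] by (simp add: cinner_minus_right)

lemma cinner_self: "cinner x x = of_real ((norm (x :: 'h::complex_hilbert_space))\<^sup>2)"
proof (rule complex_eqI)
  show "Re (cinner x x) = Re (of_real ((norm x)\<^sup>2))"
    by (simp add: power2_norm_eq_inner inner_eq_Re_cinner)
  have "Im (cinner x x) = Im (cnj (cinner x x))" by (metis cinner_commute)
  then show "Im (cinner x x) = Im (of_real ((norm x)\<^sup>2))" by simp
qed

lemma cmod_sq: "(complex_of_real (cmod c))\<^sup>2 = c * cnj c"
  by (metis complex_norm_square of_real_power)

lemma norm_scaleC: "norm (c *\<^sub>C x) = cmod c * norm (x :: 'h::complex_hilbert_space)"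
proof -
  have "complex_of_real ((norm (c *\<^sub>C x))\<^sup>2) = of_real ((cmod c * norm x)\<^sup>2)"
    unfolding cinner_self[symmetric] cinner_scaleC_left cinner_scaleC_right
    by (simp add: cinner_self power_mult_distrib cmod_sq mult_ac)
  then have "(norm (c *\<^sub>C x))\<^sup>2 = (cmod c * norm x)\<^sup>2" using of_real_eq_iff by blast
  then show ?thesis by (simp add: power2_eq_iff_nonneg)
qed

lemma cmod_cinner_le: "cmod (cinner x y) \<le> norm x * norm (y :: 'h::complex_hilbert_space)"
proof (cases "cinner x y = 0")
  case False
  define c where "c = cinner x y"
  \<comment> \<open>A phase that turns the complex product into its modulus, so that the real
    Cauchy-Schwarz inequality applies.\<close>
  define u where "u = cnj c / of_real (cmod c)"
  have "cinner x (u *\<^sub>C y) = of_real (cmod c)"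
    using False unfolding cinner_scaleC_right u_def c_def[symmetric]
    using cmod_sq[of c] by (simp add: field_simps power2_eq_square c_def)
  then have "cmod c = x \<bullet> (u *\<^sub>C y)" by (simp add: inner_eq_Re_cinner)
  also have "\<dots> \<le> norm x * norm (u *\<^sub>C y)" by (rule norm_cauchy_schwarz)
  also have "\<dots> = norm x * norm y" using False by (simp add: norm_scaleC u_def c_def norm_divide)
  finally show ?thesis by (simp add: c_def)
qed simp

lemma bounded_linear_cinner: "bounded_linear (cinner (x :: 'h::complex_hilbert_space))"
proof (rule bounded_linear_intro[where K = "norm x"])
  show "norm (cinner x y) \<le> norm y * norm x" for y
    using cmod_cinner_le[of x y] by (simp add: mult.commute)
qed (simp_all add: cinner_add_right scaleR_scaleC cinner_scaleC_right scaleR_conv_of_real)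

lemma bounded_linear_scaleC: "bounded_linear (scaleC c :: 'h \<Rightarrow> 'h::complex_hilbert_space)"
  by (rule bounded_linear_intro[where K = "cmod c"])
    (simp_all add: scaleC_add_right scaleR_scaleC scaleC_scaleC norm_scaleC mult_ac)

lemma bounded_clinear_add:
  "bounded_clinear S \<Longrightarrow> bounded_clinear T \<Longrightarrow> bounded_clinear (\<lambda>x. S x + T x)"
  unfolding bounded_clinear_def by (auto intro: bounded_linear_add simp: scaleC_add_right)

lemma bounded_clinear_scaleC: "bounded_clinear T \<Longrightarrow> bounded_clinear (\<lambda>x. c *\<^sub>C T x)"
  unfolding bounded_clinear_def
  by (auto intro: bounded_linear_compose[OF bounded_linear_scaleC] simp: scaleC_scaleC mult.commute)

lemma bounded_clinear_comp:
  "bounded_clinear S \<Longrightarrow> bounded_clinear T \<Longrightarrow> bounded_clinear (\<lambda>x. S (T x))"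
  unfolding bounded_clinear_def by (auto intro: bounded_linear_compose)

lemma bounded_clinear_id: "bounded_clinear (\<lambda>x. x)"
  unfolding bounded_clinear_def by (auto intro: bounded_linear_ident)

lemma bounded_clinear_zero: "bounded_clinear (\<lambda>x. 0)"
  unfolding bounded_clinear_def by auto

lemma bounded_clinearD:
  assumes "bounded_clinear T"
  shows "T (x + y) = T x + T y" "T (c *\<^sub>C x) = c *\<^sub>C T x" "T 0 = 0" "T (x - y) = T x - T y"
  using assms unfolding bounded_clinear_def
  by (auto simp: linear_simps bounded_linear.linear linear_add linear_diff linear_0)

section \<open>The space of spinors\<close>

lemma coeff_scaleC [simp]: "coeff (c *\<^sub>C x) i = c * coeff x i"
  by (simp add: scaleC_spinor_inst)

lemma coeff_sum [simp]: "coeff (\<Sum>a\<in>A. f a) i = (\<Sum>a\<in>A. coeff (f a) i)"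
  by (induction A rule: infinite_finite_induct) auto

lemma cinner_spinor_eq: "cinner x y = (\<Sum>\<^sub>\<infinity>i. cnj (coeff x i) * coeff y i)"
  by (simp add: cinner_spinor_inst cinner_spinor_def)

text \<open>The index triple is a single argument, so that moving along the basis is a map on the
  index type.\<close>

definition vec :: "real \<times> real \<times> real \<Rightarrow> spinor" where
  "vec i = basis_v (fst i) (fst (snd i)) (snd (snd i))"

lemma vec_eq: "basis_v l m N = vec (l, m, N)"
  by (simp add: vec_def)

lemma coeff_vec: "coeff (vec i) j = (if j = i \<and> i \<in> spinor_index then 1 else 0)"
  by (cases i) (auto simp: vec_def coeff_basis_v)

lemma vec_outside: "i \<notin> spinor_index \<Longrightarrow> vec i = 0"
  by (rule spinor_eqI) (simp add: coeff_vec)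

lemma cinner_vec_left: "cinner (vec i) x = coeff x i"
proof -
  have "(\<Sum>\<^sub>\<infinity>j. cnj (coeff (vec i) j) * coeff x j) = (\<Sum>\<^sub>\<infinity>j\<in>{i}. cnj (coeff (vec i) j) * coeff x j)"
    by (rule infsum_cong_neutral) (auto simp: coeff_vec)
  then show ?thesis by (auto simp: cinner_spinor_eq coeff_vec coeff_outside)
qed

lemma cinner_vec_right: "cinner x (vec i) = cnj (coeff x i)"
  by (metis cinner_commute cinner_vec_left)

lemma \<W>_zero [simp]: "0 \<in> \<W>" by (simp add: \<W>_def)

lemma \<W>_add [intro]: "x \<in> \<W> \<Longrightarrow> y \<in> \<W> \<Longrightarrow> x + y \<in> \<W>"
  unfolding \<W>_def mem_Collect_eq
  by (rule finite_subset[of _ "{i. coeff x i \<noteq> 0} \<union> {i. coeff y i \<noteq> 0}"]) auto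

lemma \<W>_scaleC [intro]: "x \<in> \<W> \<Longrightarrow> c *\<^sub>C x \<in> \<W>"
  unfolding \<W>_def mem_Collect_eq by (rule finite_subset[of _ "{i. coeff x i \<noteq> 0}"]) auto

lemma \<W>_vec [simp]: "vec i \<in> \<W>"
  unfolding \<W>_def mem_Collect_eq by (rule finite_subset[of _ "{i}"]) (auto simp: coeff_vec split: if_splits)

lemma \<W>_sum [intro]: "(\<And>a. a \<in> A \<Longrightarrow> f a \<in> \<W>) \<Longrightarrow> (\<Sum>a\<in>A. f a) \<in> \<W>"
  by (induction A rule: infinite_finite_induct) auto

lemma \<W>_expand:
  assumes "finite F" "{i. coeff x i \<noteq> 0} \<subseteq> F"
  shows "x = (\<Sum>i\<in>F. coeff x i *\<^sub>C vec i)"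
proof (rule spinor_eqI)
  fix j
  have "coeff (\<Sum>i\<in>F. coeff x i *\<^sub>C vec i) j = (\<Sum>i\<in>F. if i = j then coeff x j else 0)"
    unfolding coeff_sum by (rule sum.cong) (auto simp: coeff_vec coeff_outside)
  also have "\<dots> = coeff x j" using assms by (auto simp: sum.delta)
  finally show "coeff x j = coeff (\<Sum>i\<in>F. coeff x i *\<^sub>C vec i) j" by simp
qed

lemma \<W>_induct [consumes 1, case_names zero vec add scaleC]:
  assumes "x \<in> \<W>" "P 0" "\<And>i. i \<in> spinor_index \<Longrightarrow> P (vec i)"
    "\<And>x y. x \<in> \<W> \<Longrightarrow> y \<in> \<W> \<Longrightarrow> P x \<Longrightarrow> P y \<Longrightarrow> P (x + y)" "\<And>c x. x \<in> \<W> \<Longrightarrow> P x \<Longrightarrow> P (c *\<^sub>C x)"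
  shows "P x"
proof -
  have s: "P (\<Sum>i\<in>F. coeff x i *\<^sub>C vec i)" if "finite F" for F
    using that
  proof (induction F)
    case (insert i F)
    have "P (vec i)" using assms(2,3) vec_outside by metis
    then show ?case unfolding sum.insert[OF insert(1,2)]
      by (intro assms(4,5) \<W>_sum \<W>_scaleC \<W>_vec insert.IH)
  qed (simp add: assms(2))
  have fin: "finite {i. coeff x i \<noteq> 0}" using assms(1) by (simp add: \<W>_def)
  show ?thesis using s[OF fin] unfolding \<W>_expand[OF fin order_refl, symmetric] .
qed

text \<open>The sum over \<open>F\<close> is an orthogonal projection of \<open>x\<close>: by
  Pythagoras the squared error is the tail of the series of squared coefficients.\<close>

lemma \<W>_approx:
  assumes "0 < e"
  shows "\<exists>F. finite F \<and> norm (x - (\<Sum>i\<in>F. coeff x i *\<^sub>C vec i)) < e"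
proof -
  let ?f = "\<lambda>i. (cmod (coeff x i))\<^sup>2"
  have "(sum ?f \<longlongrightarrow> (norm x)\<^sup>2) (finite_subsets_at_top UNIV)"
    using has_sum_infsum[OF coeff_sq_summable[of x]] unfolding has_sum_def norm_spinor_sq .
  then have "\<forall>\<^sub>F F in finite_subsets_at_top UNIV. dist (sum ?f F) ((norm x)\<^sup>2) < e\<^sup>2"
    using assms by (intro tendstoD) auto
  then obtain F where F: "finite F" "dist (sum ?f F) ((norm x)\<^sup>2) < e\<^sup>2"
    unfolding eventually_finite_subsets_at_top by blast
  define y where "y = (\<Sum>i\<in>F. coeff x i *\<^sub>C vec i)"
  have cy: "coeff y j = (if j \<in> F then coeff x j else 0)" for j
  proof -
    have "coeff y j = (\<Sum>i\<in>F. if i = j then coeff x j else 0)"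
      unfolding y_def coeff_sum by (rule sum.cong) (auto simp: coeff_vec coeff_outside)
    then show ?thesis using F(1) by simp
  qed
  have "(norm (x - y))\<^sup>2 + sum ?f F = (norm x)\<^sup>2"
  proof -
    have "(norm (x - y))\<^sup>2 = infsum ?f (- F)"
      unfolding norm_spinor_sq by (rule infsum_cong_neutral) (auto simp: cy)
    moreover have "infsum ?f (- F) + infsum ?f F = infsum ?f (- F \<union> F)"
      by (rule infsum_Un_disjoint[symmetric])
        (auto intro: summable_on_subset_banach[OF coeff_sq_summable])
    ultimately show ?thesis unfolding norm_spinor_sq[of x] using F(1) by simp
  qed
  then have "(norm (x - y))\<^sup>2 < e\<^sup>2" using F(2) by (simp add: dist_real_def)
  then have "norm (x - y) < e" using assms power2_less_imp_less[of "norm (x - y)" e] by simp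
  then show ?thesis using F(1) unfolding y_def by blast
qed

lemma \<W>_dense: "closure \<W> = UNIV"
proof -
  have "x \<in> closure \<W>" for x
    unfolding closure_approachable
  proof (intro allI impI)
    fix e :: real assume "0 < e"
    then obtain F where "finite F" "norm (x - (\<Sum>i\<in>F. coeff x i *\<^sub>C vec i)) < e"
      using \<W>_approx by blast
    moreover have "(\<Sum>i\<in>F. coeff x i *\<^sub>C vec i) \<in> \<W>"
      by (intro \<W>_sum \<W>_scaleC \<W>_vec)
    ultimately show "\<exists>y\<in>\<W>. dist y x < e" by (metis dist_norm norm_minus_commute)
  qed
  then show ?thesis by auto
qed

text \<open>Agreement on the basis extends to the dense span \<open>\<W>\<close>, and the set of
  agreement is closed. This gives uniqueness in the definition of \<open>spinor_rep_gen\<close> and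
  later carries identities from \<open>\<W>\<close> to the whole space.\<close>

lemma bounded_clinear_eqI:
  assumes S: "bounded_clinear S" and T: "bounded_clinear T"
    and eq: "\<And>i. i \<in> spinor_index \<Longrightarrow> S (vec i) = T (vec i)"
  shows "S = T"
proof
  fix x
  have "S x = T x" if "x \<in> \<W>" for x
    using that by (induction rule: \<W>_induct)
      (use eq in \<open>simp_all add: bounded_clinearD[OF S] bounded_clinearD[OF T]\<close>)
  then have "\<W> \<subseteq> {x. S x = T x}" by auto
  moreover have "closed {x. S x = T x}"
    using S T unfolding bounded_clinear_def
    by (intro closed_Collect_eq linear_continuous_on) auto
  ultimately have "closure \<W> \<subseteq> {x. S x = T x}" by (rule closure_minimal)
  then show "S x = T x" using \<W>_dense by auto
qed

text \<open>
  Outside \<^const>\<open>spinor_index\<close> the coefficients of a spinor vanish, so only weights \<open>c i\<close> that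
  connect two valid indices have to be bounded.
\<close>

definition wshift :: "(real \<times> real \<times> real \<Rightarrow> complex) \<Rightarrow>
    (real \<times> real \<times> real \<Rightarrow> real \<times> real \<times> real) \<Rightarrow> spinor \<Rightarrow> spinor" where
  "wshift c \<phi> x = Abs_spinor (\<lambda>i. if i \<in> spinor_index then c i * coeff x (\<phi> i) else 0)"

text \<open>Injectivity of \<open>\<phi>\<close> makes the reindexed coefficients a subfamily of
  those of \<open>x\<close>, so their square sum is at most the squared norm.
  \<open>Abs_spinor\<close> can be evaluated only after this summability is known, hence formula,
  norm bound and boundedness are proved together.\<close>

lemma
  assumes inj: "inj \<phi>" and B: "0 \<le> B"
    and c: "\<And>i. i \<in> spinor_index \<Longrightarrow> \<phi> i \<in> spinor_index \<Longrightarrow> cmod (c i) \<le> B"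
  shows coeff_wshift: "coeff (wshift c \<phi> x) i = (if i \<in> spinor_index then c i * coeff x (\<phi> i) else 0)"
    and norm_wshift_le: "norm (wshift c \<phi> x) \<le> B * norm x"
    and bounded_clinear_wshift: "bounded_clinear (wshift c \<phi>)"
proof -
  let ?g = "\<lambda>x i. if i \<in> spinor_index then c i * coeff x (\<phi> i) else 0"
  have le: "(cmod (?g x i))\<^sup>2 \<le> B\<^sup>2 * (cmod (coeff x (\<phi> i)))\<^sup>2" for x i
  proof (cases "i \<in> spinor_index \<and> \<phi> i \<in> spinor_index")
    case True
    then show ?thesis
      using c[of i] B by (auto simp: norm_mult power_mult_distrib intro!: mult_right_mono power_mono)
  qed (auto simp: coeff_outside)
  have sr: "(\<lambda>i. (cmod (coeff x (\<phi> i)))\<^sup>2) summable_on UNIV" for x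
    using summable_on_reindex[OF inj, of "\<lambda>i. (cmod (coeff x i))\<^sup>2"]
      summable_on_subset_banach[OF coeff_sq_summable[of x], of "range \<phi>"] by (simp add: o_def)
  have sB: "(\<lambda>i. B\<^sup>2 * (cmod (coeff x (\<phi> i)))\<^sup>2) summable_on UNIV" for x
    by (intro summable_on_cmult_right sr)
  have sg: "(\<lambda>i. (cmod (?g x i))\<^sup>2) summable_on UNIV" for x
    by (rule summable_on_comparison_test[OF sB[of x]]) (rule le, simp)
  have co: "coeff (wshift c \<phi> x) i = ?g x i" for x i
    unfolding wshift_def by (subst Abs_spinor_inverse) (use sg in auto)
  then show "coeff (wshift c \<phi> x) i = ?g x i" .
  have nm: "norm (wshift c \<phi> x) \<le> B * norm x" for x
  proof -
    have "(norm (wshift c \<phi> x))\<^sup>2 \<le> (\<Sum>\<^sub>\<infinity>i. B\<^sup>2 * (cmod (coeff x (\<phi> i)))\<^sup>2)"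
      unfolding norm_spinor_sq co by (rule infsum_mono[OF sg sB le])
    also have "\<dots> = B\<^sup>2 * (\<Sum>\<^sub>\<infinity>i. (cmod (coeff x (\<phi> i)))\<^sup>2)"
      by (rule infsum_cmult_right) (use sr in auto)
    also have "(\<Sum>\<^sub>\<infinity>i. (cmod (coeff x (\<phi> i)))\<^sup>2) = infsum (\<lambda>i. (cmod (coeff x i))\<^sup>2) (range \<phi>)"
      using infsum_reindex[OF inj, of "\<lambda>i. (cmod (coeff x i))\<^sup>2"] by (simp add: o_def)
    also have "B\<^sup>2 * \<dots> \<le> B\<^sup>2 * (norm x)\<^sup>2"
      unfolding norm_spinor_sq
      by (intro mult_left_mono infsum_mono_neutral)
        (auto intro: summable_on_subset_banach[OF coeff_sq_summable] coeff_sq_summable)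
    finally have "(norm (wshift c \<phi> x))\<^sup>2 \<le> (B * norm x)\<^sup>2" by (simp add: power_mult_distrib)
    then show ?thesis using B by (simp add: power2_le_iff_abs_le)
  qed
  then show "norm (wshift c \<phi> x) \<le> B * norm x" .
  show "bounded_clinear (wshift c \<phi>)"
    unfolding bounded_clinear_def
  proof (intro conjI allI bounded_linear_intro[where K = B])
    show "norm (wshift c \<phi> x) \<le> norm x * B" for x using nm[of x] by (simp add: mult.commute)
  qed (auto intro!: spinor_eqI simp: co algebra_simps)
qed

section \<open>Linear extension from free algebras\<close>

text \<open>The scalar action \<open>s\<close> is a parameter because three are needed:
  \<open>scaleC\<close> on spinors, multiplication by \<open>cst\<close> in free algebras, and its
  conjugate-linear variant for the star.\<close>

definition lext :: "(complex \<Rightarrow> 'b \<Rightarrow> 'b) \<Rightarrow> ('k \<Rightarrow> 'b) \<Rightarrow> ('k, complex) poly_mapping \<Rightarrow> 'b::ab_group_add"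
  where "lext s F a = (\<Sum>w\<in>Poly_Mapping.keys a. s (Poly_Mapping.lookup a w) (F w))"

context
  fixes s :: "complex \<Rightarrow> 'b \<Rightarrow> 'b::ab_group_add"
  assumes s: "Modules.module s"
begin

interpretation Modules.module s by (rule s)

lemma lext_superset:
  assumes "finite S" "Poly_Mapping.keys a \<subseteq> S"
  shows "lext s F a = (\<Sum>w\<in>S. s (Poly_Mapping.lookup a w) (F w))"
  unfolding lext_def using assms
  by (intro sum.mono_neutral_left) (auto simp: in_keys_iff)

lemma lext_add: "lext s F (a + b) = lext s F a + lext s F b"
proof -
  let ?S = "Poly_Mapping.keys a \<union> Poly_Mapping.keys b"
  have "lext s F x = (\<Sum>w\<in>?S. s (Poly_Mapping.lookup x w) (F w))" if "x \<in> {a, b, a + b}" for x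
    using that by (intro lext_superset) (auto dest: subsetD[OF Poly_Mapping.keys_add])
  then show ?thesis by (simp add: lookup_add scale_left_distrib sum.distrib)
qed

lemma lext_single: "lext s F (Poly_Mapping.single w c) = s c (F w)"
  unfolding lext_def by (simp add: scale_zero_left)

lemma lext_zero: "lext s F 0 = 0"
  unfolding lext_def by simp

lemma lext_minus: "lext s F (- a) = - lext s F a"
  using lext_add[of F a "- a"] by (simp add: lext_zero eq_neg_iff_add_eq_0 add.commute)

lemma lext_diff: "lext s F (a - b) = lext s F a - lext s F b"
  using lext_add[of F a "- b"] by (simp add: lext_minus)

end

lemma poly_mapping_sum_single:
  fixes a :: "('k, complex) poly_mapping"
  shows "(\<Sum>w\<in>Poly_Mapping.keys a. Poly_Mapping.single w (Poly_Mapping.lookup a w)) = a"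
proof (rule poly_mapping_eqI)
  fix k
  have "(\<Sum>w\<in>Poly_Mapping.keys a. Poly_Mapping.lookup (Poly_Mapping.single w (Poly_Mapping.lookup a w)) k)
      = (\<Sum>w\<in>Poly_Mapping.keys a. if w = k then Poly_Mapping.lookup a k else 0)"
    by (rule sum.cong) (auto simp: lookup_single)
  then show "Poly_Mapping.lookup (\<Sum>w\<in>Poly_Mapping.keys a.
      Poly_Mapping.single w (Poly_Mapping.lookup a w)) k = Poly_Mapping.lookup a k"
    by (simp add: lookup_sum in_keys_iff)
qed

lemma pm_induct [case_names single add]:
  fixes a :: "('k, complex) poly_mapping"
  assumes single: "\<And>w c. P (Poly_Mapping.single w c)" and add: "\<And>a b. P a \<Longrightarrow> P b \<Longrightarrow> P (a + b)"
  shows "P a"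
proof -
  have P0: "P 0" using single[of undefined 0] by simp
  have "P (\<Sum>w\<in>S. Poly_Mapping.single w (Poly_Mapping.lookup a w))" if "finite S" for S
    using that by (induction S rule: finite_induct) (auto intro: assms P0)
  then show ?thesis using poly_mapping_sum_single[of a] by (metis finite_keys)
qed

lemma cst_add: "cst (c + d) = cst c + cst d" by (simp add: cst_def single_add)
lemma cst_mult: "cst (c * d) = cst c * cst d" by (simp add: cst_def mult_single)
lemma cst_zero [simp]: "cst 0 = 0" by (simp add: cst_def)
lemma cst_one [simp]: "cst 1 = 1" by (simp add: cst_def)
lemma cst_minus: "cst (- c) = - cst c" by (simp add: cst_def single_uminus)
lemma cst_times_single: "cst c * Poly_Mapping.single w d = Poly_Mapping.single w (c * d)"
  by (simp add: cst_def mult_single)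

lemma cst_commute: "a * cst c = cst c * a"
  by (induction a rule: pm_induct) (simp_all add: cst_def mult_single algebra_simps)

lemma cst_left_commute: "a * (cst c * b) = cst c * (a * b)"
  by (metis cst_commute mult.assoc)

lemma module_cst: "Modules.module (\<lambda>c a. cst c * a :: ('k::monoid_add, complex) poly_mapping)"
  by unfold_locales (simp_all add: distrib_left distrib_right mult.assoc cst_add cst_mult)

lemma module_cst_cnj: "Modules.module (\<lambda>c a. cst (cnj c) * a :: ('k::monoid_add, complex) poly_mapping)"
  by unfold_locales (simp_all add: distrib_left distrib_right mult.assoc cst_add cst_mult)

lemma lext_cst_times:
  assumes "Modules.module s"
  shows "lext s F (cst c * a) = s c (lext s F a)"
proof (induction a rule: pm_induct)
  case (single w d)
  show ?case using assms by (simp add: cst_times_single lext_single Modules.module.scale_scale)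
next
  case (add a b)
  then show ?case using assms
    by (simp add: distrib_left lext_add Modules.module.scale_right_distrib)
qed

lemma single_word_Nil: "Poly_Mapping.single (Word []) c = cst c"
  by (simp add: cst_def zero_word_def)

lemma single_word_Cons:
  "Poly_Mapping.single (Word (x # xs)) c = gen x * Poly_Mapping.single (Word xs) c"
  by (simp add: gen_def mult_single plus_word_def)

text \<open>Stability under left multiplication by one generator covers all words, which suits maps
  that are built letter by letter.\<close>

lemma free_alg_induct [case_names cst gen add]:
  fixes a :: "'g free_alg"
  assumes cst: "\<And>c. P (cst c)" and gen: "\<And>x a. P a \<Longrightarrow> P (gen x * a)"
    and add: "\<And>a b. P a \<Longrightarrow> P b \<Longrightarrow> P (a + b)"
  shows "P a"
proof (induction a rule: pm_induct)
  case (single w c)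
  have "P (Poly_Mapping.single (Word xs) c)" for xs
    by (induction xs) (simp_all add: single_word_Nil single_word_Cons cst gen)
  then show ?case by (cases w) auto
qed (rule add)

text \<open>The homomorphism from the free algebra to operators that is fixed by the images
  \<open>T\<close> of the generators. Its three instances are \<open>U\<close> and \<open>fr\<close>
  on spinors and \<open>af\<close> on the free algebra of the sphere.\<close>

definition opext :: "(complex \<Rightarrow> 'b \<Rightarrow> 'b) \<Rightarrow> ('g \<Rightarrow> 'b \<Rightarrow> 'b) \<Rightarrow> 'g free_alg \<Rightarrow> 'b \<Rightarrow> 'b::ab_group_add"
  where "opext s T a x = lext s (\<lambda>w. foldr T (letters w) x) a"

context
  fixes s :: "complex \<Rightarrow> 'b \<Rightarrow> 'b::ab_group_add"
  assumes s: "Modules.module s"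
begin

lemma opext_add: "opext s T (a + b) x = opext s T a x + opext s T b x"
  by (simp add: opext_def lext_add[OF s])

lemma opext_diff: "opext s T (a - b) x = opext s T a x - opext s T b x"
  by (simp add: opext_def lext_diff[OF s])

lemma opext_minus: "opext s T (- a) x = - opext s T a x"
  by (simp add: opext_def lext_minus[OF s])

lemma opext_zero: "opext s T 0 x = 0"
  by (simp add: opext_def lext_zero[OF s])

lemma opext_cst: "opext s T (cst c) x = s c x"
  by (simp add: opext_def cst_def lext_single[OF s] zero_word_def)

lemma opext_one: "opext s T 1 x = x"
  using opext_cst[of T 1 x] by (simp add: Modules.module.scale_one[OF s])

lemma opext_cst_times: "opext s T (cst c * a) x = s c (opext s T a x)"
  by (simp add: opext_def lext_cst_times[OF s])

lemma opext_gen: "opext s T (gen g) x = T g x"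
  by (simp add: opext_def gen_def lext_single[OF s] Modules.module.scale_one[OF s])

lemma opext_word: "opext s T (Poly_Mapping.single (Word xs) c) x = s c (foldr T xs x)"
  by (simp add: opext_def lext_single[OF s])

context
  fixes V :: "'b set" and T :: "'g \<Rightarrow> 'b \<Rightarrow> 'b"
  assumes add_closed: "\<And>x y. x \<in> V \<Longrightarrow> y \<in> V \<Longrightarrow> x + y \<in> V" and scale_closed: "\<And>c x. x \<in> V \<Longrightarrow> s c x \<in> V"
    and T_closed: "\<And>g x. x \<in> V \<Longrightarrow> T g x \<in> V"
    and T_add: "\<And>g x y. x \<in> V \<Longrightarrow> y \<in> V \<Longrightarrow> T g (x + y) = T g x + T g y"
    and T_scale: "\<And>g c x. x \<in> V \<Longrightarrow> T g (s c x) = s c (T g x)"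
begin

text \<open>Here and in the next lemmas linearity of \<open>T\<close> is asked on \<open>V\<close>
  only. The action of \<open>U\<^sub>q\<close> is linear on \<open>\<W>\<close>; elsewhere its
  defining sum runs over an infinite support and collapses to zero. For operators that are linear
  everywhere \<open>V\<close> is \<open>UNIV\<close>.\<close>

lemma opext_closed:
  assumes "x \<in> V" shows "opext s T a x \<in> V"
proof (induction a rule: pm_induct)
  case (single w c)
  have "foldr T xs x \<in> V" for xs by (induction xs) (use assms T_closed in auto)
  then show ?case by (cases w) (simp add: opext_word scale_closed)
qed (simp add: opext_add add_closed)

lemma opext_gen_times:
  assumes "x \<in> V" shows "opext s T (gen g * a) x = T g (opext s T a x)"
proof (induction a rule: pm_induct)
  case (single w c)
  have "foldr T xs x \<in> V" for xs by (induction xs) (use assms T_closed in auto)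
  then show ?case by (cases w) (simp add: opext_word T_scale flip: single_word_Cons)
qed (use assms in \<open>simp add: distrib_left opext_add T_add opext_closed\<close>)

lemma opext_mult:
  assumes "x \<in> V" shows "opext s T (a * b) x = opext s T a (opext s T b x)"
  by (induction a rule: free_alg_induct)
    (use assms in \<open>simp_all add: opext_cst opext_cst_times mult.assoc opext_gen_times distrib_right
        opext_add opext_closed\<close>)

lemma opext_vec_add:
  assumes "x \<in> V" "y \<in> V" shows "opext s T a (x + y) = opext s T a x + opext s T a y"
  by (induction a rule: free_alg_induct)
    (use assms in \<open>simp_all add: opext_cst opext_gen_times opext_add T_add add_closed opext_closed
        Modules.module.scale_right_distrib[OF s] algebra_simps\<close>)

lemma opext_vec_scale:
  assumes "x \<in> V" shows "opext s T a (s c x) = s c (opext s T a x)"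
  by (induction a rule: free_alg_induct)
    (use assms in \<open>simp_all add: opext_cst opext_gen_times opext_add T_scale scale_closed opext_closed
        Modules.module.scale_right_distrib[OF s] Modules.module.scale_scale[OF s] mult.commute\<close>)

end

end

section \<open>Quotients of rings by two-sided ideals\<close>

lemma ring_ring_of_type_algebra: "ring (ring_of_type_algebra :: 'r::ring_1 ring)"
proof -
  have "\<exists>y. x + y = 0" for x :: 'r
    using add.right_inverse by blast
  then show ?thesis
    unfolding ring_of_type_algebra_def using add.right_inverse
    by unfold_locales (auto simp: algebra_simps Units_def)
qed

lemma carrier_type_algebra [simp]: "carrier (ring_of_type_algebra :: 'r::ring_1 ring) = UNIV"
  by (simp add: ring_of_type_algebra_def)

lemma ops_type_algebra [simp]:
  "x \<oplus>\<^bsub>ring_of_type_algebra\<^esub> y = x + (y :: 'r::ring_1)"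
  "x \<otimes>\<^bsub>ring_of_type_algebra\<^esub> y = x * (y :: 'r::ring_1)"
  "\<one>\<^bsub>ring_of_type_algebra\<^esub> = (1 :: 'r::ring_1)"
  "\<zero>\<^bsub>ring_of_type_algebra\<^esub> = (0 :: 'r::ring_1)"
  by (simp_all add: ring_of_type_algebra_def)

lemma ideal_two_sided_ideal: "ideal (two_sided_ideal R) (ring_of_type_algebra :: 'r::ring_1 ring)"
  unfolding two_sided_ideal_def by (rule ring.genideal_ideal[OF ring_ring_of_type_algebra]) simp

lemma ideal_type_algebraI:
  fixes J :: "'r::ring_1 set"
  assumes "0 \<in> J" "\<And>a b. a \<in> J \<Longrightarrow> b \<in> J \<Longrightarrow> a + b \<in> J"
    "\<And>a b. a \<in> J \<Longrightarrow> b * a \<in> J" "\<And>a b. a \<in> J \<Longrightarrow> a * b \<in> J"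
  shows "ideal J (ring_of_type_algebra :: 'r ring)"
proof (rule idealI[OF ring_ring_of_type_algebra])
  interpret ring "ring_of_type_algebra :: 'r ring" by (rule ring_ring_of_type_algebra)
  have inv: "inv\<^bsub>add_monoid (ring_of_type_algebra :: 'r ring)\<^esub> a = - a" for a :: 'r
    unfolding a_inv_def[symmetric] by (rule minus_equality) auto
  have neg: "- a \<in> J" if "a \<in> J" for a using assms(3)[OF that, of "- 1"] by simp
  show "subgroup J (add_monoid (ring_of_type_algebra :: 'r ring))"
  proof
    show "inv\<^bsub>add_monoid (ring_of_type_algebra :: 'r ring)\<^esub> a \<in> J" if "a \<in> J" for a
      using neg[OF that] inv[of a] by simp
  qed (use assms in auto)
qed (use assms in auto)

text \<open>The form in which the generated ideal is used: \<open>J\<close> is the set of elements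
  with the wanted property, and only the generators and closure under the ring operations remain to
  be checked.\<close>

lemma two_sided_ideal_minimal:
  assumes "R \<subseteq> J" "0 \<in> J" "\<And>a b. a \<in> J \<Longrightarrow> b \<in> J \<Longrightarrow> a + b \<in> J"
    "\<And>a b. a \<in> J \<Longrightarrow> b * a \<in> J" "\<And>a b. a \<in> J \<Longrightarrow> a * b \<in> J"
  shows "two_sided_ideal R \<subseteq> (J :: 'r::ring_1 set)"
  unfolding two_sided_ideal_def
  by (rule ring.genideal_minimal[OF ring_ring_of_type_algebra ideal_type_algebraI]) (use assms in auto)

context
  fixes R :: "'r::ring_1 set"
begin

interpretation I: ideal "two_sided_ideal R" "ring_of_type_algebra :: 'r ring"
  by (rule ideal_two_sided_ideal)

lemma tsi_base: "r \<in> R \<Longrightarrow> r \<in> two_sided_ideal R"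
  unfolding two_sided_ideal_def using ring.genideal_self[OF ring_ring_of_type_algebra, of R] by auto

lemma tsi_zero: "0 \<in> two_sided_ideal R" using additive_subgroup.zero_closed[OF I.is_additive_subgroup] by simp

lemma tsi_add: "a \<in> two_sided_ideal R \<Longrightarrow> b \<in> two_sided_ideal R \<Longrightarrow> a + b \<in> two_sided_ideal R"
  using additive_subgroup.a_closed[OF I.is_additive_subgroup, of a b] by simp

lemma tsi_lmult: "a \<in> two_sided_ideal R \<Longrightarrow> b * a \<in> two_sided_ideal R"
  using I.I_l_closed[of a b] by simp

lemma tsi_rmult: "a \<in> two_sided_ideal R \<Longrightarrow> a * b \<in> two_sided_ideal R"
  using I.I_r_closed[of a b] by simp

lemma tsi_minus: "a \<in> two_sided_ideal R \<Longrightarrow> - a \<in> two_sided_ideal R"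
  using tsi_lmult[of a "- 1"] by simp

lemma tsi_diff: "a \<in> two_sided_ideal R \<Longrightarrow> b \<in> two_sided_ideal R \<Longrightarrow> a - b \<in> two_sided_ideal R"
  using tsi_add[of a "- b"] tsi_minus[of b] by simp

lemma residue_class_eq: "residue_class R a = {b. b - a \<in> two_sided_ideal R}"
proof -
  have "b \<in> residue_class R a \<longleftrightarrow> (\<exists>h\<in>two_sided_ideal R. b = h + a)" for b
    by (auto simp: residue_class_def a_r_coset_def r_coset_def)
  then show ?thesis by (metis (no_types, lifting) Collect_cong Collect_mem_eq add_diff_cancel_right' diff_add_cancel)
qed

lemma residue_class_eq_iff: "residue_class R a = residue_class R b \<longleftrightarrow> a - b \<in> two_sided_ideal R"
proof
  assume "residue_class R a = residue_class R b"
  moreover have "a \<in> residue_class R a" by (simp add: residue_class_eq tsi_zero)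
  ultimately show "a - b \<in> two_sided_ideal R" by (simp add: residue_class_eq)
next
  assume ab: "a - b \<in> two_sided_ideal R"
  have "c - a \<in> two_sided_ideal R \<longleftrightarrow> c - b \<in> two_sided_ideal R" for c
    using tsi_add[OF _ ab, of "c - a"] tsi_diff[OF _ ab, of "c - b"] by auto
  then show "residue_class R a = residue_class R b" by (simp add: residue_class_eq)
qed

lemma residue_class_self: "a \<in> residue_class R a"
  by (simp add: residue_class_eq tsi_zero)

lemma quotient_carrier: "carrier (quotient_ring R) = range (residue_class R)"
  by (auto simp: quotient_ring_def FactRing_def A_RCOSETS_def RCOSETS_def residue_class_def a_r_coset_def)

lemma quotient_mult: "residue_class R a \<otimes>\<^bsub>quotient_ring R\<^esub> residue_class R b = residue_class R (a * b)"
  unfolding quotient_ring_def residue_class_def FactRing_def using I.rcoset_mult_add[of a b] by simp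

lemma quotient_add: "residue_class R a \<oplus>\<^bsub>quotient_ring R\<^esub> residue_class R b = residue_class R (a + b)"
  unfolding quotient_ring_def residue_class_def FactRing_def using I.a_rcos_sum[of a b] by simp

lemma quotient_one: "\<one>\<^bsub>quotient_ring R\<^esub> = residue_class R 1"
  unfolding quotient_ring_def residue_class_def FactRing_def by simp

lemma quotient_zero: "\<zero>\<^bsub>quotient_ring R\<^esub> = residue_class R 0"
proof -
  have "residue_class R 0 = two_sided_ideal R" unfolding residue_class_eq by simp
  then show ?thesis unfolding quotient_ring_def FactRing_def by simp
qed

end

text \<open>\<open>descend\<close> takes \<open>the_elem\<close> of an image; constancy on
  \<open>Y\<close> makes that image a singleton, and any representative computes it.\<close>

lemma descend_eq:
  assumes "a \<in> Y" "\<And>b. b \<in> Y \<Longrightarrow> f b = f a"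
  shows "descend f Y = f a"
proof -
  have "f ` Y \<subseteq> {f a}" using assms(2) by blast
  moreover have "f a \<in> f ` Y" using assms(1) by blast
  ultimately have "f ` Y = {f a}" by blast
  then show ?thesis by (simp add: descend_def)
qed

lemma descend_residue_class:
  assumes "\<And>a b. a - b \<in> two_sided_ideal R \<Longrightarrow> f a = f b"
  shows "descend f (residue_class R a) = f a"
  by (rule descend_eq[OF residue_class_self]) (rule assms, simp add: residue_class_eq)

section \<open>The index set\<close>

text \<open>Half-integrality of \<open>l\<close> and the range of \<open>m\<close> become one
  symmetric condition on the naturals \<open>l + m\<close> and \<open>l - m\<close>, whose sum
  \<open>2 * l\<close> is odd. Shifts and edge cases are then integer arithmetic.\<close>

lemma spinor_index_iff:
  "(l, m, N) \<in> spinor_index \<longleftrightarrow>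
    (\<exists>a b :: nat. l + m = real a \<and> l - m = real b \<and> odd (a + b)) \<and> N \<in> {- 1 / 2, 1 / 2}"
proof -
  have "l \<in> half_spins \<and> m \<in> weights l \<longleftrightarrow> (\<exists>a b :: nat. l + m = real a \<and> l - m = real b \<and> odd (a + b))"
    (is "?L \<longleftrightarrow> ?R")
  proof
    assume ?L
    then obtain n j :: nat where l: "l = real n + 1 / 2" and m: "m = - l + real j" and j: "real j \<le> 2 * l"
      unfolding half_spins_def weights_def by blast
    from j l have "real j \<le> real (2 * n + 1)" by simp
    then have "j \<le> 2 * n + 1" by (simp only: of_nat_le_iff)
    then obtain b where b: "2 * n + 1 = j + b" using le_Suc_ex by blast
    then have "real (2 * n + 1) = real (j + b)" by simp
    then have "l + m = real j" "l - m = real b" using l m by simp_all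
    moreover have "odd (j + b)" using b[symmetric] by simp
    ultimately show ?R by blast
  next
    assume ?R
    then obtain a b :: nat where ab: "l + m = real a" "l - m = real b" "odd (a + b)" by blast
    from ab(3) obtain n where n: "a + b = 2 * n + 1" by (rule oddE)
    then have "real (a + b) = real (2 * n + 1)" by simp
    then have "l = real n + 1 / 2" "m = - l + real a" "real a \<le> 2 * l" using ab(1,2) by simp_all
    then show ?L unfolding half_spins_def weights_def by blast
  qed
  then show ?thesis by (auto simp: spinor_index_def)
qed

lemma spinor_indexD:
  assumes "(l, m, N) \<in> spinor_index"
  shows "l \<in> half_spins" "m \<in> weights l" "N \<in> {- 1 / 2, 1 / 2}" "1 / 2 \<le> l" "0 \<le> l + m" "0 \<le> l - m"
proof -
  show l: "l \<in> half_spins" and "m \<in> weights l" "N \<in> {- 1 / 2, 1 / 2}"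
    using assms unfolding spinor_index_def by blast+
  show "1 / 2 \<le> l" using l unfolding half_spins_def by auto
  obtain a b :: nat where "l + m = real a" "l - m = real b"
    using assms unfolding spinor_index_iff by blast
  then show "0 \<le> l + m" "0 \<le> l - m" by simp_all
qed

lemma half_spins_ge: "l \<in> half_spins \<Longrightarrow> 1 / 2 \<le> l"
  by (auto simp: half_spins_def)

lemma half_spins_less: "l \<in> half_spins \<Longrightarrow> 1 / 2 < l \<Longrightarrow> 3 / 2 \<le> l"
proof -
  assume "l \<in> half_spins" and l: "1 / 2 < l"
  then obtain n :: nat where n: "l = real n + 1 / 2" unfolding half_spins_def by blast
  with l have "1 \<le> n" by (cases n) auto
  then have "1 \<le> real n" by simp
  with n show "3 / 2 \<le> l" by simp
qed

lemma half_spins_Suc: "l \<in> half_spins \<Longrightarrow> l + 1 \<in> half_spins"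
proof -
  assume "l \<in> half_spins"
  then obtain n :: nat where "l = real n + 1 / 2" unfolding half_spins_def by blast
  then have "l + 1 = real (Suc n) + 1 / 2" by simp
  then show "l + 1 \<in> half_spins" unfolding half_spins_def by blast
qed

lemma spinor_index_opposite: "(l, m, - N) \<in> spinor_index \<longleftrightarrow> (l, m, N) \<in> spinor_index"
  by (auto simp: spinor_index_iff)

lemma nat_shift:
  assumes "x = real a" "0 \<le> x + of_int k" shows "\<exists>a'::nat. x + of_int k = real a' \<and> int a' = int a + k"
  using assms by (intro exI[of _ "nat (int a + k)"]) auto

text \<open>A shift of \<open>l\<close> by \<open>i\<close> changes the sum of the two naturals by
  \<open>2 * i\<close>, so parity survives and only the two inequalities of the range are
  left.\<close>

lemma spinor_index_shift:
  assumes "(l, m, N) \<in> spinor_index" "l' = l + of_int i" "m' = m + of_int j"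
    "0 \<le> l' + m'" "0 \<le> l' - m'"
  shows "(l', m', N) \<in> spinor_index"
proof -
  from assms(1) obtain a b :: nat where ab: "l + m = real a" "l - m = real b" "odd (a + b)"
    and N: "N \<in> {- 1 / 2, 1 / 2}" unfolding spinor_index_iff by blast
  obtain a' where a': "l + m + of_int (i + j) = real a'" "int a' = int a + (i + j)"
    using nat_shift[OF ab(1), of "i + j"] assms by (auto simp: algebra_simps)
  obtain b' where b': "l - m + of_int (i - j) = real b'" "int b' = int b + (i - j)"
    using nat_shift[OF ab(2), of "i - j"] assms by (auto simp: algebra_simps)
  have "int (a' + b') = int (a + b) + 2 * i" using a'(2) b'(2) by simp
  then have "odd (int (a' + b'))" using ab(3) by (metis even_add even_mult_iff even_numeral even_of_nat)
  then have "odd (a' + b')" using even_of_nat by blast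
  moreover have "l' + m' = real a'" "l' - m' = real b'" using a'(1) b'(1) assms(2,3) by auto
  ultimately show ?thesis using N unfolding spinor_index_iff by blast
qed

text \<open>Integrality leaves gaps next to the edge of a multiplet. They turn the absence of a
  neighbouring index into the vanishing of a q-number, as the boundary lemmas require.\<close>

lemma spinor_index_gap:
  assumes "(l, m, N) \<in> spinor_index"
  shows "l + m = 0 \<or> 1 \<le> l + m" "l - m = 0 \<or> 1 \<le> l - m" "l - m = 0 \<or> l - m = 1 \<or> 2 \<le> l - m"
    "l + m = 0 \<or> l + m = 1 \<or> 2 \<le> l + m"
  using assms unfolding spinor_index_iff by force+

lemma pm_halfE: "N \<in> {- 1 / 2, 1 / 2 :: real} \<Longrightarrow> (N = - 1 / 2 \<Longrightarrow> P) \<Longrightarrow> (N = 1 / 2 \<Longrightarrow> P) \<Longrightarrow> P"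
  by auto

section \<open>Estimates of the matrix elements\<close>

locale podles =
  fixes q t :: real
  assumes q0: "0 < q" and q1: "q < 1" and t0: "0 \<le> t" and t1: "t \<le> 1"
begin

section \<open>q-numbers and their exponential growth\<close>

abbreviation qn :: "real \<Rightarrow> real" where "qn \<equiv> qnum q"

lemma q_lt_inv: "q < 1 / q"
  using q0 q1 by (simp add: field_simps) (metis mult_strict_mono' mult_1 less_imp_le zero_less_one)

text \<open>Both signs in the quotient defining \<open>qnum\<close> are reversed, because
  \<open>q - 1 / q\<close> is negative; this gives a positive prefactor.\<close>

definition wq :: real where "wq = 1 / (1 / q - q)"

lemma wq_pos: "0 < wq" using q_lt_inv by (simp add: wq_def)

lemma qn_eq: "qn n = wq * (q powr (- n) - q powr n)"
proof -
  have "q - 1 / q = - (1 / q - q)" by simp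
  then show ?thesis unfolding qnum_def wq_def by (metis minus_diff_eq divide_minus_right minus_divide_left mult.commute times_divide_eq_right mult_1_right)
qed

lemma qn_0 [simp]: "qn 0 = 0" by (simp add: qn_eq)

lemma qn_minus: "qn (- n) = - qn n" by (simp add: qn_eq algebra_simps)

lemma powr_q_mono: "a \<le> b \<Longrightarrow> q powr b \<le> q powr a"
  using q0 q1 by (simp add: powr_mono')

lemma powr_q_le1: "0 \<le> a \<Longrightarrow> q powr a \<le> 1"
  using powr_q_mono[of 0 a] q0 by simp

lemma qn_mono: "a \<le> b \<Longrightarrow> qn a \<le> qn b"
  unfolding qn_eq using wq_pos powr_q_mono[of a b] powr_q_mono[of "- b" "- a"] by (intro mult_left_mono) auto

lemma qn_nonneg: "0 \<le> n \<Longrightarrow> 0 \<le> qn n"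
  using qn_mono[of 0 n] by simp

lemma qn_le: "qn n \<le> wq * q powr (- n)"
  unfolding qn_eq using wq_pos q0 by (intro mult_left_mono) auto

text \<open>Counterpart of \<open>qn_le\<close>: for \<open>n \<ge> 1\<close> the q-number
  \<open>[n]\<close> is comparable with \<open>q^(-n)\<close>. The constant is sharp at
  \<open>n = 1\<close>, where both sides equal \<open>1\<close>.\<close>

lemma qn_ge: assumes "1 \<le> n" shows "q * q powr (- n) \<le> qn n"
proof -
  have "q * q powr (- n) * (1 / q - q) = q powr (- n) - q * q * q powr (- n)"
    using q0 by (simp add: field_simps)
  moreover have "q * q * q powr (- n) = q powr (2 - n)"
    using q0 by (simp add: powr_diff powr_minus field_simps power2_eq_square)
  moreover have "q powr n \<le> q powr (2 - n)" using assms by (intro powr_q_mono) auto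
  ultimately have "q * q powr (- n) * (1 / q - q) \<le> q powr (- n) - q powr n" by linarith
  then show ?thesis using q_lt_inv unfolding qn_eq wq_def by (simp add: pos_le_divide_eq)
qed

lemma qn_pos: assumes "0 < n" shows "0 < qn n"
proof -
  have "q powr n < q powr (- n)" using q0 q1 assms by (intro powr_less_mono') auto
  then show ?thesis unfolding qn_eq using wq_pos by simp
qed

text \<open>\<open>qn_le\<close> enters in the numerator and \<open>qn_ge\<close> in the
  denominator; the exponent is the difference of the two growth rates.\<close>

lemma sqrt_qn_ratio:
  assumes "0 \<le> a" "0 \<le> b" "1 \<le> c" "1 \<le> d"
  shows "sqrt (qn a) * sqrt (qn b) / (sqrt (qn c) * sqrt (qn d)) \<le> wq / q * q powr ((c + d - a - b) / 2)"
proof -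
  have ge: "0 < q * q powr (- c)" "0 < q * q powr (- d)" using q0 by auto
  have "qn a * qn b / (qn c * qn d) \<le> (wq * q powr (- a) * (wq * q powr (- b))) / ((q * q powr (- c)) * (q * q powr (- d)))"
    using assms ge by (intro frac_le mult_mono mult_pos_pos mult_nonneg_nonneg qn_le qn_ge qn_nonneg) (use wq_pos q0 in auto)
  also have "\<dots> = (wq / q)\<^sup>2 * q powr (c + d - a - b)"
    using q0 by (simp add: powr_diff powr_add powr_minus field_simps power2_eq_square)
  also have "q powr (c + d - a - b) = (q powr ((c + d - a - b) / 2))\<^sup>2"
    by (simp add: power2_eq_square flip: powr_add)
  finally have "qn a * qn b / (qn c * qn d) \<le> (wq / q * q powr ((c + d - a - b) / 2))\<^sup>2"
    by (simp only: power_mult_distrib)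
  then have "sqrt (qn a * qn b / (qn c * qn d)) \<le> wq / q * q powr ((c + d - a - b) / 2)"
    using wq_pos q0 by (intro real_le_lsqrt) auto
  then show ?thesis by (simp add: real_sqrt_mult real_sqrt_divide)
qed

text \<open>The \<open>m\<close>-dependent factors of the matrix elements, Clebsch-Gordan
  coefficients up to normalization. The other factor, \<open>alphaN\<close> or \<open>betaN\<close>,
  is the reduced matrix element and carries all dependence on \<open>N\<close> and
  \<open>t\<close>.\<close>

fun cplus :: "sphere_gen \<Rightarrow> real \<Rightarrow> real \<Rightarrow> real" where
  "cplus Xp l m = q powr (- l + m) * sqrt (qn (l + m + 1)) * sqrt (qn (l + m + 2))
      / (sqrt (qn (2 * l + 1)) * sqrt (qn (2 * l + 2)))"
| "cplus X0 l m = q powr m * sqrt (qn (l - m + 1)) * sqrt (qn (l + m + 1)) * sqrt (qn 2)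
      / (sqrt (qn (2 * l + 1)) * sqrt (qn (2 * l + 2)))"
| "cplus Xm l m = q powr (l + m) * sqrt (qn (l - m + 1)) * sqrt (qn (l - m + 2))
      / (sqrt (qn (2 * l + 1)) * sqrt (qn (2 * l + 2)))"

fun czero :: "sphere_gen \<Rightarrow> real \<Rightarrow> real \<Rightarrow> real" where
  "czero Xp l m = - (q powr (m + 2)) * sqrt (qn (l - m)) * sqrt (qn (l + m + 1)) * sqrt (qn 2) / qn (2 * l)"
| "czero X0 l m = (qn (l - m + 1) * qn (l + m) - q\<^sup>2 * qn (l - m) * qn (l + m + 1)) / qn (2 * l)"
| "czero Xm l m = q powr m * sqrt (qn (l - m + 1)) * sqrt (qn (l + m)) * sqrt (qn 2) / qn (2 * l)"

fun cminus :: "sphere_gen \<Rightarrow> real \<Rightarrow> real \<Rightarrow> real" where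
  "cminus Xp l m = - (q powr (l + m + 1)) * sqrt (qn (l - m - 1)) * sqrt (qn (l - m))
      / (sqrt (qn (2 * l - 1)) * sqrt (qn (2 * l)))"
| "cminus X0 l m = q powr m * sqrt (qn (l - m)) * sqrt (qn (l + m)) * sqrt (qn 2)
      / (sqrt (qn (2 * l - 1)) * sqrt (qn (2 * l)))"
| "cminus Xm l m = - (q powr (- l + m - 1)) * sqrt (qn (l + m - 1)) * sqrt (qn (l + m))
      / (sqrt (qn (2 * l - 1)) * sqrt (qn (2 * l)))"

lemma alpha_eq:
  "alpha_plus q t x l m N = cplus x l m * alphaN q t N (l + 1)"
  "alpha_zero q t x l m N = czero x l m * betaN q t N l"
  "alpha_minus q t x l m N = cminus x l m * alphaN q t N l"
  by (cases x; simp)+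

text \<open>One constant for all nine families of coefficients. The last factor \<open>1 / q\<close>
  absorbs the cases whose exponents leave a surplus \<open>q^(-1)\<close>; the summand
  \<open>2 * (wq / q)^2\<close> serves the difference in \<open>czero X0\<close>.\<close>

definition cX :: real where "cX = wq / q * (1 + sqrt (qn 2)) / q + 2 * (wq / q)\<^sup>2"

lemma qn2_nonneg: "0 \<le> qn 2" by (rule qn_nonneg) simp

lemma cX_ge: "wq / q \<le> cX" "wq / q * sqrt (qn 2) \<le> cX" "wq / q / q \<le> cX" "wq / q * sqrt (qn 2) / q \<le> cX" "2 * (wq / q)\<^sup>2 \<le> cX" "0 \<le> cX"
proof -
  have p: "0 < wq / q" "0 \<le> sqrt (qn 2)" "1 \<le> 1 / q" using wq_pos q0 q1 qn2_nonneg by auto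
  have e: "cX = wq / q * (1 / q) + wq / q * sqrt (qn 2) * (1 / q) + 2 * (wq / q)\<^sup>2"
    unfolding cX_def by (simp add: algebra_simps add_divide_distrib)
  have le: "x \<le> x * (1 / q)" if "0 \<le> x" for x using mult_left_mono[OF p(3) that] by simp
  note le[OF less_imp_le[OF p(1)]] le[OF mult_nonneg_nonneg[OF less_imp_le[OF p(1)] p(2)]]
  moreover have "0 \<le> wq / q * (1 / q)" "0 \<le> wq / q * sqrt (qn 2) * (1 / q)" "0 \<le> 2 * (wq / q)\<^sup>2"
    using less_imp_le[OF p(1)] p(2) q0 by (intro mult_nonneg_nonneg; simp only: real_sqrt_ge_0_iff qn2_nonneg zero_le_power2 zero_le_divide_1_iff zero_le_numeral)+
  moreover have A: "wq / q / q = wq / q * (1 / q)" "wq / q * sqrt (qn 2) / q = wq / q * sqrt (qn 2) * (1 / q)"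
    by simp_all
  ultimately show "wq / q \<le> cX" "wq / q * sqrt (qn 2) \<le> cX" "wq / q / q \<le> cX"
    "wq / q * sqrt (qn 2) / q \<le> cX" "2 * (wq / q)\<^sup>2 \<le> cX" "0 \<le> cX"
    unfolding e A by linarith+
qed

text \<open>Bookkeeping of exponents: the leading power and the four roots together are of order at
  most \<open>q^(-k)\<close>. The values in use are \<open>k = 0\<close> and
  \<open>k = 1\<close>.\<close>

lemma ratio_bound:
  assumes "0 \<le> a" "0 \<le> b" "1 \<le> c" "1 \<le> d" "0 \<le> e + e + c + d - a - b + k + k"
  shows "q powr e * sqrt (qn a) * sqrt (qn b) / (sqrt (qn c) * sqrt (qn d)) \<le> wq / q * q powr (- k)"
proof -
  have k: "- k \<le> e + (c + d - a - b) / 2" using assms(5) by (simp add: field_simps)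
  have "q powr e * (sqrt (qn a) * sqrt (qn b) / (sqrt (qn c) * sqrt (qn d)))
      \<le> q powr e * (wq / q * q powr ((c + d - a - b) / 2))"
    using assms by (intro mult_left_mono sqrt_qn_ratio) auto
  also have "\<dots> = wq / q * q powr (e + (c + d - a - b) / 2)" by (simp add: powr_add)
  also have "\<dots> \<le> wq / q * q powr (- k)"
    using wq_pos q0 by (intro mult_left_mono powr_q_mono k) auto
  finally show ?thesis by (simp add: mult.assoc)
qed

lemma abs_diff_le: "0 \<le> a \<Longrightarrow> a \<le> c \<Longrightarrow> 0 \<le> b \<Longrightarrow> b \<le> c \<Longrightarrow> \<bar>a - b\<bar> \<le> 2 * (c::real)" by simp

lemmas qn_nn = mult_nonneg_nonneg divide_nonneg_nonneg real_sqrt_ge_zero qn_nonneg powr_ge_zero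

lemma cplus_bound:
  assumes "(l, m, N) \<in> spinor_index" shows "\<bar>cplus x l m\<bar> \<le> cX"
proof -
  note I = spinor_indexD[OF assms]
  have nn: "0 \<le> cplus x l m"
    by (cases x; simp only: cplus.simps; intro qn_nn; use I in linarith)
  show ?thesis
  proof (cases x)
    case Xp
    have "cplus Xp l m \<le> wq / q * q powr (- 0)"
      unfolding cplus.simps by (intro ratio_bound; ((use I in linarith) | simp))
    then show ?thesis using nn cX_ge q0 unfolding Xp by simp
  next
    case X0
    have "q powr m * sqrt (qn (l - m + 1)) * sqrt (qn (l + m + 1))
        / (sqrt (qn (2 * l + 1)) * sqrt (qn (2 * l + 2))) \<le> wq / q * q powr (- 0)"
      by (intro ratio_bound; ((use I in linarith) | simp))
    from mult_right_mono[OF this, of "sqrt (qn 2)"] have "cplus X0 l m \<le> wq / q * sqrt (qn 2)"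
      using qn2_nonneg q0 by (simp add: mult_ac)
    then show ?thesis using nn cX_ge unfolding X0 by simp
  next
    case Xm
    have "cplus Xm l m \<le> wq / q * q powr (- 0)"
      unfolding cplus.simps by (intro ratio_bound; ((use I in linarith) | simp))
    then show ?thesis using nn cX_ge q0 unfolding Xm by simp
  qed
qed

text \<open>The target index forces \<open>l \<ge> 3 / 2\<close>, away from the zero of
  \<open>[2l - 1]\<close> in the denominator, and keeps the arguments under the roots
  nonnegative.\<close>

lemma cminus_bound:
  assumes "(l, m, N) \<in> spinor_index" "(l - 1, m + idx x, N) \<in> spinor_index" shows "\<bar>cminus x l m\<bar> \<le> cX"
proof -
  note I = spinor_indexD[OF assms(1)] spinor_indexD[OF assms(2)]
  have l: "3 / 2 \<le> l" using I by simp
  show ?thesis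
  proof (cases x)
    case Xp
    note I = I[unfolded Xp idx.simps]
    let ?E = "q powr (l + m + 1) * sqrt (qn (l - m - 1)) * sqrt (qn (l - m))
        / (sqrt (qn (2 * l - 1)) * sqrt (qn (2 * l)))"
    have "0 \<le> ?E" by (intro qn_nn; use I l in linarith)
    moreover have "?E \<le> wq / q * q powr (- 0)"
      by (intro ratio_bound; ((use I l in linarith) | simp))
    moreover have "cminus Xp l m = - ?E" by simp
    ultimately show ?thesis using cX_ge q0 unfolding Xp by (simp only: abs_minus_cancel, simp?)
  next
    case X0
    note I = I[unfolded X0 idx.simps]
    have "0 \<le> cminus X0 l m"
      unfolding cminus.simps by (intro qn_nn; use I l in linarith)
    moreover have "q powr m * sqrt (qn (l - m)) * sqrt (qn (l + m))
        / (sqrt (qn (2 * l - 1)) * sqrt (qn (2 * l))) \<le> wq / q * q powr (- 0)"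
      by (intro ratio_bound; ((use I l in linarith) | simp))
    from mult_right_mono[OF this, of "sqrt (qn 2)"] have "cminus X0 l m \<le> wq / q * sqrt (qn 2)"
      using qn2_nonneg q0 by (simp add: mult_ac)
    ultimately show ?thesis using cX_ge unfolding X0 by simp
  next
    case Xm
    note I = I[unfolded Xm idx.simps]
    let ?E = "q powr (- l + m - 1) * sqrt (qn (l + m - 1)) * sqrt (qn (l + m))
        / (sqrt (qn (2 * l - 1)) * sqrt (qn (2 * l)))"
    have "0 \<le> ?E" by (intro qn_nn; use I l in linarith)
    moreover have "?E \<le> wq / q * q powr (- 1)"
      by (intro ratio_bound; ((use I l in linarith) | simp))
    moreover have "wq / q * q powr (- 1) \<le> cX" using cX_ge(3) q0 by (simp add: powr_minus_divide)
    moreover have "cminus Xm l m = - ?E" by simp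
    ultimately show ?thesis unfolding Xm by (simp only: abs_minus_cancel, simp?)
  qed
qed

lemma czero_bound:
  assumes "(l, m, N) \<in> spinor_index" "(l, m + idx x, N) \<in> spinor_index" shows "\<bar>czero x l m\<bar> \<le> cX"
proof -
  note I = spinor_indexD[OF assms(1)] spinor_indexD[OF assms(2)]
  have s: "sqrt (qn (2 * l)) * sqrt (qn (2 * l)) = qn (2 * l)"
    using I qn_nonneg[of "2 * l"] by simp
  show ?thesis
  proof (cases x)
    case Xp
    note I = I[unfolded Xp idx.simps]
    let ?E = "q powr (m + 2) * sqrt (qn (l - m)) * sqrt (qn (l + m + 1)) * sqrt (qn 2) / qn (2 * l)"
    have "0 \<le> ?E" by (intro qn_nn; use I in linarith)
    moreover have "q powr (m + 2) * sqrt (qn (l - m)) * sqrt (qn (l + m + 1))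
        / (sqrt (qn (2 * l)) * sqrt (qn (2 * l))) \<le> wq / q * q powr (- 0)"
      by (intro ratio_bound; ((use I in linarith) | simp))
    from mult_right_mono[OF this, of "sqrt (qn 2)"] have "?E \<le> wq / q * sqrt (qn 2)"
      unfolding s using qn2_nonneg q0 by (simp add: mult_ac)
    moreover have "czero Xp l m = - ?E" by simp
    ultimately show ?thesis using cX_ge(2) unfolding Xp by (simp only: abs_minus_cancel, simp?)
  next
    case Xm
    note I = I[unfolded Xm idx.simps]
    have "0 \<le> czero Xm l m" unfolding czero.simps by (intro qn_nn; use I in linarith)
    moreover have "q powr m * sqrt (qn (l - m + 1)) * sqrt (qn (l + m))
        / (sqrt (qn (2 * l)) * sqrt (qn (2 * l))) \<le> wq / q * q powr (- 1)"
      by (intro ratio_bound; ((use I in linarith) | simp))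
    from mult_right_mono[OF this, of "sqrt (qn 2)"] have "czero Xm l m \<le> wq / q * sqrt (qn 2) / q"
      unfolding s using qn2_nonneg q0 by (simp add: mult_ac powr_minus_divide)
    ultimately show ?thesis using cX_ge(4) unfolding Xm by simp
  next
    case X0
    \<comment> \<open>Both products in the numerator have arguments with sum
      \<open>2 * l + 1\<close>, so each is of order \<open>q^(-2l-1)\<close> and comparable with
      \<open>[2l]\<close>.\<close>
    have b: "qn a * qn b / qn (2 * l) \<le> (wq / q)\<^sup>2" if "a + b = 2 * l + 1" "0 \<le> a" "0 \<le> b" for a b
    proof -
      have "qn a * qn b / qn (2 * l) \<le> (wq * q powr (- a)) * (wq * q powr (- b)) / (q * q powr (- (2 * l)))"
        using that I wq_pos q0 by (intro frac_le mult_mono qn_le qn_ge qn_nonneg mult_nonneg_nonneg mult_pos_pos) auto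
      also have "\<dots> = wq\<^sup>2 * q powr (2 * l - a - b) / q"
        using q0 by (simp add: powr_diff powr_add powr_minus field_simps power2_eq_square)
      also have "2 * l - a - b = - 1" using that by simp
      finally show ?thesis using q0 by (simp add: powr_minus_divide power2_eq_square)
    qed
    let ?A = "qn (l - m + 1) * qn (l + m) / qn (2 * l)" and ?B = "qn (l - m) * qn (l + m + 1) / qn (2 * l)"
    have A: "0 \<le> ?A" and B: "0 \<le> ?B" by (intro qn_nn; use I in linarith)+
    have A2: "?A \<le> (wq / q)\<^sup>2" and B2: "?B \<le> (wq / q)\<^sup>2" using I by (intro b; simp)+
    have "q\<^sup>2 * ?B \<le> 1 * ?B" using B q0 q1 by (intro mult_right_mono) (auto simp: power_le_one)
    then have B3: "q\<^sup>2 * ?B \<le> (wq / q)\<^sup>2" using B2 by (simp only: mult_1)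
    have "0 \<le> q\<^sup>2 * ?B" by (rule mult_nonneg_nonneg[OF zero_le_power2 B])
    from abs_diff_le[OF A A2 this B3] have "\<bar>czero X0 l m\<bar> \<le> 2 * (wq / q)\<^sup>2"
      by (simp add: diff_divide_distrib)
    then show ?thesis using cX_ge(5) unfolding X0 by linarith
  qed
qed

section \<open>Size of the reduced matrix elements and of their differences in
  \<open>N\<close>\<close>

definition gterm :: "real \<Rightarrow> real \<Rightarrow> real" where
  "gterm N l = q powr (- 2 * N) / (qn (2 * l))\<^sup>2 * (qn l)\<^sup>2 * (t - 1 + q powr (2 * N))\<^sup>2"

text \<open>For \<open>N = 1/2\<close> and \<open>N = -1/2\<close> the product
  \<open>[l + N][l - N]\<close> is the same. The whole dependence of \<open>alphaN\<close> on
  \<open>N\<close> therefore sits in \<open>gterm\<close>, which is why differences in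
  \<open>N\<close> are small.\<close>

definition apre :: "real \<Rightarrow> real" where
  "apre l = sqrt (qn 2) * (sqrt (qn (l + 1 / 2)) * sqrt (qn (l - 1 / 2))) * sqrt (qn (2 * l))
      / (sqrt (qn (2 * l + 1)) * qn l)"

lemma alphaN_eq: "N \<in> {- 1 / 2, 1 / 2} \<Longrightarrow> alphaN q t N l = apre l * sqrt (1 - t + gterm N l)"
  by (elim pm_halfE; hypsubst; simp add: alphaN_def apre_def gterm_def)

text \<open>\<open>wq / q\<close> comes from the ratio \<open>[l] / [2l]\<close>; the two factors
  \<open>1 / q\<close> bound the roots of \<open>q^(-2N)\<close> and of
  \<open>(t - 1 + q^(2N))^2\<close>.\<close>

definition cG :: real where "cG = wq / q * (1 / q) * (1 / q)"

lemma gterm_bounds: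
  assumes "l \<in> half_spins" "N \<in> {- 1 / 2, 1 / 2}"
  shows "0 \<le> gterm N l" "gterm N l \<le> (cG * q powr l)\<^sup>2"
proof -
  have l: "1 / 2 \<le> l" using assms(1) by (rule half_spins_ge)
  show "0 \<le> gterm N l" by (simp add: gterm_def)
  have 1: "qn l / qn (2 * l) \<le> wq / q * q powr l"
  proof -
    have "qn l / qn (2 * l) \<le> (wq * q powr (- l)) / (q * q powr (- (2 * l)))"
      using l wq_pos q0 by (intro frac_le qn_le qn_ge) auto
    also have "\<dots> = wq / q * q powr l"
      using q0 by (simp add: powr_diff powr_add powr_minus field_simps power2_eq_square flip: powr_add)
    finally show ?thesis .
  qed
  have 2: "q powr (- 2 * N) \<le> (1 / q)\<^sup>2"
    using powr_q_mono[of "- 2" "- 2 * N"] assms(2) q0 by (auto simp: powr_minus_divide power_one_over)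
  have 3: "(t - 1 + q powr (2 * N))\<^sup>2 \<le> (1 / q)\<^sup>2"
  proof -
    have "q powr (2 * N) \<le> 1 / q" "0 < q powr (2 * N)"
      using powr_q_mono[of "- 1" "2 * N"] assms(2) q0 by (auto simp: powr_minus_divide)
    moreover have "1 < 1 / q" using q0 q1 by simp
    ultimately have "\<bar>t - 1 + q powr (2 * N)\<bar> \<le> 1 / q" using t0 t1 by linarith
    then show ?thesis using q0 by (intro abs_le_square_iff[THEN iffD1]) auto
  qed
  have e: "gterm N l = q powr (- 2 * N) * (qn l / qn (2 * l))\<^sup>2 * (t - 1 + q powr (2 * N))\<^sup>2"
    by (simp add: gterm_def power_divide)
  have "gterm N l \<le> (1 / q)\<^sup>2 * (wq / q * q powr l)\<^sup>2 * (1 / q)\<^sup>2"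
    unfolding e using l by (intro mult_mono power_mono 1 2 3 divide_nonneg_nonneg qn_nonneg) auto
  also have "\<dots> = (cG * q powr l)\<^sup>2" by (simp add: cG_def power_mult_distrib power_divide)
  finally show "gterm N l \<le> (cG * q powr l)\<^sup>2" .
qed

lemma apre_bound:
  assumes "l \<in> half_spins" shows "0 \<le> apre l" "apre l \<le> sqrt (qn 2) * (wq / q)"
proof -
  have l: "1 / 2 \<le> l" using assms by (rule half_spins_ge)
  show "0 \<le> apre l" unfolding apre_def by (intro qn_nn; use l in linarith)
  show "apre l \<le> sqrt (qn 2) * (wq / q)"
  \<comment> \<open>At \<open>l = 1 / 2\<close> the factor \<open>[l - 1/2]\<close> vanishes. Every
    other spin is at least \<open>3 / 2\<close>, where the lower bound \<open>qn_ge\<close> applies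
    to \<open>[l]\<close>.\<close>
  proof (cases "l = 1 / 2")
    case True
    show ?thesis unfolding True apre_def using wq_pos q0 qn2_nonneg by simp
  next
    case False
    then have l: "3 / 2 \<le> l" using half_spins_less[OF assms] l by simp
    have 1: "sqrt (qn (l + 1 / 2)) * sqrt (qn (l - 1 / 2)) / (sqrt (qn l) * sqrt (qn l))
        \<le> wq / q * q powr ((l + l - (l + 1 / 2) - (l - 1 / 2)) / 2)"
      using l by (intro sqrt_qn_ratio) auto
    have 2: "sqrt (qn (2 * l)) / sqrt (qn (2 * l + 1)) \<le> 1"
      using l qn_mono[of "2 * l" "2 * l + 1"] qn_pos[of "2 * l + 1"] by (simp add: divide_le_eq)
    have "apre l = sqrt (qn 2) * (sqrt (qn (l + 1 / 2)) * sqrt (qn (l - 1 / 2)) / (sqrt (qn l) * sqrt (qn l)))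
        * (sqrt (qn (2 * l)) / sqrt (qn (2 * l + 1)))"
      using l qn_nonneg[of l] by (simp add: apre_def)
    also have "\<dots> \<le> sqrt (qn 2) * (wq / q) * 1"
      using 1 2 l q0 qn2_nonneg by (intro mult_mono qn_nn) (simp_all add: wq_pos[THEN less_imp_le])
    finally show ?thesis by simp
  qed
qed

lemma alphaN_bound: "\<exists>c\<ge>0. \<forall>l\<in>half_spins. \<forall>N\<in>{- 1 / 2, 1 / 2}. \<bar>alphaN q t N l\<bar> \<le> c"
proof (intro exI conjI ballI)
  let ?c = "sqrt (qn 2) * (wq / q) * sqrt (1 + cG\<^sup>2)"
  show "0 \<le> ?c" using wq_pos q0 qn2_nonneg by auto
  fix l N :: real assume l: "l \<in> half_spins" and N: "N \<in> {- 1 / 2, 1 / 2}"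
  note g = gterm_bounds[OF l N]
  have "(cG * q powr l)\<^sup>2 \<le> cG\<^sup>2 * 1"
    unfolding power_mult_distrib using powr_q_le1[of l] half_spins_ge[OF l]
    by (intro mult_left_mono power_le_one) auto
  then have "1 - t + gterm N l \<le> 1 + cG\<^sup>2" "0 \<le> 1 - t + gterm N l" using g t0 t1 by linarith+
  then have "apre l * sqrt (1 - t + gterm N l) \<le> ?c"
    using apre_bound[OF l] by (intro mult_mono) auto
  moreover have "0 \<le> apre l * sqrt (1 - t + gterm N l)"
    using apre_bound[OF l] \<open>0 \<le> 1 - t + gterm N l\<close> by simp
  ultimately show "\<bar>alphaN q t N l\<bar> \<le> ?c" unfolding alphaN_eq[OF N] by simp
qed

text \<open>For \<open>t = 1\<close> only \<open>gterm\<close> is left under the root, and its root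
  is of order \<open>q^l\<close>.\<close>

lemma alphaN_bound_t1:
  assumes "t = 1"
  shows "\<exists>c\<ge>0. \<forall>l\<in>half_spins. \<forall>N\<in>{- 1 / 2, 1 / 2}. \<bar>alphaN q t N l\<bar> \<le> c * q powr l"
proof (intro exI conjI ballI)
  have cG: "0 \<le> cG" using wq_pos q0 by (simp add: cG_def)
  let ?c = "sqrt (qn 2) * (wq / q) * cG"
  show "0 \<le> ?c" using wq_pos q0 qn2_nonneg cG by auto
  fix l N :: real assume l: "l \<in> half_spins" and N: "N \<in> {- 1 / 2, 1 / 2}"
  note g = gterm_bounds[OF l N]
  have "sqrt (1 - t + gterm N l) \<le> cG * q powr l"
    using g assms cG by (intro real_le_lsqrt) auto
  then have "apre l * sqrt (1 - t + gterm N l) \<le> sqrt (qn 2) * (wq / q) * (cG * q powr l)"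
    using apre_bound[OF l] g assms qn2_nonneg wq_pos q0 by (intro mult_mono) auto
  moreover have "0 \<le> apre l * sqrt (1 - t + gterm N l)"
    using apre_bound[OF l] g assms by simp
  ultimately show "\<bar>alphaN q t N l\<bar> \<le> ?c * q powr l" unfolding alphaN_eq[OF N] by (simp add: mult.assoc)
qed

text \<open>A difference of roots is the difference of the radicands over the sum of the roots. The
  radicands differ by terms of order \<open>q^(2l)\<close>, and the sum of the roots stays above
  \<open>sqrt (1 - t)\<close>, which is positive exactly because
  \<open>t \<noteq> 1\<close>.\<close>

lemma alphaN_diff_bound:
  assumes "t \<noteq> 1"
  shows "\<exists>c\<ge>0. \<forall>l\<in>half_spins. \<forall>N\<in>{- 1 / 2, 1 / 2}. \<forall>N'\<in>{- 1 / 2, 1 / 2}.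
    \<bar>alphaN q t N l - alphaN q t N' l\<bar> \<le> c * q powr (2 * l)"
proof (intro exI conjI ballI)
  have t: "0 < 1 - t" using t1 assms by simp
  let ?c = "sqrt (qn 2) * (wq / q) * (cG\<^sup>2 / sqrt (1 - t))"
  show "0 \<le> ?c" using wq_pos q0 qn2_nonneg t by auto
  fix l N N' :: real assume l: "l \<in> half_spins" and N: "N \<in> {- 1 / 2, 1 / 2}" "N' \<in> {- 1 / 2, 1 / 2}"
  note g = gterm_bounds[OF l N(1)] gterm_bounds[OF l N(2)]
  let ?a = "1 - t + gterm N l" and ?b = "1 - t + gterm N' l"
  have e2: "(cG * q powr l)\<^sup>2 = cG\<^sup>2 * q powr (2 * l)"
    by (simp add: power_mult_distrib power2_eq_square flip: powr_add)
  have s: "sqrt (1 - t) \<le> sqrt ?a + sqrt ?b" using g t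
    by (smt (verit) real_sqrt_ge_zero real_sqrt_le_mono)
  have "(sqrt ?a - sqrt ?b) * (sqrt ?a + sqrt ?b) = ?a - ?b"
    using g t by (simp add: algebra_simps)
  then have "\<bar>sqrt ?a - sqrt ?b\<bar> * (sqrt ?a + sqrt ?b) = \<bar>?a - ?b\<bar>"
    using g t by (metis abs_mult abs_of_nonneg add_nonneg_nonneg real_sqrt_ge_zero less_imp_le)
  also have "\<dots> \<le> cG\<^sup>2 * q powr (2 * l)" using g unfolding e2[symmetric] by linarith
  finally have "\<bar>sqrt ?a - sqrt ?b\<bar> * sqrt (1 - t) \<le> cG\<^sup>2 * q powr (2 * l)"
    using mult_left_mono[OF s, of "\<bar>sqrt ?a - sqrt ?b\<bar>"] by linarith
  then have d: "\<bar>sqrt ?a - sqrt ?b\<bar> \<le> cG\<^sup>2 / sqrt (1 - t) * q powr (2 * l)"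
    using t by (simp add: field_simps)
  have "\<bar>alphaN q t N l - alphaN q t N' l\<bar> = apre l * \<bar>sqrt ?a - sqrt ?b\<bar>"
    unfolding alphaN_eq[OF N(1)] alphaN_eq[OF N(2)] using apre_bound(1)[OF l]
    by (simp add: abs_mult flip: right_diff_distrib)
  also have "\<dots> \<le> sqrt (qn 2) * (wq / q) * (cG\<^sup>2 / sqrt (1 - t) * q powr (2 * l))"
    using apre_bound[OF l] d qn2_nonneg wq_pos q0 by (intro mult_mono) auto
  finally show "\<bar>alphaN q t N l - alphaN q t N' l\<bar> \<le> ?c * q powr (2 * l)" by (simp add: mult.assoc)
qed

lemma betaN_eq:
  assumes "N \<in> {- 1 / 2, 1 / 2}"
  shows "betaN q t N l = (sgn N * (1 / q + q - q powr (sgn N) * t)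
     + t * (q - 1 / q) * (qn (1 / 2) * qn (3 / 2) - qn l * qn (l + 1))) / (q * qn (2 * l + 2))"
proof -
  have "qn 1 = 1" using q0 q_lt_inv by (simp add: qnum_def powr_minus_divide)
  then show ?thesis using assms unfolding betaN_def
    by (elim pm_halfE; hypsubst; simp)
qed

lemma inv_qn_bound:
  assumes "l \<in> half_spins" shows "1 / (q * qn (2 * l + 2)) \<le> q powr (2 * l)" "0 < qn (2 * l + 2)"
proof -
  have l: "1 / 2 \<le> l" using assms by (rule half_spins_ge)
  then show p: "0 < qn (2 * l + 2)" by (intro qn_pos) auto
  have "1 / (q * qn (2 * l + 2)) \<le> 1 / (q * (q * q powr (- (2 * l + 2))))"
    using l q0 by (intro divide_left_mono mult_left_mono qn_ge mult_pos_pos p) auto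
  also have "\<dots> = q powr (2 * l)"
    using q0 by (simp add: powr_minus powr_add powr_diff field_simps power2_eq_square)
  finally show "1 / (q * qn (2 * l + 2)) \<le> q powr (2 * l)" .
qed

lemma sgn_term_bound: "\<bar>sgn N * (1 / q + q - q powr (sgn N) * t)\<bar> \<le> 3 / q" if "N \<in> {- 1 / 2, 1 / 2 :: real}"
proof -
  have "q powr (sgn N) \<le> 1 / q" "0 < q powr (sgn N)"
    using powr_q_mono[of "- 1" "sgn N"] that q0 by (auto simp: powr_minus_divide)
  then have "q powr (sgn N) * t \<le> 1 / q * 1" using t0 t1 q0 by (intro mult_mono) auto
  moreover have "0 \<le> q powr (sgn N) * t" using t0 by simp
  moreover have "\<bar>sgn N\<bar> = 1" using that by auto
  moreover have "0 < q" "q < 1 / q" using q0 q_lt_inv by auto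
  moreover have "1 / q * 1 = 1 / q" "3 / q = 1 / q + 1 / q + 1 / q" by simp_all
  ultimately show ?thesis unfolding abs_mult by (simp only: mult_1, linarith?)
qed

text \<open>The growing part \<open>[l][l + 1]\<close> of the numerator does not depend on the sign
  of \<open>N\<close> and cancels. What is left is bounded, so the decay is that of
  \<open>1 / [2l + 2]\<close>; the constant is twice the \<open>3 / q\<close> of
  \<open>sgn_term_bound\<close>.\<close>

lemma betaN_diff_bound:
  "\<exists>c\<ge>0. \<forall>l\<in>half_spins. \<forall>N\<in>{- 1 / 2, 1 / 2}. \<forall>N'\<in>{- 1 / 2, 1 / 2}.
    \<bar>betaN q t N l - betaN q t N' l\<bar> \<le> c * q powr (2 * l)"
proof (intro exI conjI ballI)
  show "0 \<le> 6 / q" using q0 by simp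
  fix l N N' :: real assume l: "l \<in> half_spins" and N: "N \<in> {- 1 / 2, 1 / 2}" "N' \<in> {- 1 / 2, 1 / 2}"
  let ?s = "\<lambda>N. sgn N * (1 / q + q - q powr (sgn N) * t)"
  have "betaN q t N l - betaN q t N' l = (?s N - ?s N') * (1 / (q * qn (2 * l + 2)))"
    unfolding betaN_eq[OF N(1)] betaN_eq[OF N(2)] by (simp flip: diff_divide_distrib)
  then have "\<bar>betaN q t N l - betaN q t N' l\<bar> = \<bar>?s N - ?s N'\<bar> * (1 / (q * qn (2 * l + 2)))"
    using inv_qn_bound(2)[OF l] q0 by (simp add: abs_mult)
  also have "\<dots> \<le> 6 / q * q powr (2 * l)"
    using sgn_term_bound[OF N(1)] sgn_term_bound[OF N(2)] inv_qn_bound[OF l] q0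
    by (intro mult_mono) (auto intro: order_trans[OF abs_triangle_ineq4])
  finally show "\<bar>betaN q t N l - betaN q t N' l\<bar> \<le> 6 / q * q powr (2 * l)" .
qed

lemma affine_bound:
  fixes x :: real
  assumes "\<bar>x\<bar> \<le> S" "\<bar>T\<bar> \<le> H" "0 \<le> r" "r \<le> 1" "0 \<le> B * r" "B * r \<le> b"
  shows "\<bar>(x + T * (A - B)) * r\<bar> \<le> S + H * (\<bar>A\<bar> + b)"
proof -
  have "\<bar>x\<bar> * r \<le> S * 1" "\<bar>A\<bar> * r \<le> \<bar>A\<bar> * 1"
    using assms by (intro mult_mono; simp)+
  moreover have "\<bar>A * r - B * r\<bar> \<le> \<bar>A\<bar> * r + B * r"
    using assms by (metis abs_mult abs_of_nonneg abs_triangle_ineq4)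
  ultimately have x: "\<bar>x * r\<bar> \<le> S" and "\<bar>A * r - B * r\<bar> \<le> \<bar>A\<bar> + b"
    using assms by (auto simp: abs_mult)
  then have "\<bar>T\<bar> * \<bar>A * r - B * r\<bar> \<le> H * (\<bar>A\<bar> + b)"
    using assms by (intro mult_mono) auto
  moreover have "(x + T * (A - B)) * r = x * r + T * (A * r - B * r)" by (simp add: algebra_simps)
  ultimately show ?thesis using x abs_triangle_ineq[of "x * r" "T * (A * r - B * r)"]
    by (simp add: abs_mult)
qed

text \<open>Here nothing cancels: the numerator grows like \<open>[l][l + 1]\<close>, of order
  \<open>q^(-2l-1)\<close>, and the denominator \<open>[2l + 2]\<close> balances it.\<close>

lemma betaN_bound: "\<exists>c\<ge>0. \<forall>l\<in>half_spins. \<forall>N\<in>{- 1 / 2, 1 / 2}. \<bar>betaN q t N l\<bar> \<le> c"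
proof (intro exI conjI ballI)
  define h where "h = \<bar>q - 1 / q\<bar>"
  let ?c = "3 / q + h * (\<bar>qn (1 / 2) * qn (3 / 2)\<bar> + wq\<^sup>2 / q)"
  show "0 \<le> ?c" using q0 wq_pos by (simp add: h_def)
  fix l N :: real assume l: "l \<in> half_spins" and N: "N \<in> {- 1 / 2, 1 / 2}"
  have l2: "1 / 2 \<le> l" using half_spins_ge[OF l] .
  define r where "r = 1 / (q * qn (2 * l + 2))"
  have r: "0 < r" "r \<le> q powr (2 * l)" using inv_qn_bound[OF l] q0 by (auto simp: r_def)
  have r1: "r \<le> 1" using r powr_q_le1[of "2 * l"] l2 by simp
  have "qn l * qn (l + 1) \<le> (wq * q powr (- l)) * (wq * q powr (- (l + 1)))"
    using l2 wq_pos by (intro mult_mono qn_le qn_nonneg mult_nonneg_nonneg) auto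
  then have "qn l * qn (l + 1) * r \<le> (wq * q powr (- l)) * (wq * q powr (- (l + 1))) * q powr (2 * l)"
    by (rule mult_mono[OF _ r(2)]) (use wq_pos r in auto)
  also have "\<dots> = wq\<^sup>2 * (q powr (- l) * q powr (- (l + 1)) * q powr (2 * l))"
    by (simp add: power2_eq_square)
  also have "q powr (- l) * q powr (- (l + 1)) * q powr (2 * l) = q powr (- 1)"
    by (simp flip: powr_add)
  also have "wq\<^sup>2 * q powr (- 1) = wq\<^sup>2 / q" using q0 by (simp add: powr_minus_divide)
  finally have b: "qn l * qn (l + 1) * r \<le> wq\<^sup>2 / q" .
  have "0 \<le> qn l * qn (l + 1) * r"
    by (intro mult_nonneg_nonneg qn_nonneg less_imp_le[OF r(1)]; use l2 in linarith)
  note b = b this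
  have T: "\<bar>t * (q - 1 / q)\<bar> \<le> h"
    using t0 t1 mult_right_mono[of t 1 h] by (simp add: abs_mult h_def)
  have "betaN q t N l = (sgn N * (1 / q + q - q powr (sgn N) * t)
      + t * (q - 1 / q) * (qn (1 / 2) * qn (3 / 2) - qn l * qn (l + 1))) * r"
    unfolding betaN_eq[OF N] r_def by simp
  then show "\<bar>betaN q t N l\<bar> \<le> ?c"
    using affine_bound[OF sgn_term_bound[OF N] T less_imp_le[OF r(1)] r1 b(2,1)] by (simp only:)
qed

end

section \<open>The action of the quantized enveloping algebra on spinors\<close>

fun us :: "u_gen \<Rightarrow> real" where
  "us Uf = 1" | "us Ue = - 1" | "us Uk = 0" | "us Uk_inv = 0"

lemma add_inverse_diff:
  fixes a b :: real
  assumes "a > 0" "b > 0"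
  shows "b + 1 / b - (a + 1 / a) = (a - b) * (1 - a * b) / (a * b)"
proof -
  define x y where "x = 1 / a" and "y = 1 / b"
  have "a * x = 1" "b * y = 1" using assms by (simp_all add: x_def y_def)
  moreover have "(b + y - (a + x)) * (a * b) = a * b * b + a * (b * y) - a * a * b - b * (a * x)"
    by (simp add: algebra_simps)
  ultimately have "(b + y - (a + x)) * (a * b) = (a - b) * (1 - a * b)" by (simp add: algebra_simps)
  moreover have "a * b \<noteq> 0" using assms by simp
  ultimately show ?thesis unfolding x_def y_def by (metis nonzero_mult_div_cancel_right)
qed

context podles
begin

fun uc :: "u_gen \<Rightarrow> real \<Rightarrow> real \<Rightarrow> real" where
  "uc Uk l m = q powr m"
| "uc Uk_inv l m = q powr (- m)"
| "uc Uf l m = sqrt (qn (l - m)) * sqrt (qn (l + m + 1))"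
| "uc Ue l m = sqrt (qn (l - m + 1)) * sqrt (qn (l + m))"

lemma u_gen_vector_eq: "u_gen_vector q g (l, m, N) = of_real (uc g l m) *\<^sub>C vec (l, m + us g, N)"
  by (cases g) (simp_all add: vec_eq)

text \<open>At the edge of the multiplet the step out of it has the factor
  \<open>[l - m] = 0\<close> or \<open>[l + m] = 0\<close>. The convention for missing basis vectors
  is thus already contained in the coefficients.\<close>

lemma uc_boundary:
  assumes "(l, m, N) \<in> spinor_index" "(l, m + us g, N) \<notin> spinor_index"
  shows "uc g l m = 0"
proof (cases g)
  case Uf
  have "\<not> 1 \<le> l - m"
    using spinor_index_shift[OF assms(1), of l 0 "m + 1" 1] assms(2) spinor_indexD[OF assms(1)] Uf by auto
  then have "l - m = 0" using spinor_index_gap[OF assms(1)] by auto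
  then show ?thesis unfolding Uf by simp
next
  case Ue
  have "\<not> 1 \<le> l + m"
    using spinor_index_shift[OF assms(1), of l 0 "m - 1" "- 1"] assms(2) spinor_indexD[OF assms(1)] Ue by auto
  then have "l + m = 0" using spinor_index_gap[OF assms(1)] by auto
  then show ?thesis unfolding Ue by simp
qed (use assms in auto)

abbreviation act :: "u_gen \<Rightarrow> spinor \<Rightarrow> spinor" where "act \<equiv> spinor_act_gen q"

text \<open>A formula without any test of membership in \<open>spinor_index\<close>, thanks to
  \<open>uc_boundary\<close>; operator identities on \<open>\<W>\<close> become identities of scalar
  factors.\<close>

lemma act_coeff:
  assumes "x \<in> \<W>"
  shows "coeff (act g x) (l, m, N) = of_real (uc g l (m - us g)) * coeff x (l, m - us g, N)"
proof -
  let ?S = "{i. coeff x i \<noteq> 0}" and ?j = "(l, m - us g, N)"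
  let ?c = "of_real (uc g l (m - us g)) * coeff x ?j"
  have fin: "finite ?S" using assms by (simp add: \<W>_def)
  have "coeff (act g x) (l, m, N) = (\<Sum>i\<in>?S. coeff x i * coeff (u_gen_vector q g i) (l, m, N))"
    by (simp add: spinor_act_gen_def)
  also have "\<dots> = (\<Sum>i\<in>?S. if i = ?j then ?c else 0)"
  proof (rule sum.cong)
    fix i assume i: "i \<in> ?S"
    obtain l' m' N' where i': "i = (l', m', N')" by (cases i)
    have ind: "(l', m', N') \<in> spinor_index" using i i' coeff_outside by blast
    show "coeff x i * coeff (u_gen_vector q g i) (l, m, N) = (if i = ?j then ?c else 0)"
    proof (cases "i = ?j")
      case True
      then have e: "l' = l" "m' = m - us g" "N' = N" using i' by auto
      show ?thesis
      proof (cases "(l, m, N) \<in> spinor_index")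
        case False
        then have "uc g l (m - us g) = 0" using uc_boundary[of l "m - us g" N g] ind e by simp
        then show ?thesis using True e unfolding i' u_gen_vector_eq by (simp add: coeff_vec)
      qed (use True e in \<open>simp add: i' u_gen_vector_eq coeff_vec\<close>)
    next
      case False
      then show ?thesis unfolding i' u_gen_vector_eq by (auto simp: coeff_vec)
    qed
  qed simp
  also have "\<dots> = ?c" using fin by simp
  finally show ?thesis .
qed

lemma act_\<W> [simp]: "x \<in> \<W> \<Longrightarrow> act g x \<in> \<W>"
proof -
  have "u_gen_vector q g i \<in> \<W>" for i
    by (cases i) (simp only: u_gen_vector_eq, intro \<W>_scaleC \<W>_vec)
  then show "act g x \<in> \<W>" unfolding spinor_act_gen_def by (intro \<W>_sum \<W>_scaleC)
qed

lemma act_add: "x \<in> \<W> \<Longrightarrow> y \<in> \<W> \<Longrightarrow> act g (x + y) = act g x + act g y"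
  by (rule spinor_eqI, rename_tac i, case_tac i) (simp add: act_coeff \<W>_add algebra_simps)

lemma act_scale: "x \<in> \<W> \<Longrightarrow> act g (c *\<^sub>C x) = c *\<^sub>C act g x"
  by (rule spinor_eqI, rename_tac i, case_tac i) (simp add: act_coeff \<W>_scaleC algebra_simps)

abbreviation U :: "u_gen free_alg \<Rightarrow> spinor \<Rightarrow> spinor" where "U \<equiv> opext scaleC act"

lemma spinor_act_free_eq: "spinor_act_free q = U"
  by (intro ext) (simp add: spinor_act_free_def opext_def lext_def)

lemmas U_simps = opext_add[OF scaleC.module_axioms] opext_diff[OF scaleC.module_axioms]
  opext_minus[OF scaleC.module_axioms] opext_zero[OF scaleC.module_axioms]
  opext_cst[OF scaleC.module_axioms] opext_one[OF scaleC.module_axioms]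
  opext_gen[OF scaleC.module_axioms] opext_cst_times[OF scaleC.module_axioms]

lemma U_\<W> [simp]: "x \<in> \<W> \<Longrightarrow> U a x \<in> \<W>"
  by (rule opext_closed[OF scaleC.module_axioms, of \<W>]) (auto simp: act_add act_scale)

lemma U_mult: "x \<in> \<W> \<Longrightarrow> U (a * b) x = U a (U b x)"
  by (rule opext_mult[OF scaleC.module_axioms, of \<W>]) (auto simp: act_add act_scale)

lemma U_add: "x \<in> \<W> \<Longrightarrow> y \<in> \<W> \<Longrightarrow> U a (x + y) = U a x + U a y"
  by (rule opext_vec_add[OF scaleC.module_axioms, of \<W>]) (auto simp: act_add act_scale)

lemma U_scale: "x \<in> \<W> \<Longrightarrow> U a (c *\<^sub>C x) = c *\<^sub>C U a x"
  by (rule opext_vec_scale[OF scaleC.module_axioms, of \<W>]) (auto simp: act_add act_scale)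

lemma U_vec_zero [simp]: "U a 0 = 0"
  using U_scale[of 0 a 0] by simp

lemma q_facts: "q \<noteq> 0" "q * q \<noteq> 1" "1 - q * q \<noteq> 0" "q * q - 1 \<noteq> 0" "1 / q - q \<noteq> 0" "wq * (1 - q * q) = q"
proof -
  show "q \<noteq> 0" using q0 by simp
  have "q * q < 1 * 1" using q0 q1 by (intro mult_strict_mono) auto
  then show qq: "q * q \<noteq> 1" "1 - q * q \<noteq> 0" "q * q - 1 \<noteq> 0" by auto
  show "1 / q - q \<noteq> 0" using q_lt_inv by simp
  then show "wq * (1 - q * q) = q" using q0 qq by (simp add: wq_def field_simps)
qed

lemma wq_alt: "wq = q / (1 - q * q)"
  using q_facts by (simp add: field_simps)

lemma qn_commutator:
  "q powr m * q powr m - q powr (- m) * q powr (- m)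
    = (q - 1 / q) * (qn (l - m + 1) * qn (l + m) - qn (l - m) * qn (l + m + 1))"
proof -
  have "q powr l > 0" "q powr m > 0" using q0 by auto
  then show ?thesis using q0 q_facts(1-4)
    by (simp add: qn_eq wq_alt powr_add powr_diff powr_minus divide_simps) (simp add: algebra_simps power2_eq_square)
qed

lemma qn_times: "(q - 1 / q) * qn n = q powr n - q powr (- n)"
  using q_facts by (simp add: qnum_def)

text \<open>The factor \<open>(q - 1 / q)^2\<close> clears both q-numbers. Of the four powers that
  arise, the two depending on \<open>m\<close> cancel against the terms of \<open>k^2\<close> and
  \<open>k^(-2)\<close>.\<close>

lemma qn_casimir:
  "q * (q powr m * q powr m) + 1 / q * (q powr (- m) * q powr (- m))
    + (q - 1 / q)\<^sup>2 * (qn (l - m) * qn (l + m + 1)) = q powr (2 * l + 1) + q powr (- 2 * l - 1)"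
proof -
  have "(q - 1 / q)\<^sup>2 * (qn (l - m) * qn (l + m + 1))
      = ((q - 1 / q) * qn (l - m)) * ((q - 1 / q) * qn (l + m + 1))"
    by (simp add: power2_eq_square mult_ac)
  also have "\<dots> = q powr (l - m) * q powr (l + m + 1) - q powr (l - m) * q powr (- (l + m + 1))
      - q powr (- (l - m)) * q powr (l + m + 1) + q powr (- (l - m)) * q powr (- (l + m + 1))"
    unfolding qn_times by (simp only: left_diff_distrib right_diff_distrib)
  also have "\<dots> = q powr (2 * l + 1) - q powr (- 2 * m - 1) - q powr (2 * m + 1) + q powr (- 2 * l - 1)"
  proof -
    have "l - m + (l + m + 1) = 2 * l + 1" "l - m + - (l + m + 1) = - 2 * m - 1"
      "- (l - m) + (l + m + 1) = 2 * m + 1" "- (l - m) + - (l + m + 1) = - 2 * l - 1" by simp_all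
    then show ?thesis unfolding powr_add[symmetric] by (simp only:)
  qed
  finally have "(q - 1 / q)\<^sup>2 * (qn (l - m) * qn (l + m + 1))
    = q powr (2 * l + 1) - q powr (- 2 * m - 1) - q powr (2 * m + 1) + q powr (- 2 * l - 1)" .
  moreover have "q * (q powr m * q powr m) = q powr (2 * m + 1)"
  proof -
    have "2 * m + 1 = 1 + (m + m)" by simp
    then show ?thesis using q0 by (simp only: powr_add powr_one)
  qed
  moreover have "1 / q * (q powr (- m) * q powr (- m)) = q powr (- 2 * m - 1)"
  proof -
    have "- 2 * m - 1 = - 1 + (- m + - m)" "q powr - 1 = 1 / q" using q0 by (simp_all add: powr_minus_divide)
    then show ?thesis by (simp only: powr_add)
  qed
  ultimately show ?thesis by linarith
qed

lemma sqrt_qn_sq: "0 \<le> n \<Longrightarrow> sqrt (qn n) * sqrt (qn n) = qn n"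
  using qn_nonneg by simp

lemma act_k_kinv: "x \<in> \<W> \<Longrightarrow> act Uk (act Uk_inv x) = x" "x \<in> \<W> \<Longrightarrow> act Uk_inv (act Uk x) = x"
  using q0 by (auto intro!: spinor_eqI simp: act_coeff simp flip: of_real_mult powr_add mult.assoc)

lemma act_k_f: "x \<in> \<W> \<Longrightarrow> act Uk (act Uf x) = of_real q *\<^sub>C act Uf (act Uk x)"
  using q0 by (auto intro!: spinor_eqI simp: act_coeff powr_diff)

lemma act_k_e: "x \<in> \<W> \<Longrightarrow> act Uk (act Ue x) = of_real (1 / q) *\<^sub>C act Ue (act Uk x)"
  using q0 by (auto intro!: spinor_eqI simp: act_coeff powr_add)

lemma act_fe_coeff:
  assumes "x \<in> \<W>"
  shows "coeff (act Uf (act Ue x)) (l, m, N) = of_real (qn (l - m + 1) * qn (l + m)) * coeff x (l, m, N)"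
    "coeff (act Ue (act Uf x)) (l, m, N) = of_real (qn (l - m) * qn (l + m + 1)) * coeff x (l, m, N)"
proof -
  have "of_real (uc Uf l (m - 1) * uc Ue l m) * coeff x (l, m, N) = of_real (qn (l - m + 1) * qn (l + m)) * coeff x (l, m, N)
    \<and> of_real (uc Ue l (m + 1) * uc Uf l m) * coeff x (l, m, N) = of_real (qn (l - m) * qn (l + m + 1)) * coeff x (l, m, N)"
  proof (cases "(l, m, N) \<in> spinor_index")
    case True
    note I = spinor_indexD[OF True]
    have "uc Uf l (m - 1) * uc Ue l m = (sqrt (qn (l - m + 1)) * sqrt (qn (l - m + 1))) * (sqrt (qn (l + m)) * sqrt (qn (l + m)))"
      by (simp add: algebra_simps)
    also have "\<dots> = qn (l - m + 1) * qn (l + m)" using I by (simp only: sqrt_qn_sq)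
    finally have 1: "uc Uf l (m - 1) * uc Ue l m = qn (l - m + 1) * qn (l + m)" .
    have "uc Ue l (m + 1) * uc Uf l m = (sqrt (qn (l - m)) * sqrt (qn (l - m))) * (sqrt (qn (l + m + 1)) * sqrt (qn (l + m + 1)))"
      by (simp add: algebra_simps)
    also have "\<dots> = qn (l - m) * qn (l + m + 1)" using I by (simp only: sqrt_qn_sq)
    finally show ?thesis unfolding 1 by simp
  qed (simp add: coeff_outside)
  then show "coeff (act Uf (act Ue x)) (l, m, N) = of_real (qn (l - m + 1) * qn (l + m)) * coeff x (l, m, N)"
    "coeff (act Ue (act Uf x)) (l, m, N) = of_real (qn (l - m) * qn (l + m + 1)) * coeff x (l, m, N)"
    using assms by (simp_all add: act_coeff del: uc.simps)
qed

lemma act_kk_coeff: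
  assumes "x \<in> \<W>"
  shows "coeff (act Uk (act Uk x)) (l, m, N) = of_real (q powr m * q powr m) * coeff x (l, m, N)"
    "coeff (act Uk_inv (act Uk_inv x)) (l, m, N) = of_real (q powr (- m) * q powr (- m)) * coeff x (l, m, N)"
  using assms by (simp_all add: act_coeff)

lemma act_commutator:
  assumes "x \<in> \<W>"
  shows "act Uk (act Uk x) - act Uk_inv (act Uk_inv x)
    = of_real (q - 1 / q) *\<^sub>C (act Uf (act Ue x) - act Ue (act Uf x))"
proof (rule spinor_eqI)
  fix i :: "real \<times> real \<times> real"
  obtain l m N where i: "i = (l, m, N)" by (cases i)
  show "coeff (act Uk (act Uk x) - act Uk_inv (act Uk_inv x)) i
    = coeff (of_real (q - 1 / q) *\<^sub>C (act Uf (act Ue x) - act Ue (act Uf x))) i"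
    unfolding i coeff_minus coeff_scaleC act_kk_coeff[OF assms] act_fe_coeff[OF assms]
      left_diff_distrib[symmetric] of_real_diff[symmetric] mult.assoc[symmetric] of_real_mult[symmetric]
    unfolding qn_commutator[of m l] ..
qed

lemma U_relation:
  assumes "r \<in> u_relations q" "x \<in> \<W>"
  shows "U r x = 0"
  using assms act_commutator[OF assms(2)]
  unfolding u_relations_def Let_def
  by (auto simp: U_simps U_mult act_k_kinv act_k_f act_k_e)

lemma U_ideal:
  assumes "a \<in> two_sided_ideal (u_relations q)" "x \<in> \<W>"
  shows "U a x = 0"
proof -
  have "two_sided_ideal (u_relations q) \<subseteq> {a. \<forall>x\<in>\<W>. U a x = 0}"
    by (rule two_sided_ideal_minimal) (auto simp: U_simps U_mult U_relation)
  then show ?thesis using assms by auto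
qed

lemma spinor_act_class:
  assumes "x \<in> \<W>"
  shows "spinor_act q (residue_class (u_relations q) a) x = U a x"
  unfolding spinor_act_def spinor_act_free_eq
proof (rule descend_residue_class)
  fix a b :: "u_gen free_alg" assume "a - b \<in> two_sided_ideal (u_relations q)"
  from U_ideal[OF this assms] show "U a x = U b x" by (simp add: U_simps)
qed

definition cas :: "real \<Rightarrow> real" where "cas l = q powr (2 * l + 1) + q powr (- 2 * l - 1)"

lemma casimir_coeff:
  assumes "x \<in> \<W>"
  shows "coeff (spinor_act q (casimir_element q) x) (l, m, N) = of_real (cas l) * coeff x (l, m, N)"
proof -
  have "spinor_act q (casimir_element q) x = of_real q *\<^sub>C act Uk (act Uk x)
      + of_real (1 / q) *\<^sub>C act Uk_inv (act Uk_inv x)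
      + of_real ((q - 1 / q)\<^sup>2) *\<^sub>C act Ue (act Uf x)"
    unfolding casimir_element_def Let_def spinor_act_class[OF assms]
    using assms by (simp add: U_simps U_mult)
  then show ?thesis
    unfolding cas_def qn_casimir[of m l, symmetric]
    by (simp only: coeff_plus coeff_scaleC act_kk_coeff[OF assms] act_fe_coeff[OF assms]
        of_real_add of_real_mult distrib_right mult.assoc)
qed

lemma casimir_vec: "spinor_act q (casimir_element q) (vec (l, m, N)) = of_real (cas l) *\<^sub>C vec (l, m, N)"
  by (rule spinor_eqI, rename_tac i, case_tac i) (simp add: casimir_coeff, simp add: coeff_vec)

text \<open>With \<open>a = q^(2l+1)\<close> the eigenvalue is \<open>a + 1 / a\<close>, which is
  strictly decreasing for \<open>a\<close> between \<open>0\<close> and \<open>1\<close>. This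
  separation of spins is what strong commutation with the Casimir operator exploits.\<close>

lemma cas_inj: assumes "cas l = cas l'" "0 \<le> l" "0 \<le> l'" shows "l = l'"
proof -
  have mono: "cas l < cas l'" if "0 \<le> l" "l < l'" for l l'
  proof -
    define a b where "a = q powr (2 * l + 1)" and "b = q powr (2 * l' + 1)"
    have "q powr (2 * l + 1) < q powr 0" using that q0 q1 by (intro powr_less_mono') auto
    moreover have "b < a" using that q0 q1 unfolding a_def b_def by (intro powr_less_mono') auto
    moreover have "0 < b" using q0 by (simp add: b_def)
    ultimately have b: "0 < b" "b < a" "a < 1" using q0 by (simp_all add: a_def)
    have e: "cas l = a + 1 / a" "cas l' = b + 1 / b"
    proof -
      have "- 2 * l - 1 = - (2 * l + 1)" for l :: real by simp
      then show "cas l = a + 1 / a" "cas l' = b + 1 / b"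
        unfolding cas_def a_def b_def by (simp_all only: powr_minus_divide)
    qed
    have "a * b < 1 * 1" by (rule mult_strict_mono) (use b in linarith)+
    then have ab: "a * b < 1" by simp
    have "cas l' - cas l = (a - b) * (1 - a * b) / (a * b)"
      unfolding e by (rule add_inverse_diff) (use b in linarith)+
    moreover have "0 < (a - b) * (1 - a * b) / (a * b)" using b ab by (intro divide_pos_pos mult_pos_pos) auto
    ultimately show ?thesis by simp
  qed
  show ?thesis using assms mono[of l l'] mono[of l' l] by (metis less_irrefl linorder_less_linear)
qed

end

section \<open>The spinor representation on generators\<close>

text \<open>The five shapes of the equivariance identities over a common denominator
  \<open>d\<close>. The letters m, z, p stand for the factor \<open>q\<close>, \<open>1\<close>,
  \<open>1 / q\<close> that belongs to \<open>x_{-1}\<close>, \<open>x_0\<close>,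
  \<open>x_1\<close>; the digit is the number of terms on the right.\<close>

lemma frac_id_m2: "n = a + q * b \<Longrightarrow> n / d = a / d + q * (b / d)" for n :: real
  by (simp add: add_divide_distrib)
lemma frac_id_m1: "n = q * b \<Longrightarrow> n / d = q * (b / d)" for n :: real
  by simp
lemma frac_id_z2: "n = a + b \<Longrightarrow> n / d = a / d + b / d" for n :: real
  by (simp add: add_divide_distrib)
lemma frac_id_p2: "0 < q \<Longrightarrow> q * n = q * a + b \<Longrightarrow> n / d = a / d + 1 / q * (b / d)" for n :: real
proof -
  assume q: "0 < q" "q * n = q * a + b"
  have "n = q * n / q" using q(1) by simp
  also have "\<dots> = a + 1 / q * b" unfolding q(2) using q(1) by (simp add: add_divide_distrib)
  finally have "n = a + 1 / q * b" .
  then show ?thesis by (simp add: add_divide_distrib)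
qed
lemma frac_id_p1: "0 < q \<Longrightarrow> q * n = b \<Longrightarrow> n / d = 1 / q * (b / d)" for n :: real
proof -
  assume q: "0 < q" "q * n = b"
  have "n = q * n / q" using q(1) by simp
  then show ?thesis unfolding q(2)[symmetric] by simp
qed

text \<open>Polynomial cores of the identities proved further below. Roots \<open>s\<close>,
  q-numbers \<open>n\<close> and powers \<open>p\<close> are opaque variables, tied together only by
  \<open>s * s = n\<close> and by the one or two identities that carry the content. This keeps the
  ideal membership problems small.\<close>

lemma we_Uf_m_Xm_alg:
  fixes q W n0 n1 n2 p3 p4 p5 s6 s7 s8 s9 :: real
  shows "- (p3 * n0) = n2 * (p5 * p5) - q * (p4 * n1) \<Longrightarrow> W * W = n2 \<Longrightarrow> s6 * s6 * s7 = n0 * s7 \<Longrightarrow> s8 * s8 = n1 \<Longrightarrow> ((s9 * s6) * (- (p3) * s6 * s7)) = (W * (p5 * s9 * s7 * W) * p5) + q * ((- (p4) * s7 * s8) * (s9 * s8))"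
  by Groebner_Basis.algebra

lemma we_Uf_m_X0_alg:
  fixes q W n0 n1 p2 p3 p4 n5 s6 s7 s8 s9 :: real
  shows "p4 * n0 = - (p2 * p4) + p3 * n1 \<Longrightarrow> W * W = n5 \<Longrightarrow> s6 * s6 = n0 \<Longrightarrow> s7 * s7 = n1 \<Longrightarrow> ((s8 * s6) * (p4 * s9 * s6 * W)) = (W * (- (p2) * s8 * s9) * p4) + ((p3 * s8 * s7 * W) * (s9 * s7))"
  by Groebner_Basis.algebra

lemma we_Uf_m_Xp_alg:
  fixes q W p0 p1 s2 s3 s4 s5 :: real
  shows "p0 * q = p1 \<Longrightarrow> q * ((s2 * s3) * (- (p0) * s4 * s5)) = ((- (p1) * s2 * s4) * (s5 * s3))"
  by (hypsubst, simp)

lemma we_Uf_z_Xm_alg: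
  fixes q W p0 p1 n2 s3 n4 s5 n6 s7 n8 s9 n10 :: real
  shows "p0 = q * p1 \<Longrightarrow> W * W = n2 \<Longrightarrow> s3 * s3 = n4 \<Longrightarrow> s5 * s5 = n6 \<Longrightarrow> s7 * s7 = n8 \<Longrightarrow> s9 * s9 = n10 \<Longrightarrow> ((s3 * s5) * (p1 * s3 * s5 * W)) = (W * ((n4 * n6) - q\<^sup>2 * (n8 * n10)) * p1) + q * ((p0 * s7 * s9 * W) * (s7 * s9))"
  by Groebner_Basis.algebra

lemma we_Uf_z_X0_alg:
  fixes q W n0 n1 n2 n3 n4 n5 n6 p7 p8 s9 s10 :: real
  shows "n0 * n1 - q\<^sup>2 * (n2 * n3) = - (n6 * (p7 * p8)) + (n2 * n3 - q\<^sup>2 * (n4 * n5)) \<Longrightarrow> W * W = n6 \<Longrightarrow> ((s9 * s10) * ((n0 * n1) - q\<^sup>2 * (n2 * n3))) = (W * (- (p7) * s9 * s10 * W) * p8) + (((n2 * n3) - q\<^sup>2 * (n4 * n5)) * (s9 * s10))"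
  by Groebner_Basis.algebra

lemma we_Uf_z_Xp_alg:
  fixes q W p0 p1 s2 s3 s4 s5 :: real
  shows "p0 * q = p1 \<Longrightarrow> q * ((s2 * s3) * (- (p0) * s4 * s5 * W)) = ((- (p1) * s2 * s3 * W) * (s4 * s5))"
  by (hypsubst, simp)

lemma we_Uf_p_Xm_alg:
  fixes q W n0 n1 n2 p3 p4 p5 s6 s7 s8 s9 :: real
  shows "p3 * n0 = n2 * (p5 * p5) + q * (p4 * n1) \<Longrightarrow> W * W = n2 \<Longrightarrow> s6 * s6 = n0 \<Longrightarrow> s7 * s7 = n1 \<Longrightarrow> ((s6 * s8) * (p3 * s9 * s6)) = (W * (p5 * s9 * s8 * W) * p5) + q * ((p4 * s7 * s9) * (s7 * s8))"
  by Groebner_Basis.algebra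

lemma we_Uf_p_X0_alg:
  fixes q W n0 n1 p2 p3 p4 n5 s6 s7 s8 s9 :: real
  shows "p4 * n0 = p2 * p4 + p3 * n1 \<Longrightarrow> W * W = n5 \<Longrightarrow> s6 * s6 = n0 \<Longrightarrow> s7 * s7 = n1 \<Longrightarrow> ((s6 * s8) * (p4 * s6 * s9 * W)) = (W * (p2 * s9 * s8) * p4) + ((p3 * s7 * s8 * W) * (s7 * s9))"
  by Groebner_Basis.algebra

lemma we_Uf_p_Xp_alg:
  fixes q W p0 p1 s2 s3 s4 s5 :: real
  shows "p0 * q = p1 \<Longrightarrow> q * ((s2 * s3) * (p0 * s4 * s5)) = ((p1 * s5 * s3) * (s2 * s4))"
  by (hypsubst, simp)

lemma we_Ue_m_Xm_alg:
  fixes q W p0 p1 s2 s3 s4 s5 :: real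
  shows "p0 = q * p1 \<Longrightarrow> ((s2 * s3) * (- (p0) * s4 * s5)) = q * ((- (p1) * s3 * s4) * (s2 * s5))"
  by (hypsubst, simp)

lemma we_Ue_m_X0_alg:
  fixes q W n0 n1 p2 p3 p4 n5 s6 s7 s8 s9 :: real
  shows "p4 * n0 = - (p2 * p4) + p3 * n1 \<Longrightarrow> W * W = n5 \<Longrightarrow> s6 * s6 = n0 \<Longrightarrow> s7 * s7 = n1 \<Longrightarrow> ((s6 * s8) * (p4 * s6 * s9 * W)) = (W * (- (p2) * s8 * s9) * p4) + ((p3 * s7 * s8 * W) * (s7 * s9))"
  by Groebner_Basis.algebra

lemma we_Ue_m_Xp_alg:
  fixes q W n0 n1 n2 p3 p4 p5 s6 s7 s8 s9 :: real
  shows "- (p3 * n0) * q = q * n2 * (p5 * p5) - p4 * n1 \<Longrightarrow> W * W = n2 \<Longrightarrow> s6 * s6 * s7 = n0 * s7 \<Longrightarrow> s8 * s8 = n1 \<Longrightarrow> q * ((s6 * s9) * (- (p3) * s6 * s7)) = q * (W * (p5 * s7 * s9 * W) * p5) + ((- (p4) * s7 * s8) * (s8 * s9))"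
  by Groebner_Basis.algebra

lemma we_Ue_z_Xm_alg:
  fixes q W p0 p1 s2 s3 s4 s5 :: real
  shows "p1 = q * p0 \<Longrightarrow> ((s2 * s3) * (p1 * s4 * s5 * W)) = q * ((p0 * s2 * s3 * W) * (s4 * s5))"
  by (hypsubst, simp)

lemma we_Ue_z_X0_alg:
  fixes q W n0 n1 n2 n3 n4 n5 n6 p7 s8 s9 :: real
  shows "n0 * n1 - q\<^sup>2 * (n2 * n3) = n6 * (p7 * p7) + (n4 * n5 - q\<^sup>2 * (n0 * n1)) \<Longrightarrow> W * W = n6 \<Longrightarrow> ((s8 * s9) * ((n0 * n1) - q\<^sup>2 * (n2 * n3))) = (W * (p7 * s8 * s9 * W) * p7) + (((n4 * n5) - q\<^sup>2 * (n0 * n1)) * (s8 * s9))"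
  by Groebner_Basis.algebra

lemma we_Ue_z_Xp_alg:
  fixes q W p0 p1 p2 n3 s4 n5 s6 n7 s8 n9 s10 n11 :: real
  shows "p0 = q\<^sup>2 * p1 \<Longrightarrow> p2 = q * p1 \<Longrightarrow> W * W = n3 \<Longrightarrow> s4 * s4 = n5 \<Longrightarrow> s6 * s6 = n7 \<Longrightarrow> s8 * s8 = n9 \<Longrightarrow> s10 * s10 = n11 \<Longrightarrow> q * ((s8 * s10) * (- (p0) * s8 * s10 * W)) = q * (W * ((n5 * n7) - q\<^sup>2 * (n9 * n11)) * p1) + ((- (p2) * s4 * s6 * W) * (s4 * s6))"
  by Groebner_Basis.algebra

lemma we_Ue_p_Xm_alg:
  fixes q W p0 p1 s2 s3 s4 s5 :: real
  shows "p0 = q * p1 \<Longrightarrow> ((s2 * s3) * (p0 * s4 * s5)) = q * ((p1 * s5 * s2) * (s4 * s3))"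
  by (hypsubst, simp)

lemma we_Ue_p_X0_alg:
  fixes q W n0 n1 p2 p3 p4 n5 s6 s7 s8 s9 :: real
  shows "p4 * n0 = p2 * p4 + p3 * n1 \<Longrightarrow> W * W = n5 \<Longrightarrow> s6 * s6 = n0 \<Longrightarrow> s7 * s7 = n1 \<Longrightarrow> ((s8 * s6) * (p4 * s9 * s6 * W)) = (W * (p2 * s9 * s8) * p4) + ((p3 * s8 * s7 * W) * (s9 * s7))"
  by Groebner_Basis.algebra

lemma we_Ue_p_Xp_alg:
  fixes q W n0 n1 n2 p3 p4 p5 s6 s7 s8 s9 :: real
  shows "p3 * n0 * q = q * n2 * (p5 * p5) + p4 * n1 \<Longrightarrow> W * W = n2 \<Longrightarrow> s6 * s6 = n0 \<Longrightarrow> s7 * s7 = n1 \<Longrightarrow> q * ((s8 * s6) * (p3 * s9 * s6)) = q * (W * (p5 * s8 * s9 * W) * p5) + ((p4 * s7 * s9) * (s8 * s7))"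
  by Groebner_Basis.algebra

context podles
begin

section \<open>Behaviour at the edge and the bounded operators of the generators\<close>

abbreviation AN :: "real \<Rightarrow> real \<Rightarrow> real" where "AN \<equiv> alphaN q t"
abbreviation BN :: "real \<Rightarrow> real \<Rightarrow> real" where "BN \<equiv> betaN q t"

lemma qn_add: "qn (x + y) = q powr (- x) * qn y + q powr y * qn x"
  and qn_add2: "qn (x + y) = q powr x * qn y + q powr (- y) * qn x"
  unfolding qn_eq minus_add_distrib powr_add by (simp_all only: algebra_simps)

lemma qn_1: "qn 1 = 1"
  using q_facts q0 by (simp add: qnum_def powr_minus_divide)

lemma AN_half: "N \<in> {- 1 / 2, 1 / 2} \<Longrightarrow> AN N (1 / 2) = 0"
  by (simp add: alphaN_eq apre_def)

text \<open>There are two reasons for the vanishing. At \<open>l = 1 / 2\<close> no lower spin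
  exists and the reduced element \<open>alphaN\<close> is zero; otherwise the weight leaves the
  smaller multiplet and a root in \<open>cminus\<close> is zero.\<close>

lemma alpha_minus_boundary:
  assumes I: "(l, m, N) \<in> spinor_index" and J: "(l - 1, m + idx x, N) \<notin> spinor_index"
  shows "cminus x l m * AN N l = 0"
proof (cases "l = 1 / 2")
  case True
  show ?thesis unfolding True AN_half[OF spinor_indexD(3)[OF I]] by simp
next
  case False
  then have l: "3 / 2 \<le> l" using half_spins_less[OF spinor_indexD(1)[OF I]] spinor_indexD(4)[OF I] by auto
  note g = spinor_index_gap[OF I] and D = spinor_indexD(5,6)[OF I]
  have "cminus x l m = 0"
  proof (cases x)
    case Xp
    have "\<not> 2 \<le> l - m"
      using spinor_index_shift[OF I, of "l - 1" "- 1" "m + 1" 1] J D Xp by auto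
    then have "l - m = 0 \<or> l - m - 1 = 0" using g(3) by linarith
    then show ?thesis unfolding Xp by auto
  next
    case X0
    have "\<not> (1 \<le> l - m \<and> 1 \<le> l + m)"
      using spinor_index_shift[OF I, of "l - 1" "- 1" m 0] J D X0 by auto
    then have "l - m = 0 \<or> l + m = 0" using g(1,2) by linarith
    then show ?thesis unfolding X0 by auto
  next
    case Xm
    have "\<not> 2 \<le> l + m"
      using spinor_index_shift[OF I, of "l - 1" "- 1" "m - 1" "- 1"] J D Xm by auto
    then have "l + m = 0 \<or> l + m - 1 = 0" using g(4) by linarith
    then show ?thesis unfolding Xm by auto
  qed
  then show ?thesis by simp
qed

lemma alpha_zero_boundary:
  assumes I: "(l, m, N) \<in> spinor_index" and J: "(l, m + idx x, N) \<notin> spinor_index"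
  shows "czero x l m = 0"
proof (cases x)
  case Xp
  note g = spinor_index_gap[OF I] and D = spinor_indexD(5,6)[OF I]
  have "\<not> 1 \<le> l - m" using spinor_index_shift[OF I, of l 0 "m + 1" 1] J D Xp by auto
  then have "l - m = 0" using g(2) by linarith
  then show ?thesis unfolding Xp by simp
next
  case Xm
  note g = spinor_index_gap[OF I] and D = spinor_indexD(5,6)[OF I]
  have "\<not> 1 \<le> l + m" using spinor_index_shift[OF I, of l 0 "m - 1" "- 1"] J D Xm by auto
  then have "l + m = 0" using g(1) by linarith
  then show ?thesis unfolding Xm by simp
qed (use assms in auto)

lemma spinor_index_up:
  assumes I: "(l, m, N) \<in> spinor_index" shows "(l + 1, m + idx x, N) \<in> spinor_index"
proof -
  note D = spinor_indexD(5,6)[OF I]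
  show ?thesis
    using spinor_index_shift[OF I, of "l + 1" 1 "m + 1" 1] spinor_index_shift[OF I, of "l + 1" 1 m 0]
      spinor_index_shift[OF I, of "l + 1" 1 "m - 1" "- 1"] D by (cases x) auto
qed

text \<open>\<open>wshift\<close> acts on coefficients, not on basis vectors, so the weights are
  evaluated at the source index, with weight \<open>m - idx x\<close>. The argument of
  \<open>AN\<close> is always the larger of the two spins involved.\<close>

definition xop :: "sphere_gen \<Rightarrow> spinor \<Rightarrow> spinor" where
  "xop x \<xi> = wshift (\<lambda>(l, m, N). of_real (cminus x (l + 1) (m - idx x) * AN N (l + 1))) (\<lambda>(l, m, N). (l + 1, m - idx x, N)) \<xi>
    + wshift (\<lambda>(l, m, N). of_real (czero x l (m - idx x) * BN N l)) (\<lambda>(l, m, N). (l, m - idx x, N)) \<xi>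
    + wshift (\<lambda>(l, m, N). of_real (cplus x (l - 1) (m - idx x) * AN N l)) (\<lambda>(l, m, N). (l - 1, m - idx x, N)) \<xi>"

lemma xop_weights:
  "\<exists>B\<ge>0. \<forall>l m N. (l, m, N) \<in> spinor_index \<longrightarrow>
    ((l + 1, m - idx x, N) \<in> spinor_index \<longrightarrow> \<bar>cminus x (l + 1) (m - idx x) * AN N (l + 1)\<bar> \<le> B) \<and>
    ((l, m - idx x, N) \<in> spinor_index \<longrightarrow> \<bar>czero x l (m - idx x) * BN N l\<bar> \<le> B) \<and>
    ((l - 1, m - idx x, N) \<in> spinor_index \<longrightarrow> \<bar>cplus x (l - 1) (m - idx x) * AN N l\<bar> \<le> B)"
proof -
  obtain c where c: "0 \<le> c" "\<And>l N. l \<in> half_spins \<Longrightarrow> N \<in> {- 1 / 2, 1 / 2} \<Longrightarrow> \<bar>AN N l\<bar> \<le> c"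
    using alphaN_bound by blast
  obtain d where d: "0 \<le> d" "\<And>l N. l \<in> half_spins \<Longrightarrow> N \<in> {- 1 / 2, 1 / 2} \<Longrightarrow> \<bar>BN N l\<bar> \<le> d"
    using betaN_bound by blast
  have le: "cX * c \<le> cX * (c + d)" "cX * d \<le> cX * (c + d)" "0 \<le> cX * (c + d)"
    using c(1) d(1) cX_ge(6) by (auto intro!: mult_left_mono)
  show ?thesis
  proof (intro exI[of _ "cX * (c + d)"] conjI allI impI le(3))
    fix l m N
    assume I: "(l, m, N) \<in> spinor_index"
    note H = spinor_indexD(1,3)[OF I]
    show "\<bar>cminus x (l + 1) (m - idx x) * AN N (l + 1)\<bar> \<le> cX * (c + d)" if J: "(l + 1, m - idx x, N) \<in> spinor_index"
    proof -
      have "\<bar>cminus x (l + 1) (m - idx x)\<bar> \<le> cX" using cminus_bound[OF J, of x] I by simp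
      then have "\<bar>cminus x (l + 1) (m - idx x)\<bar> * \<bar>AN N (l + 1)\<bar> \<le> cX * c"
        using c(2)[OF half_spins_Suc[OF H(1)] H(2)] cX_ge(6) by (intro mult_mono) auto
      then show ?thesis using le(1) by (simp add: abs_mult)
    qed
    show "\<bar>czero x l (m - idx x) * BN N l\<bar> \<le> cX * (c + d)" if J: "(l, m - idx x, N) \<in> spinor_index"
    proof -
      have "\<bar>czero x l (m - idx x)\<bar> \<le> cX" using czero_bound[OF J, of x] I by simp
      then have "\<bar>czero x l (m - idx x)\<bar> * \<bar>BN N l\<bar> \<le> cX * d"
        using d(2)[OF H] cX_ge(6) by (intro mult_mono) auto
      then show ?thesis using le(2) by (simp add: abs_mult)
    qed
    show "\<bar>cplus x (l - 1) (m - idx x) * AN N l\<bar> \<le> cX * (c + d)" if J: "(l - 1, m - idx x, N) \<in> spinor_index"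
    proof -
      have "\<bar>cplus x (l - 1) (m - idx x)\<bar> \<le> cX" using cplus_bound[OF J, of x] by simp
      then have "\<bar>cplus x (l - 1) (m - idx x)\<bar> * \<bar>AN N l\<bar> \<le> cX * c"
        using c(2)[OF H] cX_ge(6) by (intro mult_mono) auto
      then show ?thesis using le(1) by (simp add: abs_mult)
    qed
  qed
qed

lemma inj_shift3: "inj (\<lambda>(l, m, N). (l + a :: real, m - b :: real, N :: real))" "inj (\<lambda>(l, m, N). (l - a :: real, m - b :: real, N :: real))"
  "inj (\<lambda>(l :: real, m, N). (l, m - b :: real, N :: real))"
  by (auto intro!: injI)

text \<open>The boundary lemmas allow the coefficient formula to hold on all triples, so that later
  identities need no case distinction on target indices.\<close>

lemma xop_clinear: "bounded_clinear (xop x)"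
  and coeff_xop: "coeff (xop x \<xi>) (l, m, N) =
    of_real (cminus x (l + 1) (m - idx x) * AN N (l + 1)) * coeff \<xi> (l + 1, m - idx x, N)
    + of_real (czero x l (m - idx x) * BN N l) * coeff \<xi> (l, m - idx x, N)
    + of_real (cplus x (l - 1) (m - idx x) * AN N l) * coeff \<xi> (l - 1, m - idx x, N)"
proof -
  obtain B where B: "0 \<le> B"
    "\<And>l m N. (l, m, N) \<in> spinor_index \<Longrightarrow> (l + 1, m - idx x, N) \<in> spinor_index \<Longrightarrow>
      \<bar>cminus x (l + 1) (m - idx x) * AN N (l + 1)\<bar> \<le> B"
    "\<And>l m N. (l, m, N) \<in> spinor_index \<Longrightarrow> (l, m - idx x, N) \<in> spinor_index \<Longrightarrow>
      \<bar>czero x l (m - idx x) * BN N l\<bar> \<le> B"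
    "\<And>l m N. (l, m, N) \<in> spinor_index \<Longrightarrow> (l - 1, m - idx x, N) \<in> spinor_index \<Longrightarrow>
      \<bar>cplus x (l - 1) (m - idx x) * AN N l\<bar> \<le> B"
    using xop_weights[of x] by blast
  let ?c1 = "\<lambda>(l, m, N). complex_of_real (cminus x (l + 1) (m - idx x) * AN N (l + 1))"
  let ?c2 = "\<lambda>(l, m, N). complex_of_real (czero x l (m - idx x) * BN N l)"
  let ?c3 = "\<lambda>(l, m, N). complex_of_real (cplus x (l - 1) (m - idx x) * AN N l)"
  have b1: "cmod (?c1 i) \<le> B" if "i \<in> spinor_index" "(\<lambda>(l, m, N). (l + 1, m - idx x, N)) i \<in> spinor_index" for i
    using that B(2) by (cases i) (simp only: prod.case norm_of_real)
  have b2: "cmod (?c2 i) \<le> B" if "i \<in> spinor_index" "(\<lambda>(l, m, N). (l, m - idx x, N)) i \<in> spinor_index" for i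
    using that B(3) by (cases i) (simp only: prod.case norm_of_real)
  have b3: "cmod (?c3 i) \<le> B" if "i \<in> spinor_index" "(\<lambda>(l, m, N). (l - 1, m - idx x, N)) i \<in> spinor_index" for i
    using that B(4) by (cases i) (simp only: prod.case norm_of_real)
  note i = inj_shift3(1)[of 1 "idx x"] inj_shift3(3)[of "idx x"] inj_shift3(2)[of 1 "idx x"]
  have xop': "xop x = (\<lambda>\<xi>. wshift ?c1 (\<lambda>(l, m, N). (l + 1, m - idx x, N)) \<xi>
    + wshift ?c2 (\<lambda>(l, m, N). (l, m - idx x, N)) \<xi> + wshift ?c3 (\<lambda>(l, m, N). (l - 1, m - idx x, N)) \<xi>)"
    by (rule ext) (rule xop_def)
  show "bounded_clinear (xop x)" unfolding xop'
    by (intro bounded_clinear_add bounded_clinear_wshift[OF i(1) B(1) b1]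
        bounded_clinear_wshift[OF i(2) B(1) b2] bounded_clinear_wshift[OF i(3) B(1) b3])
  let ?r = "\<lambda>l m N. of_real (cminus x (l + 1) (m - idx x) * AN N (l + 1)) * coeff \<xi> (l + 1, m - idx x, N)
    + of_real (czero x l (m - idx x) * BN N l) * coeff \<xi> (l, m - idx x, N)
    + of_real (cplus x (l - 1) (m - idx x) * AN N l) * coeff \<xi> (l - 1, m - idx x, N)"
  have "coeff (xop x \<xi>) (l, m, N) = (if (l, m, N) \<in> spinor_index then ?r l m N else 0)"
  proof -
    have "coeff (wshift ?c1 (\<lambda>(l, m, N). (l + 1, m - idx x, N)) \<xi>) (l, m, N) = (if (l, m, N) \<in> spinor_index
        then of_real (cminus x (l + 1) (m - idx x) * AN N (l + 1)) * coeff \<xi> (l + 1, m - idx x, N) else 0)"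
      by (subst coeff_wshift[OF i(1) B(1)], erule (1) b1) simp
    moreover have "coeff (wshift ?c2 (\<lambda>(l, m, N). (l, m - idx x, N)) \<xi>) (l, m, N) = (if (l, m, N) \<in> spinor_index
        then of_real (czero x l (m - idx x) * BN N l) * coeff \<xi> (l, m - idx x, N) else 0)"
      by (subst coeff_wshift[OF i(2) B(1)], erule (1) b2) simp
    moreover have "coeff (wshift ?c3 (\<lambda>(l, m, N). (l - 1, m - idx x, N)) \<xi>) (l, m, N) = (if (l, m, N) \<in> spinor_index
        then of_real (cplus x (l - 1) (m - idx x) * AN N l) * coeff \<xi> (l - 1, m - idx x, N) else 0)"
      by (subst coeff_wshift[OF i(3) B(1)], erule (1) b3) simp
    ultimately show ?thesis unfolding xop' coeff_plus by (simp only: if_True if_False split: if_split) simp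
  qed
  also have "\<dots> = ?r l m N"
  proof (cases "(l, m, N) \<in> spinor_index")
    case False
    have 1: "of_real (cminus x (l + 1) (m - idx x) * AN N (l + 1)) * coeff \<xi> (l + 1, m - idx x, N) = 0"
    proof (cases "(l + 1, m - idx x, N) \<in> spinor_index")
      case True
      have "cminus x (l + 1) (m - idx x) * AN N (l + 1) = 0"
        by (rule alpha_minus_boundary[OF True]) (use False in simp)
      then show ?thesis by simp
    qed (simp add: coeff_outside)
    have 2: "of_real (czero x l (m - idx x) * BN N l) * coeff \<xi> (l, m - idx x, N) = 0"
    proof (cases "(l, m - idx x, N) \<in> spinor_index")
      case True
      have "czero x l (m - idx x) = 0" by (rule alpha_zero_boundary[OF True]) (use False in simp)
      then show ?thesis by simp
    qed (simp add: coeff_outside)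
    have "(l - 1, m - idx x, N) \<notin> spinor_index"
      using spinor_index_up[of "l - 1" "m - idx x" N x] False by auto
    then have 3: "of_real (cplus x (l - 1) (m - idx x) * AN N l) * coeff \<xi> (l - 1, m - idx x, N) = 0"
      by (simp add: coeff_outside)
    show ?thesis unfolding 1 2 3 using False by simp
  qed simp
  finally show "coeff (xop x \<xi>) (l, m, N) = ?r l m N" .
qed

lemma xop_vec: assumes "(l, m, N) \<in> spinor_index"
  shows "xop x (vec (l, m, N)) =
        of_real (alpha_minus q t x l m N) *\<^sub>C vec (l - 1, m + idx x, N)
      + of_real (alpha_zero q t x l m N) *\<^sub>C vec (l, m + idx x, N)
      + of_real (alpha_plus q t x l m N) *\<^sub>C vec (l + 1, m + idx x, N)" (is "_ = ?r")
proof (rule spinor_eqI)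
  fix i :: "real \<times> real \<times> real"
  obtain l' m' N' where i: "i = (l', m', N')" by (cases i)
  have s1: "(l' + 1, m' - idx x, N') = (l, m, N) \<longleftrightarrow> (l', m', N') = (l - 1, m + idx x, N)"
    and s2: "(l', m' - idx x, N') = (l, m, N) \<longleftrightarrow> (l', m', N') = (l, m + idx x, N)"
    and s3: "(l' - 1, m' - idx x, N') = (l, m, N) \<longleftrightarrow> (l', m', N') = (l + 1, m + idx x, N)" by auto
  have v1: "of_real (cminus x (l' + 1) (m' - idx x) * AN N' (l' + 1)) * coeff (vec (l, m, N)) (l' + 1, m' - idx x, N')
     = of_real (cminus x l m * AN N l) * coeff (vec (l - 1, m + idx x, N)) (l', m', N')"
  proof (cases "(l', m', N') = (l - 1, m + idx x, N)")
    case True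
    then show ?thesis using assms alpha_minus_boundary[OF assms, of x]
      by (cases "(l - 1, m + idx x, N) \<in> spinor_index") (simp_all add: coeff_vec flip: of_real_mult)
  next
    case False
    then show ?thesis unfolding coeff_vec s1 by auto
  qed
  have v2: "of_real (czero x l' (m' - idx x) * BN N' l') * coeff (vec (l, m, N)) (l', m' - idx x, N')
     = of_real (czero x l m * BN N l) * coeff (vec (l, m + idx x, N)) (l', m', N')"
  proof (cases "(l', m', N') = (l, m + idx x, N)")
    case True
    then show ?thesis using assms alpha_zero_boundary[OF assms, of x]
      by (cases "(l, m + idx x, N) \<in> spinor_index") (simp_all add: coeff_vec)
  next
    case False
    then show ?thesis unfolding coeff_vec s2 by auto
  qed
  have v3: "of_real (cplus x (l' - 1) (m' - idx x) * AN N' l') * coeff (vec (l, m, N)) (l' - 1, m' - idx x, N')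
     = of_real (cplus x l m * AN N (l + 1)) * coeff (vec (l + 1, m + idx x, N)) (l', m', N')"
  proof (cases "(l', m', N') = (l + 1, m + idx x, N)")
    case True
    then show ?thesis using assms spinor_index_up[OF assms, of x] by (simp add: coeff_vec)
  next
    case False
    then show ?thesis unfolding coeff_vec s3 by auto
  qed
  show "coeff (xop x (vec (l, m, N))) i = coeff ?r i"
    unfolding i coeff_xop v1 v2 v3 coeff_plus coeff_scaleC alpha_eq ..
qed

lemma spinor_rep_gen_eq: "spinor_rep_gen q t x = xop x"
  unfolding spinor_rep_gen_def
proof (rule the_equality)
  show "bounded_clinear (xop x) \<and> (\<forall>(l, m, N)\<in>spinor_index. xop x (basis_v l m N) =
        of_real (alpha_minus q t x l m N) *\<^sub>C basis_v (l - 1) (m + idx x) N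
      + of_real (alpha_zero q t x l m N) *\<^sub>C basis_v l (m + idx x) N
      + of_real (alpha_plus q t x l m N) *\<^sub>C basis_v (l + 1) (m + idx x) N)"
    using xop_vec by (auto simp: xop_clinear vec_eq)
  fix T
  assume T: "bounded_clinear T \<and> (\<forall>(l, m, N)\<in>spinor_index. T (basis_v l m N) =
        of_real (alpha_minus q t x l m N) *\<^sub>C basis_v (l - 1) (m + idx x) N
      + of_real (alpha_zero q t x l m N) *\<^sub>C basis_v l (m + idx x) N
      + of_real (alpha_plus q t x l m N) *\<^sub>C basis_v (l + 1) (m + idx x) N)"
  show "T = xop x"
  proof (rule bounded_clinear_eqI[OF _ xop_clinear])
    show "bounded_clinear T" using T by blast
    fix i assume i: "i \<in> spinor_index"
    obtain l m N where i': "i = (l, m, N)" by (cases i)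
    show "T (vec i) = xop x (vec i)" unfolding i' xop_vec[OF i[unfolded i']]
      using T i unfolding i' vec_eq by blast
  qed
qed

lemmas xop_lin = bounded_clinearD[OF xop_clinear]

lemma xop_\<W> [simp]: assumes "\<xi> \<in> \<W>" shows "xop x \<xi> \<in> \<W>"
  using assms
proof (induction rule: \<W>_induct)
  case (vec i)
  obtain l m N where i: "i = (l, m, N)" by (cases i)
  show ?case using vec unfolding i by (subst xop_vec) (auto intro!: \<W>_add \<W>_scaleC)
qed (auto simp: xop_lin)

text \<open>Wigner--Eckart identities: the dependence of the matrix elements on \<open>m\<close> is dictated by equivariance.\<close>

lemma sqrt_sq_gap:
  assumes "-1 \<le> n" "n \<notin> {-1<..<0}"
  shows "sqrt (qn n) * sqrt (qn n) * sqrt (qn (n + 1)) = qn n * sqrt (qn (n + 1))"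
proof (cases "n = -1")
  case False
  then have "0 \<le> n" using assms by auto
  then show ?thesis by (simp add: qn_nonneg)
qed simp

text \<open>The names of the eighteen identities list the acting generator, the component (m, z, p
  for target spin \<open>l - 1\<close>, \<open>l\<close>, \<open>l + 1\<close>) and the generator of
  the sphere. All terms share a denominator independent of \<open>m\<close>; after removing it,
  \<open>key\<close> isolates the identities of powers and q-numbers that carry the content, and the
  rest is cancellation of roots.\<close>

lemma we_Uf_m_Xm:
  assumes "(l, m, N) \<in> spinor_index"
  shows "uc Uf (l - 1) (m - 1) * cminus Xm l m = sqrt (qn 2) * cminus X0 l m * q powr m + q * cminus Xm l (m + 1) * uc Uf l m"
proof -
  note I = spinor_indexD(5,6)[OF assms] and G = spinor_index_gap[OF assms]
  have p: "q powr l > 0" "q powr m > 0" using q0 by auto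
  define W where "W = sqrt (qn 2)"
  have W: "W * W = qn 2" using qn2_nonneg by (simp add: W_def)
  have key: "- (q powr (- l + m - 1) * qn (l + m - 1)) = qn 2 * (q powr m * q powr m) - q * (q powr (- l + m) * qn (l + m + 1))"
    using p q0 q_facts(1-4)
    by (simp add: qn_eq wq_alt powr_add powr_diff powr_minus divide_simps power2_eq_square power3_eq_cube; (simp add: algebra_simps power2_eq_square power3_eq_cube)?)
  have h0: "sqrt (qn (l + m - 1)) * sqrt (qn (l + m - 1)) * sqrt (qn (l + m)) = qn (l + m - 1) * sqrt (qn (l + m))" using sqrt_sq_gap[of "l + m - 1"] I G by auto
  have h1: "sqrt (qn (l + m + 1)) * sqrt (qn (l + m + 1)) = qn (l + m + 1)" by (rule sqrt_qn_sq) (use I in linarith)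
  have num: "((sqrt (qn (l - m)) * sqrt (qn (l + m - 1))) * (- (q powr (- l + m - 1)) * sqrt (qn (l + m - 1)) * sqrt (qn (l + m)))) = (W * (q powr (m) * sqrt (qn (l - m)) * sqrt (qn (l + m)) * W) * q powr m) + q * ((- (q powr (- l + m)) * sqrt (qn (l + m)) * sqrt (qn (l + m + 1))) * (sqrt (qn (l - m)) * sqrt (qn (l + m + 1))))"
    by (rule we_Uf_m_Xm_alg[OF key W h0 h1])
  have e1: "uc Uf (l - 1) (m - 1) * cminus Xm l m = ((sqrt (qn (l - m)) * sqrt (qn (l + m - 1))) * (- (q powr (- l + m - 1)) * sqrt (qn (l + m - 1)) * sqrt (qn (l + m)))) / (sqrt (qn (2 * l - 1)) * sqrt (qn (2 * l)))"
    by (simp add: W_def algebra_simps)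
  have e2: "sqrt (qn 2) * cminus X0 l m * q powr m = (W * (q powr (m) * sqrt (qn (l - m)) * sqrt (qn (l + m)) * W) * q powr m) / (sqrt (qn (2 * l - 1)) * sqrt (qn (2 * l)))"
    by (simp add: W_def algebra_simps)
  have e3: "cminus Xm l (m + 1) * uc Uf l m = ((- (q powr (- l + m)) * sqrt (qn (l + m)) * sqrt (qn (l + m + 1))) * (sqrt (qn (l - m)) * sqrt (qn (l + m + 1)))) / (sqrt (qn (2 * l - 1)) * sqrt (qn (2 * l)))"
    by (simp add: W_def algebra_simps)
  show ?thesis unfolding e1 e2 mult.assoc[of _ "cminus Xm l (m + 1)"] e3
    using num q0 by (rule_tac frac_id_m2) (auto)
qed

lemma we_Uf_m_X0:
  assumes "(l, m, N) \<in> spinor_index"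
  shows "uc Uf (l - 1) (m) * cminus X0 l m = sqrt (qn 2) * cminus Xp l m * q powr m + cminus X0 l (m + 1) * uc Uf l m"
proof -
  note I = spinor_indexD(5,6)[OF assms] and G = spinor_index_gap[OF assms]
  have p: "q powr l > 0" "q powr m > 0" using q0 by auto
  define W where "W = sqrt (qn 2)"
  have W: "W * W = qn 2" using qn2_nonneg by (simp add: W_def)
  have key: "q powr m * qn (l + m) = - (q powr (l + m + 1) * q powr m) + q powr (m + 1) * qn (l + m + 1)"
    using p q0 q_facts(1-4)
    by (simp add: qn_eq wq_alt powr_add powr_diff powr_minus divide_simps power2_eq_square power3_eq_cube; (simp add: algebra_simps power2_eq_square power3_eq_cube)?)
  have h0: "sqrt (qn (l + m)) * sqrt (qn (l + m)) = qn (l + m)" by (rule sqrt_qn_sq) (use I in linarith)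
  have h1: "sqrt (qn (l + m + 1)) * sqrt (qn (l + m + 1)) = qn (l + m + 1)" by (rule sqrt_qn_sq) (use I in linarith)
  have num: "((sqrt (qn (l - m - 1)) * sqrt (qn (l + m))) * (q powr (m) * sqrt (qn (l - m)) * sqrt (qn (l + m)) * W)) = (W * (- (q powr (l + m + 1)) * sqrt (qn (l - m - 1)) * sqrt (qn (l - m))) * q powr m) + ((q powr (m + 1) * sqrt (qn (l - m - 1)) * sqrt (qn (l + m + 1)) * W) * (sqrt (qn (l - m)) * sqrt (qn (l + m + 1))))"
    by (rule we_Uf_m_X0_alg[OF key W h0 h1])
  have e1: "uc Uf (l - 1) (m) * cminus X0 l m = ((sqrt (qn (l - m - 1)) * sqrt (qn (l + m))) * (q powr (m) * sqrt (qn (l - m)) * sqrt (qn (l + m)) * W)) / (sqrt (qn (2 * l - 1)) * sqrt (qn (2 * l)))"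
    by (simp add: W_def algebra_simps)
  have e2: "sqrt (qn 2) * cminus Xp l m * q powr m = (W * (- (q powr (l + m + 1)) * sqrt (qn (l - m - 1)) * sqrt (qn (l - m))) * q powr m) / (sqrt (qn (2 * l - 1)) * sqrt (qn (2 * l)))"
    by (simp add: W_def algebra_simps)
  have e3: "cminus X0 l (m + 1) * uc Uf l m = ((q powr (m + 1) * sqrt (qn (l - m - 1)) * sqrt (qn (l + m + 1)) * W) * (sqrt (qn (l - m)) * sqrt (qn (l + m + 1)))) / (sqrt (qn (2 * l - 1)) * sqrt (qn (2 * l)))"
    by (simp add: W_def algebra_simps)
  show ?thesis unfolding e1 e2 mult.assoc[of _ "cminus X0 l (m + 1)"] e3
    using num q0 by (rule_tac frac_id_z2) (auto)
qed

lemma we_Uf_m_Xp: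
  assumes "(l, m, N) \<in> spinor_index"
  shows "uc Uf (l - 1) (m + 1) * cminus Xp l m = 1 / q * cminus Xp l (m + 1) * uc Uf l m"
proof -
  note I = spinor_indexD(5,6)[OF assms] and G = spinor_index_gap[OF assms]
  have p: "q powr l > 0" "q powr m > 0" using q0 by auto
  define W where "W = sqrt (qn 2)"
  have W: "W * W = qn 2" using qn2_nonneg by (simp add: W_def)
  have key: "q powr (l + m + 1) * q = q powr (l + m + 2)"
    using p q0 q_facts(1-4)
    by (simp add: qn_eq wq_alt powr_add powr_diff powr_minus divide_simps power2_eq_square power3_eq_cube; (simp add: algebra_simps power2_eq_square power3_eq_cube)?)
  have num: "q * ((sqrt (qn (l - m - 2)) * sqrt (qn (l + m + 1))) * (- (q powr (l + m + 1)) * sqrt (qn (l - m - 1)) * sqrt (qn (l - m)))) = ((- (q powr (l + m + 2)) * sqrt (qn (l - m - 2)) * sqrt (qn (l - m - 1))) * (sqrt (qn (l - m)) * sqrt (qn (l + m + 1))))"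
    by (rule we_Uf_m_Xp_alg[OF key])
  have e1: "uc Uf (l - 1) (m + 1) * cminus Xp l m = ((sqrt (qn (l - m - 2)) * sqrt (qn (l + m + 1))) * (- (q powr (l + m + 1)) * sqrt (qn (l - m - 1)) * sqrt (qn (l - m)))) / (sqrt (qn (2 * l - 1)) * sqrt (qn (2 * l)))"
    by (simp add: W_def algebra_simps)
  have e3: "cminus Xp l (m + 1) * uc Uf l m = ((- (q powr (l + m + 2)) * sqrt (qn (l - m - 2)) * sqrt (qn (l - m - 1))) * (sqrt (qn (l - m)) * sqrt (qn (l + m + 1)))) / (sqrt (qn (2 * l - 1)) * sqrt (qn (2 * l)))"
    by (simp add: W_def algebra_simps)
  show ?thesis unfolding e1  mult.assoc[of _ "cminus Xp l (m + 1)"] e3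
    using num q0 by (rule_tac frac_id_p1) (auto)
qed

lemma we_Uf_z_Xm:
  assumes "(l, m, N) \<in> spinor_index"
  shows "uc Uf (l) (m - 1) * czero Xm l m = sqrt (qn 2) * czero X0 l m * q powr m + q * czero Xm l (m + 1) * uc Uf l m"
proof -
  note I = spinor_indexD(5,6)[OF assms] and G = spinor_index_gap[OF assms]
  have p: "q powr l > 0" "q powr m > 0" using q0 by auto
  define W where "W = sqrt (qn 2)"
  have W: "W * W = qn 2" using qn2_nonneg by (simp add: W_def)
  have key: "q powr (m + 1) = q * q powr m"
    using p q0 q_facts(1-4)
    by (simp add: qn_eq wq_alt powr_add powr_diff powr_minus divide_simps power2_eq_square power3_eq_cube; (simp add: algebra_simps power2_eq_square power3_eq_cube)?)
  have h0: "sqrt (qn (l - m + 1)) * sqrt (qn (l - m + 1)) = qn (l - m + 1)" by (rule sqrt_qn_sq) (use I in linarith)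
  have h1: "sqrt (qn (l + m)) * sqrt (qn (l + m)) = qn (l + m)" by (rule sqrt_qn_sq) (use I in linarith)
  have h2: "sqrt (qn (l - m)) * sqrt (qn (l - m)) = qn (l - m)" by (rule sqrt_qn_sq) (use I in linarith)
  have h3: "sqrt (qn (l + m + 1)) * sqrt (qn (l + m + 1)) = qn (l + m + 1)" by (rule sqrt_qn_sq) (use I in linarith)
  have num: "((sqrt (qn (l - m + 1)) * sqrt (qn (l + m))) * (q powr (m) * sqrt (qn (l - m + 1)) * sqrt (qn (l + m)) * W)) = (W * ((qn (l - m + 1) * qn (l + m)) - q\<^sup>2 * (qn (l - m) * qn (l + m + 1))) * q powr m) + q * ((q powr (m + 1) * sqrt (qn (l - m)) * sqrt (qn (l + m + 1)) * W) * (sqrt (qn (l - m)) * sqrt (qn (l + m + 1))))"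
    by (rule we_Uf_z_Xm_alg[OF key W h0 h1 h2 h3])
  have e1: "uc Uf (l) (m - 1) * czero Xm l m = ((sqrt (qn (l - m + 1)) * sqrt (qn (l + m))) * (q powr (m) * sqrt (qn (l - m + 1)) * sqrt (qn (l + m)) * W)) / qn (2 * l)"
    by (simp add: W_def algebra_simps)
  have e2: "sqrt (qn 2) * czero X0 l m * q powr m = (W * ((qn (l - m + 1) * qn (l + m)) - q\<^sup>2 * (qn (l - m) * qn (l + m + 1))) * q powr m) / qn (2 * l)"
    by (simp add: W_def algebra_simps)
  have e3: "czero Xm l (m + 1) * uc Uf l m = ((q powr (m + 1) * sqrt (qn (l - m)) * sqrt (qn (l + m + 1)) * W) * (sqrt (qn (l - m)) * sqrt (qn (l + m + 1)))) / qn (2 * l)"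
    by (simp add: W_def algebra_simps)
  show ?thesis unfolding e1 e2 mult.assoc[of _ "czero Xm l (m + 1)"] e3
    using num q0 by (rule_tac frac_id_m2) (auto)
qed

lemma we_Uf_z_X0:
  assumes "(l, m, N) \<in> spinor_index"
  shows "uc Uf (l) (m) * czero X0 l m = sqrt (qn 2) * czero Xp l m * q powr m + czero X0 l (m + 1) * uc Uf l m"
proof -
  note I = spinor_indexD(5,6)[OF assms] and G = spinor_index_gap[OF assms]
  have p: "q powr l > 0" "q powr m > 0" using q0 by auto
  define W where "W = sqrt (qn 2)"
  have W: "W * W = qn 2" using qn2_nonneg by (simp add: W_def)
  have key: "qn (l - m + 1) * qn (l + m) - q\<^sup>2 * (qn (l - m) * qn (l + m + 1)) = - (qn 2 * (q powr (m + 2) * q powr m)) + (qn (l - m) * qn (l + m + 1) - q\<^sup>2 * (qn (l - m - 1) * qn (l + m + 2)))"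
    using p q0 q_facts(1-4)
    by (simp add: qn_eq wq_alt powr_add powr_diff powr_minus divide_simps power2_eq_square power3_eq_cube; (simp add: algebra_simps power2_eq_square power3_eq_cube)?)
  have num: "((sqrt (qn (l - m)) * sqrt (qn (l + m + 1))) * ((qn (l - m + 1) * qn (l + m)) - q\<^sup>2 * (qn (l - m) * qn (l + m + 1)))) = (W * (- (q powr (m + 2)) * sqrt (qn (l - m)) * sqrt (qn (l + m + 1)) * W) * q powr m) + (((qn (l - m) * qn (l + m + 1)) - q\<^sup>2 * (qn (l - m - 1) * qn (l + m + 2))) * (sqrt (qn (l - m)) * sqrt (qn (l + m + 1))))"
    by (rule we_Uf_z_X0_alg[OF key W])
  have e1: "uc Uf (l) (m) * czero X0 l m = ((sqrt (qn (l - m)) * sqrt (qn (l + m + 1))) * ((qn (l - m + 1) * qn (l + m)) - q\<^sup>2 * (qn (l - m) * qn (l + m + 1)))) / qn (2 * l)"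
    by (simp add: W_def algebra_simps)
  have e2: "sqrt (qn 2) * czero Xp l m * q powr m = (W * (- (q powr (m + 2)) * sqrt (qn (l - m)) * sqrt (qn (l + m + 1)) * W) * q powr m) / qn (2 * l)"
    by (simp add: W_def algebra_simps)
  have e3: "czero X0 l (m + 1) * uc Uf l m = (((qn (l - m) * qn (l + m + 1)) - q\<^sup>2 * (qn (l - m - 1) * qn (l + m + 2))) * (sqrt (qn (l - m)) * sqrt (qn (l + m + 1)))) / qn (2 * l)"
    by (simp add: W_def algebra_simps)
  show ?thesis unfolding e1 e2 mult.assoc[of _ "czero X0 l (m + 1)"] e3
    using num q0 by (rule_tac frac_id_z2) (auto)
qed

lemma we_Uf_z_Xp:
  assumes "(l, m, N) \<in> spinor_index"
  shows "uc Uf (l) (m + 1) * czero Xp l m = 1 / q * czero Xp l (m + 1) * uc Uf l m"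
proof -
  note I = spinor_indexD(5,6)[OF assms] and G = spinor_index_gap[OF assms]
  have p: "q powr l > 0" "q powr m > 0" using q0 by auto
  define W where "W = sqrt (qn 2)"
  have W: "W * W = qn 2" using qn2_nonneg by (simp add: W_def)
  have key: "q powr (m + 2) * q = q powr (m + 3)"
    using p q0 q_facts(1-4)
    by (simp add: qn_eq wq_alt powr_add powr_diff powr_minus divide_simps power2_eq_square power3_eq_cube; (simp add: algebra_simps power2_eq_square power3_eq_cube)?)
  have num: "q * ((sqrt (qn (l - m - 1)) * sqrt (qn (l + m + 2))) * (- (q powr (m + 2)) * sqrt (qn (l - m)) * sqrt (qn (l + m + 1)) * W)) = ((- (q powr (m + 3)) * sqrt (qn (l - m - 1)) * sqrt (qn (l + m + 2)) * W) * (sqrt (qn (l - m)) * sqrt (qn (l + m + 1))))"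
    by (rule we_Uf_z_Xp_alg[OF key])
  have e1: "uc Uf (l) (m + 1) * czero Xp l m = ((sqrt (qn (l - m - 1)) * sqrt (qn (l + m + 2))) * (- (q powr (m + 2)) * sqrt (qn (l - m)) * sqrt (qn (l + m + 1)) * W)) / qn (2 * l)"
    by (simp add: W_def algebra_simps)
  have e3: "czero Xp l (m + 1) * uc Uf l m = ((- (q powr (m + 3)) * sqrt (qn (l - m - 1)) * sqrt (qn (l + m + 2)) * W) * (sqrt (qn (l - m)) * sqrt (qn (l + m + 1)))) / qn (2 * l)"
    by (simp add: W_def algebra_simps)
  show ?thesis unfolding e1  mult.assoc[of _ "czero Xp l (m + 1)"] e3
    using num q0 by (rule_tac frac_id_p1) (auto)
qed

lemma we_Uf_p_Xm:
  assumes "(l, m, N) \<in> spinor_index"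
  shows "uc Uf (l + 1) (m - 1) * cplus Xm l m = sqrt (qn 2) * cplus X0 l m * q powr m + q * cplus Xm l (m + 1) * uc Uf l m"
proof -
  note I = spinor_indexD(5,6)[OF assms] and G = spinor_index_gap[OF assms]
  have p: "q powr l > 0" "q powr m > 0" using q0 by auto
  define W where "W = sqrt (qn 2)"
  have W: "W * W = qn 2" using qn2_nonneg by (simp add: W_def)
  have key: "q powr (l + m) * qn (l - m + 2) = qn 2 * (q powr m * q powr m) + q * (q powr (l + m + 1) * qn (l - m))"
  proof -
    have e: "q powr (l + m) * q powr (- (l - m)) = q powr m * q powr m" "q powr (l + m) * q powr 2 = q * q powr (l + m + 1)"
    proof -
      have "l + m + - (l - m) = m + m" "l + m + 2 = 1 + (l + m + 1)" by simp_all
      then show "q powr (l + m) * q powr (- (l - m)) = q powr m * q powr m" "q powr (l + m) * q powr 2 = q * q powr (l + m + 1)"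
        using q0 by (metis powr_add, metis powr_add powr_one less_imp_le)
    qed
    show ?thesis unfolding qn_add distrib_left mult.assoc[symmetric] e by (simp only: mult_ac)
  qed
  have h0: "sqrt (qn (l - m + 2)) * sqrt (qn (l - m + 2)) = qn (l - m + 2)" by (rule sqrt_qn_sq) (use I in linarith)
  have h1: "sqrt (qn (l - m)) * sqrt (qn (l - m)) = qn (l - m)" by (rule sqrt_qn_sq) (use I in linarith)
  have num: "((sqrt (qn (l - m + 2)) * sqrt (qn (l + m + 1))) * (q powr (l + m) * sqrt (qn (l - m + 1)) * sqrt (qn (l - m + 2)))) = (W * (q powr (m) * sqrt (qn (l - m + 1)) * sqrt (qn (l + m + 1)) * W) * q powr m) + q * ((q powr (l + m + 1) * sqrt (qn (l - m)) * sqrt (qn (l - m + 1))) * (sqrt (qn (l - m)) * sqrt (qn (l + m + 1))))"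
    by (rule we_Uf_p_Xm_alg[OF key W h0 h1])
  have e1: "uc Uf (l + 1) (m - 1) * cplus Xm l m = ((sqrt (qn (l - m + 2)) * sqrt (qn (l + m + 1))) * (q powr (l + m) * sqrt (qn (l - m + 1)) * sqrt (qn (l - m + 2)))) / (sqrt (qn (2 * l + 1)) * sqrt (qn (2 * l + 2)))"
    by (simp add: W_def algebra_simps)
  have e2: "sqrt (qn 2) * cplus X0 l m * q powr m = (W * (q powr (m) * sqrt (qn (l - m + 1)) * sqrt (qn (l + m + 1)) * W) * q powr m) / (sqrt (qn (2 * l + 1)) * sqrt (qn (2 * l + 2)))"
    by (simp add: W_def algebra_simps)
  have e3: "cplus Xm l (m + 1) * uc Uf l m = ((q powr (l + m + 1) * sqrt (qn (l - m)) * sqrt (qn (l - m + 1))) * (sqrt (qn (l - m)) * sqrt (qn (l + m + 1)))) / (sqrt (qn (2 * l + 1)) * sqrt (qn (2 * l + 2)))"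
    by (simp add: W_def algebra_simps)
  show ?thesis unfolding e1 e2 mult.assoc[of _ "cplus Xm l (m + 1)"] e3
    using num q0 by (rule_tac frac_id_m2) (auto)
qed

lemma we_Uf_p_X0:
  assumes "(l, m, N) \<in> spinor_index"
  shows "uc Uf (l + 1) (m) * cplus X0 l m = sqrt (qn 2) * cplus Xp l m * q powr m + cplus X0 l (m + 1) * uc Uf l m"
proof -
  note I = spinor_indexD(5,6)[OF assms] and G = spinor_index_gap[OF assms]
  have p: "q powr l > 0" "q powr m > 0" using q0 by auto
  define W where "W = sqrt (qn 2)"
  have W: "W * W = qn 2" using qn2_nonneg by (simp add: W_def)
  have key: "q powr m * qn (l - m + 1) = q powr (- l + m) * q powr m + q powr (m + 1) * qn (l - m)"
    using p q0 q_facts(1-4)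
    by (simp add: qn_eq wq_alt powr_add powr_diff powr_minus divide_simps power2_eq_square power3_eq_cube; (simp add: algebra_simps power2_eq_square power3_eq_cube)?)
  have h0: "sqrt (qn (l - m + 1)) * sqrt (qn (l - m + 1)) = qn (l - m + 1)" by (rule sqrt_qn_sq) (use I in linarith)
  have h1: "sqrt (qn (l - m)) * sqrt (qn (l - m)) = qn (l - m)" by (rule sqrt_qn_sq) (use I in linarith)
  have num: "((sqrt (qn (l - m + 1)) * sqrt (qn (l + m + 2))) * (q powr (m) * sqrt (qn (l - m + 1)) * sqrt (qn (l + m + 1)) * W)) = (W * (q powr (- l + m) * sqrt (qn (l + m + 1)) * sqrt (qn (l + m + 2))) * q powr m) + ((q powr (m + 1) * sqrt (qn (l - m)) * sqrt (qn (l + m + 2)) * W) * (sqrt (qn (l - m)) * sqrt (qn (l + m + 1))))"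
    by (rule we_Uf_p_X0_alg[OF key W h0 h1])
  have e1: "uc Uf (l + 1) (m) * cplus X0 l m = ((sqrt (qn (l - m + 1)) * sqrt (qn (l + m + 2))) * (q powr (m) * sqrt (qn (l - m + 1)) * sqrt (qn (l + m + 1)) * W)) / (sqrt (qn (2 * l + 1)) * sqrt (qn (2 * l + 2)))"
    by (simp add: W_def algebra_simps)
  have e2: "sqrt (qn 2) * cplus Xp l m * q powr m = (W * (q powr (- l + m) * sqrt (qn (l + m + 1)) * sqrt (qn (l + m + 2))) * q powr m) / (sqrt (qn (2 * l + 1)) * sqrt (qn (2 * l + 2)))"
    by (simp add: W_def algebra_simps)
  have e3: "cplus X0 l (m + 1) * uc Uf l m = ((q powr (m + 1) * sqrt (qn (l - m)) * sqrt (qn (l + m + 2)) * W) * (sqrt (qn (l - m)) * sqrt (qn (l + m + 1)))) / (sqrt (qn (2 * l + 1)) * sqrt (qn (2 * l + 2)))"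
    by (simp add: W_def algebra_simps)
  show ?thesis unfolding e1 e2 mult.assoc[of _ "cplus X0 l (m + 1)"] e3
    using num q0 by (rule_tac frac_id_z2) (auto)
qed

lemma we_Uf_p_Xp:
  assumes "(l, m, N) \<in> spinor_index"
  shows "uc Uf (l + 1) (m + 1) * cplus Xp l m = 1 / q * cplus Xp l (m + 1) * uc Uf l m"
proof -
  note I = spinor_indexD(5,6)[OF assms] and G = spinor_index_gap[OF assms]
  have p: "q powr l > 0" "q powr m > 0" using q0 by auto
  define W where "W = sqrt (qn 2)"
  have W: "W * W = qn 2" using qn2_nonneg by (simp add: W_def)
  have key: "q powr (- l + m) * q = q powr (- l + m + 1)"
    using p q0 q_facts(1-4)
    by (simp add: qn_eq wq_alt powr_add powr_diff powr_minus divide_simps power2_eq_square power3_eq_cube; (simp add: algebra_simps power2_eq_square power3_eq_cube)?)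
  have num: "q * ((sqrt (qn (l - m)) * sqrt (qn (l + m + 3))) * (q powr (- l + m) * sqrt (qn (l + m + 1)) * sqrt (qn (l + m + 2)))) = ((q powr (- l + m + 1) * sqrt (qn (l + m + 2)) * sqrt (qn (l + m + 3))) * (sqrt (qn (l - m)) * sqrt (qn (l + m + 1))))"
    by (rule we_Uf_p_Xp_alg[OF key])
  have e1: "uc Uf (l + 1) (m + 1) * cplus Xp l m = ((sqrt (qn (l - m)) * sqrt (qn (l + m + 3))) * (q powr (- l + m) * sqrt (qn (l + m + 1)) * sqrt (qn (l + m + 2)))) / (sqrt (qn (2 * l + 1)) * sqrt (qn (2 * l + 2)))"
    by (simp add: W_def algebra_simps)
  have e3: "cplus Xp l (m + 1) * uc Uf l m = ((q powr (- l + m + 1) * sqrt (qn (l + m + 2)) * sqrt (qn (l + m + 3))) * (sqrt (qn (l - m)) * sqrt (qn (l + m + 1)))) / (sqrt (qn (2 * l + 1)) * sqrt (qn (2 * l + 2)))"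
    by (simp add: W_def algebra_simps)
  show ?thesis unfolding e1  mult.assoc[of _ "cplus Xp l (m + 1)"] e3
    using num q0 by (rule_tac frac_id_p1) (auto)
qed

lemma we_Ue_m_Xm:
  assumes "(l, m, N) \<in> spinor_index"
  shows "uc Ue (l - 1) (m - 1) * cminus Xm l m = q * cminus Xm l (m - 1) * uc Ue l m"
proof -
  note I = spinor_indexD(5,6)[OF assms] and G = spinor_index_gap[OF assms]
  have p: "q powr l > 0" "q powr m > 0" using q0 by auto
  define W where "W = sqrt (qn 2)"
  have W: "W * W = qn 2" using qn2_nonneg by (simp add: W_def)
  have key: "q powr (- l + m - 1) = q * q powr (- l + m - 2)"
    using p q0 q_facts(1-4)
    by (simp add: qn_eq wq_alt powr_add powr_diff powr_minus divide_simps power2_eq_square power3_eq_cube; (simp add: algebra_simps power2_eq_square power3_eq_cube)?)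
  have num: "((sqrt (qn (l - m + 1)) * sqrt (qn (l + m - 2))) * (- (q powr (- l + m - 1)) * sqrt (qn (l + m - 1)) * sqrt (qn (l + m)))) = q * ((- (q powr (- l + m - 2)) * sqrt (qn (l + m - 2)) * sqrt (qn (l + m - 1))) * (sqrt (qn (l - m + 1)) * sqrt (qn (l + m))))"
    by (rule we_Ue_m_Xm_alg[OF key])
  have e1: "uc Ue (l - 1) (m - 1) * cminus Xm l m = ((sqrt (qn (l - m + 1)) * sqrt (qn (l + m - 2))) * (- (q powr (- l + m - 1)) * sqrt (qn (l + m - 1)) * sqrt (qn (l + m)))) / (sqrt (qn (2 * l - 1)) * sqrt (qn (2 * l)))"
    by (simp add: W_def algebra_simps)
  have e3: "cminus Xm l (m - 1) * uc Ue l m = ((- (q powr (- l + m - 2)) * sqrt (qn (l + m - 2)) * sqrt (qn (l + m - 1))) * (sqrt (qn (l - m + 1)) * sqrt (qn (l + m)))) / (sqrt (qn (2 * l - 1)) * sqrt (qn (2 * l)))"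
    by (simp add: W_def algebra_simps)
  show ?thesis unfolding e1  mult.assoc[of _ "cminus Xm l (m - 1)"] e3
    using num q0 by (rule_tac frac_id_m1) (auto)
qed

lemma we_Ue_m_X0:
  assumes "(l, m, N) \<in> spinor_index"
  shows "uc Ue (l - 1) (m) * cminus X0 l m = sqrt (qn 2) * cminus Xm l m * q powr m + cminus X0 l (m - 1) * uc Ue l m"
proof -
  note I = spinor_indexD(5,6)[OF assms] and G = spinor_index_gap[OF assms]
  have p: "q powr l > 0" "q powr m > 0" using q0 by auto
  define W where "W = sqrt (qn 2)"
  have W: "W * W = qn 2" using qn2_nonneg by (simp add: W_def)
  have key: "q powr m * qn (l - m) = - (q powr (- l + m - 1) * q powr m) + q powr (m - 1) * qn (l - m + 1)"
    using p q0 q_facts(1-4)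
    by (simp add: qn_eq wq_alt powr_add powr_diff powr_minus divide_simps power2_eq_square power3_eq_cube; (simp add: algebra_simps power2_eq_square power3_eq_cube)?)
  have h0: "sqrt (qn (l - m)) * sqrt (qn (l - m)) = qn (l - m)" by (rule sqrt_qn_sq) (use I in linarith)
  have h1: "sqrt (qn (l - m + 1)) * sqrt (qn (l - m + 1)) = qn (l - m + 1)" by (rule sqrt_qn_sq) (use I in linarith)
  have num: "((sqrt (qn (l - m)) * sqrt (qn (l + m - 1))) * (q powr (m) * sqrt (qn (l - m)) * sqrt (qn (l + m)) * W)) = (W * (- (q powr (- l + m - 1)) * sqrt (qn (l + m - 1)) * sqrt (qn (l + m))) * q powr m) + ((q powr (m - 1) * sqrt (qn (l - m + 1)) * sqrt (qn (l + m - 1)) * W) * (sqrt (qn (l - m + 1)) * sqrt (qn (l + m))))"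
    by (rule we_Ue_m_X0_alg[OF key W h0 h1])
  have e1: "uc Ue (l - 1) (m) * cminus X0 l m = ((sqrt (qn (l - m)) * sqrt (qn (l + m - 1))) * (q powr (m) * sqrt (qn (l - m)) * sqrt (qn (l + m)) * W)) / (sqrt (qn (2 * l - 1)) * sqrt (qn (2 * l)))"
    by (simp add: W_def algebra_simps)
  have e2: "sqrt (qn 2) * cminus Xm l m * q powr m = (W * (- (q powr (- l + m - 1)) * sqrt (qn (l + m - 1)) * sqrt (qn (l + m))) * q powr m) / (sqrt (qn (2 * l - 1)) * sqrt (qn (2 * l)))"
    by (simp add: W_def algebra_simps)
  have e3: "cminus X0 l (m - 1) * uc Ue l m = ((q powr (m - 1) * sqrt (qn (l - m + 1)) * sqrt (qn (l + m - 1)) * W) * (sqrt (qn (l - m + 1)) * sqrt (qn (l + m)))) / (sqrt (qn (2 * l - 1)) * sqrt (qn (2 * l)))"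
    by (simp add: W_def algebra_simps)
  show ?thesis unfolding e1 e2 mult.assoc[of _ "cminus X0 l (m - 1)"] e3
    using num q0 by (rule_tac frac_id_z2) (auto)
qed

lemma we_Ue_m_Xp:
  assumes "(l, m, N) \<in> spinor_index"
  shows "uc Ue (l - 1) (m + 1) * cminus Xp l m = sqrt (qn 2) * cminus X0 l m * q powr m + 1 / q * cminus Xp l (m - 1) * uc Ue l m"
proof -
  note I = spinor_indexD(5,6)[OF assms] and G = spinor_index_gap[OF assms]
  have p: "q powr l > 0" "q powr m > 0" using q0 by auto
  define W where "W = sqrt (qn 2)"
  have W: "W * W = qn 2" using qn2_nonneg by (simp add: W_def)
  have key: "- (q powr (l + m + 1) * qn (l - m - 1)) * q = q * qn 2 * (q powr m * q powr m) - q powr (l + m) * qn (l - m + 1)"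
    using p q0 q_facts(1-4)
    by (simp add: qn_eq wq_alt powr_add powr_diff powr_minus divide_simps power2_eq_square power3_eq_cube; (simp add: algebra_simps power2_eq_square power3_eq_cube)?)
  have h0: "sqrt (qn (l - m - 1)) * sqrt (qn (l - m - 1)) * sqrt (qn (l - m)) = qn (l - m - 1) * sqrt (qn (l - m))" using sqrt_sq_gap[of "l - m - 1"] I G by auto
  have h1: "sqrt (qn (l - m + 1)) * sqrt (qn (l - m + 1)) = qn (l - m + 1)" by (rule sqrt_qn_sq) (use I in linarith)
  have num: "q * ((sqrt (qn (l - m - 1)) * sqrt (qn (l + m))) * (- (q powr (l + m + 1)) * sqrt (qn (l - m - 1)) * sqrt (qn (l - m)))) = q * (W * (q powr (m) * sqrt (qn (l - m)) * sqrt (qn (l + m)) * W) * q powr m) + ((- (q powr (l + m)) * sqrt (qn (l - m)) * sqrt (qn (l - m + 1))) * (sqrt (qn (l - m + 1)) * sqrt (qn (l + m))))"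
    by (rule we_Ue_m_Xp_alg[OF key W h0 h1])
  have e1: "uc Ue (l - 1) (m + 1) * cminus Xp l m = ((sqrt (qn (l - m - 1)) * sqrt (qn (l + m))) * (- (q powr (l + m + 1)) * sqrt (qn (l - m - 1)) * sqrt (qn (l - m)))) / (sqrt (qn (2 * l - 1)) * sqrt (qn (2 * l)))"
    by (simp add: W_def algebra_simps)
  have e2: "sqrt (qn 2) * cminus X0 l m * q powr m = (W * (q powr (m) * sqrt (qn (l - m)) * sqrt (qn (l + m)) * W) * q powr m) / (sqrt (qn (2 * l - 1)) * sqrt (qn (2 * l)))"
    by (simp add: W_def algebra_simps)
  have e3: "cminus Xp l (m - 1) * uc Ue l m = ((- (q powr (l + m)) * sqrt (qn (l - m)) * sqrt (qn (l - m + 1))) * (sqrt (qn (l - m + 1)) * sqrt (qn (l + m)))) / (sqrt (qn (2 * l - 1)) * sqrt (qn (2 * l)))"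
    by (simp add: W_def algebra_simps)
  show ?thesis unfolding e1 e2 mult.assoc[of _ "cminus Xp l (m - 1)"] e3
    using num q0 by (rule_tac frac_id_p2) (auto)
qed

lemma we_Ue_z_Xm:
  assumes "(l, m, N) \<in> spinor_index"
  shows "uc Ue (l) (m - 1) * czero Xm l m = q * czero Xm l (m - 1) * uc Ue l m"
proof -
  note I = spinor_indexD(5,6)[OF assms] and G = spinor_index_gap[OF assms]
  have p: "q powr l > 0" "q powr m > 0" using q0 by auto
  define W where "W = sqrt (qn 2)"
  have W: "W * W = qn 2" using qn2_nonneg by (simp add: W_def)
  have key: "q powr m = q * q powr (m - 1)"
    using p q0 q_facts(1-4)
    by (simp add: qn_eq wq_alt powr_add powr_diff powr_minus divide_simps power2_eq_square power3_eq_cube; (simp add: algebra_simps power2_eq_square power3_eq_cube)?)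
  have num: "((sqrt (qn (l - m + 2)) * sqrt (qn (l + m - 1))) * (q powr (m) * sqrt (qn (l - m + 1)) * sqrt (qn (l + m)) * W)) = q * ((q powr (m - 1) * sqrt (qn (l - m + 2)) * sqrt (qn (l + m - 1)) * W) * (sqrt (qn (l - m + 1)) * sqrt (qn (l + m))))"
    by (rule we_Ue_z_Xm_alg[OF key])
  have e1: "uc Ue (l) (m - 1) * czero Xm l m = ((sqrt (qn (l - m + 2)) * sqrt (qn (l + m - 1))) * (q powr (m) * sqrt (qn (l - m + 1)) * sqrt (qn (l + m)) * W)) / qn (2 * l)"
    by (simp add: W_def algebra_simps)
  have e3: "czero Xm l (m - 1) * uc Ue l m = ((q powr (m - 1) * sqrt (qn (l - m + 2)) * sqrt (qn (l + m - 1)) * W) * (sqrt (qn (l - m + 1)) * sqrt (qn (l + m)))) / qn (2 * l)"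
    by (simp add: W_def algebra_simps)
  show ?thesis unfolding e1  mult.assoc[of _ "czero Xm l (m - 1)"] e3
    using num q0 by (rule_tac frac_id_m1) (auto)
qed

lemma we_Ue_z_X0:
  assumes "(l, m, N) \<in> spinor_index"
  shows "uc Ue (l) (m) * czero X0 l m = sqrt (qn 2) * czero Xm l m * q powr m + czero X0 l (m - 1) * uc Ue l m"
proof -
  note I = spinor_indexD(5,6)[OF assms] and G = spinor_index_gap[OF assms]
  have p: "q powr l > 0" "q powr m > 0" using q0 by auto
  define W where "W = sqrt (qn 2)"
  have W: "W * W = qn 2" using qn2_nonneg by (simp add: W_def)
  have key: "qn (l - m + 1) * qn (l + m) - q\<^sup>2 * (qn (l - m) * qn (l + m + 1)) = qn 2 * (q powr m * q powr m) + (qn (l - m + 2) * qn (l + m - 1) - q\<^sup>2 * (qn (l - m + 1) * qn (l + m)))"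
    using p q0 q_facts(1-4)
    by (simp add: qn_eq wq_alt powr_add powr_diff powr_minus divide_simps power2_eq_square power3_eq_cube; (simp add: algebra_simps power2_eq_square power3_eq_cube)?)
  have num: "((sqrt (qn (l - m + 1)) * sqrt (qn (l + m))) * ((qn (l - m + 1) * qn (l + m)) - q\<^sup>2 * (qn (l - m) * qn (l + m + 1)))) = (W * (q powr (m) * sqrt (qn (l - m + 1)) * sqrt (qn (l + m)) * W) * q powr m) + (((qn (l - m + 2) * qn (l + m - 1)) - q\<^sup>2 * (qn (l - m + 1) * qn (l + m))) * (sqrt (qn (l - m + 1)) * sqrt (qn (l + m))))"
    by (rule we_Ue_z_X0_alg[OF key W])
  have e1: "uc Ue (l) (m) * czero X0 l m = ((sqrt (qn (l - m + 1)) * sqrt (qn (l + m))) * ((qn (l - m + 1) * qn (l + m)) - q\<^sup>2 * (qn (l - m) * qn (l + m + 1)))) / qn (2 * l)"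
    by (simp add: W_def algebra_simps)
  have e2: "sqrt (qn 2) * czero Xm l m * q powr m = (W * (q powr (m) * sqrt (qn (l - m + 1)) * sqrt (qn (l + m)) * W) * q powr m) / qn (2 * l)"
    by (simp add: W_def algebra_simps)
  have e3: "czero X0 l (m - 1) * uc Ue l m = (((qn (l - m + 2) * qn (l + m - 1)) - q\<^sup>2 * (qn (l - m + 1) * qn (l + m))) * (sqrt (qn (l - m + 1)) * sqrt (qn (l + m)))) / qn (2 * l)"
    by (simp add: W_def algebra_simps)
  show ?thesis unfolding e1 e2 mult.assoc[of _ "czero X0 l (m - 1)"] e3
    using num q0 by (rule_tac frac_id_z2) (auto)
qed

lemma we_Ue_z_Xp:
  assumes "(l, m, N) \<in> spinor_index"
  shows "uc Ue (l) (m + 1) * czero Xp l m = sqrt (qn 2) * czero X0 l m * q powr m + 1 / q * czero Xp l (m - 1) * uc Ue l m"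
proof -
  note I = spinor_indexD(5,6)[OF assms] and G = spinor_index_gap[OF assms]
  have p: "q powr l > 0" "q powr m > 0" using q0 by auto
  define W where "W = sqrt (qn 2)"
  have W: "W * W = qn 2" using qn2_nonneg by (simp add: W_def)
  have key: "q powr (m + 2) = q\<^sup>2 * q powr m \<and> q powr (m + 1) = q * q powr m"
    using p q0 q_facts(1-4)
    by (simp add: qn_eq wq_alt powr_add powr_diff powr_minus divide_simps power2_eq_square power3_eq_cube; (simp add: algebra_simps power2_eq_square power3_eq_cube)?)
  have h0: "sqrt (qn (l - m + 1)) * sqrt (qn (l - m + 1)) = qn (l - m + 1)" by (rule sqrt_qn_sq) (use I in linarith)
  have h1: "sqrt (qn (l + m)) * sqrt (qn (l + m)) = qn (l + m)" by (rule sqrt_qn_sq) (use I in linarith)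
  have h2: "sqrt (qn (l - m)) * sqrt (qn (l - m)) = qn (l - m)" by (rule sqrt_qn_sq) (use I in linarith)
  have h3: "sqrt (qn (l + m + 1)) * sqrt (qn (l + m + 1)) = qn (l + m + 1)" by (rule sqrt_qn_sq) (use I in linarith)
  have num: "q * ((sqrt (qn (l - m)) * sqrt (qn (l + m + 1))) * (- (q powr (m + 2)) * sqrt (qn (l - m)) * sqrt (qn (l + m + 1)) * W)) = q * (W * ((qn (l - m + 1) * qn (l + m)) - q\<^sup>2 * (qn (l - m) * qn (l + m + 1))) * q powr m) + ((- (q powr (m + 1)) * sqrt (qn (l - m + 1)) * sqrt (qn (l + m)) * W) * (sqrt (qn (l - m + 1)) * sqrt (qn (l + m))))"
    by (rule we_Ue_z_Xp_alg[OF conjunct1[OF key] conjunct2[OF key] W h0 h1 h2 h3])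
  have e1: "uc Ue (l) (m + 1) * czero Xp l m = ((sqrt (qn (l - m)) * sqrt (qn (l + m + 1))) * (- (q powr (m + 2)) * sqrt (qn (l - m)) * sqrt (qn (l + m + 1)) * W)) / qn (2 * l)"
    by (simp add: W_def algebra_simps)
  have e2: "sqrt (qn 2) * czero X0 l m * q powr m = (W * ((qn (l - m + 1) * qn (l + m)) - q\<^sup>2 * (qn (l - m) * qn (l + m + 1))) * q powr m) / qn (2 * l)"
    by (simp add: W_def algebra_simps)
  have e3: "czero Xp l (m - 1) * uc Ue l m = ((- (q powr (m + 1)) * sqrt (qn (l - m + 1)) * sqrt (qn (l + m)) * W) * (sqrt (qn (l - m + 1)) * sqrt (qn (l + m)))) / qn (2 * l)"
    by (simp add: W_def algebra_simps)
  show ?thesis unfolding e1 e2 mult.assoc[of _ "czero Xp l (m - 1)"] e3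
    using num q0 by (rule_tac frac_id_p2) (auto)
qed

lemma we_Ue_p_Xm:
  assumes "(l, m, N) \<in> spinor_index"
  shows "uc Ue (l + 1) (m - 1) * cplus Xm l m = q * cplus Xm l (m - 1) * uc Ue l m"
proof -
  note I = spinor_indexD(5,6)[OF assms] and G = spinor_index_gap[OF assms]
  have p: "q powr l > 0" "q powr m > 0" using q0 by auto
  define W where "W = sqrt (qn 2)"
  have W: "W * W = qn 2" using qn2_nonneg by (simp add: W_def)
  have key: "q powr (l + m) = q * q powr (l + m - 1)"
    using p q0 q_facts(1-4)
    by (simp add: qn_eq wq_alt powr_add powr_diff powr_minus divide_simps power2_eq_square power3_eq_cube; (simp add: algebra_simps power2_eq_square power3_eq_cube)?)
  have num: "((sqrt (qn (l - m + 3)) * sqrt (qn (l + m))) * (q powr (l + m) * sqrt (qn (l - m + 1)) * sqrt (qn (l - m + 2)))) = q * ((q powr (l + m - 1) * sqrt (qn (l - m + 2)) * sqrt (qn (l - m + 3))) * (sqrt (qn (l - m + 1)) * sqrt (qn (l + m))))"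
    by (rule we_Ue_p_Xm_alg[OF key])
  have e1: "uc Ue (l + 1) (m - 1) * cplus Xm l m = ((sqrt (qn (l - m + 3)) * sqrt (qn (l + m))) * (q powr (l + m) * sqrt (qn (l - m + 1)) * sqrt (qn (l - m + 2)))) / (sqrt (qn (2 * l + 1)) * sqrt (qn (2 * l + 2)))"
    by (simp add: W_def algebra_simps)
  have e3: "cplus Xm l (m - 1) * uc Ue l m = ((q powr (l + m - 1) * sqrt (qn (l - m + 2)) * sqrt (qn (l - m + 3))) * (sqrt (qn (l - m + 1)) * sqrt (qn (l + m)))) / (sqrt (qn (2 * l + 1)) * sqrt (qn (2 * l + 2)))"
    by (simp add: W_def algebra_simps)
  show ?thesis unfolding e1  mult.assoc[of _ "cplus Xm l (m - 1)"] e3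
    using num q0 by (rule_tac frac_id_m1) (auto)
qed

lemma we_Ue_p_X0:
  assumes "(l, m, N) \<in> spinor_index"
  shows "uc Ue (l + 1) (m) * cplus X0 l m = sqrt (qn 2) * cplus Xm l m * q powr m + cplus X0 l (m - 1) * uc Ue l m"
proof -
  note I = spinor_indexD(5,6)[OF assms] and G = spinor_index_gap[OF assms]
  have p: "q powr l > 0" "q powr m > 0" using q0 by auto
  define W where "W = sqrt (qn 2)"
  have W: "W * W = qn 2" using qn2_nonneg by (simp add: W_def)
  have key: "q powr m * qn (l + m + 1) = q powr (l + m) * q powr m + q powr (m - 1) * qn (l + m)"
  proof -
    have e: "q powr m * q powr (l + m) = q powr (l + m) * q powr m" "q powr m * q powr - 1 = q powr (m - 1)"
      using q0 by (simp_all add: powr_diff powr_minus_divide)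
    show ?thesis unfolding qn_add2 distrib_left mult.assoc[symmetric] e qn_1 by simp
  qed
  have h0: "sqrt (qn (l + m + 1)) * sqrt (qn (l + m + 1)) = qn (l + m + 1)" by (rule sqrt_qn_sq) (use I in linarith)
  have h1: "sqrt (qn (l + m)) * sqrt (qn (l + m)) = qn (l + m)" by (rule sqrt_qn_sq) (use I in linarith)
  have num: "((sqrt (qn (l - m + 2)) * sqrt (qn (l + m + 1))) * (q powr (m) * sqrt (qn (l - m + 1)) * sqrt (qn (l + m + 1)) * W)) = (W * (q powr (l + m) * sqrt (qn (l - m + 1)) * sqrt (qn (l - m + 2))) * q powr m) + ((q powr (m - 1) * sqrt (qn (l - m + 2)) * sqrt (qn (l + m)) * W) * (sqrt (qn (l - m + 1)) * sqrt (qn (l + m))))"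
    by (rule we_Ue_p_X0_alg[OF key W h0 h1])
  have e1: "uc Ue (l + 1) (m) * cplus X0 l m = ((sqrt (qn (l - m + 2)) * sqrt (qn (l + m + 1))) * (q powr (m) * sqrt (qn (l - m + 1)) * sqrt (qn (l + m + 1)) * W)) / (sqrt (qn (2 * l + 1)) * sqrt (qn (2 * l + 2)))"
    by (simp add: W_def algebra_simps)
  have e2: "sqrt (qn 2) * cplus Xm l m * q powr m = (W * (q powr (l + m) * sqrt (qn (l - m + 1)) * sqrt (qn (l - m + 2))) * q powr m) / (sqrt (qn (2 * l + 1)) * sqrt (qn (2 * l + 2)))"
    by (simp add: W_def algebra_simps)
  have e3: "cplus X0 l (m - 1) * uc Ue l m = ((q powr (m - 1) * sqrt (qn (l - m + 2)) * sqrt (qn (l + m)) * W) * (sqrt (qn (l - m + 1)) * sqrt (qn (l + m)))) / (sqrt (qn (2 * l + 1)) * sqrt (qn (2 * l + 2)))"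
    by (simp add: W_def algebra_simps)
  show ?thesis unfolding e1 e2 mult.assoc[of _ "cplus X0 l (m - 1)"] e3
    using num q0 by (rule_tac frac_id_z2) (auto)
qed

lemma we_Ue_p_Xp:
  assumes "(l, m, N) \<in> spinor_index"
  shows "uc Ue (l + 1) (m + 1) * cplus Xp l m = sqrt (qn 2) * cplus X0 l m * q powr m + 1 / q * cplus Xp l (m - 1) * uc Ue l m"
proof -
  note I = spinor_indexD(5,6)[OF assms] and G = spinor_index_gap[OF assms]
  have p: "q powr l > 0" "q powr m > 0" using q0 by auto
  define W where "W = sqrt (qn 2)"
  have W: "W * W = qn 2" using qn2_nonneg by (simp add: W_def)
  have key: "q powr (- l + m) * qn (l + m + 2) * q = q * qn 2 * (q powr m * q powr m) + q powr (- l + m - 1) * qn (l + m)"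
    using p q0 q_facts(1-4)
    by (simp add: qn_eq wq_alt powr_add powr_diff powr_minus divide_simps power2_eq_square power3_eq_cube; (simp add: algebra_simps power2_eq_square power3_eq_cube)?)
  have h0: "sqrt (qn (l + m + 2)) * sqrt (qn (l + m + 2)) = qn (l + m + 2)" by (rule sqrt_qn_sq) (use I in linarith)
  have h1: "sqrt (qn (l + m)) * sqrt (qn (l + m)) = qn (l + m)" by (rule sqrt_qn_sq) (use I in linarith)
  have num: "q * ((sqrt (qn (l - m + 1)) * sqrt (qn (l + m + 2))) * (q powr (- l + m) * sqrt (qn (l + m + 1)) * sqrt (qn (l + m + 2)))) = q * (W * (q powr (m) * sqrt (qn (l - m + 1)) * sqrt (qn (l + m + 1)) * W) * q powr m) + ((q powr (- l + m - 1) * sqrt (qn (l + m)) * sqrt (qn (l + m + 1))) * (sqrt (qn (l - m + 1)) * sqrt (qn (l + m))))"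
    by (rule we_Ue_p_Xp_alg[OF key W h0 h1])
  have e1: "uc Ue (l + 1) (m + 1) * cplus Xp l m = ((sqrt (qn (l - m + 1)) * sqrt (qn (l + m + 2))) * (q powr (- l + m) * sqrt (qn (l + m + 1)) * sqrt (qn (l + m + 2)))) / (sqrt (qn (2 * l + 1)) * sqrt (qn (2 * l + 2)))"
    by (simp add: W_def algebra_simps)
  have e2: "sqrt (qn 2) * cplus X0 l m * q powr m = (W * (q powr (m) * sqrt (qn (l - m + 1)) * sqrt (qn (l + m + 1)) * W) * q powr m) / (sqrt (qn (2 * l + 1)) * sqrt (qn (2 * l + 2)))"
    by (simp add: W_def algebra_simps)
  have e3: "cplus Xp l (m - 1) * uc Ue l m = ((q powr (- l + m - 1) * sqrt (qn (l + m)) * sqrt (qn (l + m + 1))) * (sqrt (qn (l - m + 1)) * sqrt (qn (l + m)))) / (sqrt (qn (2 * l + 1)) * sqrt (qn (2 * l + 2)))"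
    by (simp add: W_def algebra_simps)
  show ?thesis unfolding e1 e2 mult.assoc[of _ "cplus Xp l (m - 1)"] e3
    using num q0 by (rule_tac frac_id_p2) (auto)
qed

end

section \<open>The defining relations in the spinor representation\<close>

text \<open>
  The two polynomial identities behind the diagonal part of the fourth relation, in the variable
  \<open>L = q\<^bsup>2l\<^esup>\<close>; \<open>e = \<plusminus>1\<close> is the sign of \<open>N\<close>.
\<close>

lemma diag_poly1_pos:
  fixes q L t :: real
  defines "f \<equiv> (1 - t) * (1 + L)\<^sup>2 * q + (t - 1 + q)\<^sup>2 * L"
    and "h \<equiv> (1 - t) * (1 + q\<^sup>2 * L)\<^sup>2 * q + (t - 1 + q)\<^sup>2 * (q\<^sup>2 * L)"
    and "b \<equiv> (1 + q\<^sup>2 - q\<^sup>2 * t) * (1 - q\<^sup>2) * L - t * (q ^ 4 * L + L - q - q ^ 3 * L\<^sup>2)"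
    and "u \<equiv> 1 - L\<^sup>2" and "v \<equiv> 1 - q ^ 4 * L\<^sup>2" and "y \<equiv> 1 + q * L"
  shows "- ((1 + q\<^sup>2) * (1 - q ^ 3 * L) * q * h * u\<^sup>2) + (1 + q\<^sup>2) * (q - L) * f * v\<^sup>2
    + b\<^sup>2 * (1 + q\<^sup>2 * L\<^sup>2) * (1 - q\<^sup>2) * y - t * (1 - q\<^sup>2) * b * q * y * u * v = 0"
  unfolding f_def h_def b_def u_def v_def y_def by Groebner_Basis.algebra

lemma diag_poly1_neg:
  fixes q L t :: real
  defines "f \<equiv> (1 - t) * (1 + L)\<^sup>2 * q + (q * t - q + 1)\<^sup>2 * L"
    and "h \<equiv> (1 - t) * (1 + q\<^sup>2 * L)\<^sup>2 * q + (q * t - q + 1)\<^sup>2 * (q\<^sup>2 * L)"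
    and "b \<equiv> - ((1 + q\<^sup>2 - t) * (1 - q\<^sup>2) * L) - t * (q ^ 4 * L + L - q - q ^ 3 * L\<^sup>2)"
    and "u \<equiv> 1 - L\<^sup>2" and "v \<equiv> 1 - q ^ 4 * L\<^sup>2" and "y \<equiv> 1 + q * L"
  shows "- ((1 + q\<^sup>2) * (1 - q ^ 3 * L) * q * h * u\<^sup>2) + (1 + q\<^sup>2) * (q - L) * f * v\<^sup>2
    + b\<^sup>2 * (1 + q\<^sup>2 * L\<^sup>2) * (1 - q\<^sup>2) * y - t * (1 - q\<^sup>2) * b * q * y * u * v = 0"
  unfolding f_def h_def b_def u_def v_def y_def by Groebner_Basis.algebra

lemma diag_poly2_pos:
  fixes q L t :: real
  defines "f \<equiv> (1 - t) * (1 + L)\<^sup>2 * q + (t - 1 + q)\<^sup>2 * L"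
    and "h \<equiv> (1 - t) * (1 + q\<^sup>2 * L)\<^sup>2 * q + (t - 1 + q)\<^sup>2 * (q\<^sup>2 * L)"
    and "b \<equiv> (1 + q\<^sup>2 - q\<^sup>2 * t) * (1 - q\<^sup>2) * L - t * (q ^ 4 * L + L - q - q ^ 3 * L\<^sup>2)"
    and "u \<equiv> 1 - L\<^sup>2" and "v \<equiv> 1 - q ^ 4 * L\<^sup>2" and "y \<equiv> 1 + q * L"
  shows "(1 + q\<^sup>2)\<^sup>2 * (1 - q ^ 3 * L) * h * u\<^sup>2 - q * (1 + q\<^sup>2)\<^sup>2 * (q - L) * L\<^sup>2 * f * v\<^sup>2
    + q * b\<^sup>2 * ((1 + q\<^sup>2 * L\<^sup>2)\<^sup>2 * q\<^sup>2 - (1 + q\<^sup>2)\<^sup>2 * L\<^sup>2) * y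
    + t * (1 - q\<^sup>2) * (1 + q\<^sup>2 * L\<^sup>2) * b * q\<^sup>2 * y * u * v
    - (t\<^sup>2 * q ^ 3 + (1 + q\<^sup>2)\<^sup>2 * q * (1 - t)) * y * u\<^sup>2 * v\<^sup>2 = 0"
  unfolding f_def h_def b_def u_def v_def y_def by Groebner_Basis.algebra

lemma diag_poly2_neg:
  fixes q L t :: real
  defines "f \<equiv> (1 - t) * (1 + L)\<^sup>2 * q + (q * t - q + 1)\<^sup>2 * L"
    and "h \<equiv> (1 - t) * (1 + q\<^sup>2 * L)\<^sup>2 * q + (q * t - q + 1)\<^sup>2 * (q\<^sup>2 * L)"
    and "b \<equiv> - ((1 + q\<^sup>2 - t) * (1 - q\<^sup>2) * L) - t * (q ^ 4 * L + L - q - q ^ 3 * L\<^sup>2)"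
    and "u \<equiv> 1 - L\<^sup>2" and "v \<equiv> 1 - q ^ 4 * L\<^sup>2" and "y \<equiv> 1 + q * L"
  shows "(1 + q\<^sup>2)\<^sup>2 * (1 - q ^ 3 * L) * h * u\<^sup>2 - q * (1 + q\<^sup>2)\<^sup>2 * (q - L) * L\<^sup>2 * f * v\<^sup>2
    + q * b\<^sup>2 * ((1 + q\<^sup>2 * L\<^sup>2)\<^sup>2 * q\<^sup>2 - (1 + q\<^sup>2)\<^sup>2 * L\<^sup>2) * y
    + t * (1 - q\<^sup>2) * (1 + q\<^sup>2 * L\<^sup>2) * b * q\<^sup>2 * y * u * v
    - (t\<^sup>2 * q ^ 3 + (1 + q\<^sup>2)\<^sup>2 * q * (1 - t)) * y * u\<^sup>2 * v\<^sup>2 = 0"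
  unfolding f_def h_def b_def u_def v_def y_def by Groebner_Basis.algebra

text \<open>\<open>F\<close>, \<open>G\<close> and \<open>\<beta>\<close> stand for the reduced
  matrix elements, given with cleared denominators. As a function of \<open>K = q^(2m)\<close> the
  left side is affine, since its two quadratic terms cancel. The coefficient of \<open>K\<close> is
  a multiple of \<open>c1\<close> and the rest is \<open>c0\<close>; neither contains
  \<open>m\<close>, and the hypotheses \<open>p1\<close> and \<open>p2\<close> say that they
  vanish.\<close>

lemma diag_assemble:
  fixes q L t K w u v y f h b F G \<beta> :: real
  assumes nz: "q \<noteq> 0" "L \<noteq> 0" "w \<noteq> 0" "u \<noteq> 0" "v \<noteq> 0" "y \<noteq> 0" and w: "w * (1 - q\<^sup>2) = q"
    and F: "F * (q\<^sup>2 * w * y * u\<^sup>2) = (1 + q\<^sup>2) * (q - L) * L * f"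
    and G: "G * (q * w * y * v\<^sup>2) = (1 + q\<^sup>2) * (1 - q ^ 3 * L) * L * h"
    and \<beta>: "\<beta> * (q * w * u * v) = b * L"
    and p1: "- ((1 + q\<^sup>2) * (1 - q ^ 3 * L) * q * h * u\<^sup>2) + (1 + q\<^sup>2) * (q - L) * f * v\<^sup>2
      + b\<^sup>2 * (1 + q\<^sup>2 * L\<^sup>2) * (1 - q\<^sup>2) * y - t * (1 - q\<^sup>2) * b * q * y * u * v = 0"
    and p2: "(1 + q\<^sup>2)\<^sup>2 * (1 - q ^ 3 * L) * h * u\<^sup>2 - q * (1 + q\<^sup>2)\<^sup>2 * (q - L) * L\<^sup>2 * f * v\<^sup>2
      + q * b\<^sup>2 * ((1 + q\<^sup>2 * L\<^sup>2)\<^sup>2 * q\<^sup>2 - (1 + q\<^sup>2)\<^sup>2 * L\<^sup>2) * y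
      + t * (1 - q\<^sup>2) * (1 + q\<^sup>2 * L\<^sup>2) * b * q\<^sup>2 * y * u * v
      - (t\<^sup>2 * q ^ 3 + (1 + q\<^sup>2)\<^sup>2 * q * (1 - t)) * y * u\<^sup>2 * v\<^sup>2 = 0"
    and S: "S * (q * L) = 1 + q\<^sup>2 * L\<^sup>2" and d: "d * q = 1 + q\<^sup>2" and r: "r * (L * q) = 1"
  shows "d * (w * (r - K * q)) * G + d * (w * q * (K - L)) * F
    + \<beta>\<^sup>2 * (d\<^sup>2 * q ^ 3 * (w\<^sup>2 * (K * S - q * K\<^sup>2 - L * r)) + q\<^sup>2 * (w * q * (S - d * K))\<^sup>2)
    + t * (1 - q\<^sup>2) * (w * q * (S - d * K)) * \<beta> - t\<^sup>2 - d\<^sup>2 * (1 - t) = 0"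
proof -
  have Lr: "L * r * q = 1" using r by (simp add: mult_ac)
  \<comment> \<open>For \<open>d = q + 1 / q\<close> this reads \<open>(1 / q - q) * w = 1\<close>.
    It merges the two contributions to the coefficient of \<open>K * S\<close>.\<close>
  have dq: "(d - 2 * q) * w = 1"
  proof -
    have "(d - 2 * q) * w * q = (d * q - 2 * q\<^sup>2) * w" by (simp add: algebra_simps power2_eq_square)
    also have "\<dots> = (1 - q\<^sup>2) * w" unfolding d by simp
    also have "\<dots> = q" using w by (simp add: mult.commute)
    finally show ?thesis using nz by simp
  qed
  define c1 where "c1 = - G + F + \<beta>\<^sup>2 * q\<^sup>2 * S - t * (1 - q\<^sup>2) * \<beta>"
  define c0 where "c0 = d * w * r * G - d * w * q * L * F + \<beta>\<^sup>2 * w\<^sup>2 * q\<^sup>2 * (q\<^sup>2 * S\<^sup>2 - d\<^sup>2)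
    + t * (1 - q\<^sup>2) * w * q * S * \<beta> - t\<^sup>2 - d\<^sup>2 * (1 - t)"
  have "c1 * (q\<^sup>2 * w * y * u\<^sup>2 * v\<^sup>2) = 0"
  proof -
    have g: "G * (q\<^sup>2 * w * y * u\<^sup>2 * v\<^sup>2) = (1 + q\<^sup>2) * (1 - q ^ 3 * L) * L * h * (q * u\<^sup>2)"
      unfolding G[symmetric] by (simp add: power2_eq_square)
    have f: "F * (q\<^sup>2 * w * y * u\<^sup>2 * v\<^sup>2) = (1 + q\<^sup>2) * (q - L) * L * f * v\<^sup>2"
      unfolding F[symmetric] by (simp add: power2_eq_square)
    have "\<beta>\<^sup>2 * q\<^sup>2 * S * (q\<^sup>2 * w * y * u\<^sup>2 * v\<^sup>2) * (w * L) = (\<beta> * (q * w * u * v))\<^sup>2 * (S * (q * L)) * q * y"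
      by (simp add: power2_eq_square)
    also have "\<dots> = b\<^sup>2 * L * (1 + q\<^sup>2 * L\<^sup>2) * (1 - q\<^sup>2) * y * (w * L)"
    proof -
      have "b\<^sup>2 * L * (1 + q\<^sup>2 * L\<^sup>2) * (1 - q\<^sup>2) * y * (w * L)
        = (b * L)\<^sup>2 * (1 + q\<^sup>2 * L\<^sup>2) * (w * (1 - q\<^sup>2)) * y" by (simp add: power2_eq_square)
      then show ?thesis unfolding \<beta> S w by (simp only:)
    qed
    finally have b2: "\<beta>\<^sup>2 * q\<^sup>2 * S * (q\<^sup>2 * w * y * u\<^sup>2 * v\<^sup>2) = b\<^sup>2 * L * (1 + q\<^sup>2 * L\<^sup>2) * (1 - q\<^sup>2) * y"
      using nz by simp
    have b1: "t * (1 - q\<^sup>2) * \<beta> * (q\<^sup>2 * w * y * u\<^sup>2 * v\<^sup>2) = t * (1 - q\<^sup>2) * (b * L) * (q * y * u * v)"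
      unfolding \<beta>[symmetric] by (simp add: power2_eq_square)
    have "c1 * (q\<^sup>2 * w * y * u\<^sup>2 * v\<^sup>2) = L * (- ((1 + q\<^sup>2) * (1 - q ^ 3 * L) * q * h * u\<^sup>2) + (1 + q\<^sup>2) * (q - L) * f * v\<^sup>2
      + b\<^sup>2 * (1 + q\<^sup>2 * L\<^sup>2) * (1 - q\<^sup>2) * y - t * (1 - q\<^sup>2) * b * q * y * u * v)"
      unfolding c1_def left_diff_distrib distrib_right mult_minus_left g f b2 b1
      by Groebner_Basis.algebra
    then show ?thesis unfolding p1 by simp
  qed
  then have c1: "c1 = 0" using nz by simp
  have "c0 * (q ^ 3 * y * u\<^sup>2 * v\<^sup>2) = 0"
  proof -
    have g: "d * w * r * G * (q ^ 3 * y * u\<^sup>2 * v\<^sup>2) = (1 + q\<^sup>2)\<^sup>2 * (1 - q ^ 3 * L) * h * u\<^sup>2"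
    proof -
      have "d * w * r * G * (q ^ 3 * y * u\<^sup>2 * v\<^sup>2) = (d * q) * r * (G * (q * w * y * v\<^sup>2)) * (q * u\<^sup>2)"
        by (simp add: power2_eq_square power3_eq_cube)
      then show ?thesis unfolding G d using r by Groebner_Basis.algebra
    qed
    have f: "d * w * q * L * F * (q ^ 3 * y * u\<^sup>2 * v\<^sup>2) = q * (1 + q\<^sup>2)\<^sup>2 * (q - L) * L\<^sup>2 * f * v\<^sup>2"
    proof -
      have "d * w * q * L * F * (q ^ 3 * y * u\<^sup>2 * v\<^sup>2) = (d * q) * L * (F * (q\<^sup>2 * w * y * u\<^sup>2)) * (q * v\<^sup>2)"
        by (simp add: power2_eq_square power3_eq_cube)
      then show ?thesis unfolding F d by Groebner_Basis.algebra
    qed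
    have b2: "\<beta>\<^sup>2 * w\<^sup>2 * q\<^sup>2 * (q\<^sup>2 * S\<^sup>2 - d\<^sup>2) * (q ^ 3 * y * u\<^sup>2 * v\<^sup>2)
        = q * b\<^sup>2 * ((1 + q\<^sup>2 * L\<^sup>2)\<^sup>2 * q\<^sup>2 - (1 + q\<^sup>2)\<^sup>2 * L\<^sup>2) * y"
    proof -
      have "\<beta>\<^sup>2 * w\<^sup>2 * q\<^sup>2 * (q\<^sup>2 * S\<^sup>2 - d\<^sup>2) * (q ^ 3 * y * u\<^sup>2 * v\<^sup>2) * L\<^sup>2
        = (\<beta> * (q * w * u * v))\<^sup>2 * q * y * (q\<^sup>2 * (S * (q * L))\<^sup>2 - (d * q)\<^sup>2 * L\<^sup>2)"
        by Groebner_Basis.algebra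
      also have "\<dots> = q * b\<^sup>2 * ((1 + q\<^sup>2 * L\<^sup>2)\<^sup>2 * q\<^sup>2 - (1 + q\<^sup>2)\<^sup>2 * L\<^sup>2) * y * L\<^sup>2"
        unfolding \<beta> S d by Groebner_Basis.algebra
      finally show ?thesis using nz by simp
    qed
    have b1: "t * (1 - q\<^sup>2) * w * q * S * \<beta> * (q ^ 3 * y * u\<^sup>2 * v\<^sup>2)
        = t * (1 - q\<^sup>2) * (1 + q\<^sup>2 * L\<^sup>2) * b * q\<^sup>2 * y * u * v"
    proof -
      have "t * (1 - q\<^sup>2) * w * q * S * \<beta> * (q ^ 3 * y * u\<^sup>2 * v\<^sup>2) * L
        = t * (1 - q\<^sup>2) * (S * (q * L)) * (\<beta> * (q * w * u * v)) * (q\<^sup>2 * y * u * v)"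
        by Groebner_Basis.algebra
      also have "\<dots> = t * (1 - q\<^sup>2) * (1 + q\<^sup>2 * L\<^sup>2) * b * q\<^sup>2 * y * u * v * L"
        unfolding S \<beta> by (simp add: mult_ac)
      finally show ?thesis using nz by simp
    qed
    have e: "(t\<^sup>2 + d\<^sup>2 * (1 - t)) * (q ^ 3 * y * u\<^sup>2 * v\<^sup>2)
        = (t\<^sup>2 * q ^ 3 + (1 + q\<^sup>2)\<^sup>2 * q * (1 - t)) * y * u\<^sup>2 * v\<^sup>2"
      unfolding d[symmetric] by Groebner_Basis.algebra
    have "c0 * (q ^ 3 * y * u\<^sup>2 * v\<^sup>2) = d * w * r * G * (q ^ 3 * y * u\<^sup>2 * v\<^sup>2) - d * w * q * L * F * (q ^ 3 * y * u\<^sup>2 * v\<^sup>2)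
      + \<beta>\<^sup>2 * w\<^sup>2 * q\<^sup>2 * (q\<^sup>2 * S\<^sup>2 - d\<^sup>2) * (q ^ 3 * y * u\<^sup>2 * v\<^sup>2)
      + t * (1 - q\<^sup>2) * w * q * S * \<beta> * (q ^ 3 * y * u\<^sup>2 * v\<^sup>2)
      - (t\<^sup>2 + d\<^sup>2 * (1 - t)) * (q ^ 3 * y * u\<^sup>2 * v\<^sup>2)"
      unfolding c0_def by Groebner_Basis.algebra
    then show ?thesis unfolding g f b2 b1 e using p2 by simp
  qed
  then have c0: "c0 = 0" using nz by simp
  have "d * (w * (r - K * q)) * G + d * (w * q * (K - L)) * F
    + \<beta>\<^sup>2 * (d\<^sup>2 * q ^ 3 * (w\<^sup>2 * (K * S - q * K\<^sup>2 - L * r)) + q\<^sup>2 * (w * q * (S - d * K))\<^sup>2)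
    + t * (1 - q\<^sup>2) * (w * q * (S - d * K)) * \<beta> - t\<^sup>2 - d\<^sup>2 * (1 - t)
    = K * (d * w * q) * c1 + c0"
    unfolding c1_def c0_def using dq Lr by Groebner_Basis.algebra
  then show ?thesis unfolding c1 c0 by simp
qed

section \<open>The third relation, component by component\<close>

context podles
begin

text \<open>The involution on coefficients: \<open>x_0\<close> is self-adjoint and the adjoint of
  \<open>x_{-1}\<close> is \<open>-1/q\<close> times \<open>x_1\<close>. Lowering coefficients are
  thereby raising ones, so half of the components of the relation come for free.\<close>

lemma cminus_Suc:
  "cminus X0 (l + 1) m = cplus X0 l m"
  "cminus Xp (l + 1) m = - (q * cplus Xm l (m + 1))"
  "cminus Xm (l + 1) (m + 1) = - (1 / q * cplus Xp l m)"
  "czero Xp l m = - (q * czero Xm l (m + 1))"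
proof -
  show "cminus X0 (l + 1) m = cplus X0 l m" by (simp add: algebra_simps)
  have e: "q powr (l + m + 2) = q * q powr (l + m + 1)" "q powr (m + 2) = q * q powr (m + 1)"
    using q0 by (simp_all add: powr_add power2_eq_square)
  have e': "q powr (- l + m - 1) = 1 / q * q powr (- l + m)"
    using q0 by (simp add: powr_diff)
  have a: "2 * (l + 1) = 2 * l + 2" "2 * l + 2 - 1 = 2 * l + 1" "l + 1 - m - 1 = l - m" "l + 1 - m = l - m + 1"
    "l - (m + 1) + 1 = l - m" "l - (m + 1) + 2 = l - m + 1" "l + (m + 1) = l + m + 1"
    "l + 1 + m + 1 = l + m + 2" by simp_all
  show "cminus Xp (l + 1) m = - (q * cplus Xm l (m + 1))"
    unfolding cminus.simps cplus.simps a e by simp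
  have b: "l + m + 2 - 1 = l + m + 1" "l + 1 + (m + 1) = l + m + 2" "- (l + 1) + (m + 1) - 1 = - l + m - 1"
    by simp_all
  show "cminus Xm (l + 1) (m + 1) = - (1 / q * cplus Xp l m)"
    unfolding cminus.simps cplus.simps a b e' by simp
  show "czero Xp l m = - (q * czero Xm l (m + 1))"
    unfolding czero.simps a e by simp
qed

lemma powr_numerals:
  "q powr 1 = q" "q powr - 1 = 1 / q" "q powr 2 = q * q" "q powr - 2 = 1 / q * (1 / q)"
  "q powr 3 = q * q * q" "q powr - 3 = 1 / q * (1 / q) * (1 / q)"
  "q powr 4 = q * q * q * q" "q powr - 4 = 1 / q * (1 / q) * (1 / q) * (1 / q)"
  using q0 by (simp_all add: powr_minus_divide power2_eq_square power3_eq_cube power4_eq_xxxx)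

lemmas qn_expand = qn_eq mult_2 diff_conv_add_uminus minus_add_distrib minus_minus powr_add powr_numerals

lemma powr_inverse_rel:
  "q powr x * q powr (- x) = 1" "q * (1 / q) = 1" "wq * (1 / q - q) = 1" "wq * (1 - q\<^sup>2) = q"
  using q0 q_facts by (simp_all add: wq_def power2_eq_square flip: powr_add)

lemma raise_poly:
  "- (qn 2 * (qn (l + m + 2) * q powr (m - l + 1)))
    + q\<^sup>2 * (qn (l - m + 2) * qn (l + m + 1) - q\<^sup>2 * (qn (l - m + 1) * qn (l + m + 2))) = - (q\<^sup>2 * qn (2 * l + 4))"
  "qn 2 * (qn (l - m) * q powr (l + m + 3))
    + q\<^sup>2 * (qn (l - m + 1) * qn (l + m) - q\<^sup>2 * (qn (l - m) * qn (l + m + 1))) = q\<^sup>2 * qn (2 * l)"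
  "qn (l + 1) * qn (l + 2) - qn l * qn (l + 1) = qn (2 * l + 2)"
proof -
  \<comment> \<open>Negative powers become separate variables tied by \<open>P * P' = 1\<close> and
    the like; the identities of q-numbers are then memberships in a polynomial ideal.\<close>
  define P P' M M' r where "P = q powr l" and "P' = q powr (- l)" and "M = q powr m" and "M' = q powr (- m)" and "r = 1 / q"
  have rel: "P * P' = 1" "M * M' = 1" "q * r = 1" "wq * (r - q) = 1"
    unfolding P_def P'_def M_def M'_def r_def by (rule powr_inverse_rel)+
  show "- (qn 2 * (qn (l + m + 2) * q powr (m - l + 1)))
    + q\<^sup>2 * (qn (l - m + 2) * qn (l + m + 1) - q\<^sup>2 * (qn (l - m + 1) * qn (l + m + 2))) = - (q\<^sup>2 * qn (2 * l + 4))"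
    unfolding qn_expand P_def[symmetric] P'_def[symmetric] M_def[symmetric] M'_def[symmetric] r_def[symmetric]
    using rel by Groebner_Basis.algebra
  show "qn 2 * (qn (l - m) * q powr (l + m + 3))
    + q\<^sup>2 * (qn (l - m + 1) * qn (l + m) - q\<^sup>2 * (qn (l - m) * qn (l + m + 1))) = q\<^sup>2 * qn (2 * l)"
    unfolding qn_expand P_def[symmetric] P'_def[symmetric] M_def[symmetric] M'_def[symmetric] r_def[symmetric]
    using rel by Groebner_Basis.algebra
  show "qn (l + 1) * qn (l + 2) - qn l * qn (l + 1) = qn (2 * l + 2)"
    unfolding qn_expand P_def[symmetric] P'_def[symmetric] r_def[symmetric]
    using rel(1,3,4) by Groebner_Basis.algebra
qed

text \<open>The component from spin \<open>l\<close> to \<open>l + 2\<close>. Both products contain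
  the same four roots, so only the powers of \<open>q\<close> and the factor \<open>[2]\<close> are
  compared.\<close>

lemma rel_raise2:
  "- (qn 2 * (cplus Xm (l + 1) (m + 1) * cplus Xp l m)) + q\<^sup>2 * (cplus X0 (l + 1) m * cplus X0 l m) = 0"
proof -
  have a: "l + 1 - (m + 1) + 1 = l - m + 1" "l + 1 - (m + 1) + 2 = l - m + 2" "l + 1 - m + 1 = l - m + 2"
    "l + 1 + m + 1 = l + m + 2" "l + 1 + (m + 1) = l + m + 2" by simp_all
  have "q powr (l + m + 2) * q powr (- l + m) = q powr (m + m + 2)"
    by (simp flip: powr_add)
  also have "\<dots> = q\<^sup>2 * (q powr m * q powr m)"
    unfolding powr_add powr_numerals power2_eq_square by simp
  finally have e: "q powr (l + m + 2) * q powr (- l + m) = q\<^sup>2 * (q powr m * q powr m)" .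
  have s: "sqrt (qn 2) * sqrt (qn 2) = qn 2" using qn2_nonneg by simp
  define D where "D = sqrt (qn (2 * l + 1)) * sqrt (qn (2 * l + 2))"
  define D' where "D' = sqrt (qn (2 * (l + 1) + 1)) * sqrt (qn (2 * (l + 1) + 2))"
  define R where "R = sqrt (qn (l - m + 1)) * sqrt (qn (l - m + 2)) * sqrt (qn (l + m + 1)) * sqrt (qn (l + m + 2))"
  have 1: "cplus Xm (l + 1) (m + 1) * cplus Xp l m = (q powr (l + m + 2) * q powr (- l + m)) * R / (D' * D)"
    unfolding cplus.simps a D_def[symmetric] D'_def[symmetric] R_def by simp
  have 2: "cplus X0 (l + 1) m * cplus X0 l m = (q powr m * q powr m) * (sqrt (qn 2) * sqrt (qn 2)) * R / (D' * D)"
    unfolding cplus.simps a D_def[symmetric] D'_def[symmetric] R_def by simp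
  show ?thesis unfolding 1 2 e s by (simp add: mult_ac)
qed

text \<open>Recursion of the reduced element in \<open>l\<close>. The numerators at \<open>l\<close>
  and \<open>l + 1\<close> differ by a multiple of \<open>[l+1][l+2] - [l][l+1] = [2l+2]\<close>,
  which cancels the denominator and leaves a constant.\<close>

lemma betaN_step:
  assumes N: "N \<in> {- 1 / 2, 1 / 2}" and l: "-1 < l" "l \<noteq> 0"
  shows "q\<^sup>2 * qn (2 * l) * (BN N l / qn (2 * l)) - q\<^sup>2 * qn (2 * l + 4) * (BN N (l + 1) / qn (2 * l + 2)) + t * (1 - q\<^sup>2) = 0"
proof -
  let ?n = "\<lambda>l. sgn N * (1 / q + q - q powr (sgn N) * t)
     + t * (q - 1 / q) * (qn (1 / 2) * qn (3 / 2) - qn l * qn (l + 1))"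
  have p: "qn (2 * l + 4) \<noteq> 0" "qn (2 * l + 2) \<noteq> 0" using l qn_pos[of "2 * l + 4"] qn_pos[of "2 * l + 2"] by auto
  have p0: "qn (2 * l) \<noteq> 0"
  proof (cases "l < 0")
    case True
    then show ?thesis using qn_pos[of "- (2 * l)"] qn_minus[of "2 * l"] by simp
  next
    case False
    then show ?thesis using qn_pos[of "2 * l"] l by simp
  qed
  have e: "2 * (l + 1) + 2 = 2 * l + 4" "l + 1 + 1 = l + 2" by simp_all
  have 1: "q\<^sup>2 * qn (2 * l) * (BN N l / qn (2 * l)) = q * (?n l / qn (2 * l + 2))"
    using p0 q0 unfolding betaN_eq[OF N] by (simp add: power2_eq_square)
  have 2: "q\<^sup>2 * qn (2 * l + 4) * (BN N (l + 1) / qn (2 * l + 2)) = q * (?n (l + 1) / qn (2 * l + 2))"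
    using p(1) q0 unfolding betaN_eq[OF N] e by (simp add: power2_eq_square)
  have "?n l - ?n (l + 1) = t * (q - 1 / q) * (qn (l + 1) * qn (l + 2) - qn l * qn (l + 1))"
    unfolding e by (simp only: right_diff_distrib)
  also have "\<dots> = t * (q - 1 / q) * qn (2 * l + 2)" unfolding raise_poly ..
  finally have 3: "?n l / qn (2 * l + 2) - ?n (l + 1) / qn (2 * l + 2) = t * (q - 1 / q)"
    unfolding diff_divide_distrib[symmetric] using p(2) by simp
  have "q * (?n l / qn (2 * l + 2)) - q * (?n (l + 1) / qn (2 * l + 2)) = t * (q\<^sup>2 - 1)"
    unfolding right_diff_distrib[symmetric] 3 using q0 by (simp add: right_diff_distrib power2_eq_square)
  then show ?thesis unfolding 1 2 by (simp add: right_diff_distrib)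
qed

lemma rel_raise1:
  assumes N: "N \<in> {- 1 / 2, 1 / 2}" and l: "-1 < l" "l \<noteq> 0"
    and a: "l - m = -1 \<or> 0 \<le> l - m" and b: "-1 \<le> l + m"
  shows "- (qn 2 * (cplus Xp l m * czero Xm (l + 1) (m + 1) * BN N (l + 1) + cplus Xm l (m + 1) * czero Xp l m * BN N l))
    + q\<^sup>2 * (cplus X0 l m * (czero X0 (l + 1) m * BN N (l + 1) + czero X0 l m * BN N l))
    + t * (1 - q\<^sup>2) * cplus X0 l m = 0"
proof -
  define D W b1 b0 where "D = sqrt (qn (2 * l + 1)) * sqrt (qn (2 * l + 2))" and "W = sqrt (qn 2)"
    and "b1 = BN N (l + 1) / qn (2 * l + 2)" and "b0 = BN N l / qn (2 * l)"
  define r0 r1 s1 s2 where "r0 = sqrt (qn (l - m))" and "r1 = sqrt (qn (l - m + 1))" and "s1 = sqrt (qn (l + m + 1))" and "s2 = sqrt (qn (l + m + 2))"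
  have e: "2 * (l + 1) = 2 * l + 2" "l + 1 - (m + 1) + 1 = l - m + 1" "l + 1 + (m + 1) = l + m + 2"
    "l - (m + 1) + 1 = l - m" "l - (m + 1) + 2 = l - m + 1" "l + (m + 1) = l + m + 1" "l + 1 - m + 1 = l - m + 2"
    "l + 1 + m = l + m + 1" "l + 1 - m = l - m + 1" "l - m + 1 + 1 = l - m + 2" "l + m + 1 + 1 = l + m + 2" by simp_all
  have s2: "s2 * s2 = qn (l + m + 2)" unfolding s2_def by (rule sqrt_qn_sq) (use b in linarith)
  have r0: "r0 * r0 * r1 = qn (l - m) * r1" unfolding r0_def r1_def
    using a sqrt_sq_gap[of "l - m"] by auto
  have 1: "cplus Xp l m * czero Xm (l + 1) (m + 1) * BN N (l + 1)
      = W * r1 * s1 / D * (q powr (- l + m) * q powr (m + 1)) * (s2 * s2) * b1"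
    unfolding cplus.simps czero.simps e D_def[symmetric] W_def[symmetric] b1_def r1_def[symmetric] s1_def[symmetric] s2_def[symmetric]
    by simp
  have 2: "cplus Xm l (m + 1) * czero Xp l m * BN N l
      = - (W * s1 / D * (q powr (l + m + 1) * q powr (m + 2)) * (r0 * r0 * r1) * b0)"
    unfolding cplus.simps czero.simps e D_def[symmetric] W_def[symmetric] b0_def r0_def[symmetric] r1_def[symmetric] s1_def[symmetric]
    by simp
  have 3: "cplus X0 l m = q powr m * W * r1 * s1 / D"
    unfolding cplus.simps e D_def[symmetric] W_def[symmetric] r1_def[symmetric] s1_def[symmetric] by simp
  have 4: "czero X0 (l + 1) m * BN N (l + 1) = (qn (l - m + 2) * qn (l + m + 1) - q\<^sup>2 * (qn (l - m + 1) * qn (l + m + 2))) * b1"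
    unfolding czero.simps e b1_def by simp
  have 5: "czero X0 l m * BN N l = (qn (l - m + 1) * qn (l + m) - q\<^sup>2 * (qn (l - m) * qn (l + m + 1))) * b0"
    unfolding czero.simps b0_def by simp
  have p1: "q powr (- l + m) * q powr (m + 1) = q powr m * q powr (m - l + 1)"
    and p2: "q powr (l + m + 1) * q powr (m + 2) = q powr m * q powr (l + m + 3)"
    by (simp_all add: algebra_simps flip: powr_add)
  define C where "C = q powr m * W * r1 * s1 / D"
  have "- (qn 2 * (cplus Xp l m * czero Xm (l + 1) (m + 1) * BN N (l + 1) + cplus Xm l (m + 1) * czero Xp l m * BN N l))
    + q\<^sup>2 * (cplus X0 l m * (czero X0 (l + 1) m * BN N (l + 1) + czero X0 l m * BN N l))
    + t * (1 - q\<^sup>2) * cplus X0 l m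
    = C * ((- (qn 2 * (qn (l + m + 2) * q powr (m - l + 1)))
    + q\<^sup>2 * (qn (l - m + 2) * qn (l + m + 1) - q\<^sup>2 * (qn (l - m + 1) * qn (l + m + 2)))) * b1
    + (qn 2 * (qn (l - m) * q powr (l + m + 3))
    + q\<^sup>2 * (qn (l - m + 1) * qn (l + m) - q\<^sup>2 * (qn (l - m) * qn (l + m + 1)))) * b0 + t * (1 - q\<^sup>2))"
    unfolding 1 2 3 4 5 p1 p2 s2 r0 C_def divide_inverse by Groebner_Basis.algebra
  also have "\<dots> = 0"
    unfolding raise_poly using betaN_step[OF N l] unfolding b1_def b0_def by simp
  finally show ?thesis .
qed

text \<open>Multiplication by \<open>L\<close> or \<open>q * L\<close> clears the negative powers
  and makes q-numbers polynomial in \<open>L = q^(2l)\<close>. Half-integral arguments enter only in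
  products, so their fractional powers of \<open>q\<close> disappear.\<close>

lemma L_facts:
  fixes l :: real
  defines "L \<equiv> q powr l * q powr l"
  shows "qn l * qn l * L = wq\<^sup>2 * (1 - L)\<^sup>2" "qn (2 * l) * L = wq * (1 - L\<^sup>2)"
    "qn (l + 1 / 2) * qn (l - 1 / 2) * (q * L) = wq\<^sup>2 * (1 - q * L) * (q - L)"
    "qn (2 * l + 1) * (q * L) = wq * (1 - q * L) * (1 + q * L)"
    "q powr (l + 1) * q powr (l + 1) = q\<^sup>2 * L"
    "qn l * qn (l + 1) * (q * L) = wq\<^sup>2 * (1 - L) * (1 - q\<^sup>2 * L)"
proof -
  define P P' r h h' where "P = q powr l" and "P' = q powr (- l)" and "r = 1 / q" and "h = q powr (1 / 2)" and "h' = q powr (- (1 / 2))"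
  have rel: "P * P' = 1" "q * r = 1" "wq * (r - q) = 1" "h * h' = 1"
    unfolding P_def P'_def r_def h_def h'_def by (rule powr_inverse_rel)+
  have h: "h * h = q" unfolding h_def using q0 by (simp flip: powr_add)
  note ex = qn_expand P_def[symmetric] P'_def[symmetric] r_def[symmetric] h_def[symmetric] h'_def[symmetric]
  show "qn l * qn l * L = wq\<^sup>2 * (1 - L)\<^sup>2" "qn (2 * l) * L = wq * (1 - L\<^sup>2)"
    unfolding L_def ex using rel(1) by Groebner_Basis.algebra+
  show "qn (l + 1 / 2) * qn (l - 1 / 2) * (q * L) = wq\<^sup>2 * (1 - q * L) * (q - L)"
    unfolding L_def ex using rel(1,4) h by Groebner_Basis.algebra
  show "qn (2 * l + 1) * (q * L) = wq * (1 - q * L) * (1 + q * L)"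
    unfolding L_def ex using rel(1,2) by Groebner_Basis.algebra
  show "q powr (l + 1) * q powr (l + 1) = q\<^sup>2 * L"
    unfolding L_def ex by Groebner_Basis.algebra
  show "qn l * qn (l + 1) * (q * L) = wq\<^sup>2 * (1 - L) * (1 - q\<^sup>2 * L)"
    unfolding L_def ex using rel(1,2) by Groebner_Basis.algebra
qed

lemma L_bounds:
  assumes "0 < l" shows "0 < q powr l * q powr l" "q powr l * q powr l < 1"
proof -
  have "q powr l < q powr 0" using assms q0 q1 by (intro powr_less_mono') auto
  then have "q powr l < 1" using q0 by simp
  then have "q powr l * q powr l < 1 * 1" using q0 by (intro mult_strict_mono) auto
  then show "q powr l * q powr l < 1" by simp
qed (use q0 in simp)

text \<open>The radicand of \<open>alphaN\<close> divided by \<open>[l]^2\<close>; in this form the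
  square of \<open>alphaN\<close> no longer contains \<open>[l]\<close>.\<close>

definition rho :: "real \<Rightarrow> real \<Rightarrow> real" where
  "rho N l = (1 - t) / (qn l * qn l) + q powr (- 2 * N) * (t - 1 + q powr (2 * N))\<^sup>2 / (qn (2 * l))\<^sup>2"

lemma rho_L:
  assumes "0 < l"
  shows "rho N l * (wq\<^sup>2 * (1 - (q powr l * q powr l)\<^sup>2)\<^sup>2)
    = q powr l * q powr l * ((1 - t) * (1 + q powr l * q powr l)\<^sup>2
      + q powr (- 2 * N) * (t - 1 + q powr (2 * N))\<^sup>2 * (q powr l * q powr l))"
proof -
  define L g where "L = q powr l * q powr l" and "g = q powr (- 2 * N) * (t - 1 + q powr (2 * N))\<^sup>2"
  have p: "qn l > 0" "qn (2 * l) > 0" using assms qn_pos by auto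
  note f = L_facts(1,2)[of l, folded L_def]
  have "(1 - t) / (qn l * qn l) * (wq\<^sup>2 * (1 - L\<^sup>2)\<^sup>2) = (1 - t) / (qn l * qn l) * ((wq\<^sup>2 * (1 - L)\<^sup>2) * (1 + L)\<^sup>2)"
    by (simp add: power2_eq_square algebra_simps)
  also have "\<dots> = (1 - t) * L * (1 + L)\<^sup>2" unfolding f(1)[symmetric] using p by simp
  finally have 1: "(1 - t) / (qn l * qn l) * (wq\<^sup>2 * (1 - L\<^sup>2)\<^sup>2) = (1 - t) * L * (1 + L)\<^sup>2" .
  have "g / (qn (2 * l))\<^sup>2 * (wq\<^sup>2 * (1 - L\<^sup>2)\<^sup>2) = g / (qn (2 * l))\<^sup>2 * (wq * (1 - L\<^sup>2))\<^sup>2"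
    by (simp add: power_mult_distrib)
  also have "\<dots> = g * L\<^sup>2" unfolding f(2)[symmetric] using p by (simp add: power_mult_distrib)
  finally have 2: "g / (qn (2 * l))\<^sup>2 * (wq\<^sup>2 * (1 - L\<^sup>2)\<^sup>2) = g * L\<^sup>2" .
  show ?thesis unfolding rho_def L_def[symmetric] g_def[symmetric] distrib_right[of "_ / _"] 1 2
    by (simp add: power2_eq_square algebra_simps)
qed

lemma AN_sq:
  assumes l: "l \<in> half_spins" and N: "N \<in> {- 1 / 2, 1 / 2}"
  shows "(AN N l)\<^sup>2 = qn 2 * (qn (l + 1 / 2) * qn (l - 1 / 2)) * qn (2 * l) / qn (2 * l + 1) * rho N l"
proof -
  have l2: "1 / 2 \<le> l" using half_spins_ge[OF l] .
  have p: "qn l > 0" "qn (2 * l) > 0" "qn (2 * l + 1) > 0" using l2 by (auto intro: qn_pos)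
  have nn: "0 \<le> qn (l + 1 / 2)" "0 \<le> qn (l - 1 / 2)" using l2 by (auto intro: qn_nonneg)
  have rad: "0 \<le> 1 - t + gterm N l" using gterm_bounds(1)[OF l N] t1 by simp
  have "1 - t + gterm N l = rho N l * (qn l)\<^sup>2"
  proof -
    define G where "G = (t - 1 + q powr (2 * N))\<^sup>2"
    show ?thesis unfolding gterm_def rho_def G_def[symmetric] using p
      by (simp add: distrib_right power2_eq_square)
  qed
  moreover have "(apre l)\<^sup>2 = qn 2 * (qn (l + 1 / 2) * qn (l - 1 / 2)) * qn (2 * l) / (qn (2 * l + 1) * (qn l)\<^sup>2)"
    unfolding apre_def using nn p qn2_nonneg by (simp add: power_divide power_mult_distrib)
  ultimately have "(AN N l)\<^sup>2 = qn 2 * (qn (l + 1 / 2) * qn (l - 1 / 2)) * qn (2 * l) / (qn (2 * l + 1) * (qn l)\<^sup>2) * (rho N l * (qn l)\<^sup>2)"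
    unfolding alphaN_eq[OF N] power_mult_distrib using rad by simp
  then show ?thesis using p by simp
qed

text \<open>The first two identities add up the passages through spin \<open>l + 1\<close> and
  through \<open>l - 1\<close>. The others rewrite the remaining dependence on \<open>m\<close> as
  polynomials in \<open>q^(2m)\<close> and \<open>q^(2l)\<close> and the inverse of the
  latter.\<close>

lemma T_poly:
  "1 / q * (q powr (- l + m) * q powr (- l + m) * qn (l + m + 2)) + q\<^sup>2 * (q powr m * q powr m * qn (l - m + 1))
    = q powr (- l + m) * qn (2 * l + 3)"
  "q * (q powr (l + m) * q powr (l + m) * qn (l - m - 1)) + q\<^sup>2 * (q powr m * q powr m * qn (l + m))
    = q powr (l + m) * q * qn (2 * l - 1)"
  "qn (l + m + 1) * q powr (- l + m) = wq * (1 / (q powr l * q powr l * q) - q powr m * q powr m * q)"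
  "qn (l - m) * (q powr (l + m) * q) = wq * q * (q powr m * q powr m - q powr l * q powr l)"
  "q powr m * q powr m * (qn (l - m) * qn (l + m + 1)) = wq\<^sup>2 * (q powr m * q powr m * (1 / (q powr l * q powr l * q) + q powr l * q powr l * q)
     - q * (q powr m * q powr m)\<^sup>2 - q powr l * q powr l * (1 / (q powr l * q powr l * q)))"
  "qn (l - m + 1) * qn (l + m) - q\<^sup>2 * (qn (l - m) * qn (l + m + 1))
    = wq * q * (1 / (q powr l * q powr l * q) + q powr l * q powr l * q - qn 2 * (q powr m * q powr m))"
proof -
  define P P' M M' r where "P = q powr l" and "P' = q powr (- l)" and "M = q powr m" and "M' = q powr (- m)" and "r = 1 / q"
  have rel: "P * P' = 1" "M * M' = 1" "q * r = 1" "wq * (r - q) = 1"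
    unfolding P_def P'_def M_def M'_def r_def by (rule powr_inverse_rel)+
  have i: "1 / (P * P * q) = P' * P' * r"
  proof -
    have "P' = 1 / P" "r = 1 / q" using rel(1) q0 by (auto simp: P_def P'_def r_def powr_minus_divide)
    then show ?thesis by simp
  qed
  note ex = qn_expand P_def[symmetric] P'_def[symmetric] M_def[symmetric] M'_def[symmetric] r_def[symmetric] i
  show "1 / q * (q powr (- l + m) * q powr (- l + m) * qn (l + m + 2)) + q\<^sup>2 * (q powr m * q powr m * qn (l - m + 1))
    = q powr (- l + m) * qn (2 * l + 3)"
    unfolding ex using rel(1,2,3) by Groebner_Basis.algebra
  show "q * (q powr (l + m) * q powr (l + m) * qn (l - m - 1)) + q\<^sup>2 * (q powr m * q powr m * qn (l + m))
    = q powr (l + m) * q * qn (2 * l - 1)"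
    unfolding ex using rel(1,2,3) by Groebner_Basis.algebra
  show "qn (l + m + 1) * q powr (- l + m) = wq * (1 / (q powr l * q powr l * q) - q powr m * q powr m * q)"
    unfolding ex using rel(1,2) by Groebner_Basis.algebra
  show "qn (l - m) * (q powr (l + m) * q) = wq * q * (q powr m * q powr m - q powr l * q powr l)"
    unfolding ex using rel(1,2) by Groebner_Basis.algebra
  show "q powr m * q powr m * (qn (l - m) * qn (l + m + 1)) = wq\<^sup>2 * (q powr m * q powr m * (1 / (q powr l * q powr l * q) + q powr l * q powr l * q)
     - q * (q powr m * q powr m)\<^sup>2 - q powr l * q powr l * (1 / (q powr l * q powr l * q)))"
    unfolding ex using rel(1,2,3) by Groebner_Basis.algebra
  show "qn (l - m + 1) * qn (l + m) - q\<^sup>2 * (qn (l - m) * qn (l + m + 1))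
    = wq * q * (1 / (q powr l * q powr l * q) + q powr l * q powr l * q - qn 2 * (q powr m * q powr m))"
    unfolding ex using rel by Groebner_Basis.algebra
qed

text \<open>The squares of the reduced elements in the variable \<open>L\<close>, cross-multiplied
  as \<open>diag_assemble\<close> expects them. In the quotients of q-numbers the factor
  \<open>1 - q * L\<close> cancels, and only \<open>1 + q * L\<close> stays as a
  denominator.\<close>

lemma F_hyp:
  fixes l N :: real
  defines "L \<equiv> q powr l * q powr l" and "g \<equiv> q powr (- 2 * N) * (t - 1 + q powr (2 * N))\<^sup>2"
  assumes l: "l \<in> half_spins" and N: "N \<in> {- 1 / 2, 1 / 2}"
  shows "(AN N l)\<^sup>2 / qn (2 * l) * (q\<^sup>2 * wq * (1 + q * L) * (1 - L\<^sup>2)\<^sup>2)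
      = (1 + q\<^sup>2) * (q - L) * L * ((1 - t) * (1 + L)\<^sup>2 * q + g * q * L)" (is ?A)
    and "qn (2 * l + 3) * ((AN N (l + 1))\<^sup>2 / (qn (2 * l + 1) * qn (2 * l + 2))) * (q * wq * (1 + q * L) * (1 - q ^ 4 * L\<^sup>2)\<^sup>2)
      = (1 + q\<^sup>2) * (1 - q ^ 3 * L) * L * ((1 - t) * (1 + q\<^sup>2 * L)\<^sup>2 * q + g * q * (q\<^sup>2 * L))" (is ?B)
proof -
  have l2: "1 / 2 \<le> l" using half_spins_ge[OF l] .
  have p: "qn (2 * l) > 0" "qn (2 * l + 1) > 0" "qn (2 * l + 2) > 0" "qn (2 * l + 3) > 0" using l2 by (auto intro: qn_pos)
  have L: "0 < L" "L < 1" unfolding L_def using L_bounds[of l] l2 by auto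
  have qL: "q * L < 1 * 1" using L q0 q1 by (intro mult_strict_mono) auto
  have w: "wq \<noteq> 0" using wq_pos by simp
  have y: "0 < 1 + q * L" using L q0 by (simp add: add_pos_pos)
  have d: "qn 2 * q = 1 + q\<^sup>2"
  proof -
    have "qn 2 = wq * (1 / q * (1 / q) - q * q)" unfolding qn_eq powr_numerals ..
    also have "\<dots> = wq * (1 / q - q) * (1 / q + q)" by (simp add: algebra_simps)
    also have "\<dots> = 1 / q + q" unfolding powr_inverse_rel(3) by simp
    finally show ?thesis using q0 by (simp add: algebra_simps power2_eq_square)
  qed
  note f = L_facts(3,4)[of l, folded L_def]
  have r1: "qn (l + 1 / 2) * qn (l - 1 / 2) / qn (2 * l + 1) * (1 + q * L) = wq * (q - L)"
  proof -
    have "qn (l + 1 / 2) * qn (l - 1 / 2) / qn (2 * l + 1) = (qn (l + 1 / 2) * qn (l - 1 / 2) * (q * L)) / (qn (2 * l + 1) * (q * L))"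
      using L q0 by simp
    also have "\<dots> = (wq * (1 - q * L)) * (wq * (q - L)) / ((wq * (1 - q * L)) * (1 + q * L))"
      unfolding f by (simp add: power2_eq_square mult_ac)
    also have "\<dots> = wq * (q - L) / (1 + q * L)" using w qL by simp
    finally show ?thesis using y by simp
  qed
  have e2: "(AN N l)\<^sup>2 / qn (2 * l) = qn 2 * (qn (l + 1 / 2) * qn (l - 1 / 2) / qn (2 * l + 1)) * rho N l"
    unfolding AN_sq[OF l N] using p by simp
  have "(AN N l)\<^sup>2 / qn (2 * l) * (q\<^sup>2 * wq * (1 + q * L) * (1 - L\<^sup>2)\<^sup>2) * wq
    = (qn 2 * q) * q * (qn (l + 1 / 2) * qn (l - 1 / 2) / qn (2 * l + 1) * (1 + q * L)) * (rho N l * (wq\<^sup>2 * (1 - L\<^sup>2)\<^sup>2))"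
    unfolding e2 by (simp add: power2_eq_square)
  also have "\<dots> = (1 + q\<^sup>2) * (q - L) * L * ((1 - t) * (1 + L)\<^sup>2 * q + g * q * L) * wq"
    unfolding d r1 rho_L[of l N, folded L_def g_def, OF less_le_trans[OF _ l2], simplified]
    by (simp add: algebra_simps)
  finally show ?A by (simp only: mult_right_cancel[OF w])
  have l1: "l + 1 \<in> half_spins" using half_spins_Suc[OF l] .
  define L1 where "L1 = q powr (l + 1) * q powr (l + 1)"
  have L1: "L1 = q\<^sup>2 * L" unfolding L1_def L_facts(5) L_def ..
  have q2L: "q\<^sup>2 * L \<noteq> 0" using L q0 by simp
  have a: "l + 1 + 1 / 2 = l + 3 / 2" "l + 1 - 1 / 2 = l + 1 / 2" "2 * (l + 1) = 2 * l + 2" "2 * l + 2 + 1 = 2 * l + 3" by simp_all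
  have f1: "qn (l + 3 / 2) * qn (l + 1 / 2) * (q\<^sup>2 * L) = wq\<^sup>2 * (1 - q ^ 3 * L) * (1 - q * L)"
  proof -
    have "q * (qn (l + 3 / 2) * qn (l + 1 / 2) * (q\<^sup>2 * L)) = qn (l + 1 + 1 / 2) * qn (l + 1 - 1 / 2) * (q * L1)"
      unfolding L1 a by simp
    also have "\<dots> = q * (wq\<^sup>2 * (1 - q ^ 3 * L) * (1 - q * L))"
      unfolding L_facts(3)[of "l + 1", folded L1_def] unfolding L1 by Groebner_Basis.algebra
    finally show ?thesis using q0 by simp
  qed
  have r2: "qn (l + 3 / 2) * qn (l + 1 / 2) / qn (2 * l + 1) * (q * (1 + q * L)) = wq * (1 - q ^ 3 * L)"
  proof -
    have "qn (l + 3 / 2) * qn (l + 1 / 2) / qn (2 * l + 1) = (qn (l + 3 / 2) * qn (l + 1 / 2) * (q\<^sup>2 * L)) / (qn (2 * l + 1) * (q * L) * q)"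
      using L q0 by (simp add: power2_eq_square)
    also have "\<dots> = (wq * (1 - q * L)) * (wq * (1 - q ^ 3 * L)) / ((wq * (1 - q * L)) * (q * (1 + q * L)))"
      unfolding f f1 by (simp add: power2_eq_square mult_ac)
    also have "\<dots> = wq * (1 - q ^ 3 * L) / (q * (1 + q * L))" using w qL by simp
    finally show ?thesis using y q0 by simp
  qed
  have e3: "qn (2 * l + 3) * ((AN N (l + 1))\<^sup>2 / (qn (2 * l + 1) * qn (2 * l + 2)))
    = qn 2 * (qn (l + 3 / 2) * qn (l + 1 / 2) / qn (2 * l + 1)) * rho N (l + 1)"
    unfolding AN_sq[OF l1 N] a using p by simp
  have v: "1 - q ^ 4 * L\<^sup>2 = 1 - L1\<^sup>2" unfolding L1 by (simp add: power_mult_distrib flip: power_mult)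
  have "qn (2 * l + 3) * ((AN N (l + 1))\<^sup>2 / (qn (2 * l + 1) * qn (2 * l + 2))) * (q * wq * (1 + q * L) * (1 - q ^ 4 * L\<^sup>2)\<^sup>2) * wq
    = qn 2 * (qn (l + 3 / 2) * qn (l + 1 / 2) / qn (2 * l + 1) * (q * (1 + q * L))) * (rho N (l + 1) * (wq\<^sup>2 * (1 - L1\<^sup>2)\<^sup>2))"
    unfolding e3 v by (simp add: power2_eq_square)
  also have "\<dots> = (qn 2 * q) * (1 - q ^ 3 * L) * L * ((1 - t) * (1 + q\<^sup>2 * L)\<^sup>2 * q + g * q * (q\<^sup>2 * L)) * wq"
    unfolding r2 rho_L[of "l + 1" N, folded L1_def g_def, OF add_nonneg_pos[OF order_trans[OF _ l2] zero_less_one], simplified]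
    unfolding L1 by (simp add: algebra_simps power2_eq_square)
  finally show ?B unfolding d by (simp only: mult_right_cancel[OF w])
qed

lemma beta_hyp:
  fixes l N :: real
  defines "L \<equiv> q powr l * q powr l"
  assumes l: "l \<in> half_spins" and N: "N \<in> {- 1 / 2, 1 / 2}"
  shows "BN N l / qn (2 * l) * (q * wq * (1 - L\<^sup>2) * (1 - q ^ 4 * L\<^sup>2))
    = (sgn N * (1 + q\<^sup>2 - q * q powr (sgn N) * t) * (1 - q\<^sup>2) * L - t * (q ^ 4 * L + L - q - q ^ 3 * L\<^sup>2)) * L"
proof -
  have l2: "1 / 2 \<le> l" using half_spins_ge[OF l] .
  have p: "qn (2 * l) > 0" "qn (2 * l + 2) > 0" using l2 by (auto intro: qn_pos)
  have w: "wq \<noteq> 0" using wq_pos by simp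
  define n where "n = sgn N * (1 / q + q - q powr (sgn N) * t)
     + t * (q - 1 / q) * (qn (1 / 2) * qn (3 / 2) - qn l * qn (l + 1))"
  have v: "qn (2 * l + 2) * (q\<^sup>2 * L) = wq * (1 - q ^ 4 * L\<^sup>2)"
  proof -
    have "2 * (l + 1) = 2 * l + 2" by simp
    moreover have "1 - (q\<^sup>2 * L)\<^sup>2 = 1 - q ^ 4 * L\<^sup>2" by (simp add: power_mult_distrib flip: power_mult)
    ultimately show ?thesis using L_facts(2)[of "l + 1", unfolded L_facts(5), folded L_def] by simp
  qed
  have x: "qn (1 / 2) * qn (3 / 2) * (q * q) = wq\<^sup>2 * (1 - q) * (1 - q\<^sup>2 * q)"
  proof -
    have "q powr (1 / 2) * q powr (1 / 2) = q" using q0 by (simp flip: powr_add)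
    moreover have "1 / 2 + 1 = (3 / 2 :: real)" by simp
    ultimately show ?thesis using L_facts(6)[of "1 / 2"] by simp
  qed
  note y = L_facts(6)[of l, folded L_def]
  have wr: "(q - 1 / q) * wq = - 1" using powr_inverse_rel(3) by (simp add: algebra_simps)
  have B: "BN N l * (q * (wq * (1 - q ^ 4 * L\<^sup>2))) = n * (q\<^sup>2 * L)"
    unfolding betaN_eq[OF N] n_def[symmetric] v[symmetric] using p q0 by simp
  have s: "sgn N * (1 / q + q - q powr (sgn N) * t) * (q\<^sup>2 * L) = sgn N * (1 + q\<^sup>2 - q * q powr (sgn N) * t) * (1 - q\<^sup>2) * L * wq"
  proof -
    have "sgn N * (1 + q\<^sup>2 - q * q powr (sgn N) * t) * (1 - q\<^sup>2) * L * wq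
      = sgn N * (1 + q\<^sup>2 - q * q powr (sgn N) * t) * L * (wq * (1 - q\<^sup>2))" by simp
    also have "\<dots> = sgn N * (1 / q + q - q powr (sgn N) * t) * (q\<^sup>2 * L)"
      unfolding powr_inverse_rel(4) using q0 by (simp add: algebra_simps power2_eq_square)
    finally show ?thesis by (simp only:)
  qed
  have "t * (q - 1 / q) * (qn (1 / 2) * qn (3 / 2) - qn l * qn (l + 1)) * (q\<^sup>2 * L)
    = t * (q - 1 / q) * (qn (1 / 2) * qn (3 / 2) * (q * q) * L - qn l * qn (l + 1) * (q * L) * q)"
    by (simp add: algebra_simps power2_eq_square)
  also have "\<dots> = t * ((q - 1 / q) * wq) * wq * ((1 - q) * (1 - q\<^sup>2 * q) * L - (1 - L) * (1 - q\<^sup>2 * L) * q)"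
    unfolding x y by (simp add: algebra_simps power2_eq_square)
  also have "\<dots> = - (t * (q ^ 4 * L + L - q - q ^ 3 * L\<^sup>2)) * wq"
    unfolding wr by Groebner_Basis.algebra
  finally have n: "n * (q\<^sup>2 * L) = (sgn N * (1 + q\<^sup>2 - q * q powr (sgn N) * t) * (1 - q\<^sup>2) * L
      - t * (q ^ 4 * L + L - q - q ^ 3 * L\<^sup>2)) * wq"
    unfolding n_def distrib_right[of _ _ "q\<^sup>2 * L"] s by (simp add: algebra_simps)
  have "BN N l / qn (2 * l) * (q * wq * (1 - L\<^sup>2) * (1 - q ^ 4 * L\<^sup>2)) * wq
    = (BN N l * (q * (wq * (1 - q ^ 4 * L\<^sup>2)))) * (wq * (1 - L\<^sup>2)) / qn (2 * l)" by simp
  also have "\<dots> = n * (q\<^sup>2 * L) * L" unfolding B L_facts(2)[of l, folded L_def, symmetric] using p by simp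
  also have "\<dots> = (sgn N * (1 + q\<^sup>2 - q * q powr (sgn N) * t) * (1 - q\<^sup>2) * L
      - t * (q ^ 4 * L + L - q - q ^ 3 * L\<^sup>2)) * L * wq" unfolding n by simp
  finally show ?thesis by (simp only: mult_right_cancel[OF w])
qed

text \<open>The two signs of \<open>N\<close> need separate polynomials because
  \<open>q^(2N)\<close> enters. Multiplied by \<open>q\<close>, the term with
  \<open>(t - 1 + q^(2N))^2\<close> becomes \<open>(q * t - q + 1)^2\<close> for
  \<open>N = -1/2\<close> and \<open>(t - 1 + q)^2\<close> for \<open>N = 1/2\<close>.\<close>

lemma rel_diag_reduced:
  fixes l m N :: real
  defines "L \<equiv> q powr l * q powr l" and "K \<equiv> q powr m * q powr m"
  assumes l: "l \<in> half_spins" and N: "N \<in> {- 1 / 2, 1 / 2}"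
  shows "qn 2 * (wq * (1 / (L * q) - K * q)) * (qn (2 * l + 3) * ((AN N (l + 1))\<^sup>2 / (qn (2 * l + 1) * qn (2 * l + 2))))
    + qn 2 * (wq * q * (K - L)) * ((AN N l)\<^sup>2 / qn (2 * l))
    + (BN N l / qn (2 * l))\<^sup>2 * ((qn 2)\<^sup>2 * q ^ 3 * (wq\<^sup>2 * (K * (1 / (L * q) + L * q) - q * K\<^sup>2 - L * (1 / (L * q))))
      + q\<^sup>2 * (wq * q * (1 / (L * q) + L * q - qn 2 * K))\<^sup>2)
    + t * (1 - q\<^sup>2) * (wq * q * (1 / (L * q) + L * q - qn 2 * K)) * (BN N l / qn (2 * l)) - t\<^sup>2 - (qn 2)\<^sup>2 * (1 - t) = 0"
proof -
  have l2: "1 / 2 \<le> l" using half_spins_ge[OF l] .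
  have L: "0 < L" "L < 1" unfolding L_def using L_bounds[of l] l2 by auto
  have L2: "L\<^sup>2 < 1" using L by (simp add: power_less_one_iff)
  have "q ^ 4 * L\<^sup>2 < 1 * 1" using L2 q0 q1 L by (intro mult_strict_mono) (auto simp: power_less_one_iff)
  then have nz: "q \<noteq> 0" "L \<noteq> 0" "wq \<noteq> 0" "1 - L\<^sup>2 \<noteq> 0" "1 - q ^ 4 * L\<^sup>2 \<noteq> 0" "1 + q * L \<noteq> 0"
    using q0 L L2 wq_pos add_pos_pos[of 1 "q * L"] by auto
  have S: "(1 / (L * q) + L * q) * (q * L) = 1 + q\<^sup>2 * L\<^sup>2"
    using q0 L by (simp add: distrib_right power2_eq_square)
  have d: "qn 2 * q = 1 + q\<^sup>2"
  proof -
    have "qn 2 = wq * (1 / q * (1 / q) - q * q)" unfolding qn_eq powr_numerals ..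
    also have "\<dots> = wq * (1 / q - q) * (1 / q + q)" by (simp add: algebra_simps)
    also have "\<dots> = 1 / q + q" unfolding powr_inverse_rel(3) by simp
    finally show ?thesis using q0 by (simp add: algebra_simps power2_eq_square)
  qed
  have r: "1 / (L * q) * (L * q) = 1" using q0 L by simp
  note F = F_hyp[OF l N, folded L_def] and b = beta_hyp[OF l N, folded L_def]
  from N show ?thesis
  proof (elim pm_halfE)
    assume N: "N = - 1 / 2"
    have s: "q powr (- 2 * N) = q" "q powr (2 * N) = 1 / q" "sgn N = -1" "q powr (sgn N) = 1 / q"
      unfolding N using q0 by (simp_all add: powr_minus_divide)
    have g: "q powr (- 2 * N) * (t - 1 + q powr (2 * N))\<^sup>2 * q = (q * t - q + 1)\<^sup>2"
    proof -
      have "q powr (- 2 * N) * (t - 1 + q powr (2 * N))\<^sup>2 * q = (q * (t - 1 + 1 / q))\<^sup>2"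
        unfolding s by (simp add: power2_eq_square)
      also have "q * (t - 1 + 1 / q) = q * t - q + 1" using q0 by (simp add: algebra_simps)
      finally show ?thesis .
    qed
    have b': "(sgn N * (1 + q\<^sup>2 - q * q powr (sgn N) * t) * (1 - q\<^sup>2) * L - t * (q ^ 4 * L + L - q - q ^ 3 * L\<^sup>2))
      = - ((1 + q\<^sup>2 - t) * (1 - q\<^sup>2) * L) - t * (q ^ 4 * L + L - q - q ^ 3 * L\<^sup>2)"
      unfolding s(4) unfolding s(3) powr_inverse_rel(2) by Groebner_Basis.algebra
    show ?thesis
      by (rule diag_assemble[OF nz powr_inverse_rel(4) F(1)[unfolded g] F(2)[unfolded g] b[unfolded b']
            diag_poly1_neg diag_poly2_neg S d r])
  next
    assume N: "N = 1 / 2"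
    have s: "q powr (- 2 * N) = 1 / q" "q powr (2 * N) = q" "sgn N = 1" "q powr (sgn N) = q"
      unfolding N using q0 by (simp_all add: powr_minus_divide)
    have g: "q powr (- 2 * N) * (t - 1 + q powr (2 * N))\<^sup>2 * q = (t - 1 + q)\<^sup>2"
      unfolding s using q0 by simp
    have b': "(sgn N * (1 + q\<^sup>2 - q * q powr (sgn N) * t) * (1 - q\<^sup>2) * L - t * (q ^ 4 * L + L - q - q ^ 3 * L\<^sup>2))
      = (1 + q\<^sup>2 - q\<^sup>2 * t) * (1 - q\<^sup>2) * L - t * (q ^ 4 * L + L - q - q ^ 3 * L\<^sup>2)"
      unfolding s(4) unfolding s(3) by (simp add: power2_eq_square)
    show ?thesis
      by (rule diag_assemble[OF nz powr_inverse_rel(4) F(1)[unfolded g] F(2)[unfolded g] b[unfolded b']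
            diag_poly1_pos diag_poly2_pos S d r])
  qed
qed

text \<open>The paths from \<open>l\<close> back to \<open>l\<close> pass through
  \<open>l + 1\<close>, \<open>l\<close> or \<open>l - 1\<close>. Along each of them
  \<open>cminus_Suc\<close> turns the product of off-axis coefficients into a square, so all roots
  disappear and \<open>T_poly\<close> applies.\<close>

lemma rel_diag:
  assumes I: "(l, m, N) \<in> spinor_index"
  shows "- (qn 2 * (cminus Xm (l + 1) (m + 1) * cplus Xp l m * (AN N (l + 1))\<^sup>2
      + czero Xm l (m + 1) * czero Xp l m * (BN N l)\<^sup>2 + cplus Xm (l - 1) (m + 1) * cminus Xp l m * (AN N l)\<^sup>2))
    + q\<^sup>2 * (cminus X0 (l + 1) m * cplus X0 l m * (AN N (l + 1))\<^sup>2 + (czero X0 l m)\<^sup>2 * (BN N l)\<^sup>2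
      + cplus X0 (l - 1) m * cminus X0 l m * (AN N l)\<^sup>2)
    + t * (1 - q\<^sup>2) * (czero X0 l m * BN N l) - t\<^sup>2 - (qn 2)\<^sup>2 * (1 - t) = 0"
proof -
  note D = spinor_indexD[OF I] and G = spinor_index_gap[OF I]
  define L K where "L = q powr l * q powr l" and "K = q powr m * q powr m"
  define E1 E0 b0 where "E1 = (AN N (l + 1))\<^sup>2 / (qn (2 * l + 1) * qn (2 * l + 2))"
    and "E0 = (AN N l)\<^sup>2 / (qn (2 * l - 1) * qn (2 * l))" and "b0 = BN N l / qn (2 * l)"
  have s: "sqrt (qn x) * sqrt (qn x) = qn x" if "0 \<le> x" for x using sqrt_qn_sq[OF that] .
  have n: "0 \<le> l + m + 1" "0 \<le> l + m + 2" "0 \<le> l - m" "0 \<le> l - m + 1" "0 \<le> l + m" "0 \<le> 2 * l + 1" "0 \<le> 2 * l + 2"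
    "0 \<le> 2 * l" "0 \<le> 2 * l - 1" "0 \<le> (2::real)" using D(4,5,6) by auto
  have q0': "q \<noteq> 0" using q0 by simp
  have c1: "cminus Xm (l + 1) (m + 1) * cplus Xp l m * (AN N (l + 1))\<^sup>2
    = - (1 / q * (q powr (- l + m) * q powr (- l + m)) * (qn (l + m + 1) * qn (l + m + 2)) * E1)"
  proof -
    have "cplus Xp l m * cplus Xp l m = (q powr (- l + m) * q powr (- l + m)) *
        ((sqrt (qn (l + m + 1)) * sqrt (qn (l + m + 1))) * (sqrt (qn (l + m + 2)) * sqrt (qn (l + m + 2))))
        / ((sqrt (qn (2 * l + 1)) * sqrt (qn (2 * l + 1))) * (sqrt (qn (2 * l + 2)) * sqrt (qn (2 * l + 2))))"
      unfolding cplus.simps times_divide_times_eq by (simp only: mult_ac)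
    note sq = this[unfolded s[OF n(1)] s[OF n(2)] s[OF n(6)] s[OF n(7)]]
    have "cminus Xm (l + 1) (m + 1) * cplus Xp l m * (AN N (l + 1))\<^sup>2
      = - (1 / q * (cplus Xp l m * cplus Xp l m) * (AN N (l + 1))\<^sup>2)"
      unfolding cminus_Suc by (simp only: mult_minus_left mult.assoc)
    then show ?thesis unfolding sq E1_def by simp
  qed
  have c2: "cminus X0 (l + 1) m * cplus X0 l m * (AN N (l + 1))\<^sup>2
    = K * (qn (l - m + 1) * qn (l + m + 1)) * qn 2 * E1"
  proof -
    have "cplus X0 l m * cplus X0 l m = (q powr m * q powr m) *
        ((sqrt (qn (l - m + 1)) * sqrt (qn (l - m + 1))) * (sqrt (qn (l + m + 1)) * sqrt (qn (l + m + 1)))) * (sqrt (qn 2) * sqrt (qn 2))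
        / ((sqrt (qn (2 * l + 1)) * sqrt (qn (2 * l + 1))) * (sqrt (qn (2 * l + 2)) * sqrt (qn (2 * l + 2))))"
      unfolding cplus.simps times_divide_times_eq by (simp only: mult_ac)
    note sq = this[unfolded s[OF n(1)] s[OF n(4)] s[OF n(6)] s[OF n(7)] s[OF n(10)]]
    show ?thesis unfolding cminus_Suc sq E1_def K_def by simp
  qed
  have e: "2 * (l - 1) + 1 = 2 * l - 1" "2 * (l - 1) + 2 = 2 * l" "l - 1 - (m + 1) + 1 = l - m - 1" "l - 1 - (m + 1) + 2 = l - m"
    "l - 1 + (m + 1) = l + m" "l - 1 - m + 1 = l - m" "l - 1 + m + 1 = l + m" "l - 1 + 1 = l" by simp_all
  have c3: "cplus Xm (l - 1) (m + 1) * cminus Xp l m * (AN N l)\<^sup>2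
    = - (q * (q powr (l + m) * q powr (l + m)) * (qn (l - m - 1) * qn (l - m)) * E0)"
  proof -
    have g: "(sqrt (qn (l - m - 1)) * sqrt (qn (l - m - 1))) * (sqrt (qn (l - m)) * sqrt (qn (l - m))) = qn (l - m - 1) * qn (l - m)"
    proof (cases "l - m = 0")
      case False
      then have "0 \<le> l - m - 1" using G(2) by linarith
      then show ?thesis using s n(3) by simp
    qed simp
    have "cplus Xm (l - 1) (m + 1) * cplus Xm (l - 1) (m + 1) = (q powr (l + m) * q powr (l + m)) *
        ((sqrt (qn (l - m - 1)) * sqrt (qn (l - m - 1))) * (sqrt (qn (l - m)) * sqrt (qn (l - m))))
        / ((sqrt (qn (2 * l - 1)) * sqrt (qn (2 * l - 1))) * (sqrt (qn (2 * l)) * sqrt (qn (2 * l))))"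
      unfolding cplus.simps e times_divide_times_eq by (simp only: mult_ac)
    note sq = this[unfolded g s[OF n(8)] s[OF n(9)]]
    have "cplus Xm (l - 1) (m + 1) * cminus Xp l m * (AN N l)\<^sup>2
      = - (q * (cplus Xm (l - 1) (m + 1) * cplus Xm (l - 1) (m + 1)) * (AN N l)\<^sup>2)"
      unfolding cminus_Suc(2)[of "l - 1" m, unfolded e] by (simp only: mult_minus_left mult_minus_right mult_ac)
    then show ?thesis unfolding sq E0_def by simp
  qed
  have c4: "cplus X0 (l - 1) m * cminus X0 l m * (AN N l)\<^sup>2 = K * (qn (l - m) * qn (l + m)) * qn 2 * E0"
  proof -
    have "cplus X0 (l - 1) m * cplus X0 (l - 1) m = (q powr m * q powr m) *
        ((sqrt (qn (l - m)) * sqrt (qn (l - m))) * (sqrt (qn (l + m)) * sqrt (qn (l + m)))) * (sqrt (qn 2) * sqrt (qn 2))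
        / ((sqrt (qn (2 * l - 1)) * sqrt (qn (2 * l - 1))) * (sqrt (qn (2 * l)) * sqrt (qn (2 * l))))"
      unfolding cplus.simps e times_divide_times_eq by (simp only: mult_ac)
    note sq = this[unfolded s[OF n(3)] s[OF n(5)] s[OF n(8)] s[OF n(9)] s[OF n(10)]]
    show ?thesis unfolding cminus_Suc(1)[of "l - 1" m, unfolded e] sq E0_def K_def by simp
  qed
  have c5: "czero Xm l (m + 1) * czero Xp l m * (BN N l)\<^sup>2 = - (q ^ 3 * K * (qn (l - m) * qn (l + m + 1)) * qn 2 * b0\<^sup>2)"
  proof -
    have a: "l - (m + 1) + 1 = l - m" "l + (m + 1) = l + m + 1" by simp_all
    have "q powr (m + 1) * q powr (m + 1) = q\<^sup>2 * K"
      unfolding powr_add powr_numerals K_def power2_eq_square by simp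
    moreover have "czero Xm l (m + 1) * czero Xm l (m + 1) = (q powr (m + 1) * q powr (m + 1)) *
        ((sqrt (qn (l - m)) * sqrt (qn (l - m))) * (sqrt (qn (l + m + 1)) * sqrt (qn (l + m + 1)))) * (sqrt (qn 2) * sqrt (qn 2))
        / (qn (2 * l) * qn (2 * l))"
      unfolding czero.simps a times_divide_times_eq by (simp only: mult_ac)
    ultimately have sq: "czero Xm l (m + 1) * czero Xm l (m + 1) = q\<^sup>2 * K * (qn (l - m) * qn (l + m + 1)) * qn 2 / (qn (2 * l) * qn (2 * l))"
      unfolding s[OF n(1)] s[OF n(3)] s[OF n(10)] by (simp only:)
    have "czero Xm l (m + 1) * czero Xp l m * (BN N l)\<^sup>2
      = - (q * (czero Xm l (m + 1) * czero Xm l (m + 1)) * (BN N l)\<^sup>2)"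
      unfolding cminus_Suc(4) by (simp only: mult_minus_left mult_minus_right mult_ac)
    then show ?thesis unfolding sq b0_def
      by (simp add: power_divide power2_eq_square power3_eq_cube mult.assoc del: czero.simps)
  qed
  have c6: "czero X0 l m * BN N l = (qn (l - m + 1) * qn (l + m) - q\<^sup>2 * (qn (l - m) * qn (l + m + 1))) * b0"
    unfolding czero.simps b0_def by simp
  have c7: "(czero X0 l m)\<^sup>2 * (BN N l)\<^sup>2 = (qn (l - m + 1) * qn (l + m) - q\<^sup>2 * (qn (l - m) * qn (l + m + 1)))\<^sup>2 * b0\<^sup>2"
    unfolding c6[symmetric] power_mult_distrib[symmetric] ..
  \<comment> \<open>At \<open>l = 1 / 2\<close> the denominator of \<open>E0\<close> is zero, but
    \<open>alphaN\<close> vanishes there as well, so both sides are zero.\<close>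
  have F: "qn (2 * l - 1) * E0 = (AN N l)\<^sup>2 / qn (2 * l)"
  proof (cases "l = 1 / 2")
    case True
    show ?thesis unfolding E0_def True AN_half[OF D(3)] by simp
  next
    case False
    then have "1 / 2 < l" using D(4) by simp
    then have "qn (2 * l - 1) > 0" by (intro qn_pos) simp
    then show ?thesis by (simp add: E0_def)
  qed
  note T = T_poly[of l m, folded L_def K_def]
  have "- (qn 2 * (cminus Xm (l + 1) (m + 1) * cplus Xp l m * (AN N (l + 1))\<^sup>2
      + czero Xm l (m + 1) * czero Xp l m * (BN N l)\<^sup>2 + cplus Xm (l - 1) (m + 1) * cminus Xp l m * (AN N l)\<^sup>2))
    + q\<^sup>2 * (cminus X0 (l + 1) m * cplus X0 l m * (AN N (l + 1))\<^sup>2 + (czero X0 l m)\<^sup>2 * (BN N l)\<^sup>2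
      + cplus X0 (l - 1) m * cminus X0 l m * (AN N l)\<^sup>2)
    + t * (1 - q\<^sup>2) * (czero X0 l m * BN N l) - t\<^sup>2 - (qn 2)\<^sup>2 * (1 - t)
    = qn 2 * qn (l + m + 1) * E1 * (1 / q * (q powr (- l + m) * q powr (- l + m) * qn (l + m + 2)) + q\<^sup>2 * (K * qn (l - m + 1)))
    + qn 2 * qn (l - m) * E0 * (q * (q powr (l + m) * q powr (l + m) * qn (l - m - 1)) + q\<^sup>2 * (K * qn (l + m)))
    + b0\<^sup>2 * ((qn 2)\<^sup>2 * q ^ 3 * (K * (qn (l - m) * qn (l + m + 1)))
      + q\<^sup>2 * (qn (l - m + 1) * qn (l + m) - q\<^sup>2 * (qn (l - m) * qn (l + m + 1)))\<^sup>2)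
    + t * (1 - q\<^sup>2) * (qn (l - m + 1) * qn (l + m) - q\<^sup>2 * (qn (l - m) * qn (l + m + 1))) * b0 - t\<^sup>2 - (qn 2)\<^sup>2 * (1 - t)"
    unfolding c1 c2 c3 c4 c5 c6 c7 by Groebner_Basis.algebra
  also have "\<dots> = qn 2 * (qn (l + m + 1) * q powr (- l + m)) * (qn (2 * l + 3) * E1)
    + qn 2 * (qn (l - m) * (q powr (l + m) * q)) * (qn (2 * l - 1) * E0)
    + b0\<^sup>2 * ((qn 2)\<^sup>2 * q ^ 3 * (K * (qn (l - m) * qn (l + m + 1)))
      + q\<^sup>2 * (qn (l - m + 1) * qn (l + m) - q\<^sup>2 * (qn (l - m) * qn (l + m + 1)))\<^sup>2)
    + t * (1 - q\<^sup>2) * (qn (l - m + 1) * qn (l + m) - q\<^sup>2 * (qn (l - m) * qn (l + m + 1))) * b0 - t\<^sup>2 - (qn 2)\<^sup>2 * (1 - t)"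
    unfolding T(1,2) by simp
  also have "\<dots> = 0"
  proof -
    have T5: "K * (qn (l - m) * qn (l + m + 1)) = wq\<^sup>2 * (K * (1 / (L * q) + L * q) - q * K\<^sup>2 - L * (1 / (L * q)))"
      unfolding K_def L_def by (rule T_poly(5))
    show ?thesis unfolding T(3,4,6) F T5 unfolding E1_def b0_def
      using rel_diag_reduced[OF D(1,3), of m, folded L_def K_def] .
  qed
  finally show ?thesis .
qed

abbreviation fr :: "sphere_gen free_alg \<Rightarrow> spinor \<Rightarrow> spinor" where "fr \<equiv> opext scaleC xop"

lemmas fr_simps = opext_add[OF scaleC.module_axioms] opext_diff[OF scaleC.module_axioms]
  opext_minus[OF scaleC.module_axioms] opext_zero[OF scaleC.module_axioms]
  opext_cst[OF scaleC.module_axioms] opext_one[OF scaleC.module_axioms]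
  opext_gen[OF scaleC.module_axioms] opext_cst_times[OF scaleC.module_axioms]

lemma fr_mult: "fr (a * b) x = fr a (fr b x)"
  by (rule opext_mult[OF scaleC.module_axioms, of UNIV]) (auto simp: xop_lin)

lemma fr_vec_add: "fr a (x + y) = fr a x + fr a y"
  by (rule opext_vec_add[OF scaleC.module_axioms, of UNIV]) (auto simp: xop_lin)

lemma fr_vec_scale: "fr a (c *\<^sub>C x) = c *\<^sub>C fr a x"
  by (rule opext_vec_scale[OF scaleC.module_axioms, of UNIV]) (auto simp: xop_lin)

lemma fr_vec_zero [simp]: "fr a 0 = 0"
  using fr_vec_scale[of a 0 0] by simp

lemma fr_\<W> [simp]: "x \<in> \<W> \<Longrightarrow> fr a x \<in> \<W>"
  by (induction a rule: free_alg_induct) (auto simp: fr_simps fr_mult)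

lemma fr_clinear: "bounded_clinear (fr a)"
proof (induction a rule: free_alg_induct)
  case (cst c)
  have "fr (cst c) = (\<lambda>x. c *\<^sub>C x)" by (rule ext) (simp add: fr_simps)
  then show ?case using bounded_clinear_scaleC[OF bounded_clinear_id, of c] by simp
next
  case (gen x a)
  have "fr (gen x * a) = (\<lambda>y. xop x (fr a y))" by (rule ext) (simp add: fr_simps fr_mult)
  then show ?case using bounded_clinear_comp[OF xop_clinear gen] by simp
next
  case (add a b)
  have "fr (a + b) = (\<lambda>y. fr a y + fr b y)" by (rule ext) (simp add: fr_simps)
  then show ?case using bounded_clinear_add[OF add] by simp
qed

subsection \<open>Equivariance on generators\<close>

text \<open>The action of \<open>f\<close> and \<open>e\<close> on the span of the three generators
  up to the common factor \<open>sqrt [2]\<close>; \<open>None\<close> stands for zero, and is also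
  the value for \<open>k\<close>, which is handled separately.\<close>

fun nextgen :: "u_gen \<Rightarrow> sphere_gen \<Rightarrow> sphere_gen option" where
  "nextgen Uf Xm = Some X0" | "nextgen Uf X0 = Some Xp" | "nextgen Uf Xp = None"
| "nextgen Ue Xp = Some X0" | "nextgen Ue X0 = Some Xm" | "nextgen Ue Xm = None"
| "nextgen Uk x = None" | "nextgen Uk_inv x = None"

lemma nextgen_idx: "nextgen g x = Some y \<Longrightarrow> idx y = idx x + us g"
  by (cases g; cases x) auto

lemma idx_powr: "q powr (- idx Xm) = q" "q powr (- idx X0) = 1" "q powr (- idx Xp) = 1 / q"
  using q0 by (simp_all add: powr_minus_divide)

lemma wigner_eckart:
  assumes I: "(l, m, N) \<in> spinor_index" and g: "g = Uf \<or> g = Ue"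
  shows "uc g (l - 1) (m + idx x) * cminus x l m
      = sqrt (qn 2) * (case nextgen g x of None \<Rightarrow> 0 | Some y \<Rightarrow> cminus y l m) * q powr m
        + q powr (- idx x) * cminus x l (m + us g) * uc g l m" (is ?A)
    and "uc g l (m + idx x) * czero x l m
      = sqrt (qn 2) * (case nextgen g x of None \<Rightarrow> 0 | Some y \<Rightarrow> czero y l m) * q powr m
        + q powr (- idx x) * czero x l (m + us g) * uc g l m" (is ?B)
    and "uc g (l + 1) (m + idx x) * cplus x l m
      = sqrt (qn 2) * (case nextgen g x of None \<Rightarrow> 0 | Some y \<Rightarrow> cplus y l m) * q powr m
        + q powr (- idx x) * cplus x l (m + us g) * uc g l m" (is ?C)
proof -
  have s: "m + idx Xm = m - 1" "m + idx X0 = m" "m + idx Xp = m + 1" "m + us Uf = m + 1" "m + us Ue = m - 1" by simp_all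
  note z = mult_zero_left mult_zero_right add_0_left mult_1_left option.case nextgen.simps
  show ?A
  proof (cases x)
    case Xp
    show ?thesis using g unfolding Xp
      by (elim disjE) (simp_all only: s idx_powr z we_Uf_m_Xp[OF I] we_Ue_m_Xp[OF I])
  next
    case X0
    show ?thesis using g unfolding X0
      by (elim disjE) (simp_all only: s idx_powr z we_Uf_m_X0[OF I] we_Ue_m_X0[OF I])
  next
    case Xm
    show ?thesis using g unfolding Xm
      by (elim disjE) (simp_all only: s idx_powr z we_Uf_m_Xm[OF I] we_Ue_m_Xm[OF I])
  qed
  show ?B
  proof (cases x)
    case Xp
    show ?thesis using g unfolding Xp
      by (elim disjE) (simp_all only: s idx_powr z we_Uf_z_Xp[OF I] we_Ue_z_Xp[OF I])
  next
    case X0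
    show ?thesis using g unfolding X0
      by (elim disjE) (simp_all only: s idx_powr z we_Uf_z_X0[OF I] we_Ue_z_X0[OF I])
  next
    case Xm
    show ?thesis using g unfolding Xm
      by (elim disjE) (simp_all only: s idx_powr z we_Uf_z_Xm[OF I] we_Ue_z_Xm[OF I])
  qed
  show ?C
  proof (cases x)
    case Xp
    show ?thesis using g unfolding Xp
      by (elim disjE) (simp_all only: s idx_powr z we_Uf_p_Xp[OF I] we_Ue_p_Xp[OF I])
  next
    case X0
    show ?thesis using g unfolding X0
      by (elim disjE) (simp_all only: s idx_powr z we_Uf_p_X0[OF I] we_Ue_p_X0[OF I])
  next
    case Xm
    show ?thesis using g unfolding Xm
      by (elim disjE) (simp_all only: s idx_powr z we_Uf_p_Xm[OF I] we_Ue_p_Xm[OF I])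
  qed
qed

text \<open>\<open>A\<close> is the reduced matrix element common to all three terms. The
  coefficient identity is available on the index set only, and elsewhere the spinor coefficient
  \<open>v\<close> vanishes; hence the conditional hypothesis.\<close>

lemma eqv_aux:
  fixes u c s cy k d c' u' A :: real and v :: complex
  assumes "v \<noteq> 0 \<Longrightarrow> u * c = s * cy * k + d * c' * u'"
  shows "of_real u * (of_real (c * A) * v) = of_real s * (of_real (cy * A) * (of_real k * v))
    + of_real d * (of_real (c' * A) * (of_real u' * v))"
proof (cases "v = 0")
  case False
  have "u * (c * A) = s * ((cy * A) * k) + d * ((c' * A) * u')"
    using assms[OF False] by Groebner_Basis.algebra
  then have "complex_of_real (u * (c * A)) = of_real (s * ((cy * A) * k) + d * ((c' * A) * u'))" by (simp only:)
  then have "complex_of_real (u * (c * A)) * v = of_real (s * ((cy * A) * k) + d * ((c' * A) * u')) * v" by (simp only:)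
  then show ?thesis by (simp add: algebra_simps)
qed simp

text \<open>Operator form of the coproduct \<open>f \<otimes> k + k^(-1) \<otimes> f\<close>, and
  likewise for \<open>e\<close>. Each of the three components of \<open>xop x\<close> is matched
  separately by \<open>wigner_eckart\<close>.\<close>

lemma equivariance_ef:
  assumes \<xi>: "\<xi> \<in> \<W>" and g: "g = Uf \<or> g = Ue"
  shows "act g (xop x \<xi>) = (case nextgen g x of None \<Rightarrow> 0 | Some y \<Rightarrow> of_real (sqrt (qn 2)) *\<^sub>C xop y (act Uk \<xi>))
    + of_real (q powr (- idx x)) *\<^sub>C xop x (act g \<xi>)"
proof (rule spinor_eqI)
  fix i :: "real \<times> real \<times> real"
  obtain l m N where i: "i = (l, m, N)" by (cases i)
  define m' where "m' = m - us g - idx x"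
  let ?s = "sqrt (qn 2)" and ?d = "q powr (- idx x)"
  let ?n = "\<lambda>c. case nextgen g x of None \<Rightarrow> 0 | Some y \<Rightarrow> c y"
  have e: "m - us g = m' + idx x" "m' + idx x - idx x = m'" "m - idx x = m' + us g" "m' + us g - us g = m'"
    by (simp_all add: m'_def)
  let ?v1 = "coeff \<xi> (l + 1, m', N)" and ?v2 = "coeff \<xi> (l, m', N)" and ?v3 = "coeff \<xi> (l - 1, m', N)"
  have nz: "v \<in> spinor_index" if "coeff \<xi> v \<noteq> 0" for v using that coeff_outside by blast
  have 1: "of_real (uc g l (m' + idx x)) * (of_real (cminus x (l + 1) m' * AN N (l + 1)) * ?v1)
    = of_real ?s * (of_real (?n (\<lambda>y. cminus y (l + 1) m') * AN N (l + 1)) * (of_real (q powr m') * ?v1))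
    + of_real ?d * (of_real (cminus x (l + 1) (m' + us g) * AN N (l + 1)) * (of_real (uc g (l + 1) m') * ?v1))"
    using wigner_eckart(1)[OF nz g, of "l + 1" m' N x] by (intro eqv_aux) simp
  have 2: "of_real (uc g l (m' + idx x)) * (of_real (czero x l m' * BN N l) * ?v2)
    = of_real ?s * (of_real (?n (\<lambda>y. czero y l m') * BN N l) * (of_real (q powr m') * ?v2))
    + of_real ?d * (of_real (czero x l (m' + us g) * BN N l) * (of_real (uc g l m') * ?v2))"
    using wigner_eckart(2)[OF nz g, of l m' N x] by (intro eqv_aux) simp
  have 3: "of_real (uc g l (m' + idx x)) * (of_real (cplus x (l - 1) m' * AN N l) * ?v3)
    = of_real ?s * (of_real (?n (\<lambda>y. cplus y (l - 1) m') * AN N l) * (of_real (q powr m') * ?v3))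
    + of_real ?d * (of_real (cplus x (l - 1) (m' + us g) * AN N l) * (of_real (uc g (l - 1) m') * ?v3))"
    using wigner_eckart(3)[OF nz g, of "l - 1" m' N x] by (intro eqv_aux) simp
  have L: "coeff (act g (xop x \<xi>)) (l, m, N) = of_real (uc g l (m' + idx x)) *
    (of_real (cminus x (l + 1) m' * AN N (l + 1)) * ?v1 + of_real (czero x l m' * BN N l) * ?v2
      + of_real (cplus x (l - 1) m' * AN N l) * ?v3)"
    unfolding act_coeff[OF xop_\<W>[OF \<xi>]] coeff_xop e ..
  have R1: "coeff (case nextgen g x of None \<Rightarrow> 0 | Some y \<Rightarrow> of_real ?s *\<^sub>C xop y (act Uk \<xi>)) (l, m, N)
    = of_real ?s * (of_real (?n (\<lambda>y. cminus y (l + 1) m') * AN N (l + 1)) * (of_real (q powr m') * ?v1))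
    + of_real ?s * (of_real (?n (\<lambda>y. czero y l m') * BN N l) * (of_real (q powr m') * ?v2))
    + of_real ?s * (of_real (?n (\<lambda>y. cplus y (l - 1) m') * AN N l) * (of_real (q powr m') * ?v3))"
  proof (cases "nextgen g x")
    case None
    show ?thesis unfolding None by simp
  next
    case (Some y)
    have "m - idx y = m'" using nextgen_idx[OF Some] by (simp add: m'_def)
    then show ?thesis unfolding Some option.case coeff_scaleC coeff_xop act_coeff[OF \<xi>] us.simps uc.simps
      by (simp only: diff_zero distrib_left)
  qed
  have R2: "coeff (of_real ?d *\<^sub>C xop x (act g \<xi>)) (l, m, N)
    = of_real ?d * (of_real (cminus x (l + 1) (m' + us g) * AN N (l + 1)) * (of_real (uc g (l + 1) m') * ?v1))
    + of_real ?d * (of_real (czero x l (m' + us g) * BN N l) * (of_real (uc g l m') * ?v2))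
    + of_real ?d * (of_real (cplus x (l - 1) (m' + us g) * AN N l) * (of_real (uc g (l - 1) m') * ?v3))"
    unfolding coeff_scaleC coeff_xop act_coeff[OF \<xi>] e by (simp only: distrib_left)
  show "coeff (act g (xop x \<xi>)) i = coeff ((case nextgen g x of None \<Rightarrow> 0 | Some y \<Rightarrow> of_real ?s *\<^sub>C xop y (act Uk \<xi>))
    + of_real ?d *\<^sub>C xop x (act g \<xi>)) i"
    unfolding i coeff_plus L R1 R2 distrib_left 1 2 3 by (simp only: ac_simps)
qed

lemma equivariance_k:
  assumes \<xi>: "\<xi> \<in> \<W>"
  shows "act Uk (xop x \<xi>) = of_real (q powr idx x) *\<^sub>C xop x (act Uk \<xi>)"
    "act Uk_inv (xop x \<xi>) = of_real (q powr (- idx x)) *\<^sub>C xop x (act Uk_inv \<xi>)"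
proof -
  have e: "q powr m = q powr idx x * q powr (m - idx x)" "q powr (- m) = q powr (- idx x) * q powr (- (m - idx x))" for m
    by (simp_all flip: powr_add)
  show "act Uk (xop x \<xi>) = of_real (q powr idx x) *\<^sub>C xop x (act Uk \<xi>)"
  proof (rule spinor_eqI)
    fix i :: "real \<times> real \<times> real"
    obtain l m N where i: "i = (l, m, N)" by (cases i)
    show "coeff (act Uk (xop x \<xi>)) i = coeff (of_real (q powr idx x) *\<^sub>C xop x (act Uk \<xi>)) i"
      unfolding i act_coeff[OF xop_\<W>[OF \<xi>]] coeff_scaleC coeff_xop act_coeff[OF \<xi>] us.simps uc.simps diff_zero
      unfolding e(1)[of m] of_real_mult by (simp only: distrib_left ac_simps)
  qed
  show "act Uk_inv (xop x \<xi>) = of_real (q powr (- idx x)) *\<^sub>C xop x (act Uk_inv \<xi>)"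
  proof (rule spinor_eqI)
    fix i :: "real \<times> real \<times> real"
    obtain l m N where i: "i = (l, m, N)" by (cases i)
    show "coeff (act Uk_inv (xop x \<xi>)) i = coeff (of_real (q powr (- idx x)) *\<^sub>C xop x (act Uk_inv \<xi>)) i"
      unfolding i act_coeff[OF xop_\<W>[OF \<xi>]] coeff_scaleC coeff_xop act_coeff[OF \<xi>] us.simps uc.simps diff_zero
      unfolding e(2)[of m] of_real_mult by (simp only: distrib_left ac_simps)
  qed
qed

lemma act_gen_gen_ef:
  assumes "g = Uf \<or> g = Ue"
  shows "act_gen_gen q g x = (case nextgen g x of None \<Rightarrow> 0 | Some y \<Rightarrow> cst (of_real (sqrt (qn 2))) * gen y)"
    "coprod_gen g = [(g, Uk), (Uk_inv, g)]"
  using assms by (auto; cases x; auto)+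

lemma equivariance_gen:
  assumes \<xi>: "\<xi> \<in> \<W>"
  shows "act g (xop x \<xi>) = (\<Sum>(a, b)\<leftarrow>coprod_gen g. fr (act_gen_gen q a x) (act b \<xi>))"
proof (cases "g = Uf \<or> g = Ue")
  case True
  show ?thesis unfolding equivariance_ef[OF \<xi> True] act_gen_gen_ef(2)[OF True]
    by (cases "nextgen g x") (simp_all add: act_gen_gen_ef(1)[OF True] fr_simps)
next
  case False
  then have "g = Uk \<or> g = Uk_inv" by (cases g) auto
  then show ?thesis using equivariance_k[OF \<xi>] by (auto simp: fr_simps)
qed

subsection \<open>The relations\<close>

definition rel3 :: "sphere_gen free_alg" where
  "rel3 = - cst (of_real (qn 2)) * gen Xm * gen Xp
    + (cst (of_real (q\<^sup>2)) * gen X0 + cst (of_real t)) * (gen X0 - cst (of_real t))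
    - cst (of_real ((qn 2)\<^sup>2 * (1 - t)))"

lemma fr_rel3:
  "fr rel3 \<xi> = of_real (- qn 2) *\<^sub>C xop Xm (xop Xp \<xi>) + of_real (q\<^sup>2) *\<^sub>C xop X0 (xop X0 \<xi>)
    + of_real (t * (1 - q\<^sup>2)) *\<^sub>C xop X0 \<xi> - of_real (t\<^sup>2 + (qn 2)\<^sup>2 * (1 - t)) *\<^sub>C \<xi>"
  unfolding rel3_def fr_simps fr_mult mult.assoc minus_mult_left[symmetric]
  by (rule spinor_eqI)
    (simp add: fr_simps fr_mult xop_lin algebra_simps power2_eq_square)

text \<open>The relation changes the spin by at most two, so its matrix has five diagonals
  \<open>p2\<close>, ..., \<open>pm2\<close>, named by the spin of the source relative to the
  target. The first two are rewritten by \<open>cminus_Suc\<close> into the raising identities.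
  Where an identity holds only on the index set, the vanishing of the spinor coefficient covers the
  rest.\<close>

lemma rel3_zero:
  assumes "\<xi> \<in> \<W>" shows "fr rel3 \<xi> = 0"
proof (rule spinor_eqI)
  fix i :: "real \<times> real \<times> real"
  obtain l m N where i: "i = (l, m, N)" by (cases i)
  have nz: "v \<in> spinor_index" if "coeff \<xi> v \<noteq> 0" for v using that coeff_outside by blast
  have m: "m - idx Xm = m + 1" "m - idx X0 = m" "m + 1 - idx Xp = m" by simp_all
  have l: "l + 1 + 1 = l + 2" "l + 1 - 1 = l" "l - 1 + 1 = l" "l - 1 - 1 = l - 2" by simp_all
  let ?A = "\<lambda>l. AN N l" and ?B = "\<lambda>l. BN N l"
  define p2 where "p2 = (- (qn 2 * (cminus Xm (l + 1) (m + 1) * cminus Xp (l + 2) m)) + q\<^sup>2 * (cminus X0 (l + 1) m * cminus X0 (l + 2) m)) * (?A (l + 1) * ?A (l + 2))"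
  define p1 where "p1 = (- (qn 2 * (cminus Xm (l + 1) (m + 1) * czero Xp (l + 1) m * ?B (l + 1) + czero Xm l (m + 1) * cminus Xp (l + 1) m * ?B l))
    + q\<^sup>2 * (cminus X0 (l + 1) m * (czero X0 (l + 1) m * ?B (l + 1) + czero X0 l m * ?B l)) + t * (1 - q\<^sup>2) * cminus X0 (l + 1) m) * ?A (l + 1)"
  define p0 where "p0 = - (qn 2 * (cminus Xm (l + 1) (m + 1) * cplus Xp l m * (?A (l + 1))\<^sup>2
      + czero Xm l (m + 1) * czero Xp l m * (?B l)\<^sup>2 + cplus Xm (l - 1) (m + 1) * cminus Xp l m * (?A l)\<^sup>2))
    + q\<^sup>2 * (cminus X0 (l + 1) m * cplus X0 l m * (?A (l + 1))\<^sup>2 + (czero X0 l m)\<^sup>2 * (?B l)\<^sup>2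
      + cplus X0 (l - 1) m * cminus X0 l m * (?A l)\<^sup>2)
    + t * (1 - q\<^sup>2) * (czero X0 l m * ?B l) - t\<^sup>2 - (qn 2)\<^sup>2 * (1 - t)"
  define pm1 where "pm1 = (- (qn 2 * (cplus Xp (l - 1) m * czero Xm l (m + 1) * ?B l + cplus Xm (l - 1) (m + 1) * czero Xp (l - 1) m * ?B (l - 1)))
    + q\<^sup>2 * (cplus X0 (l - 1) m * (czero X0 l m * ?B l + czero X0 (l - 1) m * ?B (l - 1))) + t * (1 - q\<^sup>2) * cplus X0 (l - 1) m) * ?A l"
  define pm2 where "pm2 = (- (qn 2 * (cplus Xm (l - 1) (m + 1) * cplus Xp (l - 2) m)) + q\<^sup>2 * (cplus X0 (l - 1) m * cplus X0 (l - 2) m)) * (?A l * ?A (l - 1))"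
  have c: "coeff (fr rel3 \<xi>) (l, m, N) = of_real p2 * coeff \<xi> (l + 2, m, N) + of_real p1 * coeff \<xi> (l + 1, m, N)
    + of_real p0 * coeff \<xi> (l, m, N) + of_real pm1 * coeff \<xi> (l - 1, m, N) + of_real pm2 * coeff \<xi> (l - 2, m, N)"
    unfolding fr_rel3 coeff_plus coeff_minus coeff_scaleC coeff_xop m l p2_def p1_def p0_def pm1_def pm2_def
      of_real_mult of_real_add of_real_diff of_real_minus of_real_power of_real_1 power2_eq_square
    by Groebner_Basis.algebra
  have h2: "p2 = 0"
  proof -
    have a: "l + 1 + 1 = l + 2" by simp
    have "- (qn 2 * (cminus Xm (l + 1) (m + 1) * cminus Xp (l + 2) m)) + q\<^sup>2 * (cminus X0 (l + 1) m * cminus X0 (l + 2) m)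
      = - (qn 2 * (cplus Xm (l + 1) (m + 1) * cplus Xp l m)) + q\<^sup>2 * (cplus X0 (l + 1) m * cplus X0 l m)"
      unfolding cminus_Suc cminus_Suc[of "l + 1", unfolded a] using q0 by (simp del: cplus.simps)
    then show ?thesis unfolding p2_def rel_raise2 by simp
  qed
  have h1: "of_real p1 * coeff \<xi> (l + 1, m, N) = 0"
  proof (cases "coeff \<xi> (l + 1, m, N) = 0")
    case False
    note I = nz[OF False]
    show ?thesis
    proof (cases "l + 1 = 1 / 2")
      case True
      then show ?thesis unfolding p1_def True AN_half[OF spinor_indexD(3)[OF I]] by simp
    next
      case ne: False
      then have l2: "1 / 2 \<le> l" using half_spins_less[OF spinor_indexD(1)[OF I]] spinor_indexD(4)[OF I] by auto
      note G = spinor_index_gap(2)[OF I] and D = spinor_indexD(5,6)[OF I]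
      have a: "l - m = -1 \<or> 0 \<le> l - m" "-1 \<le> l + m" "-1 < l" "l \<noteq> 0" using G D l2 by auto
      have "p1 = (- (qn 2 * (cplus Xp l m * czero Xm (l + 1) (m + 1) * BN N (l + 1) + cplus Xm l (m + 1) * czero Xp l m * BN N l))
        + q\<^sup>2 * (cplus X0 l m * (czero X0 (l + 1) m * BN N (l + 1) + czero X0 l m * BN N l))
        + t * (1 - q\<^sup>2) * cplus X0 l m) * AN N (l + 1)"
        unfolding p1_def cminus_Suc using q0 by (simp del: cplus.simps czero.simps add: mult_ac)
      then show ?thesis unfolding rel_raise1[OF spinor_indexD(3)[OF I] a(3,4,1,2)] by simp
    qed
  qed simp
  have h0: "of_real p0 * coeff \<xi> (l, m, N) = 0"
  proof (cases "coeff \<xi> (l, m, N) = 0")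
    case False
    have "p0 = 0" unfolding p0_def by (rule rel_diag[OF nz[OF False]])
    then show ?thesis by simp
  qed simp
  have g1: "of_real pm1 * coeff \<xi> (l - 1, m, N) = 0"
  proof (cases "coeff \<xi> (l - 1, m, N) = 0")
    case False
    note I = nz[OF False]
    note D = spinor_indexD[OF I]
    have a: "l - 1 - m = -1 \<or> 0 \<le> l - 1 - m" "-1 \<le> l - 1 + m" "-1 < l - 1" "l - 1 \<noteq> 0" using D(4,5,6) by auto
    have "pm1 = 0" unfolding pm1_def
      using rel_raise1[OF D(3) a(3,4,1,2)] by (simp del: cplus.simps czero.simps)
    then show ?thesis by simp
  qed simp
  have g2: "pm2 = 0"
  proof -
    have a: "l - 2 + 1 = l - 1" by simp
    show ?thesis unfolding pm2_def using rel_raise2[of "l - 2" m, unfolded a] by (simp only: mult_zero_left)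
  qed
  show "coeff (fr rel3 \<xi>) i = coeff 0 i" unfolding i c h2 h1 h0 g1 g2 by simp
qed

subsection \<open>Equivariance on the free algebra\<close>

abbreviation ag :: "u_gen \<Rightarrow> sphere_gen free_alg \<Rightarrow> sphere_gen free_alg" where "ag \<equiv> act_gen_free q"

lemma ag_eq: "ag g = lext (\<lambda>c x. cst c * x) (\<lambda>w. act_gen_letters q g (letters w))"
  by (intro ext) (simp add: act_gen_free_def lext_def)

lemma ag_simps:
  "ag g (a + b) = ag g a + ag g b" "ag g (a - b) = ag g a - ag g b" "ag g (- a) = - ag g a" "ag g 0 = 0"
  "ag g (cst c * a) = cst c * ag g a"
  unfolding ag_eq by (simp_all add: lext_add[OF module_cst] lext_diff[OF module_cst] lext_minus[OF module_cst]
      lext_zero[OF module_cst] lext_cst_times[OF module_cst])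

lemma ag_word: "ag g (Poly_Mapping.single (Word xs) c) = cst c * act_gen_letters q g xs"
  unfolding ag_eq by (simp add: lext_single[OF module_cst])

lemma ag_gens:
  "ag g (cst c) = cst c * act_gen_letters q g []"
  "ag g (gen x) = act_gen_letters q g [x]"
  "ag g (gen x * gen y) = act_gen_letters q g [x, y]"
  using ag_word[of g "[]" c] ag_word[of g "[x]" 1] ag_word[of g "[x, y]" 1]
  by (simp_all add: single_word_Nil single_word_Cons)

lemma act_zero [simp]: "act g 0 = 0"
  using act_scale[of 0 g 0] by simp

text \<open>The induction step over words is the coassociativity of the coproduct on generators.\<close>

lemma equivariance_letters:
  assumes \<xi>: "\<xi> \<in> \<W>"
  shows "act g (foldr xop xs \<xi>) = (\<Sum>(a, b)\<leftarrow>coprod_gen g. fr (act_gen_letters q a xs) (act b \<xi>))"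
proof (induction xs arbitrary: g)
  case Nil
  show ?case by (cases g) (simp_all add: fr_simps)
next
  case (Cons x xs)
  have W: "foldr xop xs \<xi> \<in> \<W>" by (induction xs) (use \<xi> in auto)
  have "act g (foldr xop (x # xs) \<xi>) = (\<Sum>(a, b)\<leftarrow>coprod_gen g. fr (act_gen_gen q a x) (act b (foldr xop xs \<xi>)))"
    using equivariance_gen[OF W] by simp
  also have "\<dots> = (\<Sum>(a, b)\<leftarrow>coprod_gen g. fr (act_gen_letters q a (x # xs)) (act b \<xi>))"
    by (cases g) (simp_all add: Cons fr_simps fr_mult fr_vec_add add.assoc del: act_gen_gen.simps)
  finally show ?case .
qed

lemma equivariance_free:
  assumes \<xi>: "\<xi> \<in> \<W>"
  shows "act g (fr x \<xi>) = (\<Sum>(a, b)\<leftarrow>coprod_gen g. fr (ag a x) (act b \<xi>))"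
proof (induction x rule: pm_induct)
  case (single w c)
  obtain xs where w: "w = Word xs" by (cases w)
  have W: "foldr xop xs \<xi> \<in> \<W>" by (induction xs) (use \<xi> in auto)
  have "act g (fr (Poly_Mapping.single w c) \<xi>) = c *\<^sub>C (\<Sum>(a, b)\<leftarrow>coprod_gen g. fr (act_gen_letters q a xs) (act b \<xi>))"
    unfolding w opext_word[OF scaleC.module_axioms] act_scale[OF W] equivariance_letters[OF \<xi>] ..
  also have "\<dots> = (\<Sum>(a, b)\<leftarrow>coprod_gen g. fr (ag a (Poly_Mapping.single w c)) (act b \<xi>))"
    unfolding w ag_word by (cases g) (simp_all add: fr_simps scaleC_add_right)
  finally show ?case .
next
  case (add x y)
  have "act g (fr (x + y) \<xi>) = act g (fr x \<xi>) + act g (fr y \<xi>)"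
    using \<xi> by (simp add: fr_simps act_add)
  also have "\<dots> = (\<Sum>(a, b)\<leftarrow>coprod_gen g. fr (ag a (x + y)) (act b \<xi>))"
    unfolding add by (cases g) (simp_all add: fr_simps ag_simps)
  finally show ?case .
qed

text \<open>The adjoint action \<open>h_(1) x S(h_(2))\<close> with \<open>S(k) = k^(-1)\<close>,
  \<open>S(f) = - q f\<close> and \<open>S(e) = - e / q\<close> written out. It expresses the action
  through the operator of \<open>x\<close> alone, so an element that acts as zero keeps doing so
  under \<open>U\<^sub>q\<close>.\<close>

lemma fr_ag:
  assumes \<xi>: "\<xi> \<in> \<W>"
  shows "fr (ag Uk x) \<xi> = act Uk (fr x (act Uk_inv \<xi>))"
    and "fr (ag Uk_inv x) \<xi> = act Uk_inv (fr x (act Uk \<xi>))"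
    and "fr (ag Uf x) \<xi> = act Uf (fr x (act Uk_inv \<xi>)) - of_real q *\<^sub>C act Uk_inv (fr x (act Uf \<xi>))"
    and "fr (ag Ue x) \<xi> = act Ue (fr x (act Uk_inv \<xi>)) - of_real (1 / q) *\<^sub>C act Uk_inv (fr x (act Ue \<xi>))"
proof -
  have i: "act Uk (act Uk_inv \<xi>) = \<xi>" "act Uk_inv (act Uk \<xi>) = \<xi>" using act_k_kinv[OF \<xi>] .
  have W: "act g \<xi> \<in> \<W>" for g using \<xi> by simp
  show "fr (ag Uk x) \<xi> = act Uk (fr x (act Uk_inv \<xi>))"
    using equivariance_free[OF W, of Uk x Uk_inv] by (simp add: i)
  have k': "fr (ag Uk_inv x) \<xi> = act Uk_inv (fr x (act Uk \<xi>))" if "\<xi> \<in> \<W>" for \<xi>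
    using equivariance_free[OF act_\<W>[OF that], of Uk_inv x Uk] act_k_kinv[OF that] by simp
  show "fr (ag Uk_inv x) \<xi> = act Uk_inv (fr x (act Uk \<xi>))" by (rule k'[OF \<xi>])
  show "fr (ag Uf x) \<xi> = act Uf (fr x (act Uk_inv \<xi>)) - of_real q *\<^sub>C act Uk_inv (fr x (act Uf \<xi>))"
    using equivariance_free[OF W, of Uf x Uk_inv]
    by (simp add: i k' \<xi> act_k_f act_scale fr_vec_scale U_scale)
  show "fr (ag Ue x) \<xi> = act Ue (fr x (act Uk_inv \<xi>)) - of_real (1 / q) *\<^sub>C act Uk_inv (fr x (act Ue \<xi>))"
    using equivariance_free[OF W, of Ue x Uk_inv]
    by (simp add: i k' \<xi> act_k_e act_scale fr_vec_scale U_scale)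
qed

lemma fr_ag_zero:
  assumes "\<And>\<xi>. \<xi> \<in> \<W> \<Longrightarrow> fr a \<xi> = 0" "\<xi> \<in> \<W>"
  shows "fr (ag g a) \<xi> = 0"
  by (cases g) (simp_all add: fr_ag assms)

subsection \<open>All relations hold\<close>

definition rel1 :: "sphere_gen free_alg" where
  "rel1 = gen Xm * (gen X0 - cst (of_real t)) - cst (of_real (q\<^sup>2)) * (gen X0 - cst (of_real t)) * gen Xm"
definition rel2 :: "sphere_gen free_alg" where
  "rel2 = gen Xp * (gen X0 - cst (of_real t)) - cst (of_real (1 / q\<^sup>2)) * (gen X0 - cst (of_real t)) * gen Xp"
definition rel4 :: "sphere_gen free_alg" where
  "rel4 = - cst (of_real (qn 2)) * gen Xp * gen Xm
    + (cst (of_real (1 / q\<^sup>2)) * gen X0 + cst (of_real t)) * (gen X0 - cst (of_real t))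
    - cst (of_real ((qn 2)\<^sup>2 * (1 - t)))"

lemma sphere_relations_eq: "sphere_relations q t = {rel1, rel2, rel3, rel4}"
  unfolding sphere_relations_def Let_def rel1_def rel2_def rel3_def rel4_def by simp

lemma rel_expand:
  "rel1 = gen Xm * gen X0 - cst (of_real t) * gen Xm
    - (cst (of_real (q\<^sup>2)) * (gen X0 * gen Xm) - cst (of_real (q\<^sup>2)) * (cst (of_real t) * gen Xm))"
  "rel2 = gen Xp * gen X0 - cst (of_real t) * gen Xp
    - (cst (of_real (1 / q\<^sup>2)) * (gen X0 * gen Xp) - cst (of_real (1 / q\<^sup>2)) * (cst (of_real t) * gen Xp))"
  "rel3 = - (cst (of_real (qn 2)) * (gen Xm * gen Xp)) + (cst (of_real (q\<^sup>2)) * (gen X0 * gen X0) + cst (of_real t) * gen X0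
    - (cst (of_real (q\<^sup>2)) * (cst (of_real t) * gen X0) + cst (of_real t) * cst (of_real t))) - cst (of_real ((qn 2)\<^sup>2 * (1 - t)))"
  "rel4 = - (cst (of_real (qn 2)) * (gen Xp * gen Xm)) + (cst (of_real (1 / q\<^sup>2)) * (gen X0 * gen X0) + cst (of_real t) * gen X0
    - (cst (of_real (1 / q\<^sup>2)) * (cst (of_real t) * gen X0) + cst (of_real t) * cst (of_real t))) - cst (of_real ((qn 2)\<^sup>2 * (1 - t)))"
  unfolding rel1_def rel2_def rel3_def rel4_def
  by (simp_all only: left_diff_distrib right_diff_distrib distrib_left distrib_right mult.assoc
      cst_commute[of "gen Xm"] cst_commute[of "gen X0"] cst_commute[of "gen Xp"] mult_minus_left)

lemma qn2: "qn 2 = q + 1 / q"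
proof -
  have "qn 2 = wq * (1 / q - q) * (1 / q + q)" unfolding qn_eq powr_numerals by (simp add: algebra_simps)
  then show ?thesis unfolding powr_inverse_rel(3) by simp
qed

text \<open>The transitions inside the span of the four relations. Since \<open>f\<close> sends the
  first relation to the difference of the third and fourth, knowing the third gives the fourth; the
  second is then one more application of \<open>f\<close>. All coefficients here are nonzero and can
  be divided out.\<close>

lemma fr_ag_rel:
  "fr (ag Ue rel3) \<xi> = of_real (- sqrt (qn 2)) *\<^sub>C fr rel1 \<xi>"
  "fr (ag Uf rel1) \<xi> = of_real (- (sqrt (qn 2) * q / qn 2)) *\<^sub>C (fr rel3 \<xi> - fr rel4 \<xi>)"
  "fr (ag Uf rel4) \<xi> = of_real (- sqrt (qn 2)) *\<^sub>C fr rel2 \<xi>"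
proof -
  have n: "qn 2 \<noteq> 0" using qn_pos[of 2] by simp
  have f1: "fr rel1 \<xi> = xop Xm (xop X0 \<xi>) - of_real t *\<^sub>C xop Xm \<xi>
    - (of_real (q\<^sup>2) *\<^sub>C xop X0 (xop Xm \<xi>) - of_real (q\<^sup>2) *\<^sub>C of_real t *\<^sub>C xop Xm \<xi>)"
    unfolding rel_expand by (simp only: fr_simps fr_mult)
  have f2: "fr rel2 \<xi> = xop Xp (xop X0 \<xi>) - of_real t *\<^sub>C xop Xp \<xi>
    - (of_real (1 / q\<^sup>2) *\<^sub>C xop X0 (xop Xp \<xi>) - of_real (1 / q\<^sup>2) *\<^sub>C of_real t *\<^sub>C xop Xp \<xi>)"
    unfolding rel_expand by (simp only: fr_simps fr_mult)
  have f3: "fr rel3 \<xi> = - (of_real (qn 2) *\<^sub>C xop Xm (xop Xp \<xi>)) + (of_real (q\<^sup>2) *\<^sub>C xop X0 (xop X0 \<xi>) + of_real t *\<^sub>C xop X0 \<xi>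
    - (of_real (q\<^sup>2) *\<^sub>C of_real t *\<^sub>C xop X0 \<xi> + of_real t *\<^sub>C of_real t *\<^sub>C \<xi>)) - of_real ((qn 2)\<^sup>2 * (1 - t)) *\<^sub>C \<xi>"
    unfolding rel_expand by (simp only: fr_simps fr_mult)
  have f4: "fr rel4 \<xi> = - (of_real (qn 2) *\<^sub>C xop Xp (xop Xm \<xi>)) + (of_real (1 / q\<^sup>2) *\<^sub>C xop X0 (xop X0 \<xi>) + of_real t *\<^sub>C xop X0 \<xi>
    - (of_real (1 / q\<^sup>2) *\<^sub>C of_real t *\<^sub>C xop X0 \<xi> + of_real t *\<^sub>C of_real t *\<^sub>C \<xi>)) - of_real ((qn 2)\<^sup>2 * (1 - t)) *\<^sub>C \<xi>"
    unfolding rel_expand by (simp only: fr_simps fr_mult)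
  define s where "s = complex_of_real (sqrt (qn 2))"
  have p: "q powr - (- 1) = q" "q powr - 0 = 1" "q powr 0 = 1" "q powr - 1 = 1 / q" "q powr 1 = q"
    using q0 by (simp_all add: powr_minus_divide)
  note ltr = act_gen_letters.simps coprod_gen.simps act_gen_gen.simps counit_gen.simps idx.simps p of_real_1
    list.map sum_list_simps prod.case mult_zero_left mult_zero_right cst_zero cst_one mult_1_left mult_1_right
    add_0_left add_0_right s_def[symmetric]
  have l: "act_gen_letters q Uf [] = 0" "act_gen_letters q Ue [] = 0"
    "act_gen_letters q Ue [X0] = cst s * gen Xm" "act_gen_letters q Uf [X0] = cst s * gen Xp" "act_gen_letters q Uf [Xm] = cst s * gen X0"
    "act_gen_letters q Ue [Xm, Xp] = cst (of_real q) * gen Xm * (cst s * gen X0)"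
    "act_gen_letters q Ue [X0, X0] = cst s * gen Xm * gen X0 + gen X0 * (cst s * gen Xm)"
    "act_gen_letters q Uf [X0, X0] = cst s * gen Xp * gen X0 + gen X0 * (cst s * gen Xp)"
    "act_gen_letters q Uf [Xm, X0] = cst s * gen X0 * gen X0 + cst (of_real q) * gen Xm * (cst s * gen Xp)"
    "act_gen_letters q Uf [X0, Xm] = cst s * gen Xp * (cst (of_real (1 / q)) * gen Xm) + gen X0 * (cst s * gen X0)"
    "act_gen_letters q Uf [Xp, Xm] = cst (of_real (1 / q)) * gen Xp * (cst s * gen X0)"
    by (simp_all only: ltr)
  note ex = rel_expand ag_simps ag_gens l fr_simps fr_mult xop_lin mult_zero_right f1 f2 f3 f4
  define Q R T where "Q = complex_of_real q" and "R = complex_of_real (1 / q)" and "T = complex_of_real (1 / qn 2)"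
  have S: "complex_of_real (qn 2) = Q + R" unfolding Q_def R_def qn2 by simp
  have QR: "Q * R = 1" unfolding Q_def R_def using q0 by simp
  have T: "T * (Q + R) = 1" unfolding S[symmetric] T_def using n by simp
  have e: "complex_of_real (1 / q\<^sup>2) = R * R" "complex_of_real (q\<^sup>2) = Q * Q" "complex_of_real (- sqrt (qn 2)) = - s"
    "complex_of_real (- (sqrt (qn 2) * q / qn 2)) = - (s * Q * T)"
    unfolding R_def Q_def s_def T_def by (simp_all add: power2_eq_square)
  note of = e S Q_def[symmetric] R_def[symmetric] coeff_plus coeff_minus coeff_uminus coeff_zero coeff_scaleC
  show "fr (ag Ue rel3) \<xi> = of_real (- sqrt (qn 2)) *\<^sub>C fr rel1 \<xi>"
    unfolding ex by (rule spinor_eqI, unfold of) (use QR in Groebner_Basis.algebra)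
  show "fr (ag Uf rel1) \<xi> = of_real (- (sqrt (qn 2) * q / qn 2)) *\<^sub>C (fr rel3 \<xi> - fr rel4 \<xi>)"
    unfolding ex by (rule spinor_eqI, unfold of) (use QR T in Groebner_Basis.algebra)
  show "fr (ag Uf rel4) \<xi> = of_real (- sqrt (qn 2)) *\<^sub>C fr rel2 \<xi>"
    unfolding ex by (rule spinor_eqI, unfold of) (use QR in Groebner_Basis.algebra)
qed

lemma rel_zero:
  assumes "r \<in> sphere_relations q t" "\<xi> \<in> \<W>" shows "fr r \<xi> = 0"
proof -
  have s: "sqrt (qn 2) \<noteq> 0" "qn 2 \<noteq> 0" using qn_pos[of 2] by simp_all
  have c: "x = 0" if "c *\<^sub>C x = 0" "c \<noteq> 0" for c and x :: spinor
  proof -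
    have "x = (1 / c) *\<^sub>C (c *\<^sub>C x)" using that(2) by (simp add: scaleC_scaleC)
    then show ?thesis using that(1) by simp
  qed
  have c0: "complex_of_real (- sqrt (qn 2)) \<noteq> 0" "complex_of_real (- (sqrt (qn 2) * q / qn 2)) \<noteq> 0"
    unfolding of_real_eq_0_iff using s q0 by auto
  have 1: "fr rel1 \<xi> = 0" if "\<xi> \<in> \<W>" for \<xi>
    using fr_ag_zero[OF rel3_zero that, of Ue] unfolding fr_ag_rel by (rule c[OF _ c0(1)])
  have "fr rel3 \<xi> - fr rel4 \<xi> = 0" if "\<xi> \<in> \<W>" for \<xi>
    using fr_ag_zero[OF 1 that, of Uf] unfolding fr_ag_rel by (rule c[OF _ c0(2)])
  then have 4: "fr rel4 \<xi> = 0" if "\<xi> \<in> \<W>" for \<xi> using rel3_zero[OF that] that by simp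
  have 2: "fr rel2 \<xi> = 0" if "\<xi> \<in> \<W>" for \<xi>
    using fr_ag_zero[OF 4 that, of Uf] unfolding fr_ag_rel by (rule c[OF _ c0(1)])
  show ?thesis using assms 1 2 4 rel3_zero unfolding sphere_relations_eq by auto
qed

lemma fr_zero_ext:
  assumes "\<And>\<xi>. \<xi> \<in> \<W> \<Longrightarrow> fr a \<xi> = 0" shows "fr a \<xi> = 0"
proof -
  have "fr a = (\<lambda>_. 0)"
    by (rule bounded_clinear_eqI[OF fr_clinear bounded_clinear_zero]) (simp add: assms)
  then show ?thesis by simp
qed

abbreviation IS :: "sphere_gen free_alg set" where "IS \<equiv> two_sided_ideal (sphere_relations q t)"

lemma fr_ideal: assumes "a \<in> IS" shows "fr a \<xi> = 0"
proof -
  have "IS \<subseteq> {a. \<forall>\<xi>. fr a \<xi> = 0}"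
    by (rule two_sided_ideal_minimal) (auto simp: fr_simps fr_mult intro: fr_zero_ext rel_zero)
  then show ?thesis using assms by auto
qed

subsection \<open>Faithfulness\<close>

text \<open>In this variable the first two relations say that \<open>x_1\<close> and
  \<open>x_{-1}\<close> commute with \<open>y\<close> up to a power of \<open>q\<close>, and the
  other two make \<open>x_1 x_{-1}\<close> and \<open>x_{-1} x_1\<close> quadratic polynomials in
  \<open>y\<close>.\<close>

definition yel :: "sphere_gen free_alg" where "yel = gen X0 - cst (of_real t)"

text \<open>A basis of Poincare-Birkhoff-Witt type. The integer \<open>j\<close> is the weight,
  positive for powers of \<open>x_1\<close> and negative for powers of
  \<open>x_{-1}\<close>.\<close>

definition mono :: "nat \<times> int \<Rightarrow> sphere_gen free_alg" where
  "mono = (\<lambda>(i, j). yel ^ i * (if 0 \<le> j then gen Xp ^ nat j else gen Xm ^ nat (- j)))"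

lemma IS_trans: "a - b \<in> IS \<Longrightarrow> b - c \<in> IS \<Longrightarrow> a - c \<in> IS"
  using tsi_add[of "a - b" "sphere_relations q t" "b - c"] by simp

lemma IS_mult: "a - b \<in> IS \<Longrightarrow> c * a * d - c * b * d \<in> IS"
  using tsi_rmult[OF tsi_lmult[of "a - b" "sphere_relations q t" c], of d] by (simp add: algebra_simps)

text \<open>Elements congruent to a combination of the \<open>mono\<close>. Closure under congruence
  is a rule, so the reduction works on representatives and does not carry explicit sums; these
  return only in \<open>NF_expand\<close>.\<close>

inductive_set NF :: "sphere_gen free_alg set" where
  NF_mono: "mono i \<in> NF"
| NF_zero: "0 \<in> NF"
| NF_add: "a \<in> NF \<Longrightarrow> b \<in> NF \<Longrightarrow> a + b \<in> NF"
| NF_cst: "a \<in> NF \<Longrightarrow> cst c * a \<in> NF"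
| NF_cong: "a \<in> NF \<Longrightarrow> b - a \<in> IS \<Longrightarrow> b \<in> NF"

lemma NF_minus: "a \<in> NF \<Longrightarrow> - a \<in> NF"
  using NF_cst[of a "- 1"] by (simp add: cst_minus)

lemma commute_y:
  "gen Xp * yel ^ i - cst (of_real (1 / q\<^sup>2) ^ i) * yel ^ i * gen Xp \<in> IS"
  "gen Xm * yel ^ i - cst (of_real (q\<^sup>2) ^ i) * yel ^ i * gen Xm \<in> IS"
proof -
  have *: "gen x * yel ^ i - cst (c ^ i) * yel ^ i * gen x \<in> IS"
    if r: "gen x * yel - cst c * yel * gen x \<in> IS" for x c i
  proof (induction i)
    case 0
    show ?case by (simp add: tsi_zero)
  next
    case (Suc i)
    have h1: "gen x * yel * yel ^ i - cst c * yel * gen x * yel ^ i \<in> IS"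
      using IS_mult[OF r, of 1 "yel ^ i"] by (simp add: mult.assoc)
    have "cst c * yel * (gen x * yel ^ i) * 1 - cst c * yel * (cst (c ^ i) * yel ^ i * gen x) * 1 \<in> IS"
      by (rule IS_mult[OF Suc])
    then have h2: "cst c * yel * gen x * yel ^ i - cst (c ^ Suc i) * yel ^ Suc i * gen x \<in> IS"
      by (simp add: mult.assoc cst_mult cst_left_commute[of yel])
    show ?case using IS_trans[OF h1 h2] by (simp add: mult.assoc)
  qed
  have "rel2 \<in> IS" "rel1 \<in> IS" by (rule tsi_base, simp add: sphere_relations_eq)+
  then show "gen Xp * yel ^ i - cst (of_real (1 / q\<^sup>2) ^ i) * yel ^ i * gen Xp \<in> IS"
    "gen Xm * yel ^ i - cst (of_real (q\<^sup>2) ^ i) * yel ^ i * gen Xm \<in> IS"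
    using *[of Xp "of_real (1 / q\<^sup>2)" i] *[of Xm "of_real (q\<^sup>2)" i] unfolding rel1_def rel2_def yel_def by blast+
qed

text \<open>The third and fourth relations solved for the products, which requires division by
  \<open>[2]\<close>.\<close>

lemma prod_pm:
  "\<exists>a b c. gen Xp * gen Xm - (cst a * yel ^ 2 + cst b * yel + cst c) \<in> IS"
  "\<exists>a b c. gen Xm * gen Xp - (cst a * yel ^ 2 + cst b * yel + cst c) \<in> IS"
proof -
  have n: "complex_of_real (qn 2) \<noteq> 0" using qn_pos[of 2] by simp
  have *: "\<exists>a b c. z - (cst a * yel ^ 2 + cst b * yel + cst c) \<in> IS"
    if "- cst (of_real (qn 2)) * z + (cst s * gen X0 + cst (of_real t)) * (gen X0 - cst (of_real t)) - cst e \<in> IS" for z s e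
  proof -
    let ?k = "1 / complex_of_real (qn 2)"
    have X: "gen X0 = yel + cst (of_real t)" by (simp add: yel_def)
    have "- cst ?k * (- cst (of_real (qn 2)) * z + (cst s * gen X0 + cst (of_real t)) * (gen X0 - cst (of_real t)) - cst e) \<in> IS"
      by (rule tsi_lmult[OF that])
    also have "- cst ?k * (- cst (of_real (qn 2)) * z + (cst s * gen X0 + cst (of_real t)) * (gen X0 - cst (of_real t)) - cst e)
      = z - (cst (?k * s) * yel ^ 2 + cst (?k * (s * of_real t + of_real t)) * yel + cst (- (?k * e)))"
    proof -
      define W where "W = (cst s * gen X0 + cst (of_real t)) * yel"
      have W: "W = cst s * (yel * yel) + cst s * (cst (of_real t) * yel) + cst (of_real t) * yel"
        unfolding W_def X by (simp only: distrib_left distrib_right mult.assoc)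
      have k: "cst ?k * cst (of_real (qn 2)) = 1" using n by (simp flip: cst_mult)
      have "- cst ?k * (- cst (of_real (qn 2)) * z + W - cst e) = (cst ?k * cst (of_real (qn 2))) * z - cst ?k * W + cst ?k * cst e"
        by (simp add: right_diff_distrib distrib_left mult.assoc)
      also have "\<dots> = z - (cst (?k * s) * yel ^ 2 + cst (?k * (s * of_real t + of_real t)) * yel + cst (- (?k * e)))"
        unfolding k W cst_mult cst_add cst_minus power2_eq_square by (simp only: distrib_left distrib_right mult.assoc mult_1_left) simp
      finally show ?thesis unfolding W_def yel_def .
    qed
    finally show ?thesis by blast
  qed
  have "rel4 \<in> IS" "rel3 \<in> IS" by (rule tsi_base, simp add: sphere_relations_eq)+
  then show "\<exists>a b c. gen Xp * gen Xm - (cst a * yel ^ 2 + cst b * yel + cst c) \<in> IS"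
    "\<exists>a b c. gen Xm * gen Xp - (cst a * yel ^ 2 + cst b * yel + cst c) \<in> IS"
    unfolding rel3_def rel4_def by (intro *; simp only: mult.assoc mult_minus_left)+
qed

text \<open>A generator is moved past \<open>y^i\<close> at the cost of a scalar. It then either
  lengthens the power behind it or meets the opposite generator; in that case the pair is replaced
  by a quadratic in \<open>y\<close> and the power becomes shorter.\<close>

lemma NF_gen_mono: "gen x * mono ij \<in> NF"
proof -
  obtain i j where ij: "ij = (i, j)" by (cases ij)
  let ?z = "if 0 \<le> j then gen Xp ^ nat j else gen Xm ^ nat (- j)"
  have m: "mono (i, j) = yel ^ i * ?z" by (simp add: mono_def)
  have step: "gen x * mono (i, j) \<in> NF" if c: "gen x * yel ^ i - cst c * yel ^ i * gen x \<in> IS"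
    and z: "yel ^ i * (gen x * ?z) \<in> NF" for c x
  proof (rule NF_cong[OF NF_cst[OF z, of c]])
    show "gen x * mono (i, j) - cst c * (yel ^ i * (gen x * ?z)) \<in> IS"
      using IS_mult[OF c, of 1 ?z] by (simp only: m mult.assoc mult_1_left)
  qed
  \<comment> \<open>The quadratic raises the exponent of \<open>y\<close> by up to two, so
    \<open>w\<close> has to be reducible behind every power of \<open>y\<close>.\<close>
  have quad: "yel ^ i * (z * w) \<in> NF" if ex: "\<exists>a b c. z - (cst a * yel ^ 2 + cst b * yel + cst c) \<in> IS"
    and w: "\<And>i. yel ^ i * w \<in> NF" for z w
  proof -
    obtain a b c where r: "z - (cst a * yel ^ 2 + cst b * yel + cst c) \<in> IS" using ex by blast
    have yi: "yel ^ (i + 2) = yel ^ i * (yel * yel)" "yel ^ (i + 1) = yel ^ i * yel" by (simp_all only: power_add power2_eq_square power_one_right)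
    have "cst a * (yel ^ (i + 2) * w) + cst b * (yel ^ (i + 1) * w) + cst c * (yel ^ i * w) \<in> NF"
      by (intro NF_add NF_cst w)
    moreover have "yel ^ i * z * w - yel ^ i * (cst a * yel ^ 2 + cst b * yel + cst c) * w \<in> IS" by (rule IS_mult[OF r])
    then have "yel ^ i * (z * w) - (cst a * (yel ^ (i + 2) * w) + cst b * (yel ^ (i + 1) * w) + cst c * (yel ^ i * w)) \<in> IS"
      unfolding yi by (simp only: distrib_left distrib_right mult.assoc cst_left_commute[of "yel ^ i"] power2_eq_square)
    ultimately show ?thesis by (rule NF_cong)
  qed
  have "gen x * mono (i, j) \<in> NF"
  proof (cases x)
    case X0
    have "gen X0 * mono (i, j) = mono (Suc i, j) + cst (of_real t) * mono (i, j)"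
      unfolding mono_def by (simp add: yel_def algebra_simps)
    then show ?thesis unfolding X0 by (auto intro: NF_add NF_cst NF_mono)
  next
    case Xp
    show ?thesis unfolding Xp
    proof (rule step[OF commute_y(1)], cases "0 \<le> j")
      case True
      have "yel ^ i * (gen Xp * gen Xp ^ nat j) = mono (i, j + 1)"
        using True unfolding mono_def by (simp add: nat_add_distrib)
      then show "yel ^ i * (gen Xp * ?z) \<in> NF" using True NF_mono by simp
    next
      case False
      then obtain n where n: "nat (- j) = Suc n" by (metis gr0_implies_Suc neg_0_less_iff_less not_le zero_less_nat_eq)
      have w: "yel ^ i * gen Xm ^ n \<in> NF" for i
        using NF_mono[of "(i, - int n)"] by (cases "n = 0") (simp_all add: mono_def)
      show "yel ^ i * (gen Xp * ?z) \<in> NF"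
        using quad[OF prod_pm(1) w] False n by (simp add: mult.assoc)
    qed
  next
    case Xm
    show ?thesis unfolding Xm
    proof (rule step[OF commute_y(2)], cases "0 < j")
      case True
      then obtain n where n: "nat j = Suc n" by (metis gr0_implies_Suc zero_less_nat_eq)
      have w: "yel ^ i * gen Xp ^ n \<in> NF" for i
        using NF_mono[of "(i, int n)"] by (simp add: mono_def)
      show "yel ^ i * (gen Xm * ?z) \<in> NF"
        using quad[OF prod_pm(2) w] True n by (simp add: mult.assoc)
    next
      case False
      have "yel ^ i * (gen Xm * gen Xm ^ nat (- j)) = mono (i, j - 1)"
      proof -
        have "nat (- (j - 1)) = Suc (nat (- j))" using False by simp
        then show ?thesis using False unfolding mono_def by simp
      qed
      moreover have "?z = gen Xm ^ nat (- j)" using False by (cases "j = 0") auto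
      ultimately show "yel ^ i * (gen Xm * ?z) \<in> NF" using NF_mono by simp
    qed
  qed
  then show ?thesis unfolding ij .
qed

lemma NF_UNIV: "a \<in> NF"
proof (induction a rule: free_alg_induct)
  case (cst c)
  show ?case using NF_cst[OF NF_mono, of c "(0, 0)"] by (simp add: mono_def)
next
  case (gen x a)
  then show ?case
  proof (induction rule: NF.induct)
    case (NF_mono i)
    show ?case by (rule NF_gen_mono)
  next
    case NF_zero
    show ?case by (simp add: NF.NF_zero)
  next
    case (NF_add a b)
    then show ?case by (simp add: distrib_left NF.NF_add)
  next
    case (NF_cst a c)
    then show ?case by (simp add: cst_left_commute[of "gen x"] NF.NF_cst)
  next
    case (NF_cong a b)
    have "gen x * b - gen x * a \<in> IS"
      unfolding right_diff_distrib[symmetric] by (rule tsi_lmult[OF NF_cong(2)])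
    then show ?case by (rule NF.NF_cong[OF NF_cong(3)])
  qed
qed (rule NF_add)

lemma NF_expand: "\<exists>F c. finite F \<and> a - (\<Sum>ij\<in>F. cst (c ij) * mono ij) \<in> IS"
  using NF_UNIV[of a]
proof (induction rule: NF.induct)
  case (NF_mono i)
  show ?case by (intro exI[of _ "{i}"] exI[of _ "\<lambda>_. 1"]) (simp add: tsi_zero)
next
  case NF_zero
  show ?case by (intro exI[of _ "{}"]) (simp add: tsi_zero)
next
  case (NF_add a b)
  obtain F c where F: "finite F" "a - (\<Sum>ij\<in>F. cst (c ij) * mono ij) \<in> IS" using NF_add(3) by blast
  obtain G d where G: "finite G" "b - (\<Sum>ij\<in>G. cst (d ij) * mono ij) \<in> IS" using NF_add(4) by blast
  let ?e = "\<lambda>ij. (if ij \<in> F then c ij else 0) + (if ij \<in> G then d ij else 0)"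
  have "(\<Sum>ij\<in>F \<union> G. cst (?e ij) * mono ij) = (\<Sum>ij\<in>F \<union> G. cst (if ij \<in> F then c ij else 0) * mono ij)
     + (\<Sum>ij\<in>F \<union> G. cst (if ij \<in> G then d ij else 0) * mono ij)"
    by (simp only: cst_add distrib_right sum.distrib)
  also have "(\<Sum>ij\<in>F \<union> G. cst (if ij \<in> F then c ij else 0) * mono ij) = (\<Sum>ij\<in>F. cst (c ij) * mono ij)"
    using F(1) G(1) by (intro sum.mono_neutral_cong_right) auto
  also have "(\<Sum>ij\<in>F \<union> G. cst (if ij \<in> G then d ij else 0) * mono ij) = (\<Sum>ij\<in>G. cst (d ij) * mono ij)"
    using F(1) G(1) by (intro sum.mono_neutral_cong_right) auto
  finally have "a + b - (\<Sum>ij\<in>F \<union> G. cst (?e ij) * mono ij)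
    = (a - (\<Sum>ij\<in>F. cst (c ij) * mono ij)) + (b - (\<Sum>ij\<in>G. cst (d ij) * mono ij))" by simp
  then have "a + b - (\<Sum>ij\<in>F \<union> G. cst (?e ij) * mono ij) \<in> IS" using tsi_add[OF F(2) G(2)] by (simp only:)
  then show ?case using F(1) G(1) by (intro exI[of _ "F \<union> G"] exI[of _ ?e]) simp
next
  case (NF_cst a k)
  then obtain F c where F: "finite F" "a - (\<Sum>ij\<in>F. cst (c ij) * mono ij) \<in> IS" by blast
  have "cst k * a - (\<Sum>ij\<in>F. cst (k * c ij) * mono ij) = cst k * (a - (\<Sum>ij\<in>F. cst (c ij) * mono ij))"
    by (simp add: right_diff_distrib sum_distrib_left cst_mult mult.assoc)
  then have "cst k * a - (\<Sum>ij\<in>F. cst (k * c ij) * mono ij) \<in> IS" using tsi_lmult[OF F(2)] by (simp only:)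
  then show ?case using F(1) by (intro exI[of _ F] exI[of _ "\<lambda>ij. k * c ij"] conjI)
next
  case (NF_cong a b)
  then obtain F c where F: "finite F" "a - (\<Sum>ij\<in>F. cst (c ij) * mono ij) \<in> IS" by blast
  have "b - (\<Sum>ij\<in>F. cst (c ij) * mono ij) \<in> IS" by (rule IS_trans[OF NF_cong(2) F(2)])
  then show ?case using F(1) by (intro exI[of _ F] exI[of _ c] conjI)
qed

text \<open>No generator kills the component of highest spin; this yields faithfulness.\<close>

definition extremal :: "spinor \<Rightarrow> real \<Rightarrow> real \<Rightarrow> real \<Rightarrow> bool" where
  "extremal \<xi> l m N \<longleftrightarrow> (l, m, N) \<in> spinor_index \<and> coeff \<xi> (l, m, N) \<noteq> 0 \<and>
    (\<forall>l' m' N'. coeff \<xi> (l', m', N') \<noteq> 0 \<longrightarrow> l' \<le> l \<and> m' = m \<and> N' = N)"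

text \<open>The radicand is positive either through \<open>1 - t\<close> or, for
  \<open>t = 1\<close>, through \<open>gterm\<close>, which then contains the nonzero factor
  \<open>q^(2N)\<close>.\<close>

lemma AN_pos: assumes I: "(l, m, N) \<in> spinor_index" shows "AN N (l + 1) \<noteq> 0"
proof -
  note D = spinor_indexD[OF I]
  have "0 < apre (l + 1)" unfolding apre_def
    by (intro divide_pos_pos mult_pos_pos real_sqrt_gt_zero qn_pos; use D(4) in simp)
  moreover have "0 < 1 - t + gterm N (l + 1)"
  proof (cases "t = 1")
    case True
    have "qn (l + 1) \<noteq> 0" "qn (2 * (l + 1)) \<noteq> 0" using qn_pos[of "l + 1"] qn_pos[of "2 * (l + 1)"] D(4) by auto
    then have "0 < gterm N (l + 1)" unfolding gterm_def unfolding True using q0 by simp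
    then show ?thesis using True by simp
  next
    case False
    then show ?thesis using t1 gterm_bounds(1)[OF half_spins_Suc[OF D(1)] D(3)] by simp
  qed
  ultimately show ?thesis unfolding alphaN_eq[OF D(3)] by simp
qed

lemma cplus_nonzero: assumes I: "(l, m, N) \<in> spinor_index" shows "cplus x l m \<noteq> 0"
proof -
  note D = spinor_indexD[OF I]
  have "qn (l + m + 1) > 0" "qn (l + m + 2) > 0" "qn (l - m + 1) > 0" "qn (l - m + 2) > 0" "qn 2 > 0"
    "qn (2 * l + 1) > 0" "qn (2 * l + 2) > 0" using D by (auto intro: qn_pos)
  then show ?thesis using q0 by (cases x) simp_all
qed

text \<open>Subtracting a multiple of \<open>\<xi>\<close> itself covers \<open>y = x_0 - t\<close>:
  the correction has spin at most \<open>l\<close> and does not reach the new top component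
  \<open>l + 1\<close>. The raising coefficient and \<open>alphaN\<close> at \<open>l + 1\<close>
  are both nonzero.\<close>

lemma extremal_xop:
  assumes e: "extremal \<xi> l m N"
  shows "extremal (xop x \<xi> - c *\<^sub>C (if x = X0 then \<xi> else 0)) (l + 1) (m + idx x) N"
proof -
  let ?\<eta> = "xop x \<xi> - c *\<^sub>C (if x = X0 then \<xi> else 0)"
  have I: "(l, m, N) \<in> spinor_index" and n: "coeff \<xi> (l, m, N) \<noteq> 0"
    and s: "\<And>l' m' N'. coeff \<xi> (l', m', N') \<noteq> 0 \<Longrightarrow> l' \<le> l \<and> m' = m \<and> N' = N"
    using e unfolding extremal_def by blast+
  have z: "coeff \<xi> (l + 1, k, N) = 0" "coeff \<xi> (l + 1 + 1, k, N) = 0" "coeff \<xi> (2 + l, k, N) = 0" for k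
    using s[of "l + 1" k N] s[of "2 + l" k N] s[of "l + 1 + 1" k N] by auto
  have "coeff ?\<eta> (l + 1, m + idx x, N) = of_real (cplus x l m * AN N (l + 1)) * coeff \<xi> (l, m, N)"
    by (simp add: coeff_xop z del: cplus.simps)
  then have 1: "coeff ?\<eta> (l + 1, m + idx x, N) \<noteq> 0"
    using n cplus_nonzero[OF I] AN_pos[OF I] by simp
  have 2: "l' \<le> l + 1 \<and> m' = m + idx x \<and> N' = N" if h: "coeff ?\<eta> (l', m', N') \<noteq> 0" for l' m' N'
  proof -
    have "coeff \<xi> (l' + 1, m' - idx x, N') \<noteq> 0 \<or> coeff \<xi> (l', m' - idx x, N') \<noteq> 0
      \<or> coeff \<xi> (l' - 1, m' - idx x, N') \<noteq> 0"
    proof (rule ccontr)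
      assume "\<not> ?thesis"
      then show False using h by (cases "x = X0") (auto simp: coeff_xop)
    qed
    then show ?thesis using s by force
  qed
  show ?thesis unfolding extremal_def using spinor_index_up[OF I] 1 2 by blast
qed

lemma extremal_mono:
  assumes "extremal \<xi> l m N"
  shows "extremal (fr (mono (i, j)) \<xi>) (l + real_of_int \<bar>j\<bar> + real i) (m + of_int j) N"
proof -
  have x: "extremal (fr (gen x ^ n) \<xi>) (l + real n) (m + real n * idx x) N" if "x \<noteq> X0" for x n
  proof (induction n)
    case 0
    show ?case using assms by (simp add: fr_simps)
  next
    case (Suc n)
    have "fr (gen x ^ Suc n) \<xi> = xop x (fr (gen x ^ n) \<xi>)" by (simp add: fr_mult fr_simps)
    then show ?case using extremal_xop[OF Suc, of x 0] that by (simp add: algebra_simps)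
  qed
  have z: "extremal (fr (if 0 \<le> j then gen Xp ^ nat j else gen Xm ^ nat (- j)) \<xi>) (l + real_of_int \<bar>j\<bar>) (m + of_int j) N"
    using x[of Xp "nat j"] x[of Xm "nat (- j)"] by auto
  have y: "extremal (fr (yel ^ i) \<eta>) (l + real i) m N" if "extremal \<eta> l m N" for \<eta> l m
  proof (induction i)
    case 0
    show ?case using that by (simp add: fr_simps)
  next
    case (Suc i)
    have eq: "fr (yel ^ Suc i) \<eta> = xop X0 (fr (yel ^ i) \<eta>) - of_real t *\<^sub>C fr (yel ^ i) \<eta>"
      by (simp add: yel_def fr_mult fr_simps)
    show ?case unfolding eq using extremal_xop[OF Suc, of X0 "of_real t"] by (simp add: algebra_simps)
  qed
  show ?thesis unfolding mono_def prod.case fr_mult by (rule y[OF z])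
qed

text \<open>One basis vector \<open>v\<close> detects all coefficients of a normal form. The weight
  of the image determines \<open>j\<close>, and among the monomials with the same \<open>j\<close>
  the top spins \<open>1/2 + \<bar>j\<bar> + i\<close> are distinct.\<close>

lemma fr_faithful:
  assumes "\<And>\<xi>. \<xi> \<in> \<W> \<Longrightarrow> fr a \<xi> = 0" shows "a \<in> IS"
proof -
  obtain F c where F: "finite F" and a: "a - (\<Sum>ij\<in>F. cst (c ij) * mono ij) \<in> IS" using NF_expand by blast
  define v where "v = vec (1 / 2, 1 / 2, 1 / 2)"
  have "(1 / 2, 1 / 2, 1 / 2) \<in> spinor_index" unfolding spinor_index_iff by (auto intro!: exI[of _ 1] exI[of _ 0])
  then have v: "extremal v (1 / 2) (1 / 2) (1 / 2)" unfolding extremal_def v_def by (simp add: coeff_vec)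
  have z: "(\<Sum>ij\<in>F. c ij *\<^sub>C fr (mono ij) v) = 0"
  proof -
    have "fr (\<Sum>ij\<in>F. cst (c ij) * mono ij) v = 0"
      using fr_ideal[OF a, of v] assms[of v] by (simp add: fr_simps v_def)
    moreover have "fr (\<Sum>ij\<in>F. cst (c ij) * mono ij) v = (\<Sum>ij\<in>F. c ij *\<^sub>C fr (mono ij) v)"
      using F by (induction F) (simp_all add: fr_simps)
    ultimately show ?thesis by simp
  qed
  have "c ij = 0" if "ij \<in> F" for ij
  proof (rule ccontr)
    assume n: "c ij \<noteq> 0"
    obtain i0 j where ij: "ij = (i0, j)" by (cases ij)
    define A where "A = {i. (i, j) \<in> F \<and> c (i, j) \<noteq> 0}"
    have "finite A" unfolding A_def by (rule finite_subset[OF _ finite_imageI[OF F, of fst]]) force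
    moreover have "i0 \<in> A" using that n ij by (simp add: A_def)
    ultimately have d: "Max A \<in> A" "\<And>i. i \<in> A \<Longrightarrow> i \<le> Max A" by (auto intro: Max_in)
    \<comment> \<open>At the index \<open>?p\<close> the monomials of other weight vanish, and those
      with the same \<open>j\<close> and smaller \<open>i\<close> do not reach the spin; only the
      term \<open>(d, j)\<close> contributes.\<close>
    define d where "d = Max A"
    let ?p = "(1 / 2 + real_of_int \<bar>j\<bar> + real d, 1 / 2 + real_of_int j, 1 / 2)"
    have "coeff (c ij' *\<^sub>C fr (mono ij') v) ?p = 0" if h: "ij' \<in> F" "ij' \<noteq> (d, j)" for ij'
    proof (rule ccontr)
      assume "coeff (c ij' *\<^sub>C fr (mono ij') v) ?p \<noteq> 0"
      then have c': "c ij' \<noteq> 0" and m: "coeff (fr (mono ij') v) ?p \<noteq> 0" by auto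
      obtain i' j' where ij': "ij' = (i', j')" by (cases ij')
      have le: "1 / 2 + real_of_int \<bar>j\<bar> + real d \<le> 1 / 2 + real_of_int \<bar>j'\<bar> + real i' \<and> 1 / 2 + real_of_int j = 1 / 2 + real_of_int j'"
        using extremal_mono[OF v, of i' j'] m unfolding extremal_def ij' by blast
      then have j: "j' = j" by simp
      have "d \<le> i'" using le unfolding j by simp
      moreover have "i' \<le> d" using d(2)[of i'] h(1) c' unfolding ij' j A_def d_def by auto
      ultimately show False using h(2) ij' j by simp
    qed
    then have "coeff (\<Sum>ij\<in>F. c ij *\<^sub>C fr (mono ij) v) ?p = (\<Sum>ij\<in>{(d, j)}. coeff (c ij *\<^sub>C fr (mono ij) v) ?p)"
      unfolding coeff_sum using d(1) F by (intro sum.mono_neutral_right) (auto simp: A_def d_def)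
    moreover have "coeff (fr (mono (d, j)) v) ?p \<noteq> 0" using extremal_mono[OF v, of d j] unfolding extremal_def by blast
    moreover have "c (d, j) \<noteq> 0" using d(1) by (simp add: A_def d_def)
    ultimately show False using z by simp
  qed
  then have "(\<Sum>ij\<in>F. cst (c ij) * mono ij) = 0" by (intro sum.neutral) simp
  then show ?thesis using a by simp
qed

text \<open>The ideal is the kernel of the representation on \<open>\<W>\<close>. Membership of
  elements produced by the star or by the action is decided through this equivalence instead of
  manipulations in the free algebra.\<close>

lemma IS_iff: "a \<in> IS \<longleftrightarrow> (\<forall>\<xi>\<in>\<W>. fr a \<xi> = 0)"
  using fr_ideal fr_faithful by blast

lemma IS_diff_iff: "a - b \<in> IS \<longleftrightarrow> (\<forall>\<xi>\<in>\<W>. fr a \<xi> = fr b \<xi>)"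
  unfolding IS_iff by (simp add: fr_simps)

lemma fr_cong: "a - b \<in> IS \<Longrightarrow> fr a = fr b"
  using fr_ideal[of "a - b"] by (intro ext) (simp add: fr_simps)

abbreviation cls :: "sphere_gen free_alg \<Rightarrow> sphere_gen free_alg set" where
  "cls \<equiv> residue_class (sphere_relations q t)"

lemma cls_eq_iff: "cls a = cls b \<longleftrightarrow> (\<forall>\<xi>\<in>\<W>. fr a \<xi> = fr b \<xi>)"
  unfolding residue_class_eq_iff IS_diff_iff ..

lemma cls_eqI: "(\<And>\<xi>. \<xi> \<in> \<W> \<Longrightarrow> fr a \<xi> = fr b \<xi>) \<Longrightarrow> cls a = cls b"
  unfolding cls_eq_iff by blast

lemma spinor_rep_cls: "spinor_rep q t (cls a) = fr a"
proof
  fix \<xi>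
  have e: "(\<lambda>a. \<Sum>w\<in>Poly_Mapping.keys a. Poly_Mapping.lookup a w *\<^sub>C foldr (spinor_rep_gen q t) (letters w) \<xi>) = (\<lambda>a. fr a \<xi>)"
    unfolding opext_def lext_def spinor_rep_gen_eq[abs_def] by (rule ext) (simp add: spinor_rep_gen_eq cong: foldr_cong)
  show "spinor_rep q t (cls a) \<xi> = fr a \<xi>"
    unfolding spinor_rep_def e by (rule descend_residue_class) (simp add: fr_cong)
qed

section \<open>The quantum sphere is a star algebra\<close>

abbreviation sf :: "sphere_gen free_alg \<Rightarrow> sphere_gen free_alg" where "sf \<equiv> star_free q"

lemma sf_eq: "sf = lext (\<lambda>c x. cst (cnj c) * x) (\<lambda>w. prod_list (map (star_gen q) (rev (letters w))))"
  by (intro ext) (simp add: star_free_def lext_def)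

lemma sf_simps: "sf (a + b) = sf a + sf b" "sf (cst c * a) = cst (cnj c) * sf a" "sf (cst c) = cst (cnj c)"
  unfolding sf_eq using lext_single[OF module_cst_cnj, of "\<lambda>w. prod_list (map (star_gen q) (rev (letters w)))" "Word []" c]
  unfolding single_word_Nil
  by (simp_all add: lext_add[OF module_cst_cnj] lext_cst_times[OF module_cst_cnj])

lemma sf_gen_times: "sf (gen x * a) = sf a * star_gen q x"
proof (induction a rule: pm_induct)
  case (single w c)
  obtain xs where w: "w = Word xs" by (cases w)
  show ?case unfolding w single_word_Cons[symmetric] unfolding sf_eq
    by (simp add: lext_single[OF module_cst_cnj] mult.assoc)
qed (simp add: distrib_left distrib_right sf_simps)

lemma bounded_linear_cinner_left: "bounded_linear (\<lambda>x. cinner x (y :: spinor))"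
proof -
  have "(\<lambda>x. cinner x y) = (\<lambda>x. cnj (cinner y x))" by (rule ext) (rule cinner_commute)
  moreover have "bounded_linear (\<lambda>x. cnj (cinner y x))"
    by (rule bounded_linear_compose[OF bounded_linear_cnj bounded_linear_cinner])
  ultimately show ?thesis by simp
qed

text \<open>An adjointness relation between bounded operators extends from basis vectors by density,
  in one argument after the other.\<close>

lemma cinner_ext:
  assumes S: "bounded_clinear S" and T: "bounded_clinear T"
    and eq: "\<And>i j. i \<in> spinor_index \<Longrightarrow> j \<in> spinor_index \<Longrightarrow> cinner (S (vec i)) (vec j) = cinner (vec i) (T (vec j))"
  shows "cinner (S \<xi>) \<eta> = cinner \<xi> (T \<eta>)"
proof -
  note lin = bounded_clinearD[OF S] bounded_clinearD[OF T] cinner_add_left cinner_add_right cinner_scaleC_left cinner_scaleC_right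
  have bl: "bounded_linear S" "bounded_linear T" using S T unfolding bounded_clinear_def by auto
  have 1: "cinner (S \<xi>) (vec j) = cinner \<xi> (T (vec j))" if "\<xi> \<in> \<W>" "j \<in> spinor_index" for \<xi> j
    using that by (induction \<xi> rule: \<W>_induct) (simp_all add: lin eq)
  have 2: "cinner (S \<xi>) \<eta> = cinner \<xi> (T \<eta>)" if "\<xi> \<in> \<W>" for \<xi> \<eta>
  proof -
    have "cinner (S \<xi>) \<eta> = cinner \<xi> (T \<eta>)" if "\<eta> \<in> \<W>" for \<eta>
      using that by (induction \<eta> rule: \<W>_induct) (simp_all add: lin 1 \<open>\<xi> \<in> \<W>\<close>)
    then have "\<W> \<subseteq> {\<eta>. cinner (S \<xi>) \<eta> = cinner \<xi> (T \<eta>)}" by auto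
    moreover have "closed {\<eta>. cinner (S \<xi>) \<eta> = cinner \<xi> (T \<eta>)}"
      by (intro closed_Collect_eq linear_continuous_on bounded_linear_cinner
          bounded_linear_compose[OF bounded_linear_cinner bl(2)])
    ultimately have "closure \<W> \<subseteq> {\<eta>. cinner (S \<xi>) \<eta> = cinner \<xi> (T \<eta>)}" by (rule closure_minimal)
    then show ?thesis using \<W>_dense by auto
  qed
  have "\<W> \<subseteq> {\<xi>. cinner (S \<xi>) \<eta> = cinner \<xi> (T \<eta>)}" using 2 by auto
  moreover have "closed {\<xi>. cinner (S \<xi>) \<eta> = cinner \<xi> (T \<eta>)}"
    by (intro closed_Collect_eq linear_continuous_on bounded_linear_cinner_left
        bounded_linear_compose[OF bounded_linear_cinner_left bl(1)])
  ultimately have "closure \<W> \<subseteq> {\<xi>. cinner (S \<xi>) \<eta> = cinner \<xi> (T \<eta>)}" by (rule closure_minimal)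
  then show ?thesis using \<W>_dense by auto
qed

fun sx :: "sphere_gen \<Rightarrow> sphere_gen" where "sx Xm = Xp" | "sx X0 = X0" | "sx Xp = Xm"
fun sc :: "sphere_gen \<Rightarrow> real" where "sc Xm = - 1 / q" | "sc X0 = 1" | "sc Xp = - q"

lemma star_gen_eq: "star_gen q x = cst (of_real (sc x)) * gen (sx x)"
  by (cases x) simp_all

lemma adjoint_coeff:
  "cminus x (l + 1) (m - idx x) = sc x * cplus (sx x) l m"
  "czero x l (m - idx x) = sc x * czero (sx x) l m"
  "cplus x (l - 1) (m - idx x) = sc x * cminus (sx x) l m"
proof -
  have a: "m - 1 + 1 = m" "l - 1 + 1 = l" "m - idx Xm = m + 1" "m - idx X0 = m" "m - idx Xp = m - 1" by simp_all
  show "cminus x (l + 1) (m - idx x) = sc x * cplus (sx x) l m"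
    apply (cases x) apply (simp_all only: a sc.simps sx.simps cminus_Suc(1,3) cminus_Suc(2)[of l "m - 1", unfolded a])
    apply (simp_all)?
    done
  show "czero x l (m - idx x) = sc x * czero (sx x) l m"
    using q0 apply (cases x) apply (simp_all only: a sc.simps sx.simps cminus_Suc(4)[of l m] cminus_Suc(4)[of l "m - 1", unfolded a])
    apply (simp_all del: czero.simps)?
    done
  show "cplus x (l - 1) (m - idx x) = sc x * cminus (sx x) l m"
    using q0 apply (cases x) apply (simp_all only: a sc.simps sx.simps cminus_Suc(1)[of "l - 1" m, unfolded a]
        cminus_Suc(2)[of "l - 1" m, unfolded a] cminus_Suc(3)[of "l - 1" "m - 1", unfolded a])
    apply (simp_all del: cplus.simps)?
    done
qed

lemma adjoint_gen: "cinner (fr (star_gen q x) \<xi>) \<eta> = cinner \<xi> (xop x \<eta>)"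
proof (rule cinner_ext[OF fr_clinear xop_clinear])
  fix i j assume i: "i \<in> spinor_index" and j: "j \<in> spinor_index"
  obtain l m N where i': "i = (l, m, N)" by (cases i)
  obtain l' m' N' where j': "j = (l', m', N')" by (cases j)
  have x: "m + idx (sx x) = m - idx x" by (cases x) simp_all
  have fl: "fr (star_gen q x) (vec i) = of_real (sc x) *\<^sub>C xop (sx x) (vec i)"
    unfolding star_gen_eq fr_simps ..
  have v: "coeff (vec (a, b, c)) j = (if j = (a, b, c) then 1 else 0)" for a b c
    using j by (auto simp: coeff_vec)
  have v': "coeff (vec j) (a, b, c) = (if j = (a, b, c) then 1 else 0)" for a b c
    using j by (auto simp: coeff_vec)
  have "coeff (fr (star_gen q x) (vec i)) j = of_real (sc x) * (of_real (cminus (sx x) l m * AN N l) * (if j = (l - 1, m - idx x, N) then 1 else 0)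
    + of_real (czero (sx x) l m * BN N l) * (if j = (l, m - idx x, N) then 1 else 0)
    + of_real (cplus (sx x) l m * AN N (l + 1)) * (if j = (l + 1, m - idx x, N) then 1 else 0))"
    unfolding fl coeff_scaleC unfolding i' xop_vec[OF i[unfolded i']] coeff_plus alpha_eq x coeff_scaleC v ..
  also have "\<dots> = cnj \<dots>" by simp
  finally have 1: "cinner (fr (star_gen q x) (vec i)) (vec j) = of_real (sc x) * (of_real (cminus (sx x) l m * AN N l) * (if j = (l - 1, m - idx x, N) then 1 else 0)
    + of_real (czero (sx x) l m * BN N l) * (if j = (l, m - idx x, N) then 1 else 0)
    + of_real (cplus (sx x) l m * AN N (l + 1)) * (if j = (l + 1, m - idx x, N) then 1 else 0))"
    unfolding cinner_vec_right by simp
  have 2: "cinner (vec i) (xop x (vec j)) = of_real (sc x * cplus (sx x) l m * AN N (l + 1)) * (if j = (l + 1, m - idx x, N) then 1 else 0)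
    + of_real (sc x * czero (sx x) l m * BN N l) * (if j = (l, m - idx x, N) then 1 else 0)
    + of_real (sc x * cminus (sx x) l m * AN N l) * (if j = (l - 1, m - idx x, N) then 1 else 0)"
    unfolding cinner_vec_left i' coeff_xop adjoint_coeff v' ..
  show "cinner (fr (star_gen q x) (vec i)) (vec j) = cinner (vec i) (xop x (vec j))"
    unfolding 1 2 of_real_mult by (simp only: distrib_left ac_simps)
qed

lemma adjoint_fr: "cinner (fr (sf a) \<xi>) \<eta> = cinner \<xi> (fr a \<eta>)"
proof (induction a arbitrary: \<xi> \<eta> rule: free_alg_induct)
  case (cst c)
  show ?case by (simp add: sf_simps fr_simps cinner_scaleC_left cinner_scaleC_right)
next
  case (gen x a)
  show ?case unfolding sf_gen_times fr_mult gen fr_simps using adjoint_gen .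
next
  case (add a b)
  then show ?case by (simp add: sf_simps fr_simps cinner_add_left cinner_add_right)
qed

lemma cinner_eqI: "(\<And>\<eta>. cinner x \<eta> = cinner y \<eta>) \<Longrightarrow> x = (y :: spinor)"
  by (rule spinor_eqI) (metis cinner_vec_right complex_cnj_cnj)

lemma fr_sf_eqI: assumes "\<And>\<xi> \<eta>. cinner (fr a \<xi>) \<eta> = cinner (fr b \<xi>) \<eta>" shows "cls a = cls b"
  by (rule cls_eqI, rule cinner_eqI) (rule assms)

text \<open>The operator of \<open>sf a\<close> is the adjoint of the operator of \<open>a\<close>
  and hence depends only on the class of \<open>a\<close>. This replaces a check of the star on each
  relation.\<close>

lemma sf_cong: assumes "a - b \<in> IS" shows "cls (sf a) = cls (sf b)"
  by (rule fr_sf_eqI) (simp add: adjoint_fr fr_cong[OF assms])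

abbreviation QS where "QS \<equiv> quantum_sphere q t"

lemma QS_simps:
  "carrier QS = range cls" "cls a \<otimes>\<^bsub>QS\<^esub> cls b = cls (a * b)" "cls a \<oplus>\<^bsub>QS\<^esub> cls b = cls (a + b)"
  "\<one>\<^bsub>QS\<^esub> = cls 1" "\<zero>\<^bsub>QS\<^esub> = cls 0"
  unfolding quantum_sphere_def Let_def
  by (simp_all add: quotient_carrier quotient_mult quotient_add quotient_one quotient_zero)

lemma QS_smult: "c \<odot>\<^bsub>QS\<^esub> cls a = cls (cst c * a)"
proof -
  have "descend (\<lambda>a. cls (cst c * a)) (cls a) = cls (cst c * a)"
    by (rule descend_residue_class) (rule cls_eqI, simp add: fr_simps fr_cong)
  then show ?thesis unfolding quantum_sphere_def Let_def by simp
qed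

lemma QS_star: "star QS (cls a) = cls (sf a)"
proof -
  have "descend (\<lambda>a. cls (sf a)) (cls a) = cls (sf a)"
    by (rule descend_residue_class) (rule sf_cong)
  then show ?thesis unfolding quantum_sphere_def Let_def by simp
qed

lemma ring_QS: "ring QS"
proof (rule ringI)
  show "abelian_group QS"
  proof (rule abelian_groupI)
    fix x assume "x \<in> carrier QS"
    then obtain a where a: "x = cls a" by (auto simp: QS_simps)
    show "\<exists>y\<in>carrier QS. y \<oplus>\<^bsub>QS\<^esub> x = \<zero>\<^bsub>QS\<^esub>"
      by (rule bexI[of _ "cls (- a)"]) (simp_all add: a QS_simps)
  qed (auto simp: QS_simps add.assoc add.left_commute add.commute)
  show "Group.monoid QS" by (rule monoidI) (auto simp: QS_simps mult.assoc)
qed (auto simp: QS_simps distrib_left distrib_right)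

text \<open>On classes this is the adjoint of a product of operators, read back through
  faithfulness; no induction on words is needed.\<close>

lemma sf_mult_cls: "cls (sf (a * b)) = cls (sf b * sf a)"
  by (rule fr_sf_eqI) (simp add: adjoint_fr fr_mult)

lemma sf_sf_cls: "cls (sf (sf a)) = cls a"
proof (rule fr_sf_eqI)
  fix \<xi> \<eta>
  have "cinner (fr (sf (sf a)) \<xi>) \<eta> = cnj (cinner (fr (sf a) \<eta>) \<xi>)"
    unfolding adjoint_fr[of "sf a"] by (rule cinner_commute)
  also have "\<dots> = cinner (fr a \<xi>) \<eta>" unfolding adjoint_fr by (rule cinner_commute[symmetric])
  finally show "cinner (fr (sf (sf a)) \<xi>) \<eta> = cinner (fr a \<xi>) \<eta>" .
qed

lemma cls_cst_left_commute: "cls (a * (cst c * b)) = cls (cst c * (a * b))"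
  by (simp only: cst_left_commute[of a])

lemma star_algebra_QS: "star_algebra QS"
  unfolding star_algebra_def
proof (intro conjI)
  show "ring QS" by (rule ring_QS)
  interpret ring QS by (rule ring_QS)
  show "Module.module (ring_of_type_algebra :: complex ring) QS"
  proof (rule Module.moduleI)
    show "cring (ring_of_type_algebra :: complex ring)" by (rule cring_from_type_algebra)
    show "abelian_group QS" by (rule is_abelian_group)
  qed (auto simp: QS_simps QS_smult cst_add cst_mult distrib_left distrib_right mult.assoc)
qed (auto simp: QS_simps QS_smult QS_star sf_mult_cls sf_sf_cls sf_simps mult.assoc cls_cst_left_commute)

lemma star_representation_QS: "star_representation QS (spinor_rep q t)"
  unfolding star_representation_def
  by (auto simp: QS_simps QS_smult QS_star spinor_rep_cls fr_clinear fr_simps fr_mult adjoint_fr)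

lemma inj_on_QS: "inj_on (spinor_rep q t) (carrier QS)"
  by (auto intro!: inj_onI cls_eqI simp: QS_simps spinor_rep_cls)

section \<open>Equivariance of the spinor representation\<close>

abbreviation IU :: "u_gen free_alg set" where "IU \<equiv> two_sided_ideal (u_relations q)"

abbreviation af :: "u_gen free_alg \<Rightarrow> sphere_gen free_alg \<Rightarrow> sphere_gen free_alg" where
  "af \<equiv> opext (\<lambda>c x. cst c * x) ag"

lemma act_free_eq: "act_free q h x = af h x"
  by (simp add: act_free_def opext_def lext_def)

lemmas af_simps = opext_add[OF module_cst] opext_diff[OF module_cst] opext_minus[OF module_cst] opext_zero[OF module_cst]
  opext_cst[OF module_cst] opext_one[OF module_cst] opext_gen[OF module_cst] opext_cst_times[OF module_cst]

lemma af_mult: "af (a * b) x = af a (af b x)"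
  by (rule opext_mult[OF module_cst, of UNIV]) (auto simp: ag_simps)

lemma af_vec: "af a (x + y) = af a x + af a y" "af a (cst c * x) = cst c * af a x"
  by (rule opext_vec_add[OF module_cst, of UNIV] opext_vec_scale[OF module_cst, of UNIV]; simp add: ag_simps)+

lemma af_diff: "af a (x - y) = af a x - af a y"
  using af_vec(1)[of a x "- y"] af_vec(2)[of a "- 1" y] by (simp add: cst_minus)

lemma ag_IS: "x \<in> IS \<Longrightarrow> ag g x \<in> IS"
  unfolding IS_iff by (auto intro: fr_ag_zero)

lemma af_IS: "x \<in> IS \<Longrightarrow> af a x \<in> IS"
  by (induction a rule: free_alg_induct) (auto simp: af_simps af_mult intro: tsi_lmult tsi_add ag_IS)

lemma act_kinv_f: "x \<in> \<W> \<Longrightarrow> act Uf (act Uk_inv x) = of_real q *\<^sub>C act Uk_inv (act Uf x)"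
  using act_k_f[of "act Uk_inv x"] by (metis act_\<W> act_k_kinv act_scale)

lemma act_kinv_e: "x \<in> \<W> \<Longrightarrow> act Ue (act Uk_inv x) = of_real (1 / q) *\<^sub>C act Uk_inv (act Ue x)"
  using act_k_e[of "act Uk_inv x"] by (metis act_\<W> act_k_kinv act_scale)

text \<open>By \<open>fr_ag\<close> both sides become operators of the form \<open>h x S(h')\<close>
  on \<open>\<W>\<close>, where the relations of \<open>U\<^sub>q\<close> are already known. Except
  for the commutator of \<open>f\<close> and \<open>e\<close>, moving \<open>k\<close> past
  \<open>e\<close> and \<open>f\<close> suffices.\<close>

lemma af_relation:
  assumes r: "r \<in> u_relations q"
  shows "af r x \<in> IS"
  unfolding IS_iff
proof
  fix \<xi> assume \<xi>: "\<xi> \<in> \<W>"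
  note k = act_k_kinv
  have ad: "act g (a - b) = act g a - act g b" if "a \<in> \<W>" "b \<in> \<W>" for g a b
    using act_add[OF that(1) \<W>_scaleC[OF that(2), of "- 1"], of g] act_scale[OF that(2), of g "- 1"]
    by (simp add: scaleC.scale_minus_left)
  have sW: "c *\<^sub>C a \<in> \<W>" if "a \<in> \<W>" for c a using that by (rule \<W>_scaleC)
  have dW: "a - b \<in> \<W>" if "a \<in> \<W>" "b \<in> \<W>" for a b
    using \<W>_add[OF that(1) \<W>_scaleC[OF that(2), of "- 1"]] by (simp add: scaleC.scale_minus_left)
  have q': "of_real q *\<^sub>C of_real (1 / q) *\<^sub>C a = a" "of_real (1 / q) *\<^sub>C of_real q *\<^sub>C a = a" for a :: spinor
    using q0 by (simp_all add: scaleC_scaleC)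
  note W = \<xi> act_\<W> fr_\<W> sW dW
  consider "r = gen Uk * gen Uk_inv - 1" | "r = gen Uk_inv * gen Uk - 1"
    | "r = gen Uk * gen Uk - gen Uk_inv * gen Uk_inv - cst (of_real (q - 1 / q)) * (gen Uf * gen Ue - gen Ue * gen Uf)"
    | "r = gen Uk * gen Uf - cst (of_real q) * gen Uf * gen Uk"
    | "r = gen Uk * gen Ue - cst (of_real (1 / q)) * gen Ue * gen Uk"
    using r unfolding u_relations_def Let_def by blast
  then show "fr (af r x) \<xi> = 0"
  proof cases
    case 1
    then show ?thesis using \<xi> by (simp add: af_simps af_mult fr_simps fr_ag k)
  next
    case 2
    then show ?thesis using \<xi> by (simp add: af_simps af_mult fr_simps fr_ag k)
  next
    case 3
    define T where "T = fr x"
    have TW: "T a \<in> \<W>" if "a \<in> \<W>" for a using that by (simp add: T_def)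
    have Ts: "T (c *\<^sub>C a) = c *\<^sub>C T a" "T (a - b) = T a - T b" for c a b
      unfolding T_def by (simp_all add: fr_vec_scale bounded_clinearD[OF fr_clinear])
    let ?c = "complex_of_real (q - 1 / q)"
    have fe: "fr (ag Uf (ag Ue x)) \<xi> = act Uf (act Ue (T (act Uk_inv (act Uk_inv \<xi>)))) - of_real (1 / q) *\<^sub>C act Uk_inv (act Uf (T (act Uk_inv (act Ue \<xi>))))
       - of_real q *\<^sub>C act Uk_inv (act Ue (T (act Uk_inv (act Uf \<xi>)))) + act Uk_inv (act Uk_inv (T (act Ue (act Uf \<xi>))))"
      using \<xi> q_facts(1) by (simp add: fr_ag ad act_scale W TW act_kinv_e act_kinv_f T_def[symmetric] Ts scaleC.scale_right_diff_distrib q' algebra_simps)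
    have ef: "fr (ag Ue (ag Uf x)) \<xi> = act Ue (act Uf (T (act Uk_inv (act Uk_inv \<xi>)))) - of_real q *\<^sub>C act Uk_inv (act Ue (T (act Uk_inv (act Uf \<xi>))))
       - of_real (1 / q) *\<^sub>C act Uk_inv (act Uf (T (act Uk_inv (act Ue \<xi>)))) + act Uk_inv (act Uk_inv (T (act Uf (act Ue \<xi>))))"
      using \<xi> q_facts(1) by (simp add: fr_ag ad act_scale W TW act_kinv_e act_kinv_f T_def[symmetric] Ts scaleC.scale_right_diff_distrib q' algebra_simps)
    \<comment> \<open>In \<open>fe - ef\<close> the mixed terms cancel. \<open>d1\<close> uses the
      commutator relation to the left of \<open>x\<close>, \<open>d2\<close> to its right.\<close>
    have d1: "?c *\<^sub>C act Uf (act Ue (T (act Uk_inv (act Uk_inv \<xi>)))) - ?c *\<^sub>C act Ue (act Uf (T (act Uk_inv (act Uk_inv \<xi>))))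
      = act Uk (act Uk (T (act Uk_inv (act Uk_inv \<xi>)))) - act Uk_inv (act Uk_inv (T (act Uk_inv (act Uk_inv \<xi>))))"
      using act_commutator[of "T (act Uk_inv (act Uk_inv \<xi>))"] \<xi> TW by (simp add: scaleC.scale_right_diff_distrib)
    have d2: "?c *\<^sub>C act Uk_inv (act Uk_inv (T (act Uf (act Ue \<xi>)))) - ?c *\<^sub>C act Uk_inv (act Uk_inv (T (act Ue (act Uf \<xi>))))
      = act Uk_inv (act Uk_inv (T (act Uk (act Uk \<xi>)))) - act Uk_inv (act Uk_inv (T (act Uk_inv (act Uk_inv \<xi>))))"
    proof -
      have "?c *\<^sub>C act Uk_inv (act Uk_inv (T (act Uf (act Ue \<xi>)))) - ?c *\<^sub>C act Uk_inv (act Uk_inv (T (act Ue (act Uf \<xi>))))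
        = act Uk_inv (act Uk_inv (T (?c *\<^sub>C (act Uf (act Ue \<xi>) - act Ue (act Uf \<xi>)))))"
        using \<xi> by (simp add: Ts ad act_scale W TW scaleC.scale_right_diff_distrib)
      also have "\<dots> = act Uk_inv (act Uk_inv (T (act Uk (act Uk \<xi>)))) - act Uk_inv (act Uk_inv (T (act Uk_inv (act Uk_inv \<xi>))))"
        unfolding act_commutator[OF \<xi>, symmetric] using \<xi> by (simp add: Ts ad W TW)
      finally show ?thesis .
    qed
    have kk: "fr (ag Uk (ag Uk x)) \<xi> = act Uk (act Uk (T (act Uk_inv (act Uk_inv \<xi>))))"
      "fr (ag Uk_inv (ag Uk_inv x)) \<xi> = act Uk_inv (act Uk_inv (T (act Uk (act Uk \<xi>))))"
      using \<xi> by (simp_all add: fr_ag T_def)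
    \<comment> \<open>\<open>Z\<close> is the term with \<open>k^(-2)\<close> on both sides of
      \<open>x\<close>, produced by \<open>d1\<close> and by \<open>d2\<close>; \<open>p\<close> and
      \<open>r\<close> are the mixed terms, listed in opposite order in the two expansions.\<close>
    have gen: "A - B - c *\<^sub>C ((x1 - p - r + y1) - (x2 - r - p + y2)) = 0"
      if "c *\<^sub>C x1 - c *\<^sub>C x2 = A - Z" "c *\<^sub>C y2 - c *\<^sub>C y1 = B - Z" for A B Z x1 x2 y1 y2 p r :: spinor and c
    proof -
      have "(x1 - p - r + y1) - (x2 - r - p + y2) = (x1 - x2) - (y2 - y1)" by simp
      then have "c *\<^sub>C ((x1 - p - r + y1) - (x2 - r - p + y2)) = (A - Z) - (B - Z)"
        using that by (simp only: scaleC.scale_right_diff_distrib)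
      then show ?thesis by simp
    qed
    have "fr (af r x) \<xi> = fr (ag Uk (ag Uk x)) \<xi> - fr (ag Uk_inv (ag Uk_inv x)) \<xi>
      - ?c *\<^sub>C (fr (ag Uf (ag Ue x)) \<xi> - fr (ag Ue (ag Uf x)) \<xi>)"
      unfolding 3 by (simp add: af_simps af_mult fr_simps)
    also have "\<dots> = 0"
      unfolding kk fe ef by (rule gen[OF d1 d2])
    finally show ?thesis .
  next
    case 4
    then show ?thesis using \<xi>
      by (simp add: af_simps af_mult fr_simps fr_ag mult.assoc act_k_f act_kinv_f ad act_scale W k fr_vec_scale
          scaleC.scale_right_diff_distrib)
  next
    case 5
    then show ?thesis using \<xi>
      by (simp add: af_simps af_mult fr_simps fr_ag mult.assoc act_k_e act_kinv_e ad act_scale W k fr_vec_scale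
          scaleC.scale_right_diff_distrib)
  qed
qed

lemma af_IU: assumes "a \<in> IU" shows "af a x \<in> IS"
proof -
  have "IU \<subseteq> {a. \<forall>x. af a x \<in> IS}"
    by (rule two_sided_ideal_minimal)
      (auto simp: af_simps af_mult af_relation tsi_zero intro: tsi_add af_IS)
  then show ?thesis using assms by auto
qed

lemma sphere_act_cls: "sphere_act q t (residue_class (u_relations q) h) (cls x) = cls (af h x)"
proof -
  have "descend (\<lambda>(h, x). cls (act_free q h x)) (residue_class (u_relations q) h \<times> cls x)
    = (\<lambda>(h, x). cls (act_free q h x)) (h, x)"
  proof (rule descend_eq)
    show "(h, x) \<in> residue_class (u_relations q) h \<times> cls x" by (simp add: residue_class_self)
    fix b assume "b \<in> residue_class (u_relations q) h \<times> cls x"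
    then obtain h' x' where b: "b = (h', x')" and h: "h' - h \<in> IU" and x: "x' - x \<in> IS"
      by (auto simp: residue_class_eq)
    have "af h' x' - af h x = af (h' - h) x' + af h (x' - x)" by (simp add: af_simps af_diff)
    then have "af h' x' - af h x \<in> IS" using tsi_add[OF af_IU[OF h] af_IS[OF x]] by simp
    then show "(\<lambda>(h, x). cls (act_free q h x)) b = (\<lambda>(h, x). cls (act_free q h x)) (h, x)"
      unfolding b by (simp add: act_free_eq residue_class_eq_iff)
  qed
  then show ?thesis by (simp add: sphere_act_def act_free_eq)
qed

end

section \<open>The coproduct\<close>

text \<open>Two orders of the same double sum; each makes linearity in one argument an instance of
  linearity of \<open>lext\<close>.\<close>

lemma tensor_eq_lext:
  "tensor a b = lext (\<lambda>c z. cst c * z) (\<lambda>u. lext (\<lambda>c z. cst c * z) (\<lambda>v. Poly_Mapping.single (u, v) 1) b) a"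
  "tensor a b = lext (\<lambda>c z. cst c * z) (\<lambda>v. lext (\<lambda>c z. cst c * z) (\<lambda>u. Poly_Mapping.single (u, v) 1) a) b"
  unfolding tensor_def lext_def sum_distrib_left cst_times_single
  by (simp, subst sum.swap, simp add: mult.commute)

lemma tensor_add:
  "tensor (a + a') b = tensor a b + tensor a' b" "tensor a (b + b') = tensor a b + tensor a b'"
  by (simp only: tensor_eq_lext(1) lext_add[OF module_cst], simp only: tensor_eq_lext(2) lext_add[OF module_cst])

lemma tensor_cst:
  "tensor (cst c * a) b = cst c * tensor a b" "tensor a (cst c * b) = cst c * tensor a b"
  by (simp only: tensor_eq_lext(1) lext_cst_times[OF module_cst], simp only: tensor_eq_lext(2) lext_cst_times[OF module_cst])

lemma tensor_minus: "tensor (- a) b = - tensor a b" "tensor a (- b) = - tensor a b"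
  using tensor_cst(1)[of "- 1" a b] tensor_cst(2)[of a "- 1" b] by (simp_all add: cst_minus)

lemma tensor_diff: "tensor (a - a') b = tensor a b - tensor a' b" "tensor a (b - b') = tensor a b - tensor a b'"
  using tensor_add(1)[of a "- a'" b] tensor_add(2)[of a b "- b'"] by (simp_all add: tensor_minus)

lemma tensor_single:
  "tensor (Poly_Mapping.single u c) (Poly_Mapping.single v d) = Poly_Mapping.single (u, v) (c * d)"
  unfolding tensor_eq_lext(1) by (simp add: lext_single[OF module_cst] cst_times_single)

lemma tensor_one: "tensor 1 1 = 1"
  using tensor_single[of 0 1 0 1] by (simp flip: single_one add: zero_prod_def)

lemma tensor_mult: "tensor a b * tensor a' b' = tensor (a * a') (b * b')"
proof (induction a rule: pm_induct)
  case (single u c)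
  show ?case
  proof (induction b rule: pm_induct)
    case (single v d)
    show ?case
    proof (induction a' rule: pm_induct)
      case (single u' c')
      show ?case
      proof (induction b' rule: pm_induct)
        case (single v' d')
        show ?case by (simp add: tensor_single mult_single ac_simps)
      qed (simp add: tensor_add distrib_left)
    qed (simp add: tensor_add distrib_left distrib_right)
  qed (simp add: tensor_add distrib_left distrib_right)
qed (simp add: tensor_add distrib_left distrib_right)

lemma tensor_induct [case_names tensor add]:
  assumes "\<And>a b. P (tensor a b)" "\<And>x y. P x \<Longrightarrow> P y \<Longrightarrow> P (x + y)"
  shows "P z"
proof (induction z rule: pm_induct)
  case (single w c)
  obtain u v where w: "w = (u, v)" by (cases w)
  show ?case using assms(1)[of "Poly_Mapping.single u c" "Poly_Mapping.single v 1"] unfolding w tensor_single by simp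
qed (rule assms(2))

abbreviation cg :: "u_gen \<Rightarrow> u_tensor" where
  "cg g \<equiv> (\<Sum>(a, b)\<leftarrow>coprod_gen g. tensor (gen a) (gen b))"

lemma coprod_free_eq: "coprod_free = lext (\<lambda>c z. cst c * z) (\<lambda>w. prod_list (map cg (letters w)))"
  by (intro ext) (simp add: coprod_free_def lext_def)

lemma coprod_simps:
  "coprod_free (a + b) = coprod_free a + coprod_free b" "coprod_free (a - b) = coprod_free a - coprod_free b"
  "coprod_free 0 = 0" "coprod_free (cst c * a) = cst c * coprod_free a"
  unfolding coprod_free_eq by (simp_all add: lext_add[OF module_cst] lext_diff[OF module_cst]
      lext_zero[OF module_cst] lext_cst_times[OF module_cst])

lemma coprod_cst: "coprod_free (cst c) = cst c"
  unfolding coprod_free_eq using lext_single[OF module_cst, of "\<lambda>w. prod_list (map cg (letters w))" "Word []" c]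
  by (simp add: single_word_Nil)

lemma coprod_gen_times: "coprod_free (gen g * a) = cg g * coprod_free a"
proof (induction a rule: pm_induct)
  case (single w c)
  obtain xs where w: "w = Word xs" by (cases w)
  show ?case unfolding w single_word_Cons[symmetric] unfolding coprod_free_eq lext_single[OF module_cst]
    by (simp add: cst_left_commute[of "cg g"])
qed (simp add: distrib_left coprod_simps)

lemma coprod_free_gen: "coprod_free (gen g) = cg g"
  using coprod_gen_times[of g 1] coprod_cst[of 1] by simp

lemma coprod_mult: "coprod_free (a * b) = coprod_free a * coprod_free b"
proof (induction a rule: free_alg_induct)
  case (cst c)
  show ?case by (simp add: coprod_simps coprod_cst)
qed (simp_all add: distrib_right coprod_simps coprod_gen_times mult.assoc)

context podles
begin

abbreviation IT :: "u_tensor set" where "IT \<equiv> two_sided_ideal (u_tensor_relations q)"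

text \<open>Only \<open>r \<otimes> 1\<close> and \<open>1 \<otimes> r\<close> generate the ideal; a
  second tensor factor is supplied by \<open>r \<otimes> b = (r \<otimes> 1)(1 \<otimes> b)\<close>,
  and similarly on the other side.\<close>

lemma tensor_IU: assumes "r \<in> IU" shows "tensor r b \<in> IT" "tensor b r \<in> IT"
proof -
  have "tensor 0 1 = 0" "tensor 1 0 = 0" using tensor_minus(1)[of 0 1] tensor_cst(1)[of 0 0 1] tensor_cst(2)[of 1 0 0] by simp_all
  have m: "tensor (x * y) 1 = tensor x 1 * tensor y 1" "tensor 1 (x * y) = tensor 1 x * tensor 1 y" for x y
    by (simp_all add: tensor_mult)
  have 1: "IU \<subseteq> {r. tensor r 1 \<in> IT}" "IU \<subseteq> {r. tensor 1 r \<in> IT}"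
    by (rule two_sided_ideal_minimal; auto simp: u_tensor_relations_def m tensor_add \<open>tensor 0 1 = 0\<close> \<open>tensor 1 0 = 0\<close>
        intro: tsi_base tsi_zero tsi_add tsi_lmult tsi_rmult)+
  have "tensor r b = tensor r 1 * tensor 1 b" "tensor b r = tensor b 1 * tensor 1 r" by (simp_all add: tensor_mult)
  then show "tensor r b \<in> IT" "tensor b r \<in> IT" using 1 assms by (auto intro: tsi_rmult tsi_lmult)
qed

text \<open>Each coproduct is written as a combination of tensors with one factor in the ideal of
  \<open>U\<^sub>q\<close>. The commutator relation leaves mixed terms, and \<open>x1\<close> and
  \<open>x2\<close> show that these cancel modulo the ideal.\<close>

lemma coprod_relation: assumes r: "r \<in> u_relations q" shows "coprod_free r \<in> IT"
proof -
  define e f k k' where g: "e = gen Ue" "f = gen Uf" "k = gen Uk" "k' = gen Uk_inv"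
  define a b :: "u_gen free_alg" where ab: "a = cst (of_real q)" "b = cst (of_real (1 / q))"
  define a' b' :: u_tensor where ab': "a' = cst (of_real q)" "b' = cst (of_real (1 / q))"
  define c where c: "c = complex_of_real (q - 1 / q)"
  have inv: "a * b = 1" "b * a = 1" unfolding ab using q0 by (simp_all flip: cst_mult of_real_mult)
  have com: "x * a = a * x" "x * b = b * x" "x * (a * y) = a * (x * y)" "x * (b * y) = b * (x * y)" for x y
    unfolding ab by (rule cst_commute cst_left_commute)+
  have ia: "a * (b * x) = x" "b * (a * x) = x" for x using inv by (simp_all flip: mult.assoc)
  have ta: "tensor (a * x) y = a' * tensor x y" "tensor x (a * y) = a' * tensor x y"
    "tensor (b * x) y = b' * tensor x y" "tensor x (b * y) = b' * tensor x y" for x y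
    unfolding ab ab' by (rule tensor_cst)+
  have aa: "a' * (b' * x) = x" "b' * (a' * x) = x" for x unfolding ab' using q0
    by (simp_all flip: mult.assoc cst_mult of_real_mult)
  define r1 r2 r3 r4 r5 where rs: "r1 = k * k' - 1" "r2 = k' * k - 1"
    "r3 = k * k - k' * k' - cst c * (f * e - e * f)" "r4 = k * f - a * f * k" "r5 = k * e - b * e * k"
  have R: "u_relations q = {r1, r2, r3, r4, r5}" unfolding u_relations_def Let_def rs g ab c by simp
  then have I: "r1 \<in> IU" "r2 \<in> IU" "r3 \<in> IU" "r4 \<in> IU" "r5 \<in> IU" by (auto intro: tsi_base)
  \<comment> \<open>Commutation of \<open>k^(-1)\<close> with \<open>f\<close> and \<open>e\<close>.
    It is not among the defining relations and arises from \<open>r4\<close> and \<open>r5\<close>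
    by multiplying with \<open>k^(-1)\<close> on both sides.\<close>
  define s4 s5 where s: "s4 = f * k' - a * (k' * f)" "s5 = e * k' - b * (k' * e)"
  have "s4 = k' * r4 * k' - r2 * (f * k') + a * (k' * f * r1)"
    unfolding s rs by (simp add: algebra_simps com)
  then have s4: "s4 \<in> IU" using I unfolding ab by (auto intro!: tsi_add tsi_diff intro: tsi_lmult tsi_rmult)
  have "s5 = k' * r5 * k' - r2 * (e * k') + b * (k' * e * r1)"
    unfolding s rs by (simp add: algebra_simps com)
  then have s5: "s5 \<in> IU" using I unfolding ab by (auto intro!: tsi_add tsi_diff intro: tsi_lmult tsi_rmult)
  note cp = coprod_simps coprod_cst coprod_mult coprod_free_gen
  have D: "coprod_free k = tensor k k" "coprod_free k' = tensor k' k'" "coprod_free e = tensor e k + tensor k' e"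
    "coprod_free f = tensor f k + tensor k' f" "coprod_free 1 = tensor 1 1" "coprod_free (a * x) = a' * coprod_free x"
    "coprod_free (b * x) = b' * coprod_free x" "coprod_free a = a'" "coprod_free b = b'" for x
    unfolding g ab ab' using coprod_cst[of 1] by (simp_all add: coprod_free_gen tensor_one coprod_simps coprod_cst)
  note ex = coprod_simps coprod_mult tensor_mult tensor_add tensor_diff ta D distrib_left distrib_right
    left_diff_distrib right_diff_distrib mult.assoc
  have "coprod_free r1 = tensor r1 (k * k') + tensor 1 r1" unfolding rs by (simp add: ex)
  then have 1: "coprod_free r1 \<in> IT" using I by (simp add: tsi_add tensor_IU)
  have "coprod_free r2 = tensor r2 (k' * k) + tensor 1 r2" unfolding rs by (simp add: ex)
  then have 2: "coprod_free r2 \<in> IT" using I by (simp add: tsi_add tensor_IU)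
  have "coprod_free r4 = tensor r4 (k * k) + tensor (k * k') r4 + a' * (tensor r1 (f * k) - tensor r2 (f * k))"
    unfolding rs by (simp add: ex; (simp add: algebra_simps)?)
  then have 4: "coprod_free r4 \<in> IT" using I by (simp add: tsi_add tsi_diff tensor_IU tsi_lmult)
  have "coprod_free r5 = tensor r5 (k * k) + tensor (k * k') r5 + b' * (tensor r1 (e * k) - tensor r2 (e * k))"
    unfolding rs by (simp add: ex; (simp add: algebra_simps)?)
  then have 5: "coprod_free r5 \<in> IT" using I by (simp add: tsi_add tsi_diff tensor_IU tsi_lmult)
  have x1: "tensor (f * k') (k * e) - tensor (k' * f) (e * k) = tensor s4 (k * e) + a' * tensor (k' * f) r5"
    unfolding rs s by (simp add: ex aa)
  have x2: "tensor (e * k') (k * f) - tensor (k' * e) (f * k) = tensor s5 (k * f) + b' * tensor (k' * e) r4"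
    unfolding rs s by (simp add: ex aa)
  have "coprod_free r3 = tensor r3 (k * k) + tensor (k' * k') r3
    - cst c * ((tensor (f * k') (k * e) - tensor (k' * f) (e * k)) - (tensor (e * k') (k * f) - tensor (k' * e) (f * k)))"
    unfolding rs by (simp add: ex tensor_cst coprod_cst; (simp add: algebra_simps)?)
  then have 3: "coprod_free r3 \<in> IT" unfolding x1 x2
    using I s4 s5 by (simp add: tsi_add tsi_diff tensor_IU tsi_lmult)
  show ?thesis using r 1 2 3 4 5 unfolding R by blast
qed

lemma coprod_IU: assumes "h \<in> IU" shows "coprod_free h \<in> IT"
proof -
  have "IU \<subseteq> {h. coprod_free h \<in> IT}"
    by (rule two_sided_ideal_minimal)
      (auto simp: coprod_simps coprod_mult coprod_relation intro: tsi_zero tsi_add tsi_lmult tsi_rmult)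
  then show ?thesis using assms by auto
qed

lemma coprod_cls: "coprod q (residue_class (u_relations q) h) = residue_class (u_tensor_relations q) (coprod_free h)"
  unfolding coprod_def
proof (rule descend_residue_class)
  fix a b assume "a - b \<in> IU"
  then have "coprod_free (a - b) \<in> IT" by (rule coprod_IU)
  then show "residue_class (u_tensor_relations q) (coprod_free a) = residue_class (u_tensor_relations q) (coprod_free b)"
    by (simp add: residue_class_eq_iff coprod_simps)
qed

text \<open>The expression \<open>(h_(1) \<triangleright> x) h_(2) \<xi>\<close> with an arbitrary
  tensor in place of the coproduct. Its dependence on representatives and its multiplicativity can
  be studied before coproducts enter.\<close>

definition sw :: "sphere_gen free_alg \<Rightarrow> spinor \<Rightarrow> u_tensor \<Rightarrow> spinor" where
  "sw x \<xi> = lext scaleC (\<lambda>(u, v). fr (af (Poly_Mapping.single u 1) x) (U (Poly_Mapping.single v 1) \<xi>))"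

lemma sw_simps: "sw x \<xi> (a + b) = sw x \<xi> a + sw x \<xi> b" "sw x \<xi> (a - b) = sw x \<xi> a - sw x \<xi> b"
  "sw x \<xi> 0 = 0" "sw x \<xi> (cst c * a) = c *\<^sub>C sw x \<xi> a"
  unfolding sw_def by (simp_all add: lext_add[OF scaleC.module_axioms] lext_diff[OF scaleC.module_axioms]
      lext_zero[OF scaleC.module_axioms] lext_cst_times[OF scaleC.module_axioms])

lemma sw_tensor: "sw x \<xi> (tensor a b) = fr (af a x) (U b \<xi>)"
proof (induction a rule: pm_induct)
  case (single u c)
  show ?case
  proof (induction b rule: pm_induct)
    case (single v d)
    have s: "Poly_Mapping.single u c = cst c * Poly_Mapping.single u 1" "Poly_Mapping.single v d = cst d * Poly_Mapping.single v 1"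
      by (simp_all only: cst_times_single mult_1_right)
    have "sw x \<xi> (tensor (Poly_Mapping.single u c) (Poly_Mapping.single v d)) =
      (c * d) *\<^sub>C fr (af (Poly_Mapping.single u 1) x) (U (Poly_Mapping.single v 1) \<xi>)"
      unfolding tensor_single sw_def lext_single[OF scaleC.module_axioms] by simp
    also have "\<dots> = fr (af (cst c * Poly_Mapping.single u 1) x) (U (cst d * Poly_Mapping.single v 1) \<xi>)"
      by (simp only: U_simps af_simps fr_simps fr_vec_scale scaleC_scaleC mult.commute)
    finally show ?case unfolding s[symmetric] .
  qed (simp add: tensor_add sw_simps U_simps fr_vec_add)
qed (simp add: tensor_add sw_simps af_simps fr_simps)

lemma sw_tensor_mult:
  assumes "\<xi> \<in> \<W>" shows "sw x \<xi> (z * tensor a b) = sw (af a x) (U b \<xi>) z"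
  by (induction z rule: tensor_induct) (use assms in \<open>simp_all add: tensor_mult sw_tensor af_mult U_mult distrib_right sw_simps\<close>)

text \<open>To be a two-sided ideal, \<open>?J\<close> quantifies over \<open>x\<close>,
  \<open>\<xi>\<close> and a left factor \<open>tensor a b\<close>. Left multiplication is absorbed
  by that factor; right multiplication changes \<open>x\<close> and \<open>\<xi>\<close> according
  to \<open>sw_tensor_mult\<close>.\<close>

lemma sw_IT: assumes "z \<in> IT" "\<xi> \<in> \<W>" shows "sw x \<xi> z = 0"
proof -
  let ?J = "{z. \<forall>x. \<forall>\<xi>\<in>\<W>. \<forall>a b. sw x \<xi> (tensor a b * z) = 0}"
  have "IT \<subseteq> ?J"
  proof (rule two_sided_ideal_minimal)
    have "sw x \<xi> (tensor a b * tensor r 1) = 0" "sw x \<xi> (tensor a b * tensor 1 r) = 0"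
      if "r \<in> u_relations q" "\<xi> \<in> \<W>" for r x \<xi> a b
    proof -
      have "fr (af a (af r x)) (U b \<xi>) = 0" by (rule fr_ideal[OF af_IS[OF af_relation[OF that(1)]]])
      then show "sw x \<xi> (tensor a b * tensor r 1) = 0" "sw x \<xi> (tensor a b * tensor 1 r) = 0"
        using that U_relation[OF that] fr_vec_scale[of _ 0 0] by (simp_all add: tensor_mult sw_tensor af_mult U_mult fr_vec_zero)
    qed
    then show "u_tensor_relations q \<subseteq> ?J" unfolding u_tensor_relations_def by auto
    show "0 \<in> ?J" by (simp add: sw_simps)
    show "y + z \<in> ?J" if "y \<in> ?J" "z \<in> ?J" for y z using that by (simp add: distrib_left sw_simps)
    show "w * z \<in> ?J" if z: "z \<in> ?J" for w z
    proof -
      have "sw x \<xi> (tensor a b * (w * z)) = 0" if "\<xi> \<in> \<W>" for x \<xi> a b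
        using z that by (induction w rule: tensor_induct)
          (simp_all add: tensor_mult distrib_left distrib_right sw_simps flip: mult.assoc)
      then show ?thesis by simp
    qed
    show "z * w \<in> ?J" if z: "z \<in> ?J" for w z
    proof -
      have "sw x \<xi> (tensor a b * (z * w)) = 0" if "\<xi> \<in> \<W>" for x \<xi> a b
        using z that by (induction w rule: tensor_induct)
          (simp_all add: sw_tensor_mult distrib_left sw_simps flip: mult.assoc)
      then show ?thesis by simp
    qed
  qed
  then have "sw x \<xi> (tensor 1 1 * z) = 0" using assms by blast
  then show ?thesis by (simp add: tensor_one)
qed

lemma sweedler_sw:
  assumes \<xi>: "\<xi> \<in> \<W>"
  shows "sweedler q (\<lambda>h1 h2. spinor_rep q t (sphere_act q t h1 (cls x)) (spinor_act q h2 \<xi>))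
    (residue_class (u_tensor_relations q) z) = sw x \<xi> z"
proof -
  have e: "(\<lambda>z. \<Sum>(u, v)\<in>Poly_Mapping.keys z. Poly_Mapping.lookup z (u, v) *\<^sub>C
     spinor_rep q t (sphere_act q t (residue_class (u_relations q) (Poly_Mapping.single u 1)) (cls x))
       (spinor_act q (residue_class (u_relations q) (Poly_Mapping.single v 1)) \<xi>)) = sw x \<xi>"
    unfolding sw_def lext_def sphere_act_cls spinor_rep_cls spinor_act_class[OF \<xi>]
    by (intro ext sum.cong) auto
  have "descend (sw x \<xi>) (residue_class (u_tensor_relations q) z) = sw x \<xi> z"
  proof (rule descend_residue_class)
    fix a b assume "a - b \<in> IT"
    then have "sw x \<xi> (a - b) = 0" by (rule sw_IT[OF _ \<xi>])
    then show "sw x \<xi> a = sw x \<xi> b" by (simp add: sw_simps)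
  qed
  then show ?thesis unfolding sweedler_def e .
qed

text \<open>Applying a generator is left multiplication by its coproduct; on pure tensors this is
  \<open>equivariance_free\<close>. Membership in \<open>\<W>\<close> is carried along because
  \<open>act\<close> is additive only there. Equivariance for all of \<open>U\<^sub>q\<close> then
  follows letter by letter.\<close>

lemma act_sw: assumes \<xi>: "\<xi> \<in> \<W>" shows "act g (sw x \<xi> z) = sw x \<xi> (cg g * z) \<and> sw x \<xi> z \<in> \<W>"
proof (induction z rule: tensor_induct)
  case (tensor a b)
  have "sw x \<xi> (cg g * tensor a b) = (\<Sum>(c, d)\<leftarrow>coprod_gen g. fr (ag c (af a x)) (act d (U b \<xi>)))"
    using \<xi> by (cases g) (simp_all add: tensor_mult sw_tensor sw_simps distrib_right af_mult U_mult af_simps U_simps)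
  then show ?case using \<xi> by (simp add: sw_tensor equivariance_free fr_\<W>)
qed (simp add: sw_simps act_add distrib_left \<W>_add)

lemma equivariance:
  assumes \<xi>: "\<xi> \<in> \<W>" shows "U h (fr x \<xi>) = sw x \<xi> (coprod_free h)"
proof (induction h rule: free_alg_induct)
  case (cst c)
  have "sw x \<xi> (cst c) = c *\<^sub>C fr x \<xi>" using sw_simps(4)[of x \<xi> c "tensor 1 1"] sw_tensor[of x \<xi> 1 1]
    by (simp add: tensor_one U_simps af_simps)
  then show ?case by (simp add: U_simps coprod_cst)
next
  case (gen g a)
  have "U (gen g * a) (fr x \<xi>) = act g (U a (fr x \<xi>))" using \<xi> by (simp add: U_mult U_simps fr_\<W>)
  then show ?case using act_sw[OF \<xi>, of g x "coprod_free a"] by (simp add: gen coprod_gen_times)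
qed (simp add: U_simps coprod_simps sw_simps)

lemma equivariant_representation_spinor_rep: "equivariant_representation q t (spinor_rep q t)"
  unfolding equivariant_representation_def
proof (intro ballI conjI)
  fix A \<xi> assume "A \<in> carrier QS" and \<xi>: "\<xi> \<in> \<W>"
  then obtain a where A: "A = cls a" by (auto simp: QS_simps)
  show "spinor_rep q t A \<xi> \<in> \<W>" unfolding A spinor_rep_cls using \<xi> by (rule fr_\<W>)
  fix H assume "H \<in> carrier (U\<^sub>q q)"
  then obtain h where H: "H = residue_class (u_relations q) h" by (auto simp: U\<^sub>q_def quotient_carrier)
  show "spinor_act q H (spinor_rep q t A \<xi>) =
    sweedler q (\<lambda>h1 h2. spinor_rep q t (sphere_act q t h1 A) (spinor_act q h2 \<xi>)) (coprod q H)"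
    unfolding A H coprod_cls sweedler_sw[OF \<xi>] unfolding spinor_rep_cls spinor_act_class[OF fr_\<W>[OF \<xi>]]
    by (rule equivariance[OF \<xi>])
qed

end

section \<open>Compact operators and bounded commutators\<close>

lemma compact_span:
  assumes "finite F" shows "compact {\<Sum>i\<in>F. c i *\<^sub>C vec i | c. \<forall>i\<in>F. cmod (c i) \<le> B}"
  using assms
proof (induction F)
  case empty
  have "{\<Sum>i\<in>{}. c i *\<^sub>C vec i | c. \<forall>i\<in>{}. cmod (c i) \<le> B} = {0}" by auto
  then show ?case by (simp only: compact_sing)
next
  case (insert j F)
  let ?K = "{\<Sum>i\<in>F. c i *\<^sub>C vec i | c. \<forall>i\<in>F. cmod (c i) \<le> B}"
  have bl: "bounded_linear (\<lambda>c. c *\<^sub>C vec j)"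
    by (rule bounded_linear_intro[where K = "norm (vec j)"])
      (simp_all add: scaleC_add_left norm_scaleC scaleR_scaleC scaleC_scaleC scaleR_conv_of_real)
  have "{\<Sum>i\<in>insert j F. c i *\<^sub>C vec i | c. \<forall>i\<in>insert j F. cmod (c i) \<le> B}
    = (\<lambda>z. fst z *\<^sub>C vec j + snd z) ` (cball 0 B \<times> ?K)" (is "?L = ?R")
  proof (intro equalityI subsetI)
    fix x assume "x \<in> ?L"
    then obtain c where c: "x = (\<Sum>i\<in>insert j F. c i *\<^sub>C vec i)" "\<forall>i\<in>insert j F. cmod (c i) \<le> B" by blast
    show "x \<in> ?R"
      by (rule image_eqI[of _ _ "(c j, \<Sum>i\<in>F. c i *\<^sub>C vec i)"]) (use c insert.hyps in auto)
  next
    fix x assume "x \<in> ?R"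
    then obtain d c where c: "x = d *\<^sub>C vec j + (\<Sum>i\<in>F. c i *\<^sub>C vec i)" "cmod d \<le> B" "\<forall>i\<in>F. cmod (c i) \<le> B" by auto
    have "(\<Sum>i\<in>F. (c(j := d)) i *\<^sub>C vec i) = (\<Sum>i\<in>F. c i *\<^sub>C vec i)"
      by (rule sum.cong) (use insert.hyps in auto)
    then have "x = (\<Sum>i\<in>insert j F. (c(j := d)) i *\<^sub>C vec i)" using insert.hyps c(1) by simp
    moreover have "\<forall>i\<in>insert j F. cmod ((c(j := d)) i) \<le> B" using c by auto
    ultimately show "x \<in> ?L" by blast
  qed
  moreover have "compact ?R"
    by (intro compact_continuous_image compact_Times compact_cball insert.IH continuous_on_add
        bounded_linear.continuous_on[OF bl] continuous_on_fst continuous_on_snd continuous_on_id)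
  ultimately show ?case by simp
qed

text \<open>The truncations to \<open>F\<close> have finite rank and approximate \<open>T\<close>
  uniformly on the unit ball, so the image of the ball is totally bounded. Completeness makes its
  closure compact.\<close>

lemma compact_operatorI:
  assumes bc: "bounded_clinear T"
    and ap: "\<And>e. 0 < e \<Longrightarrow> \<exists>F. finite F \<and> (\<forall>x. norm (T x - (\<Sum>i\<in>F. coeff (T x) i *\<^sub>C vec i)) \<le> e * norm x)"
  shows "compact_operator T"
proof -
  obtain B where B: "0 < B" "\<And>x. norm (T x) \<le> norm x * B"
    using bounded_linear.pos_bounded[of T] bc unfolding bounded_clinear_def by blast
  let ?S = "T ` ball 0 1"
  have "\<exists>k. finite k \<and> closure ?S \<subseteq> (\<Union>x\<in>k. ball x e)" if e: "0 < e" for e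
  proof -
    obtain F where F: "finite F" "\<And>x. norm (T x - (\<Sum>i\<in>F. coeff (T x) i *\<^sub>C vec i)) \<le> e / 4 * norm x"
      using ap[of "e / 4"] e by auto
    let ?K = "{\<Sum>i\<in>F. c i *\<^sub>C vec i | c. \<forall>i\<in>F. cmod (c i) \<le> B}"
    obtain k where k: "finite k" "?K \<subseteq> (\<Union>x\<in>k. ball x (e / 4))"
    proof -
      have "0 < e / 4" using e by simp
      then have "\<exists>k. finite k \<and> ?K \<subseteq> (\<Union>x\<in>k. ball x (e / 4))"
        using compact_span[OF F(1), of B] unfolding compact_eq_totally_bounded by blast
      then show ?thesis using that by blast
    qed
    have "T x \<in> (\<Union>y\<in>k. cball y (e / 2))" if x: "x \<in> ball 0 1" for x
    proof -
      let ?y = "\<Sum>i\<in>F. coeff (T x) i *\<^sub>C vec i"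
      have n: "norm x \<le> 1" using x by simp
      have "cmod (coeff (T x) i) \<le> B" for i
        using cmod_coeff_le_norm[of "T x" i] B(2)[of x] n B(1) mult_right_mono[OF n, of B] by linarith
      then have "?y \<in> ?K" by blast
      then obtain y where y: "y \<in> k" "dist y ?y < e / 4" using k(2) by auto
      have "e / 4 * norm x \<le> e / 4 * 1" using n e by (intro mult_left_mono) auto
      then have "dist ?y (T x) \<le> e / 4" using F(2)[of x] by (simp add: dist_norm norm_minus_commute)
      then have "dist y (T x) \<le> e / 2" using y(2) dist_triangle[of y "T x" ?y] by linarith
      then show ?thesis using y(1) by auto
    qed
    then have "?S \<subseteq> (\<Union>y\<in>k. cball y (e / 2))" by blast
    moreover have "closed (\<Union>y\<in>k. cball y (e / 2))" using k(1) by (intro closed_UN) auto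
    ultimately have "closure ?S \<subseteq> (\<Union>y\<in>k. cball y (e / 2))" by (rule closure_minimal)
    also have "\<dots> \<subseteq> (\<Union>y\<in>k. ball y e)" using e by force
    finally show ?thesis using k(1) by blast
  qed
  moreover have "complete (closure ?S)" by (simp add: complete_eq_closed)
  ultimately show ?thesis using bc unfolding compact_operator_def compact_eq_totally_bounded by blast
qed

lemma finite_index_le: "finite {i \<in> spinor_index. fst i \<le> real n}"
proof (rule finite_subset)
  show "{i \<in> spinor_index. fst i \<le> real n} \<subseteq>
    (\<lambda>((k, j), N). (real k + 1 / 2, - (real k + 1 / 2) + real j, N)) ` (({..n} \<times> {..2 * n}) \<times> {- 1 / 2, 1 / 2})"
  proof
    fix i assume i: "i \<in> {i \<in> spinor_index. fst i \<le> real n}"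
    obtain l m N where lmN: "i = (l, m, N)" by (cases i)
    have I: "(l, m, N) \<in> spinor_index" and n: "l \<le> real n" using i lmN by auto
    obtain k :: nat where k: "l = real k + 1 / 2" using spinor_indexD(1)[OF I] unfolding half_spins_def by blast
    obtain j :: nat where j: "m = - l + real j" "real j \<le> 2 * l" using spinor_indexD(2)[OF I] unfolding weights_def by blast
    have "k \<le> n" "j \<le> 2 * n" using n k j by linarith+
    then show "i \<in> (\<lambda>((k, j), N). (real k + 1 / 2, - (real k + 1 / 2) + real j, N)) ` (({..n} \<times> {..2 * n}) \<times> {- 1 / 2, 1 / 2})"
      using spinor_indexD(3)[OF I] unfolding lmN by (intro image_eqI[of _ _ "((k, j), N)"]) (auto simp: k j)
  qed
qed auto

text \<open>The Leibniz rule \<open>[D, S T] = [D, S] T + S [D, T]\<close>, where \<open>T\<close>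
  first maps the domain into itself.\<close>

lemma bounded_commutator_comp:
  assumes T: "bounded_clinear T" and S: "bounded_clinear S" and "bounded_commutator D S" "bounded_commutator D T"
  shows "bounded_commutator D (\<lambda>x. S (T x))"
proof -
  obtain C1 where C1: "\<And>x y. (x, y) \<in> D \<Longrightarrow> \<exists>z. (S x, z) \<in> D \<and> norm (z - S y) \<le> C1 * norm x"
    using assms(3) unfolding bounded_commutator_def by fast
  obtain C2 where C2: "\<And>x y. (x, y) \<in> D \<Longrightarrow> \<exists>z. (T x, z) \<in> D \<and> norm (z - T y) \<le> C2 * norm x"
    using assms(4) unfolding bounded_commutator_def by fast
  obtain K where K: "0 < K" "\<And>x. norm (T x) \<le> norm x * K"
    using bounded_linear.pos_bounded[of T] T unfolding bounded_clinear_def by blast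
  obtain L where L: "0 < L" "\<And>x. norm (S x) \<le> norm x * L"
    using bounded_linear.pos_bounded[of S] S unfolding bounded_clinear_def by blast
  have "\<exists>z. (S (T x), z) \<in> D \<and> norm (z - S (T y)) \<le> (\<bar>C1\<bar> * K + C2 * L) * norm x" if xy: "(x, y) \<in> D" for x y
  proof -
    obtain z where z: "(T x, z) \<in> D" "norm (z - T y) \<le> C2 * norm x" using C2[OF xy] by blast
    obtain w where w: "(S (T x), w) \<in> D" "norm (w - S z) \<le> C1 * norm (T x)" using C1[OF z(1)] by blast
    have "norm (w - S (T y)) \<le> norm (w - S z) + norm (S z - S (T y))"
      using norm_triangle_ineq[of "w - S z" "S z - S (T y)"] by simp
    also have "S z - S (T y) = S (z - T y)" by (simp add: bounded_clinearD[OF S])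
    also have "norm (w - S z) \<le> \<bar>C1\<bar> * (norm x * K)"
      using w(2) K(2)[of x] by (meson abs_ge_self mult_mono' norm_ge_zero order_trans abs_ge_zero mult_mono)
    also have "norm (S (z - T y)) \<le> C2 * norm x * L"
      using L(2)[of "z - T y"] mult_right_mono[OF z(2), of L] L(1) by linarith
    finally have "norm (w - S (T y)) \<le> (\<bar>C1\<bar> * K + C2 * L) * norm x" by (simp add: algebra_simps)
    then show ?thesis using w(1) by blast
  qed
  then show ?thesis unfolding bounded_commutator_def by blast
qed

lemma bounded_commutator_add:
  assumes D: "linear_operator D" and "bounded_commutator D S" "bounded_commutator D T"
  shows "bounded_commutator D (\<lambda>x. S x + T x)"
proof -
  obtain C1 where C1: "\<And>x y. (x, y) \<in> D \<Longrightarrow> \<exists>z. (S x, z) \<in> D \<and> norm (z - S y) \<le> C1 * norm x"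
    using assms(2) unfolding bounded_commutator_def by fast
  obtain C2 where C2: "\<And>x y. (x, y) \<in> D \<Longrightarrow> \<exists>z. (T x, z) \<in> D \<and> norm (z - T y) \<le> C2 * norm x"
    using assms(3) unfolding bounded_commutator_def by fast
  have "\<exists>z. (S x + T x, z) \<in> D \<and> norm (z - (S y + T y)) \<le> (C1 + C2) * norm x" if xy: "(x, y) \<in> D" for x y
  proof -
    obtain z where z: "(T x, z) \<in> D" "norm (z - T y) \<le> C2 * norm x" using C2[OF xy] by blast
    obtain w where w: "(S x, w) \<in> D" "norm (w - S y) \<le> C1 * norm x" using C1[OF xy] by blast
    have "(S x + T x, w + z) \<in> D" using D w(1) z(1) unfolding linear_operator_def by blast
    moreover have "norm (w + z - (S y + T y)) \<le> (C1 + C2) * norm x"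
      using norm_triangle_ineq[of "w - S y" "z - T y"] w(2) z(2) by (simp add: algebra_simps)
    ultimately show ?thesis by blast
  qed
  then show ?thesis unfolding bounded_commutator_def by blast
qed

lemma bounded_commutator_scaleC:
  assumes D: "linear_operator D"
  shows "bounded_commutator D (\<lambda>x. c *\<^sub>C x)"
  using D unfolding bounded_commutator_def linear_operator_def
  by (intro exI[of _ 0]) (auto intro!: exI)

section \<open>Operators given by blocks\<close>

abbreviation flip :: "real \<times> real \<times> real \<Rightarrow> real \<times> real \<times> real" where
  "flip \<equiv> \<lambda>(l, m, N). (l, m, - N)"

lemma inj_flip: "inj flip" and bij_flip: "bij_betw flip UNIV UNIV"
  by (auto intro!: injI bijI surjI[of _ flip])

text \<open>The matrix of \<open>D\<close> on \<open>W\<^sup>l\<^sub>m\<close> has the entries \<open>a l N\<close> at \<open>(N, N)\<close> and \<open>b l N\<close> at \<open>(N, - N)\<close>.\<close>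

locale block_operator =
  fixes D :: "(spinor \<times> spinor) set" and a b :: "real \<Rightarrow> real \<Rightarrow> complex"
  assumes self_adj: "self_adjoint D"
    and block: "\<And>l m N. (l, m, N) \<in> spinor_index \<Longrightarrow>
      (vec (l, m, N), a l N *\<^sub>C vec (l, m, N) + b l (- N) *\<^sub>C vec (l, m, - N)) \<in> D"
    and hermitian: "\<And>l N. l \<in> half_spins \<Longrightarrow> N \<in> {- 1 / 2, 1 / 2} \<Longrightarrow> cnj (a l N) = a l N \<and> cnj (b l N) = b l (- N)"
begin

lemma lin: "linear_operator D" using self_adj unfolding self_adjoint_def by blast

lemma adj: "(x, y) \<in> D \<longleftrightarrow> (\<forall>u w. (u, w) \<in> D \<longrightarrow> cinner x w = cinner y u)"
proof -
  have "(x, y) \<in> D \<longleftrightarrow> (x, y) \<in> adjoint_operator D" using self_adj unfolding self_adjoint_def by simp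
  also have "\<dots> \<longleftrightarrow> (\<forall>u w. (u, w) \<in> D \<longrightarrow> cinner x w = cinner y u)" unfolding adjoint_operator_def by auto
  finally show ?thesis .
qed

lemma graph_coeff:
  assumes "(x, y) \<in> D"
  shows "coeff y (l, m, N) = a l N * coeff x (l, m, N) + b l N * coeff x (l, m, - N)"
proof (cases "(l, m, N) \<in> spinor_index")
  case True
  have "cinner x (a l N *\<^sub>C vec (l, m, N) + b l (- N) *\<^sub>C vec (l, m, - N)) = cinner y (vec (l, m, N))"
    using assms block[OF True] unfolding adj[of x y] by blast
  then have "cnj (coeff y (l, m, N)) = a l N * cnj (coeff x (l, m, N)) + b l (- N) * cnj (coeff x (l, m, - N))"
    by (simp add: cinner_add_right cinner_scaleC_right cinner_vec_right)
  from arg_cong[OF this, of cnj] show ?thesis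
    using hermitian[OF spinor_indexD(1,3)[OF True]] by (metis complex_cnj_add complex_cnj_cnj complex_cnj_mult)
next
  case False
  then show ?thesis using spinor_index_opposite[of l m N] by (simp add: coeff_outside)
qed

text \<open>A pair related block by block lies in the graph of the adjoint, which is
  \<open>D\<close> itself. A self-adjoint operator is therefore the maximal operator with its
  blocks, and membership in \<open>D\<close> is a condition on coefficients.\<close>

lemma graph_iff:
  "(x, y) \<in> D \<longleftrightarrow> (\<forall>l m N. (l, m, N) \<in> spinor_index \<longrightarrow> coeff y (l, m, N) = a l N * coeff x (l, m, N) + b l N * coeff x (l, m, - N))"
proof (intro iffI allI impI)
  assume r: "\<forall>l m N. (l, m, N) \<in> spinor_index \<longrightarrow> coeff y (l, m, N) = a l N * coeff x (l, m, N) + b l N * coeff x (l, m, - N)"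
  show "(x, y) \<in> D" unfolding adj[of x y]
  proof (intro allI impI)
    fix u w assume uw: "(u, w) \<in> D"
    \<comment> \<open>Counting each index together with its opposite in \<open>N\<close> groups the
      inner product by blocks, so that hermiticity gives equality term by term.\<close>
    have two: "2 * cinner p r = (\<Sum>\<^sub>\<infinity>i. cnj (coeff p i) * coeff r i + cnj (coeff p (flip i)) * coeff r (flip i))" for p r :: spinor
    proof -
      let ?f = "\<lambda>i. cnj (coeff p i) * coeff r i"
      have s: "?f summable_on UNIV" by (rule coeff_prod_summable)
      have e: "(\<Sum>\<^sub>\<infinity>i. ?f (flip i)) = (\<Sum>\<^sub>\<infinity>i. ?f i)" by (rule infsum_reindex_bij_betw[OF bij_flip])
      have s': "(\<lambda>i. ?f (flip i)) summable_on UNIV" using summable_on_reindex_bij_betw[OF bij_flip, of ?f] s by simp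
      have "(\<Sum>\<^sub>\<infinity>i. ?f i + ?f (flip i)) = (\<Sum>\<^sub>\<infinity>i. ?f i) + (\<Sum>\<^sub>\<infinity>i. ?f (flip i))"
        by (rule infsum_add[OF s s'])
      then show ?thesis unfolding e cinner_spinor_eq by simp
    qed
    have "2 * cinner x w = 2 * cinner y u"
      unfolding two
    proof (rule infsum_cong)
      fix i :: "real \<times> real \<times> real"
      obtain l m N where i: "i = (l, m, N)" by (cases i)
      show "cnj (coeff x i) * coeff w i + cnj (coeff x (flip i)) * coeff w (flip i)
        = cnj (coeff y i) * coeff u i + cnj (coeff y (flip i)) * coeff u (flip i)"
      proof (cases "(l, m, N) \<in> spinor_index")
        case True
        then have T': "(l, m, - N) \<in> spinor_index" by (simp add: spinor_index_opposite)
        note h = hermitian[OF spinor_indexD(1,3)[OF True]] hermitian[OF spinor_indexD(1,3)[OF T'], simplified]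
        show ?thesis
          unfolding i prod.case graph_coeff[OF uw] r[rule_format, OF True] r[rule_format, OF T'] minus_minus
          using h by (simp add: algebra_simps)
      next
        case False
        then show ?thesis using spinor_index_opposite[of l m N] by (simp add: i coeff_outside)
      qed
    qed
    then show "cinner x w = cinner y u" by simp
  qed
qed (rule graph_coeff)

lemma \<W>_subset_Domain: "\<W> \<subseteq> Domain D"
proof
  fix x assume "x \<in> \<W>"
  then have "\<exists>y. (x, y) \<in> D"
  proof (induction x rule: \<W>_induct)
    case zero
    then show ?case using lin unfolding linear_operator_def by blast
  next
    case (vec i)
    then show ?case using block by (cases i) blast
  next
    case (add x y)
    then show ?case using lin unfolding linear_operator_def by blast
  next
    case (scaleC c x)
    then show ?case using lin unfolding linear_operator_def by blast
  qed
  then show "x \<in> Domain D" by blast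
qed

lemma \<W>_invariant: "D `` \<W> \<subseteq> \<W>"
proof
  fix y assume "y \<in> D `` \<W>"
  then obtain x where x: "x \<in> \<W>" "(x, y) \<in> D" by blast
  have "{i. coeff y i \<noteq> 0} \<subseteq> {i. coeff x i \<noteq> 0} \<union> flip ` {i. coeff x i \<noteq> 0}"
  proof
    fix i assume i: "i \<in> {i. coeff y i \<noteq> 0}"
    obtain l m N where lmN: "i = (l, m, N)" by (cases i)
    have "coeff x (l, m, N) \<noteq> 0 \<or> coeff x (l, m, - N) \<noteq> 0"
      using i graph_coeff[OF x(2), of l m N] unfolding lmN by auto
    then show "i \<in> {i. coeff x i \<noteq> 0} \<union> flip ` {i. coeff x i \<noteq> 0}"
      unfolding lmN by (auto intro!: image_eqI[of _ _ "(l, m, - N)"])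
  qed
  then show "y \<in> \<W>" using x(1) unfolding \<W>_def by (auto intro: finite_subset)
qed

text \<open>\<open>r\<close> and \<open>s\<close> are the diagonal and off-diagonal entries of the
  inverse of the block of \<open>D + i\<close>, and the four identities say that the inverse is
  two-sided. The bound \<open>\<rho>\<close> tends to zero, so cutting off large spins approximates
  the resolvent in norm.\<close>

lemma compact_resolventI:
  fixes r s :: "real \<Rightarrow> real \<Rightarrow> complex" and \<rho> :: "real \<Rightarrow> real"
  assumes inv: "\<And>l N. l \<in> half_spins \<Longrightarrow> N \<in> {- 1 / 2, 1 / 2} \<Longrightarrow>
      (a l N + \<i>) * r l N + b l N * s l (- N) = 1 \<and> (a l N + \<i>) * s l N + b l N * r l (- N) = 0 \<and>
      r l N * (a l N + \<i>) + s l N * b l (- N) = 1 \<and> r l N * b l N + s l N * (a l (- N) + \<i>) = 0"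
    and bnd: "\<And>l N. l \<in> half_spins \<Longrightarrow> N \<in> {- 1 / 2, 1 / 2} \<Longrightarrow> cmod (r l N) \<le> \<rho> l \<and> cmod (s l N) \<le> \<rho> l"
    and lim: "(\<lambda>n. \<rho> (real n + 1 / 2)) \<longlonglongrightarrow> 0"
  shows "compact_resolvent D"
proof -
  obtain K where K: "\<And>n. \<bar>\<rho> (real n + 1 / 2)\<bar> \<le> K" 
  proof -
    obtain K where "\<forall>n. norm (\<rho> (real n + 1 / 2)) \<le> K"
      using convergent_imp_Bseq[OF convergentI[OF lim]] unfolding Bseq_def by blast
    then show ?thesis using that[of K] by simp
  qed
  have K0: "0 \<le> K" using K[of 0] by linarith
  have rK: "\<rho> l \<le> K" if "l \<in> half_spins" for l using K that unfolding half_spins_def by (auto dest: abs_le_D1)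
  \<comment> \<open>The predicate \<open>P\<close> selects spins: all of them for the resolvent, the
    large ones for its tail.\<close>
  define R where "R = (\<lambda>P. wshift (\<lambda>(l, m, N). if P l then r l N else 0) (\<lambda>i. i))"
  define S where "S = (\<lambda>P. wshift (\<lambda>(l, m, N). if P l then s l N else 0) flip)"
  have b1: "cmod (case i of (l, m, N) \<Rightarrow> if P l then r l N else 0) \<le> B"
    "cmod (case i of (l, m, N) \<Rightarrow> if P l then s l N else 0) \<le> B"
    if "\<And>l. l \<in> half_spins \<Longrightarrow> P l \<Longrightarrow> \<rho> l \<le> B" "0 \<le> B" "i \<in> spinor_index" for i B P
  proof -
    obtain l m N where i: "i = (l, m, N)" by (cases i)
    have "l \<in> half_spins" "N \<in> {- 1 / 2, 1 / 2}" using spinor_indexD(1,3)[of l m N] that(3) i by blast+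
    then have "P l \<Longrightarrow> cmod (r l N) \<le> B" "P l \<Longrightarrow> cmod (s l N) \<le> B" using bnd[of l N] that(1)[of l] by linarith+
    then show "cmod (case i of (l, m, N) \<Rightarrow> if P l then r l N else 0) \<le> B"
      "cmod (case i of (l, m, N) \<Rightarrow> if P l then s l N else 0) \<le> B" using that(2) by (simp_all add: i)
  qed
  have inj: "inj (\<lambda>i :: real \<times> real \<times> real. i)" by simp
  have cR: "coeff (R P x) (l, m, N) = (if P l then r l N else 0) * coeff x (l, m, N)"
    and cS: "coeff (S P x) (l, m, N) = (if P l then s l N else 0) * coeff x (l, m, - N)"
    and bR: "bounded_clinear (R P)" and bS: "bounded_clinear (S P)" for P x l m N
    unfolding R_def S_def
       apply (subst coeff_wshift[OF inj K0 b1(1)]; use rK K0 in \<open>auto simp: coeff_outside\<close>)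
      apply (subst coeff_wshift[OF inj_flip K0 b1(2)]; use rK K0 spinor_index_opposite in \<open>auto simp: coeff_outside\<close>)
     apply (rule bounded_clinear_wshift[OF inj K0 b1(1)]; use rK K0 in auto)
    apply (rule bounded_clinear_wshift[OF inj_flip K0 b1(2)]; use rK K0 in auto)
    done
  have nb: "norm (R P x + S P x) \<le> 2 * B * norm x" if "\<And>l. l \<in> half_spins \<Longrightarrow> P l \<Longrightarrow> \<rho> l \<le> B" "0 \<le> B" for B P x
  proof -
    have "norm (R P x) \<le> B * norm x" unfolding R_def
      by (rule norm_wshift_le[OF inj that(2) b1(1)]) (use that in auto)
    moreover have "norm (S P x) \<le> B * norm x" unfolding S_def
      by (rule norm_wshift_le[OF inj_flip that(2) b1(2)]) (use that in auto)
    ultimately show ?thesis using norm_triangle_ineq[of "R P x" "S P x"] by (simp add: algebra_simps)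
  qed
  define T where "T = (\<lambda>x. R (\<lambda>_. True) x + S (\<lambda>_. True) x)"
  have cT: "coeff (T x) (l, m, N) = r l N * coeff x (l, m, N) + s l N * coeff x (l, m, - N)" for x l m N
    unfolding T_def by (simp add: cR cS)
  have bT: "bounded_clinear T" unfolding T_def by (rule bounded_clinear_add[OF bR bS])
  have "compact_operator T"
  proof (rule compact_operatorI[OF bT])
    fix e :: real assume e: "0 < e"
    obtain n where n: "\<And>k. n \<le> k \<Longrightarrow> \<rho> (real k + 1 / 2) \<le> e / 2"
    proof -
      have "0 < e / 2" using e by simp
      from LIMSEQ_D[OF lim this] obtain n where "\<forall>k\<ge>n. norm (\<rho> (real k + 1 / 2) - 0) < e / 2" by blast
      then have "\<rho> (real k + 1 / 2) \<le> e / 2" if "n \<le> k" for k using that by (smt (verit) real_norm_def diff_zero)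
      then show ?thesis using that by blast
    qed
    define F where "F = {i \<in> spinor_index. fst i \<le> real n}"
    have F: "finite F" unfolding F_def by (rule finite_index_le)
    have "norm (T x - (\<Sum>i\<in>F. coeff (T x) i *\<^sub>C vec i)) \<le> e * norm x" for x
    proof -
      let ?P = "\<lambda>l. \<not> l \<le> real n"
      have "T x - (\<Sum>i\<in>F. coeff (T x) i *\<^sub>C vec i) = R ?P x + S ?P x"
      proof (rule spinor_eqI)
        fix i :: "real \<times> real \<times> real"
        obtain l m N where i: "i = (l, m, N)" by (cases i)
        have "coeff (\<Sum>i\<in>F. coeff (T x) i *\<^sub>C vec i) i = (\<Sum>j\<in>F. if j = i then coeff (T x) i else 0)"
          unfolding coeff_sum by (rule sum.cong) (auto simp: coeff_vec F_def)
        also have "\<dots> = (if i \<in> F then coeff (T x) i else 0)" using F by simp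
        also have "\<dots> = (if l \<le> real n then coeff (T x) i else 0)"
          by (auto simp: F_def i coeff_outside)
        finally show "coeff (T x - (\<Sum>i\<in>F. coeff (T x) i *\<^sub>C vec i)) i = coeff (R ?P x + S ?P x) i"
          by (simp add: i cR cS cT)
      qed
      moreover have "norm (R ?P x + S ?P x) \<le> 2 * (e / 2) * norm x"
      proof (rule nb)
        fix l assume "l \<in> half_spins" "\<not> l \<le> real n"
        then obtain k where k: "l = real k + 1 / 2" "n \<le> k" unfolding half_spins_def by force
        show "\<rho> l \<le> e / 2" unfolding k(1) by (rule n[OF k(2)])
      qed (use e in simp)
      ultimately show ?thesis by simp
    qed
    then show "\<exists>F. finite F \<and> (\<forall>x. norm (T x - (\<Sum>i\<in>F. coeff (T x) i *\<^sub>C vec i)) \<le> e * norm x)" using F by blast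
  qed
  moreover have "converse (plus_i D) = {(x, T x) | x. True}"
  proof (intro equalityI subsetI)
    fix p assume "p \<in> converse (plus_i D)"
    then obtain x y where p: "p = (y + \<i> *\<^sub>C x, x)" and xy: "(x, y) \<in> D" unfolding plus_i_def by auto
    have "x = T (y + \<i> *\<^sub>C x)"
    proof (rule spinor_eqI)
      fix i :: "real \<times> real \<times> real"
      obtain l m N where i: "i = (l, m, N)" by (cases i)
      show "coeff x i = coeff (T (y + \<i> *\<^sub>C x)) i"
      proof (cases "i \<in> spinor_index")
        case True
        note v = inv[OF spinor_indexD(1,3)[OF True[unfolded i]]]
        have "coeff (T (y + \<i> *\<^sub>C x)) i = (r l N * (a l N + \<i>) + s l N * b l (- N)) * coeff x (l, m, N)
          + (r l N * b l N + s l N * (a l (- N) + \<i>)) * coeff x (l, m, - N)"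
          unfolding i cT coeff_plus coeff_scaleC graph_coeff[OF xy] minus_minus by (simp only: distrib_left distrib_right ac_simps)
        then show ?thesis using v by (simp add: i)
      qed (simp add: coeff_outside)
    qed
    then show "p \<in> {(x, T x) | x. True}" using p by auto
  next
    fix p assume "p \<in> {(x, T x) | x. True}"
    then obtain z where p: "p = (z, T z)" by blast
    have "(T z, z - \<i> *\<^sub>C T z) \<in> D" unfolding graph_iff
    proof (intro allI impI)
      fix l m N assume I: "(l, m, N) \<in> spinor_index"
      note v = inv[OF spinor_indexD(1,3)[OF I]]
      have "(a l N * coeff (T z) (l, m, N) + b l N * coeff (T z) (l, m, - N)) + \<i> * coeff (T z) (l, m, N)
        = ((a l N + \<i>) * r l N + b l N * s l (- N)) * coeff z (l, m, N)
         + ((a l N + \<i>) * s l N + b l N * r l (- N)) * coeff z (l, m, - N)"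
        unfolding cT minus_minus by (simp only: distrib_left distrib_right ac_simps)
      also have "\<dots> = coeff z (l, m, N)" using v by simp
      finally show "coeff (z - \<i> *\<^sub>C T z) (l, m, N) = a l N * coeff (T z) (l, m, N) + b l N * coeff (T z) (l, m, - N)"
        by (simp add: algebra_simps)
    qed
    then have "(T z, z - \<i> *\<^sub>C T z + \<i> *\<^sub>C T z) \<in> plus_i D" unfolding plus_i_def by blast
    then show "p \<in> converse (plus_i D)" using p by simp
  qed
  ultimately show ?thesis unfolding compact_resolvent_def by blast
qed

text \<open>The commutator on coefficients: diagonal entries of the blocks keep \<open>N\<close> and
  give \<open>E1\<close>, off-diagonal ones flip it and give \<open>F1\<close>. Their boundedness
  supplies the image of \<open>V x\<close>, and \<open>graph_iff\<close> then shows that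
  \<open>V\<close> preserves the domain.\<close>

lemma commutator_wshift:
  fixes w :: "real \<Rightarrow> real \<Rightarrow> real \<Rightarrow> complex" and d k :: real
  assumes B: "0 \<le> B"
    and bw: "\<And>l m N. (l, m, N) \<in> spinor_index \<Longrightarrow> (l + d, m + k, N) \<in> spinor_index \<Longrightarrow> cmod (w l m N) \<le> B"
    and ba: "\<And>l m N. (l, m, N) \<in> spinor_index \<Longrightarrow> (l + d, m + k, N) \<in> spinor_index \<Longrightarrow>
      cmod ((a l N - a (l + d) N) * w l m N) \<le> B"
    and bb: "\<And>l m N. (l, m, N) \<in> spinor_index \<Longrightarrow> (l + d, m + k, N) \<in> spinor_index \<Longrightarrow>
      cmod (b l N * w l m (- N) - b (l + d) N * w l m N) \<le> B"
  shows "bounded_commutator D (wshift (\<lambda>(l, m, N). w l m N) (\<lambda>(l, m, N). (l + d, m + k, N)))"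
proof -
  let ?s = "\<lambda>(l, m, N :: real). (l + d, m + k, N)" let ?f = "\<lambda>(l, m, N :: real). (l + d, m + k, - N)"
  define V where "V = wshift (\<lambda>(l, m, N). w l m N) ?s"
  define E1 where "E1 = wshift (\<lambda>(l, m, N). (a l N - a (l + d) N) * w l m N) ?s"
  define F1 where "F1 = wshift (\<lambda>(l, m, N). b l N * w l m (- N) - b (l + d) N * w l m N) ?f"
  have inj: "inj ?s" "inj ?f" by (auto intro!: injI)
  have b1: "\<And>i. i \<in> spinor_index \<Longrightarrow> ?s i \<in> spinor_index \<Longrightarrow> cmod ((\<lambda>(l, m, N). w l m N) i) \<le> B"
    and b2: "\<And>i. i \<in> spinor_index \<Longrightarrow> ?s i \<in> spinor_index \<Longrightarrow> cmod ((\<lambda>(l, m, N). (a l N - a (l + d) N) * w l m N) i) \<le> B"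
    and b3: "\<And>i. i \<in> spinor_index \<Longrightarrow> ?f i \<in> spinor_index \<Longrightarrow> cmod ((\<lambda>(l, m, N). b l N * w l m (- N) - b (l + d) N * w l m N) i) \<le> B"
    using bw ba bb spinor_index_opposite by (auto split: prod.splits)
  have cV: "coeff (V x) (l, m, N) = w l m N * coeff x (l + d, m + k, N)" if "(l, m, N) \<in> spinor_index" for x l m N
    unfolding V_def using coeff_wshift[OF inj(1) B b1, where x = x and i = "(l, m, N)"] that by simp
  have cE: "coeff (E1 x) (l, m, N) = (a l N - a (l + d) N) * w l m N * coeff x (l + d, m + k, N)"
    if "(l, m, N) \<in> spinor_index" for x l m N
    unfolding E1_def using coeff_wshift[OF inj(1) B b2, where x = x and i = "(l, m, N)"] that by simp
  have cF: "coeff (F1 x) (l, m, N) = (b l N * w l m (- N) - b (l + d) N * w l m N) * coeff x (l + d, m + k, - N)"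
    if "(l, m, N) \<in> spinor_index" for x l m N
    unfolding F1_def using coeff_wshift[OF inj(2) B b3, where x = x and i = "(l, m, N)"] that by simp
  have "\<exists>z. (V x, z) \<in> D \<and> norm (z - V y) \<le> 2 * B * norm x" if xy: "(x, y) \<in> D" for x y
  proof (intro exI conjI)
    show "(V x, V y + (E1 x + F1 x)) \<in> D" unfolding graph_iff
    proof (intro allI impI)
      fix l m N assume I: "(l, m, N) \<in> spinor_index"
      then have J: "(l, m, - N) \<in> spinor_index" by (simp add: spinor_index_opposite)
      show "coeff (V y + (E1 x + F1 x)) (l, m, N) = a l N * coeff (V x) (l, m, N) + b l N * coeff (V x) (l, m, - N)"
        unfolding coeff_plus cV[OF I] cV[OF J] cE[OF I] cF[OF I] graph_coeff[OF xy] minus_minus by (simp only: algebra_simps)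
    qed
    have "norm (E1 x) \<le> B * norm x" unfolding E1_def by (rule norm_wshift_le[OF inj(1) B b2])
    moreover have "norm (F1 x) \<le> B * norm x" unfolding F1_def by (rule norm_wshift_le[OF inj(2) B b3])
    ultimately show "norm (V y + (E1 x + F1 x) - V y) \<le> 2 * B * norm x"
      using norm_triangle_ineq[of "E1 x" "F1 x"] by simp
  qed
  then show ?thesis unfolding bounded_commutator_def V_def by blast
qed

end

section \<open>Projection-valued measures\<close>

locale pvm =
  fixes P :: "real set \<Rightarrow> 'h::complex_hilbert_space \<Rightarrow> 'h"
  assumes pvm: "projection_valued_measure P"
begin

lemma clin: "M \<in> sets borel \<Longrightarrow> bounded_clinear (P M)"
  and idem: "M \<in> sets borel \<Longrightarrow> P M (P M x) = P M x"
  and sym: "M \<in> sets borel \<Longrightarrow> cinner (P M x) y = cinner x (P M y)"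
  and univ: "P UNIV x = x"
  and additive: "range A \<subseteq> sets borel \<Longrightarrow> disjoint_family A \<Longrightarrow> (\<lambda>n::nat. P (A n) x) sums P (\<Union>n. A n) x"
proof -
  assume "M \<in> sets borel"
  then have M: "P M \<circ> P M = P M" using pvm unfolding projection_valued_measure_def by blast
  show "P M (P M x) = P M x" using fun_cong[OF M, of x] by simp
next
  have "P UNIV = id" using pvm unfolding projection_valued_measure_def by blast
  then show "P UNIV x = x" by simp
qed (use pvm in \<open>auto simp: projection_valued_measure_def\<close>)

lemma norm_sq: assumes "M \<in> sets borel" shows "(norm (P M x))\<^sup>2 = x \<bullet> P M x"
proof -
  have "cinner (P M x) (P M x) = cinner x (P M x)" using sym[OF assms, of x "P M x"] idem[OF assms] by simp
  then show ?thesis unfolding inner_eq_Re_cinner cinner_self by (metis Re_complex_of_real)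
qed

lemma empty: "P {} x = 0"
proof -
  have "(\<lambda>n::nat. P {} x) sums P {} x" using additive[of "\<lambda>_. {}" x] by (simp add: disjoint_family_on_def)
  then have "summable (\<lambda>n::nat. P {} x)" by (rule sums_summable)
  then show ?thesis by (simp add: summable_const_iff)
qed

lemma Un: assumes "A \<in> sets borel" "B \<in> sets borel" "A \<inter> B = {}" shows "P (A \<union> B) x = P A x + P B x"
proof -
  have "(\<lambda>n. P (binaryset A B n) x) sums P (\<Union>n. binaryset A B n) x"
    using assms by (intro additive) (auto simp: binaryset_def disjoint_family_on_def)
  moreover have "(\<lambda>n. P (binaryset A B n) x) sums (P A x + P B x)"
    by (rule binaryset_sums) (rule empty)
  ultimately show ?thesis unfolding UN_binaryset_eq by (rule sums_unique2)
qed

lemma compl: assumes "A \<in> sets borel" shows "P (- A) x = x - P A x"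
  using Un[of A "- A" x] assms univ[of x] by (simp add: algebra_simps)

lemma norm_le: assumes "A \<in> sets borel" shows "norm (P A x) \<le> norm x"
proof (cases "P A x = 0")
  case False
  have "norm (P A x) * norm (P A x) \<le> norm x * norm (P A x)"
    using norm_sq[OF assms, of x] Cauchy_Schwarz_ineq2[of x "P A x"] by (simp add: power2_eq_square)
  then show ?thesis using False by simp
qed simp

text \<open>For \<open>y\<close> in the range of \<open>P B\<close>, additivity gives norm squares
  adding up to that of \<open>P (A \<union> B) y\<close>, which is at most that of \<open>y\<close>.
  Since \<open>P B y = y\<close> already exhausts it, \<open>P A y\<close> must be zero.\<close>

lemma orth: assumes "A \<in> sets borel" "B \<in> sets borel" "A \<inter> B = {}" shows "P A (P B x) = 0"
proof -
  let ?y = "P B x"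
  have "(norm (P (A \<union> B) ?y))\<^sup>2 = (norm (P A ?y))\<^sup>2 + (norm (P B ?y))\<^sup>2"
    using norm_sq[OF assms(1), of ?y] norm_sq[OF assms(2), of ?y] norm_sq[OF sets.Un[OF assms(1,2)], of ?y]
    unfolding Un[OF assms] inner_add_right by linarith
  moreover have "P B ?y = ?y" by (rule idem[OF assms(2)])
  moreover have "(norm (P (A \<union> B) ?y))\<^sup>2 \<le> (norm ?y)\<^sup>2"
    by (intro power_mono norm_le sets.Un assms) simp
  ultimately have "(norm (P A ?y))\<^sup>2 \<le> 0" by simp
  then show ?thesis by simp
qed

lemma inter: assumes A: "A \<in> sets borel" and B: "B \<in> sets borel" shows "P A (P B x) = P (A \<inter> B) x"
proof -
  have s: "A \<inter> B \<in> sets borel" "B - A \<in> sets borel" "A - B \<in> sets borel" using A B by auto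
  have d: "P (S \<inter> T) y + P (S - T) y = P S y" if "S \<in> sets borel" "T \<in> sets borel" for S T y
    using Un[of "S \<inter> T" "S - T" y] that by (simp add: Int_Diff_Un sets.Int sets.Diff Int_Diff_disjoint)
  have "P B x = P (A \<inter> B) x + P (B - A) x" using d[OF B A, of x] by (simp add: Int_commute)
  then have "P A (P B x) = P A (P (A \<inter> B) x) + P A (P (B - A) x)" by (simp add: bounded_clinearD[OF clin[OF A]])
  also have "P A (P (B - A) x) = 0" by (rule orth) (use s A in auto)
  also have "P A (P (A \<inter> B) x) = P (A \<inter> B) (P (A \<inter> B) x) + P (A - B) (P (A \<inter> B) x)" using d[OF A B] by simp
  also have "P (A - B) (P (A \<inter> B) x) = 0" by (rule orth) (use s in auto)
  finally show ?thesis using idem[OF s(1)] by simp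
qed

abbreviation \<mu> :: "'h \<Rightarrow> real measure" where "\<mu> \<equiv> spectral_distribution P"

lemma sets_\<mu> [simp, measurable_cong]: "sets (\<mu> x) = sets borel" and space_\<mu> [simp]: "space (\<mu> x) = UNIV"
  using sets.sigma_sets_eq[of borel] unfolding spectral_distribution_def by (simp_all add: sets_measure_of)

lemma emeasure_\<mu>: assumes "M \<in> sets borel" shows "emeasure (\<mu> x) M = ennreal ((norm (P M x))\<^sup>2)"
  unfolding spectral_distribution_def
proof (rule emeasure_measure_of_sigma)
  show "sigma_algebra UNIV (sets borel)" using sets.sigma_algebra_axioms[of borel] by simp
  show "positive (sets borel) (\<lambda>M. ennreal ((norm (P M x))\<^sup>2))" unfolding positive_def by (simp add: empty)
  show "countably_additive (sets borel) (\<lambda>M. ennreal ((norm (P M x))\<^sup>2))"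
    unfolding countably_additive_def
  proof (intro allI impI)
    fix A :: "nat \<Rightarrow> real set" assume A: "range A \<subseteq> sets borel" "disjoint_family A" "\<Union> (range A) \<in> sets borel"
    have "(\<lambda>n. x \<bullet> P (A n) x) sums (x \<bullet> P (\<Union>n. A n) x)"
      by (rule bounded_linear.sums[OF bounded_linear_inner_right additive[OF A(1,2)]])
    then have "(\<lambda>n. (norm (P (A n) x))\<^sup>2) sums (norm (P (\<Union>n. A n) x))\<^sup>2"
      using A by (subst norm_sq, blast)+ simp
    then show "suminf (\<lambda>i. ennreal ((norm (P (A i) x))\<^sup>2)) = ennreal ((norm (P (\<Union> (range A)) x))\<^sup>2)"
      by (intro suminf_ennreal_eq) auto
  qed
qed (use assms in simp)

lemma finite_measure_\<mu>: "finite_measure (\<mu> x)"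
  by (rule finite_measureI) (simp add: emeasure_\<mu>)

text \<open>Projecting the vector restricts its distribution, so domain questions for
  \<open>P N x\<close> become integrability questions on \<open>N\<close>.\<close>

lemma \<mu>_restrict: assumes N: "N \<in> sets borel" shows "\<mu> (P N x) = density (\<mu> x) (\<lambda>s. ennreal (indicator N s))"
proof (rule measure_eqI)
  fix M assume "M \<in> sets (\<mu> (P N x))"
  then have M: "M \<in> sets borel" by simp
  have "emeasure (density (\<mu> x) (\<lambda>s. ennreal (indicator N s))) M = (\<integral>\<^sup>+s. ennreal (indicator N s) * indicator M s \<partial>\<mu> x)"
    using N M by (intro emeasure_density) auto
  also have "\<dots> = (\<integral>\<^sup>+s. indicator (N \<inter> M) s \<partial>\<mu> x)"
    by (rule nn_integral_cong) (simp split: split_indicator)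
  also have "\<dots> = emeasure (\<mu> x) (N \<inter> M)" using N M by simp
  finally show "emeasure (\<mu> (P N x)) M = emeasure (density (\<mu> x) (\<lambda>s. ennreal (indicator N s))) M"
    using N M by (simp add: emeasure_\<mu> inter Int_commute)
qed simp

lemma \<mu>_cong:
  assumes "\<And>M. M \<in> sets borel \<Longrightarrow> norm (P M x) = norm (P M y)" shows "\<mu> x = \<mu> y"
  by (rule measure_eqI) (simp_all add: emeasure_\<mu> assms)

text \<open>Strong convergence of the cutoffs, by countable additivity over the sets of
  \<open>s\<close> whose modulus lies between \<open>n\<close> and \<open>n + 1\<close>.\<close>

lemma exhaust: "(\<lambda>n. P {s. \<bar>s\<bar> < real n} x) \<longlonglongrightarrow> x"
proof -
  let ?A = "\<lambda>n::nat. {s::real. real n \<le> \<bar>s\<bar> \<and> \<bar>s\<bar> < real n + 1}" let ?B = "\<lambda>n::nat. {s::real. \<bar>s\<bar> < real n}"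
  have b: "?A n \<in> sets borel" "?B n \<in> sets borel" for n by measurable
  have dis: "disjoint_family ?A"
    unfolding disjoint_family_on_def
  proof (intro ballI impI)
    fix m n :: nat assume "m \<noteq> n"
    then have "real m + 1 \<le> real n \<or> real n + 1 \<le> real m" by linarith
    then show "?A m \<inter> ?A n = {}" by auto
  qed
  have "(\<Union>n. ?A n) = UNIV"
  proof -
    have "\<exists>n::nat. real n \<le> \<bar>s\<bar> \<and> \<bar>s\<bar> < real n + 1" for s :: real
    proof (rule exI[of _ "nat \<lfloor>\<bar>s\<bar>\<rfloor>"])
      have "real (nat \<lfloor>\<bar>s\<bar>\<rfloor>) = of_int \<lfloor>\<bar>s\<bar>\<rfloor>" by (rule of_nat_nat) simp
      then show "real (nat \<lfloor>\<bar>s\<bar>\<rfloor>) \<le> \<bar>s\<bar> \<and> \<bar>s\<bar> < real (nat \<lfloor>\<bar>s\<bar>\<rfloor>) + 1"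
        using floor_correct[of "\<bar>s\<bar>"] by linarith
    qed
    then show ?thesis by auto
  qed
  then have "(\<lambda>n. P (?A n) x) sums x" using additive[of ?A x] dis b by (simp add: image_subset_iff univ)
  then have "(\<lambda>n. \<Sum>k<n. P (?A k) x) \<longlonglongrightarrow> x" unfolding sums_def .
  moreover have "(\<Sum>k<n. P (?A k) x) = P (?B n) x" for n
  proof (induction n)
    case 0
    have "?B 0 = {}" by auto
    then show ?case by (simp add: empty)
  next
    case (Suc n)
    have "?B (Suc n) = ?B n \<union> ?A n" by auto
    moreover have "?B n \<inter> ?A n = {}" by auto
    ultimately have "P (?B (Suc n)) x = P (?B n) x + P (?A n) x" using Un[OF b(2)[of n] b(1)[of n]] by simp
    then show ?case using Suc by simp
  qed
  ultimately show ?thesis by simp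
qed

end

section \<open>Spectral measures\<close>

locale spectral = pvm P for P :: "real set \<Rightarrow> 'h::complex_hilbert_space \<Rightarrow> 'h" +
  fixes G :: "('h \<times> 'h) set"
  assumes sm: "spectral_measure P G"
begin

lemma G_lin: "linear_operator G"
  and Domain_iff: "x \<in> Domain G \<longleftrightarrow> integrable (\<mu> x) (\<lambda>s. s\<^sup>2)"
  and form: "(x, y) \<in> G \<Longrightarrow> cinner x y = of_real (integral\<^sup>L (\<mu> x) (\<lambda>s. s))"
  using sm unfolding spectral_measure_def by auto

lemma G_add: "(x, y) \<in> G \<Longrightarrow> (x', y') \<in> G \<Longrightarrow> (x + x', y + y') \<in> G"
  and G_scale: "(x, y) \<in> G \<Longrightarrow> (c *\<^sub>C x, c *\<^sub>C y) \<in> G"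
  and G_unique: "(x, y) \<in> G \<Longrightarrow> (x, z) \<in> G \<Longrightarrow> y = z"
  using G_lin unfolding linear_operator_def single_valued_def by blast+

text \<open>The vectors \<open>x + \<zeta> y\<close> with \<open>\<bar>\<zeta>\<bar> = 1\<close> all have the same distribution, so polarization applies.\<close>

lemma orth_form:
  assumes x: "(x, x') \<in> G" and y: "(y, y') \<in> G"
    and o: "\<And>M. M \<in> sets borel \<Longrightarrow> cinner (P M x) (P M y) = 0"
  shows "cinner x y' = 0"
proof -
  have n: "(norm (P M (x + \<zeta> *\<^sub>C y)))\<^sup>2 = (norm (P M x))\<^sup>2 + (norm (P M y))\<^sup>2" if "cmod \<zeta> = 1" "M \<in> sets borel" for \<zeta> M
  proof -
    have o': "cinner (P M y) (P M x) = 0" using o[OF that(2)] cinner_commute[of "P M y" "P M x"] by simp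
    have "complex_of_real ((norm (P M (x + \<zeta> *\<^sub>C y)))\<^sup>2) = of_real ((norm (P M x))\<^sup>2) + cnj \<zeta> * \<zeta> * of_real ((norm (P M y))\<^sup>2)"
      unfolding cinner_self[symmetric] using o[OF that(2)] o'
      by (simp add: bounded_clinearD[OF clin[OF that(2)]] cinner_add_left cinner_add_right cinner_scaleC_left cinner_scaleC_right)
    moreover have "cnj \<zeta> * \<zeta> = 1" using that(1) by (metis complex_norm_square mult.commute of_real_1 power_one)
    ultimately show ?thesis by (simp flip: of_real_add of_real_power)
  qed
  define E where "E \<zeta> = cinner (x + \<zeta> *\<^sub>C y) (x' + \<zeta> *\<^sub>C y')" for \<zeta>
  have E: "E \<zeta> = E 1" if "cmod \<zeta> = 1" for \<zeta>
  proof -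
    have "\<mu> (x + \<zeta> *\<^sub>C y) = \<mu> (x + 1 *\<^sub>C y)"
    proof (rule \<mu>_cong)
      fix M :: "real set" assume M: "M \<in> sets borel"
      have "(norm (P M (x + \<zeta> *\<^sub>C y)))\<^sup>2 = (norm (P M (x + 1 *\<^sub>C y)))\<^sup>2" using n[OF that M] n[OF _ M, of 1] by simp
      then show "norm (P M (x + \<zeta> *\<^sub>C y)) = norm (P M (x + 1 *\<^sub>C y))" by simp
    qed
    then show ?thesis unfolding E_def
      using form[OF G_add[OF x G_scale[OF y, of \<zeta>]]] form[OF G_add[OF x G_scale[OF y, of 1]]] by simp
  qed
  have ex: "E \<zeta> = cinner x x' + \<zeta> * cinner x y' + cnj \<zeta> * cinner y x' + cnj \<zeta> * \<zeta> * cinner y y'" for \<zeta>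
    unfolding E_def by (simp add: cinner_add_left cinner_add_right cinner_scaleC_left cinner_scaleC_right algebra_simps)
  have "E (- 1) = E 1" "E \<i> = E 1" by (rule E; simp)+
  then have "cinner y x' = - cinner x y'" and i: "\<i> * cinner x y' - \<i> * cinner y x' = cinner x y' + cinner y x'"
    unfolding ex by (auto simp: algebra_simps add_eq_0_iff2)
  then have "2 * \<i> * cinner x y' = 0" by simp
  then show ?thesis by simp
qed

lemma restrict_Domain: assumes "x \<in> Domain G" and N: "N \<in> sets borel" shows "P N x \<in> Domain G"
  unfolding Domain_iff \<mu>_restrict[OF N]
  using assms integrable_mult_indicator[of N "\<mu> x" "\<lambda>s. s\<^sup>2"]
  by (subst integrable_density) (auto simp: Domain_iff)

lemma bounded_Domain: assumes "P {s. \<bar>s\<bar> < real n} x = x" shows "x \<in> Domain G"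
proof -
  let ?B = "{s::real. \<bar>s\<bar> < real n}"
  have B: "?B \<in> sets borel" by measurable
  interpret finite_measure "\<mu> x" by (rule finite_measure_\<mu>)
  have m: "\<mu> x = density (\<mu> x) (\<lambda>s. ennreal (indicator ?B s))" using \<mu>_restrict[OF B, of x] assms by simp
  have "integrable (\<mu> x) (\<lambda>s. indicator ?B s *\<^sub>R s\<^sup>2)"
  proof (rule integrable_const_bound[where B = "(real n)\<^sup>2"])
    have "norm (indicator ?B s *\<^sub>R s\<^sup>2) \<le> (real n)\<^sup>2" for s
      by (auto simp: indicator_def power2_le_iff_abs_le)
    then show "AE s in \<mu> x. norm (indicator ?B s *\<^sub>R s\<^sup>2) \<le> (real n)\<^sup>2" by simp
    show "(\<lambda>s. indicator ?B s *\<^sub>R s\<^sup>2) \<in> borel_measurable (\<mu> x)" using B by measurable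
  qed
  then have "integrable (density (\<mu> x) (\<lambda>s. ennreal (indicator ?B s))) (\<lambda>s. s\<^sup>2)"
    using B by (subst integrable_density) auto
  then show ?thesis unfolding Domain_iff using m by simp
qed

text \<open>The parts of \<open>x\<close> inside and outside \<open>N\<close> have orthogonal images
  by \<open>orth_form\<close>, so the mean of \<open>s - c\<close> under the distribution of
  \<open>P N x\<close> is zero. On \<open>N\<close> the sign of \<open>s - c\<close> is fixed by
  \<open>\<sigma>\<close>, hence the distribution vanishes. The values \<open>1\<close> and
  \<open>-1\<close> of \<open>\<sigma>\<close> treat the two half-lines beside
  \<open>c\<close>.\<close>

lemma eigen_aux:
  assumes x: "(x, of_real c *\<^sub>C x) \<in> G" and N: "N \<in> sets borel" and \<sigma>: "\<And>s. s \<in> N \<Longrightarrow> 0 < \<sigma> * (s - c)"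
  shows "P N x = 0"
proof -
  let ?E = "P N x" let ?F = "P (- N) x"
  have N': "- N \<in> sets borel" using N by (simp add: Compl_in_sets_lebesgue borel_comp)
  have D: "x \<in> Domain G" using x by blast
  obtain e f where e: "(?E, e) \<in> G" and f: "(?F, f) \<in> G" using restrict_Domain[OF D N] restrict_Domain[OF D N'] by blast
  have "?E + ?F = x" using compl[OF N] by simp
  then have ef: "e + f = of_real c *\<^sub>C x" using G_unique[OF _ x] G_add[OF e f] by simp
  have "cinner ?E f = 0"
  proof (rule orth_form[OF e f])
    fix M :: "real set" assume M: "M \<in> sets borel"
    have "cinner (P M ?E) (P M ?F) = cinner ?E (P M ?F)" using sym[OF M] idem[OF M] by simp
    also have "\<dots> = cinner x (P N (P (M \<inter> - N) x))" using sym[OF N] inter[OF M N'] by simp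
    also have "P N (P (M \<inter> - N) x) = 0" by (rule orth) (use M N N' in auto)
    finally show "cinner (P M ?E) (P M ?F) = 0" by simp
  qed
  then have "cinner ?E e = of_real c * cinner ?E x"
    using ef by (metis add.right_neutral cinner_add_right cinner_scaleC_right)
  also have "cinner ?E x = of_real ((norm ?E)\<^sup>2)"
    unfolding cinner_self[symmetric] using sym[OF N, of x x] sym[OF N, of x "?E"] idem[OF N] by simp
  finally have I: "integral\<^sup>L (\<mu> ?E) (\<lambda>s. s) = c * (norm ?E)\<^sup>2" using form[OF e] by (metis of_real_eq_iff of_real_mult)
  interpret finite_measure "\<mu> ?E" by (rule finite_measure_\<mu>)
  have mE: "measure (\<mu> ?E) UNIV = (norm ?E)\<^sup>2" unfolding measure_def by (simp add: emeasure_\<mu> univ)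
  have i2: "integrable (\<mu> ?E) (\<lambda>s. s\<^sup>2)" using restrict_Domain[OF D N] unfolding Domain_iff .
  have i1: "integrable (\<mu> ?E) (\<lambda>s. s)"
  proof (rule Bochner_Integration.integrable_bound)
    show "integrable (\<mu> ?E) (\<lambda>s. s\<^sup>2 + 1)" using i2 by simp
    have "\<bar>s\<bar> \<le> \<bar>s\<^sup>2 + 1\<bar>" for s :: real
    proof -
      have "0 \<le> (\<bar>s\<bar> - 1)\<^sup>2" by simp
      then have "2 * \<bar>s\<bar> \<le> s\<^sup>2 + 1" by (simp add: power2_diff)
      then show ?thesis by linarith
    qed
    then show "AE s in \<mu> ?E. norm s \<le> norm (s\<^sup>2 + 1)" by simp
    show "(\<lambda>s. s) \<in> borel_measurable (\<mu> ?E)" by measurable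
  qed
  have i3: "integrable (\<mu> ?E) (\<lambda>s. \<sigma> * (s - c))" using i1 by simp
  have "integral\<^sup>L (\<mu> ?E) (\<lambda>s. \<sigma> * (s - c)) = \<sigma> * (integral\<^sup>L (\<mu> ?E) (\<lambda>s. s) - integral\<^sup>L (\<mu> ?E) (\<lambda>s. c))"
    using i1 by (simp add: Bochner_Integration.integral_diff)
  also have "\<dots> = 0" using I mE by simp
  finally have z: "integral\<^sup>L (\<mu> ?E) (\<lambda>s. \<sigma> * (s - c)) = 0" .
  have AEN: "AE s in \<mu> ?E. s \<in> N"
    unfolding \<mu>_restrict[OF N] using N by (subst AE_density) (auto simp: indicator_def)
  then have "AE s in \<mu> ?E. 0 \<le> \<sigma> * (s - c)" by eventually_elim (use \<sigma> less_imp_le in blast)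
  then have "AE s in \<mu> ?E. \<sigma> * (s - c) = 0" using integral_nonneg_eq_0_iff_AE[OF i3] z by simp
  then have "AE s in \<mu> ?E. s \<notin> N" by eventually_elim (use \<sigma> in force)
  then have "{s \<in> space (\<mu> ?E). \<not> s \<notin> N} \<in> null_sets (\<mu> ?E)" using N by (subst (asm) AE_iff_null) auto
  then have "emeasure (\<mu> ?E) N = 0" by auto
  then show ?thesis using N by (simp add: emeasure_\<mu> idem ennreal_eq_0_iff)
qed

lemma eigen: assumes x: "(x, of_real c *\<^sub>C x) \<in> G" shows "P {c} x = x"
proof -
  have "P {c<..} x = 0" by (rule eigen_aux[OF x, where \<sigma> = 1]) auto
  moreover have "P {..<c} x = 0" by (rule eigen_aux[OF x, where \<sigma> = "- 1"]) auto
  moreover have "P ({..<c} \<union> {c<..}) x = P {..<c} x + P {c<..} x" by (rule Un) auto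
  moreover have "- {c} = {..<c} \<union> {c<..}" by auto
  ultimately have "P (- {c}) x = 0" by simp
  then show ?thesis using compl[of "{c}" x] by simp
qed

end

section \<open>Diagonalization of Hermitian matrices of size two\<close>

text \<open>The eigenvalues are \<open>\<nu> + r\<close> and \<open>\<nu> - r\<close>. The vector
  \<open>(\<beta>, r - \<tau>)\<close> belongs to the larger one, and the second row of
  \<open>U\<close> is the conjugate of an orthogonal vector. The vector is zero only if
  \<open>\<beta> = 0\<close> and \<open>\<tau> = r\<close>; then \<open>H\<close> is diagonal with
  its entries already in the right order.\<close>

lemma hermitian2_diagonalization:
  fixes H :: "complex^2^2"
  assumes H: "conj_transpose H = H"
  shows "\<exists>U d1 d2. unitary_matrix U \<and> d2 \<le> d1 \<and> H = conj_transpose U ** diag2 d1 d2 ** U"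
proof -
  have mm: "(A ** B) $ i $ j = A $ i $ 1 * B $ 1 $ j + A $ i $ 2 * B $ 2 $ j" for A B :: "complex^2^2" and i j
    by (simp add: matrix_matrix_mult_def sum_2)
  have ct: "conj_transpose A $ i $ j = cnj (A $ j $ i)" for A :: "complex^2^2" and i j
    by (simp add: conj_transpose_def)
  have dg: "diag2 x y $ 1 $ 1 = of_real x" "diag2 x y $ 1 $ 2 = 0" "diag2 x y $ 2 $ 1 = 0" "diag2 x y $ 2 $ 2 = of_real y" for x y
    by (simp_all add: diag2_def)
  have mt: "(mat 1 :: complex^2^2) $ 1 $ 1 = 1" "(mat 1 :: complex^2^2) $ 1 $ 2 = 0"
    "(mat 1 :: complex^2^2) $ 2 $ 1 = 0" "(mat 1 :: complex^2^2) $ 2 $ 2 = 1"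
    by (simp_all add: mat_def)
  define \<alpha> \<delta> \<beta> where "\<alpha> = Re (H $ 1 $ 1)" "\<delta> = Re (H $ 2 $ 2)" "\<beta> = H $ 1 $ 2"
  have h: "cnj (H $ j $ i) = H $ i $ j" for i j using H ct[of H i j] by simp
  have H11: "H $ 1 $ 1 = of_real \<alpha>" and H22: "H $ 2 $ 2 = of_real \<delta>"
    using h[of 1 1] h[of 2 2] by (auto simp: \<alpha>_\<delta>_\<beta>_def complex_eq_iff)
  have H12: "H $ 1 $ 2 = \<beta>" and H21: "H $ 2 $ 1 = cnj \<beta>" using h[of 1 2] h[of 2 1] by (auto simp: \<alpha>_\<delta>_\<beta>_def)
  define \<tau> \<nu> where "\<tau> = (\<alpha> - \<delta>) / 2" "\<nu> = (\<alpha> + \<delta>) / 2"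
  have \<alpha>: "\<alpha> = \<nu> + \<tau>" and \<delta>: "\<delta> = \<nu> - \<tau>" by (simp_all add: \<tau>_\<nu>_def field_simps)
  define r where "r = sqrt (\<tau>\<^sup>2 + (cmod \<beta>)\<^sup>2)"
  have r0: "0 \<le> r" and rr: "r * r = \<tau> * \<tau> + (cmod \<beta>)\<^sup>2" by (simp_all add: r_def power2_eq_square)
  define s where "s = r - \<tau>"
  define n where "n = (cmod \<beta>)\<^sup>2 + s * s"
  show ?thesis
  proof (cases "n = 0")
    case True
    then have "(cmod \<beta>)\<^sup>2 = 0" "s * s = 0" unfolding n_def by (auto simp: add_nonneg_eq_0_iff)
    then have b: "\<beta> = 0" and s: "s = 0" by auto
    then have t: "\<tau> = r" by (simp add: s_def)
    have "conj_transpose (mat 1 :: complex^2^2) = mat 1"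
      by (simp add: vec_eq_iff forall_2 ct mt)
    moreover have "H = diag2 \<alpha> \<delta>"
      by (simp add: vec_eq_iff forall_2 dg H11 H12 H21 H22 b)
    ultimately have "unitary_matrix (mat 1 :: complex^2^2) \<and> \<delta> \<le> \<alpha> \<and> H = conj_transpose (mat 1) ** diag2 \<alpha> \<delta> ** mat 1"
      using t r0 by (simp add: unitary_matrix_def \<alpha> \<delta>)
    then show ?thesis by blast
  next
    case False
    then have n: "0 < n" unfolding n_def by (metis add_nonneg_nonneg less_eq_real_def zero_le_power2 zero_le_square)
    define w where "w = 1 / sqrt n"
    have ww: "w * w * n = 1" using n by (simp add: w_def)
    define W S R T M G where "W = complex_of_real w" "S = complex_of_real s" "R = complex_of_real r"
      "T = complex_of_real \<tau>" "M = complex_of_real \<nu>" "G = cnj \<beta>"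
    have cb: "complex_of_real ((cmod \<beta>)\<^sup>2) = \<beta> * G" using complex_norm_square[of \<beta>] by (simp add: W_S_R_T_M_G_def)
    have e1: "R * R = T * T + \<beta> * G" using arg_cong[OF rr, of complex_of_real] unfolding of_real_add of_real_mult cb
      by (simp add: W_S_R_T_M_G_def)
    have e2: "S = R - T" by (simp add: W_S_R_T_M_G_def s_def)
    have e3: "W * W * (\<beta> * G + S * S) = 1" using arg_cong[OF ww, of complex_of_real] unfolding n_def of_real_add of_real_mult cb
      by (simp add: W_S_R_T_M_G_def)
    define U :: "complex^2^2" where
      "U = (\<chi> i j. if i = 1 then (if j = 1 then G * W else S * W) else (if j = 1 then - (S * W) else \<beta> * W))"
    have u: "U $ 1 $ 1 = G * W" "U $ 1 $ 2 = S * W" "U $ 2 $ 1 = - (S * W)" "U $ 2 $ 2 = \<beta> * W"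
      by (simp_all add: U_def)
    have cj: "cnj G = \<beta>" "cnj \<beta> = G" "cnj W = W" "cnj S = S" by (simp_all add: W_S_R_T_M_G_def)
    note ex = mm ct u complex_cnj_mult complex_cnj_minus cj
    have U1: "(conj_transpose U ** U) $ 1 $ 1 = 1" "(conj_transpose U ** U) $ 1 $ 2 = 0"
      "(conj_transpose U ** U) $ 2 $ 1 = 0" "(conj_transpose U ** U) $ 2 $ 2 = 1"
      unfolding ex using e3 by Groebner_Basis.algebra+
    have U2: "(U ** conj_transpose U) $ 1 $ 1 = 1" "(U ** conj_transpose U) $ 1 $ 2 = 0"
      "(U ** conj_transpose U) $ 2 $ 1 = 0" "(U ** conj_transpose U) $ 2 $ 2 = 1"
      unfolding ex using e3 by Groebner_Basis.algebra+
    have "unitary_matrix U" unfolding unitary_matrix_def vec_eq_iff forall_2 mt U1 U2 by simp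
    moreover have "\<nu> - r \<le> \<nu> + r" using r0 by simp
    moreover have "H = conj_transpose U ** diag2 (\<nu> + r) (\<nu> - r) ** U"
    proof -
      let ?V = "conj_transpose U ** diag2 (\<nu> + r) (\<nu> - r) ** U"
      have d: "of_real (\<nu> + r) = M + R" "of_real (\<nu> - r) = M - R" by (simp_all add: W_S_R_T_M_G_def)
      have H': "H $ 1 $ 1 = M + T" "H $ 2 $ 2 = M - T" "H $ 1 $ 2 = \<beta>" "H $ 2 $ 1 = G"
        unfolding H11 H22 H12 H21 \<alpha> \<delta> by (simp_all add: W_S_R_T_M_G_def)
      have "H $ 1 $ 1 = ?V $ 1 $ 1" "H $ 1 $ 2 = ?V $ 1 $ 2" "H $ 2 $ 1 = ?V $ 2 $ 1" "H $ 2 $ 2 = ?V $ 2 $ 2"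
        unfolding ex dg d H' using e1 e2 e3 by Groebner_Basis.algebra+
      then show ?thesis unfolding vec_eq_iff forall_2 by simp
    qed
    ultimately show ?thesis by blast
  qed
qed

section \<open>The block form of an equivariant operator\<close>

lemma spectralI: "spectral_measure P G \<Longrightarrow> spectral P G"
  by unfold_locales (auto simp: spectral_measure_def)

lemma finite_spin: "finite {i \<in> spinor_index. fst i = l}"
proof -
  obtain n :: nat where "l \<le> real n" using real_arch_simple by blast
  then have "{i \<in> spinor_index. fst i = l} \<subseteq> {i \<in> spinor_index. fst i \<le> real n}" by auto
  then show ?thesis by (rule finite_subset[OF _ finite_index_le])
qed

definition spin_space :: "real \<Rightarrow> spinor set" where
  "spin_space l = {x. \<forall>i. fst i \<noteq> l \<longrightarrow> coeff x i = 0}"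

lemma spin_spaceD: "x \<in> spin_space l \<Longrightarrow> fst i \<noteq> l \<Longrightarrow> coeff x i = 0"
  unfolding spin_space_def by blast

lemma spin_space_expand:
  assumes "x \<in> spin_space l" shows "x = (\<Sum>i\<in>{i \<in> spinor_index. fst i = l}. coeff x i *\<^sub>C vec i)"
proof (rule \<W>_expand[OF finite_spin], rule subsetI)
  fix i assume "i \<in> {i. coeff x i \<noteq> 0}"
  then have "i \<in> spinor_index" "fst i = l" using assms coeff_outside[of i x] unfolding spin_space_def by blast+
  then show "i \<in> {i \<in> spinor_index. fst i = l}" by simp
qed

lemma spin_space_\<W>: assumes "x \<in> spin_space l" shows "x \<in> \<W>"
proof -
  have "(\<Sum>i\<in>{i \<in> spinor_index. fst i = l}. coeff x i *\<^sub>C vec i) \<in> \<W>"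
    by (intro \<W>_sum \<W>_scaleC \<W>_vec)
  then show ?thesis using spin_space_expand[OF assms] by simp
qed

lemma vec_spin_space: "vec i \<in> spin_space (fst i)"
  by (auto simp: spin_space_def coeff_vec)

lemma spin_space_orthogonal:
  assumes "x \<in> spin_space l" "y \<in> spin_space l'" "l \<noteq> l'" shows "cinner x y = 0"
proof -
  have "cnj (coeff x i) * coeff y i = 0" for i using spin_spaceD[OF assms(1), of i] spin_spaceD[OF assms(2), of i] assms(3) by (cases "fst i = l") auto
  then show ?thesis unfolding cinner_spinor_eq by (intro infsum_0) blast
qed

lemma spinor_pair_vec: "spinor_pair l m a = (a $ 1) *\<^sub>C vec (l, m, - 1 / 2) + (a $ 2) *\<^sub>C vec (l, m, 1 / 2)"
  by (simp add: spinor_pair_def vec_eq)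

locale equivariant_dirac = podles +
  fixes D :: "(spinor \<times> spinor) set" and P Q :: "real set \<Rightarrow> spinor \<Rightarrow> spinor"
  assumes self_adj: "self_adjoint D" and equivariant: "equivariant_operator q D"
    and smP: "spectral_measure P D" and smQ: "spectral_measure Q (closure (casimir_operator q))"
    and commute: "\<And>M N x. M \<in> sets borel \<Longrightarrow> N \<in> sets borel \<Longrightarrow> P M (Q N x) = Q N (P M x)"
begin

sublocale SP: spectral P D by (rule spectralI[OF smP])
sublocale SQ: spectral Q "closure (casimir_operator q)" by (rule spectralI[OF smQ])

lemma Q_vec: "Q {cas (fst i)} (vec i) = vec i"
proof (rule SQ.eigen)
  have "(vec i, of_real (cas (fst i)) *\<^sub>C vec i) \<in> casimir_operator q"
    unfolding casimir_operator_def using casimir_vec by (cases i) (auto simp: casimir_vec)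
  then show "(vec i, of_real (cas (fst i)) *\<^sub>C vec i) \<in> closure (casimir_operator q)"
    using closure_subset by blast
qed

text \<open>The eigenvalues of distinct spins differ, so the spectral projection at
  \<open>cas l\<close> fixes the basis vectors of spin \<open>l\<close> and annihilates all others;
  its symmetry transfers this to coefficients.\<close>

lemma coeff_Q:
  assumes l: "0 \<le> l" shows "coeff (Q {cas l} x) i = (if fst i = l then coeff x i else 0)"
proof (cases "i \<in> spinor_index")
  case True
  have "0 \<le> fst i" using True spinor_indexD(4) by (cases i) force
  then have c: "{cas l} \<inter> {cas (fst i)} = {}" if "fst i \<noteq> l" using cas_inj[of l "fst i"] l that by auto
  have "coeff (Q {cas l} x) i = cinner (Q {cas l} (vec i)) x"
    unfolding cinner_vec_left[symmetric] by (rule SQ.sym[symmetric]) simp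
  also have "Q {cas l} (vec i) = (if fst i = l then vec i else 0)"
  proof (cases "fst i = l")
    case False
    have "Q {cas l} (Q {cas (fst i)} (vec i)) = 0" by (rule SQ.orth) (use c[OF False] in simp_all)
    then show ?thesis using False Q_vec[of i] by simp
  qed (use Q_vec[of i] in simp)
  finally show ?thesis by (simp add: cinner_vec_left)
qed (simp add: coeff_outside)

lemma spin_space_iff: "0 \<le> l \<Longrightarrow> x \<in> spin_space l \<longleftrightarrow> Q {cas l} x = x"
proof -
  assume l: "0 \<le> l"
  have "Q {cas l} x = x \<longleftrightarrow> (\<forall>i. coeff (Q {cas l} x) i = coeff x i)" by (metis spinor_eqI)
  then show ?thesis unfolding coeff_Q[OF l] spin_space_def by auto
qed

lemma P_spin_space:
  assumes "0 \<le> l" "M \<in> sets borel" "x \<in> spin_space l" shows "P M x \<in> spin_space l"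
  using commute[OF assms(2), of "{cas l}" x] assms unfolding spin_space_iff[OF assms(1)] by simp

text \<open>The projections \<open>1 - P {\<bar>s\<bar> < n}\<close> tend to zero on the finitely
  many basis vectors of spin \<open>l\<close> and preserve the spin space. For large
  \<open>n\<close> such a projection has norm at most \<open>1/2\<close> there, so it is zero, and
  the distribution of \<open>x\<close> has bounded support.\<close>

lemma spin_space_Domain:
  assumes l: "0 \<le> l" and x: "x \<in> spin_space l" shows "x \<in> Domain D"
proof -
  let ?F = "{i \<in> spinor_index. fst i = l}" let ?B = "\<lambda>n::nat. {s::real. \<bar>s\<bar> < real n}"
  let ?e = "\<lambda>n. \<Sum>i\<in>?F. norm (vec i - P (?B n) (vec i))"
  have B: "?B n \<in> sets borel" for n by measurable
  have "?e \<longlonglongrightarrow> (\<Sum>i\<in>?F. norm (vec i - vec i))" by (intro tendsto_intros SP.exhaust)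
  then have "?e \<longlonglongrightarrow> 0" by simp
  then have "\<forall>\<^sub>F n in sequentially. ?e n < 1 / 2" by (rule order_tendstoD) simp
  then obtain n where n: "?e n < 1 / 2" by (auto simp: eventually_sequentially)
  define A where "A v = v - P (?B n) v" for v
  note lin = bounded_clinearD[OF SP.clin[OF B[of n]]]
  have A_add: "A (v + w) = A v + A w" "A (c *\<^sub>C v) = c *\<^sub>C A v" "A 0 = 0" for v w c
    unfolding A_def by (simp_all add: lin scaleC.scale_right_diff_distrib)
  have half: "norm (A v) \<le> norm v / 2" if v: "v \<in> spin_space l" for v
  proof -
    have "A v = (\<Sum>i\<in>?F. coeff v i *\<^sub>C A (vec i))"
    proof -
      have "A (\<Sum>i\<in>I. coeff v i *\<^sub>C vec i) = (\<Sum>i\<in>I. coeff v i *\<^sub>C A (vec i))" for I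
        by (induction I rule: infinite_finite_induct) (simp_all add: A_add)
      then show ?thesis using spin_space_expand[OF v] by metis
    qed
    also have "norm \<dots> \<le> (\<Sum>i\<in>?F. norm v * norm (A (vec i)))"
      by (rule sum_norm_le) (simp add: norm_scaleC mult_right_mono cmod_coeff_le_norm)
    also have "\<dots> = norm v * ?e n" unfolding A_def sum_distrib_left ..
    also have "\<dots> \<le> norm v * (1 / 2)" using n by (intro mult_left_mono) auto
    finally show ?thesis by simp
  qed
  have "A x \<in> spin_space l" using P_spin_space[OF l B x] x by (simp add: A_def spin_space_def)
  moreover have "A (A x) = A x" unfolding A_def by (simp add: lin SP.idem[OF B])
  ultimately have "norm (A x) \<le> norm (A x) / 2" using half[of "A x"] by simp
  then have "norm (A x) \<le> 0" by linarith
  then have "P (?B n) x = x" by (simp add: A_def)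
  then show ?thesis by (rule SP.bounded_Domain)
qed

text \<open>Spectral projections of \<open>D\<close> keep vectors of different spin orthogonal, so
  \<open>orth_form\<close> makes \<open>D x\<close> orthogonal to every basis vector of another
  spin.\<close>

lemma D_spin_space:
  assumes l: "0 \<le> l" and x: "x \<in> spin_space l" and xy: "(x, y) \<in> D" shows "y \<in> spin_space l"
  unfolding spin_space_def mem_Collect_eq
proof (intro allI impI)
  fix i :: "real \<times> real \<times> real" assume i: "fst i \<noteq> l"
  show "coeff y i = 0"
  proof (cases "i \<in> spinor_index")
    case True
    then have i0: "0 \<le> fst i" using spinor_indexD(4) by (cases i) force
    obtain z where z: "(vec i, z) \<in> D" using spin_space_Domain[OF i0 vec_spin_space[of i]] by blast
    have "cinner (vec i) y = 0"
      by (rule SP.orth_form[OF z xy], rule spin_space_orthogonal[OF _ _ i])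
        (auto intro: P_spin_space i0 l x vec_spin_space)
    then show ?thesis by (simp add: cinner_vec_left)
  qed (simp add: coeff_outside)
qed

definition dv :: "real \<times> real \<times> real \<Rightarrow> spinor" where "dv i = (THE y. (vec i, y) \<in> D)"

lemma
  assumes "i \<in> spinor_index"
  shows dv: "(vec i, dv i) \<in> D" and dv_spin_space: "dv i \<in> spin_space (fst i)"
proof -
  have i0: "0 \<le> fst i" using assms spinor_indexD(4) by (cases i) force
  obtain z where z: "(vec i, z) \<in> D" using spin_space_Domain[OF i0 vec_spin_space[of i]] by blast
  then show d: "(vec i, dv i) \<in> D" unfolding dv_def by (rule theI) (use z SP.G_unique in blast)
  show "dv i \<in> spin_space (fst i)" by (rule D_spin_space[OF i0 vec_spin_space d])
qed

lemma dv_\<W>: "i \<in> spinor_index \<Longrightarrow> dv i \<in> \<W>"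
  using dv_spin_space spin_space_\<W> by blast

lemma act_D: assumes "(x, y) \<in> D" "x \<in> \<W>" "y \<in> \<W>" shows "(act g x, act g y) \<in> D"
proof -
  have "residue_class (u_relations q) (gen g) \<in> carrier (U\<^sub>q q)" by (simp add: U\<^sub>q_def quotient_carrier)
  then have "(spinor_act q (residue_class (u_relations q) (gen g)) x, spinor_act q (residue_class (u_relations q) (gen g)) y) \<in> D"
    using equivariant assms unfolding equivariant_operator_def by blast
  then show ?thesis by (simp add: spinor_act_class assms U_simps)
qed

lemma act_vec:
  assumes "(l, m, N) \<in> spinor_index" shows "act g (vec (l, m, N)) = of_real (uc g l m) *\<^sub>C vec (l, m + us g, N)"
proof (rule spinor_eqI)
  fix i :: "real \<times> real \<times> real"
  obtain l' m' N' where i: "i = (l', m', N')" by (cases i)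
  show "coeff (act g (vec (l, m, N))) i = coeff (of_real (uc g l m) *\<^sub>C vec (l, m + us g, N)) i"
  proof (cases "l' = l \<and> m' = m + us g \<and> N' = N")
    case True
    then show ?thesis
      using uc_boundary[OF assms, of g] assms unfolding i act_coeff[OF \<W>_vec] by (auto simp: coeff_vec)
  next
    case False
    then have "\<not> (l' = l \<and> m' - us g = m \<and> N' = N)" by auto
    then show ?thesis using False unfolding i act_coeff[OF \<W>_vec] by (auto simp: coeff_vec)
  qed
qed

text \<open>Equivariance under \<open>k\<close> makes the image an eigenvector with eigenvalue
  \<open>q^m\<close>, and these values are distinct for distinct weights.\<close>

lemma coeff_dv_weight:
  assumes I: "(l, m, N) \<in> spinor_index" and n: "(l', m') \<noteq> (l, m)"
  shows "coeff (dv (l, m, N)) (l', m', N') = 0"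
proof (cases "l' = l")
  case False
  then show ?thesis using dv_spin_space[OF I] by (simp add: spin_space_def)
next
  case True
  then have m: "m' \<noteq> m" using n by simp
  let ?v = "vec (l, m, N)" let ?w = "dv (l, m, N)"
  have "(act Uk ?v, act Uk ?w) \<in> D" by (rule act_D[OF dv[OF I] \<W>_vec dv_\<W>[OF I]])
  moreover have "(of_real (q powr m) *\<^sub>C ?v, of_real (q powr m) *\<^sub>C ?w) \<in> D" by (rule SP.G_scale[OF dv[OF I]])
  moreover have "act Uk ?v = of_real (q powr m) *\<^sub>C ?v" using act_vec[OF I, of Uk] by simp
  ultimately have "act Uk ?w = of_real (q powr m) *\<^sub>C ?w" using SP.G_unique by simp
  from arg_cong[OF this, of "\<lambda>x. coeff x (l', m', N')"]
  have "(of_real (q powr m') - of_real (q powr m)) * coeff ?w (l', m', N') = 0"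
    by (simp add: act_coeff[OF dv_\<W>[OF I]] left_diff_distrib)
  moreover have "q powr m' \<noteq> q powr m" using m q0 q1 by (simp add: powr_inj)
  ultimately show ?thesis by simp
qed

text \<open>Equivariance under \<open>f\<close> carries the block from \<open>m\<close> to
  \<open>m + 1\<close>. The factor of \<open>f\<close> is the same on both sides and nonzero,
  because the upper index still belongs to the multiplet.\<close>

lemma coeff_dv_step:
  assumes I: "(l, m, N) \<in> spinor_index" and J: "(l, m + 1, N) \<in> spinor_index"
  shows "coeff (dv (l, m + 1, N)) (l, m + 1, N') = coeff (dv (l, m, N)) (l, m, N')"
proof -
  let ?c = "complex_of_real (uc Uf l m)"
  have "0 < uc Uf l m" using spinor_indexD(5,6)[OF I] spinor_indexD(5,6)[OF J]
    by (simp add: qn_pos)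
  then have "uc Uf l m \<noteq> 0" by linarith
  then have c: "?c \<noteq> 0" unfolding of_real_eq_0_iff .
  have "(act Uf (vec (l, m, N)), act Uf (dv (l, m, N))) \<in> D" by (rule act_D[OF dv[OF I] \<W>_vec dv_\<W>[OF I]])
  moreover have "(?c *\<^sub>C vec (l, m + 1, N), ?c *\<^sub>C dv (l, m + 1, N)) \<in> D" by (rule SP.G_scale[OF dv[OF J]])
  ultimately have "?c *\<^sub>C dv (l, m + 1, N) = act Uf (dv (l, m, N))"
    using act_vec[OF I, of Uf] SP.G_unique by simp
  from arg_cong[OF this, of "\<lambda>x. coeff x (l, m + 1, N')"]
  have "?c * coeff (dv (l, m + 1, N)) (l, m + 1, N') = ?c * coeff (dv (l, m, N)) (l, m, N')"
    by (simp add: act_coeff[OF dv_\<W>[OF I]] del: uc.simps)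
  then show ?thesis using c by (simp del: uc.simps)
qed

lemma coeff_dv_const:
  assumes l: "l \<in> half_spins" and N: "N \<in> {- 1 / 2, 1 / 2}" and j: "real j \<le> 2 * l"
  shows "coeff (dv (l, - l + real j, N)) (l, - l + real j, N') = coeff (dv (l, - l, N)) (l, - l, N')"
  using j
proof (induction j)
  case (Suc j)
  have index: "(l, - l + real k, N) \<in> spinor_index" if "real k \<le> 2 * l" for k
    using that l N unfolding spinor_index_def weights_def by auto
  have I: "(l, - l + real j, N) \<in> spinor_index" by (rule index) (use Suc.prems in simp)
  have J': "(l, - l + real (Suc j), N) \<in> spinor_index" by (rule index[OF Suc.prems])
  have e: "- l + real (Suc j) = (- l + real j) + 1" by simp
  note J = J'[unfolded e]
  show ?case unfolding e coeff_dv_step[OF I J] using Suc by simp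
qed simp

definition Nv :: "2 \<Rightarrow> real" where "Nv i = (if i = 1 then - 1 / 2 else 1 / 2)"

definition block_matrix :: "real \<Rightarrow> complex^2^2" where
  "block_matrix l = (\<chi> i j. coeff (dv (l, - l, Nv j)) (l, - l, Nv i))"

lemma dv_eq:
  assumes l: "l \<in> half_spins" and m: "m \<in> weights l"
  shows "dv (l, m, Nv j) = (block_matrix l $ 1 $ j) *\<^sub>C vec (l, m, - 1 / 2) + (block_matrix l $ 2 $ j) *\<^sub>C vec (l, m, 1 / 2)"
proof (rule spinor_eqI)
  fix i :: "real \<times> real \<times> real"
  obtain l' m' N' where i: "i = (l', m', N')" by (cases i)
  have I: "(l, m, N) \<in> spinor_index" if "N \<in> {- 1 / 2, 1 / 2}" for N using that l m by (simp add: spinor_index_def)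
  have Nv: "Nv j \<in> {- 1 / 2, 1 / 2}" by (simp add: Nv_def)
  obtain k :: nat where k: "m = - l + real k" "real k \<le> 2 * l" using m unfolding weights_def by blast
  have c: "coeff (dv (l, m, Nv j)) (l, m, Nv i) = block_matrix l $ i $ j" for i
    unfolding k(1) coeff_dv_const[OF l Nv k(2)] block_matrix_def by simp
  have n: "Nv 1 = - 1 / 2" "Nv 2 = 1 / 2" by (simp_all add: Nv_def)
  show "coeff (dv (l, m, Nv j)) i = coeff ((block_matrix l $ 1 $ j) *\<^sub>C vec (l, m, - 1 / 2) + (block_matrix l $ 2 $ j) *\<^sub>C vec (l, m, 1 / 2)) i"
  proof (cases "(l', m') = (l, m)")
    case False
    then show ?thesis using coeff_dv_weight[OF I[OF Nv] False] unfolding i by (auto simp: coeff_vec)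
  next
    case True
    then have lm: "l' = l" "m' = m" by auto
    consider "N' = - 1 / 2" | "N' = 1 / 2" | "N' \<notin> {- 1 / 2, 1 / 2}" by blast
    then show ?thesis
    proof cases
      case 1
      then show ?thesis using c[of 1] I[of "- 1 / 2"] unfolding i lm n 1 by (simp add: coeff_vec)
    next
      case 2
      then show ?thesis using c[of 2] I[of "1 / 2"] unfolding i lm n 2 by (simp add: coeff_vec)
    next
      case 3
      then have "i \<notin> spinor_index" unfolding i spinor_index_def by simp
      then show ?thesis by (simp add: coeff_outside)
    qed
  qed
qed

lemma block_matrix_pair:
  assumes l: "l \<in> half_spins" and m: "m \<in> weights l"
  shows "(spinor_pair l m a, spinor_pair l m (block_matrix l *v a)) \<in> D"
proof -
  have I: "(l, m, Nv j) \<in> spinor_index" for j using l m by (simp add: spinor_index_def Nv_def)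
  have n: "Nv 1 = - 1 / 2" "Nv 2 = 1 / 2" by (simp_all add: Nv_def)
  have "((a $ 1) *\<^sub>C vec (l, m, Nv 1) + (a $ 2) *\<^sub>C vec (l, m, Nv 2), (a $ 1) *\<^sub>C dv (l, m, Nv 1) + (a $ 2) *\<^sub>C dv (l, m, Nv 2)) \<in> D"
    by (intro SP.G_add SP.G_scale dv I)
  moreover have "(a $ 1) *\<^sub>C dv (l, m, Nv 1) + (a $ 2) *\<^sub>C dv (l, m, Nv 2) = spinor_pair l m (block_matrix l *v a)"
    unfolding dv_eq[OF l m] spinor_pair_vec matrix_vector_mult_def
    by (simp add: sum_2 scaleC_add_left scaleC_add_right scaleC_scaleC algebra_simps)
  ultimately show ?thesis unfolding spinor_pair_vec n by simp
qed

lemma block_matrix_hermitian: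
  assumes l: "l \<in> half_spins" shows "conj_transpose (block_matrix l) = block_matrix l"
proof -
  have "- l \<in> weights l" using half_spins_ge[OF l] unfolding weights_def by (auto intro!: exI[of _ 0])
  then have I: "(l, - l, Nv j) \<in> spinor_index" for j using l by (simp add: spinor_index_def Nv_def)
  have "cnj (coeff (dv (l, - l, Nv i)) (l, - l, Nv j)) = coeff (dv (l, - l, Nv j)) (l, - l, Nv i)" for i j
  proof -
    have "(vec (l, - l, Nv i), dv (l, - l, Nv i)) \<in> adjoint_operator D"
      using self_adj dv[OF I[of i]] unfolding self_adjoint_def by simp
    then have "cinner (vec (l, - l, Nv i)) (dv (l, - l, Nv j)) = cinner (dv (l, - l, Nv i)) (vec (l, - l, Nv j))"
      using dv[OF I[of j]] unfolding adjoint_operator_def by blast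
    then show ?thesis by (simp add: cinner_vec_left cinner_vec_right)
  qed
  then show ?thesis by (simp add: vec_eq_iff conj_transpose_def block_matrix_def)
qed

lemma block_form_exists: "\<exists>U d_up d_down. block_form D U d_up d_down"
proof -
  have "\<forall>l\<in>half_spins. \<exists>z. unitary_matrix (fst z) \<and> snd (snd z) \<le> fst (snd z) \<and>
    block_matrix l = conj_transpose (fst z) ** diag2 (fst (snd z)) (snd (snd z)) ** fst z"
    using hermitian2_diagonalization[OF block_matrix_hermitian] by (metis fst_conv snd_conv)
  then obtain z where z: "\<forall>l\<in>half_spins. unitary_matrix (fst (z l)) \<and> snd (snd (z l)) \<le> fst (snd (z l)) \<and>
    block_matrix l = conj_transpose (fst (z l)) ** diag2 (fst (snd (z l))) (snd (snd (z l))) ** fst (z l)"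
    unfolding bchoice_iff by blast
  have "block_form D (\<lambda>l. fst (z l)) (\<lambda>l. fst (snd (z l))) (\<lambda>l. snd (snd (z l)))"
    unfolding block_form_def dirac_matrix_def
    using z block_matrix_pair by (metis (no_types, lifting))
  then show ?thesis by blast
qed

end

section \<open>Entries of the blocks\<close>

text \<open>Entries of the adjoint of \<open>U\<close> times the diagonal matrix of \<open>x\<close>
  and \<open>y\<close> times \<open>U\<close>. Complex \<open>x\<close> and \<open>y\<close> are
  allowed, so the blocks of \<open>D\<close> and of its resolvent are treated alike.\<close>

definition entry :: "complex^2^2 \<Rightarrow> complex \<Rightarrow> complex \<Rightarrow> 2 \<Rightarrow> 2 \<Rightarrow> complex" where
  "entry U x y i j = cnj (U $ 1 $ i) * x * U $ 1 $ j + cnj (U $ 2 $ i) * y * U $ 2 $ j"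

context
  fixes U :: "complex^2^2"
  assumes U: "unitary_matrix U"
begin

lemma unitary_rows:
  "U $ 1 $ 1 * cnj (U $ 1 $ 1) + U $ 1 $ 2 * cnj (U $ 1 $ 2) = 1"
  "U $ 2 $ 1 * cnj (U $ 2 $ 1) + U $ 2 $ 2 * cnj (U $ 2 $ 2) = 1"
  "U $ 1 $ 1 * cnj (U $ 2 $ 1) + U $ 1 $ 2 * cnj (U $ 2 $ 2) = 0"
  "U $ 2 $ 1 * cnj (U $ 1 $ 1) + U $ 2 $ 2 * cnj (U $ 1 $ 2) = 0"
proof -
  have e: "U ** conj_transpose U = mat 1" using U unfolding unitary_matrix_def by blast
  have "U $ i $ 1 * cnj (U $ j $ 1) + U $ i $ 2 * cnj (U $ j $ 2) = (if i = j then 1 else 0)" for i j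
    using arg_cong[OF e, of "\<lambda>A. A $ i $ j"] by (simp add: matrix_matrix_mult_def sum_2 conj_transpose_def mat_def)
  note this[of 1 1] this[of 2 2] this[of 1 2] this[of 2 1]
  then show "U $ 1 $ 1 * cnj (U $ 1 $ 1) + U $ 1 $ 2 * cnj (U $ 1 $ 2) = 1"
    "U $ 2 $ 1 * cnj (U $ 2 $ 1) + U $ 2 $ 2 * cnj (U $ 2 $ 2) = 1"
    "U $ 1 $ 1 * cnj (U $ 2 $ 1) + U $ 1 $ 2 * cnj (U $ 2 $ 2) = 0"
    "U $ 2 $ 1 * cnj (U $ 1 $ 1) + U $ 2 $ 2 * cnj (U $ 1 $ 2) = 0" by simp_all
qed

lemma entry_one: "entry U 1 1 i j = (if i = j then 1 else 0)"
proof -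
  have e: "conj_transpose U ** U = mat 1" using U unfolding unitary_matrix_def by blast
  show ?thesis unfolding entry_def
    using arg_cong[OF e, of "\<lambda>A. A $ i $ j"] by (simp add: matrix_matrix_mult_def sum_2 conj_transpose_def mat_def)
qed

text \<open>Conjugation by a fixed unitary is multiplicative because the rows of \<open>U\<close>
  are orthonormal; inverting a block thus reduces to inverting its two eigenvalues.\<close>

lemma entry_mult:
  "entry U x y i 1 * entry U x' y' 1 j + entry U x y i 2 * entry U x' y' 2 j = entry U (x * x') (y * y') i j"
proof -
  have expand: "(a * u + b * v) * (u' * c + v' * d) + (a * r + b * s) * (r' * c + s' * d)
    = a * (u * u' + r * r') * c + a * (u * v' + r * s') * d + b * (v * u' + s * r') * c + b * (v * v' + s * s') * d"
    for a b c d u v r s u' v' r' s' :: complex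
    by (simp only: distrib_left distrib_right ac_simps)
  have e: "entry U x' y' k j = cnj (U $ 1 $ k) * (x' * U $ 1 $ j) + cnj (U $ 2 $ k) * (y' * U $ 2 $ j)" for k
    by (simp only: entry_def mult.assoc)
  have "entry U x y i 1 * entry U x' y' 1 j + entry U x y i 2 * entry U x' y' 2 j
    = cnj (U $ 1 $ i) * x * (x' * U $ 1 $ j) + cnj (U $ 2 $ i) * y * (y' * U $ 2 $ j)"
    unfolding e entry_def[of U x y] expand unitary_rows by (simp only: mult_1_right mult_zero_right mult_zero_left add_0_right)
  then show ?thesis by (simp only: entry_def mult.assoc)
qed

lemma cmod_entry_le: "cmod (entry U x y i j) \<le> cmod x + cmod y"
proof -
  have sq: "z * cnj z = of_real ((cmod z)\<^sup>2)" for z using complex_norm_square[of z] by simp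
  have "complex_of_real ((cmod (U $ 1 $ 1))\<^sup>2 + (cmod (U $ 1 $ 2))\<^sup>2) = of_real 1"
    "complex_of_real ((cmod (U $ 2 $ 1))\<^sup>2 + (cmod (U $ 2 $ 2))\<^sup>2) = of_real 1"
    using unitary_rows(1,2) unfolding sq by (simp_all only: of_real_add of_real_1)
  then have n: "(cmod (U $ 1 $ 1))\<^sup>2 + (cmod (U $ 1 $ 2))\<^sup>2 = 1" "(cmod (U $ 2 $ 1))\<^sup>2 + (cmod (U $ 2 $ 2))\<^sup>2 = 1"
    by (simp_all only: of_real_eq_iff)
  have sq_le: "a\<^sup>2 + b\<^sup>2 = 1 \<Longrightarrow> a\<^sup>2 \<le> 1 \<and> b\<^sup>2 \<le> 1" for a b :: real
    using zero_le_power2[of a] zero_le_power2[of b] by linarith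
  have "\<forall>k i. (cmod (U $ k $ i))\<^sup>2 \<le> 1"
    unfolding forall_2 using sq_le[OF n(1)] sq_le[OF n(2)] by blast
  then have le: "cmod (U $ k $ i) \<le> 1" for k i
    by (simp add: abs_square_le_1)
  have "cmod (cnj (U $ k $ i) * z * U $ k $ j) \<le> cmod z" for k z
  proof -
    have "cmod (U $ k $ i) * cmod z * cmod (U $ k $ j) \<le> 1 * cmod z * 1"
      by (intro mult_mono le) auto
    then show ?thesis by (simp add: norm_mult)
  qed
  then show ?thesis unfolding entry_def by (meson add_mono norm_triangle_ineq order_trans)
qed

end

lemma dirac_matrix_entry: "dirac_matrix U u d l $ i $ j = entry (U l) (of_real (u l)) (of_real (d l)) i j"
  by (simp add: dirac_matrix_def entry_def matrix_matrix_mult_def sum_2 conj_transpose_def diag2_def)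

lemma entry_hermitian: "cnj (entry U (of_real x) (of_real y) i j) = entry U (of_real x) (of_real y) j i"
  by (simp add: entry_def mult_ac)

definition ix :: "real \<Rightarrow> 2" where "ix N = (if N = 1 / 2 then 2 else 1)"

lemma ix_simps [simp]: "ix (1 / 2) = 2" "ix (- (1 / 2)) = 1" "ix (- 1 / 2) = 1"
  by (simp_all add: ix_def)

locale dirac_blocks =
  fixes D :: "(spinor \<times> spinor) set" and U :: "real \<Rightarrow> complex^2^2" and u d :: "real \<Rightarrow> real"
  assumes self_adj: "self_adjoint D" and blocks: "block_form D U u d"
begin

definition da :: "real \<Rightarrow> real \<Rightarrow> complex" where
  "da l N = entry (U l) (of_real (u l)) (of_real (d l)) (ix N) (ix N)"

definition db :: "real \<Rightarrow> real \<Rightarrow> complex" where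
  "db l N = entry (U l) (of_real (u l)) (of_real (d l)) (ix N) (ix (- N))"

lemma unitary: "l \<in> half_spins \<Longrightarrow> unitary_matrix (U l)"
  using blocks unfolding block_form_def by blast

sublocale block_operator D da db
proof
  fix l m N assume I: "(l, m, N) \<in> spinor_index"
  note D = spinor_indexD[OF I]
  define v :: "complex^2" where "v = (\<chi> i. if i = ix N then 1 else 0)"
  have pair: "(spinor_pair l m v, spinor_pair l m (dirac_matrix U u d l *v v)) \<in> D"
    using blocks D(1,2) unfolding block_form_def by blast
  have N: "N = - 1 / 2 \<or> N = 1 / 2" using D(3) by simp
  have "spinor_pair l m v = vec (l, m, N)"
    unfolding v_def spinor_pair_vec using N by (elim disjE; hypsubst) simp_all
  moreover have "spinor_pair l m (dirac_matrix U u d l *v v) = da l N *\<^sub>C vec (l, m, N) + db l (- N) *\<^sub>C vec (l, m, - N)"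
    unfolding v_def spinor_pair_vec da_def db_def using N by (elim disjE; hypsubst)
      (simp_all add: matrix_vector_mult_def sum_2 dirac_matrix_entry add.commute)
  ultimately show "(vec (l, m, N), da l N *\<^sub>C vec (l, m, N) + db l (- N) *\<^sub>C vec (l, m, - N)) \<in> D" using pair by simp
qed (simp_all add: self_adj da_def db_def entry_hermitian)

lemma compact_resolvent:
  assumes "filterlim (\<lambda>n. \<bar>u (real n + 1 / 2)\<bar>) at_top sequentially"
    and "filterlim (\<lambda>n. \<bar>d (real n + 1 / 2)\<bar>) at_top sequentially"
  shows "compact_resolvent D"
proof -
  define x y where "x l = inverse (complex_of_real (u l) + \<i>)" and "y l = inverse (complex_of_real (d l) + \<i>)" for l
  have nz: "complex_of_real r + \<i> \<noteq> 0" for r by (simp add: complex_eq_iff)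
  have xp: "(complex_of_real (u l) + \<i>) * x l = 1" "(complex_of_real (d l) + \<i>) * y l = 1"
    "x l * (complex_of_real (u l) + \<i>) = 1" "y l * (complex_of_real (d l) + \<i>) = 1" for l
    unfolding x_def y_def using nz by simp_all
  show ?thesis
  proof (rule compact_resolventI[where r = "\<lambda>l N. entry (U l) (x l) (y l) (ix N) (ix N)"
        and s = "\<lambda>l N. entry (U l) (x l) (y l) (ix N) (ix (- N))" and \<rho> = "\<lambda>l. cmod (x l) + cmod (y l)"])
    fix l N :: real assume l: "l \<in> half_spins" and N: "N \<in> {- 1 / 2, 1 / 2}"
    let ?E = "entry (U l) (of_real (u l)) (of_real (d l))" and ?P = "entry (U l) (of_real (u l) + \<i>) (of_real (d l) + \<i>)"
      and ?R = "entry (U l) (x l) (y l)"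
    have P: "?P i j = ?E i j + \<i> * (if i = j then 1 else 0)" for i j
      unfolding entry_one[OF unitary[OF l], symmetric] by (simp add: entry_def algebra_simps)
    have PR: "?P i 1 * ?R 1 j + ?P i 2 * ?R 2 j = (if i = j then 1 else 0)"
      "?R i 1 * ?P 1 j + ?R i 2 * ?P 2 j = (if i = j then 1 else 0)" for i j
      unfolding entry_mult[OF unitary[OF l]] xp by (rule entry_one[OF unitary[OF l]])+
    have z: "(1 :: 2) \<noteq> 2" "(2 :: 2) \<noteq> 1" by simp_all
    note f = PR[unfolded P]
    show "(da l N + \<i>) * ?R (ix N) (ix N) + db l N * ?R (ix (- N)) (ix (- (- N))) = 1 \<and>
      (da l N + \<i>) * ?R (ix N) (ix (- N)) + db l N * ?R (ix (- N)) (ix (- N)) = 0 \<and>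
      ?R (ix N) (ix N) * (da l N + \<i>) + ?R (ix N) (ix (- N)) * db l (- N) = 1 \<and>
      ?R (ix N) (ix N) * db l N + ?R (ix N) (ix (- N)) * (da l (- N) + \<i>) = 0"
      using N
    proof (rule pm_halfE)
      assume N: "N = - 1 / 2"
      show ?thesis using f(1)[of 1 1] f(1)[of 1 2] f(2)[of 1 1] f(2)[of 1 2]
        unfolding da_def db_def N by (simp add: z)
    next
      assume N: "N = 1 / 2"
      show ?thesis using f(1)[of 2 2] f(1)[of 2 1] f(2)[of 2 2] f(2)[of 2 1]
        unfolding da_def db_def N by (simp add: z add.commute)
    qed
    show "cmod (?R (ix N) (ix N)) \<le> cmod (x l) + cmod (y l) \<and> cmod (?R (ix N) (ix (- N))) \<le> cmod (x l) + cmod (y l)"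
      by (intro conjI cmod_entry_le unitary l)
  next
    have lim: "(\<lambda>n. cmod (inverse (complex_of_real (f n) + \<i>))) \<longlonglongrightarrow> 0" if "filterlim (\<lambda>n. \<bar>f n\<bar>) at_top sequentially" for f
    proof -
      have le: "\<bar>f n\<bar> \<le> cmod (complex_of_real (f n) + \<i>)" for n using abs_Re_le_cmod[of "complex_of_real (f n) + \<i>"] by simp
      have "filterlim (\<lambda>n. cmod (complex_of_real (f n) + \<i>)) at_top sequentially"
        by (rule filterlim_at_top_mono[OF that]) (simp add: le)
      then show ?thesis unfolding norm_inverse by (rule tendsto_inverse_0_at_top)
    qed
    show "(\<lambda>n. cmod (x (real n + 1 / 2)) + cmod (y (real n + 1 / 2))) \<longlonglongrightarrow> 0"
      using tendsto_add[OF lim[OF assms(1)] lim[OF assms(2)]] unfolding x_def y_def by simp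
  qed
qed

lemma entries_le:
  assumes "l \<in> half_spins" shows "cmod (da l N) \<le> \<bar>u l\<bar> + \<bar>d l\<bar>" "cmod (db l N) \<le> \<bar>u l\<bar> + \<bar>d l\<bar>"
  unfolding da_def db_def
  using cmod_entry_le[OF unitary[OF assms], of "of_real (u l)" "of_real (d l)"] by simp_all

lemma entries_diff_le:
  assumes "onorm ((*v) (dirac_matrix U u d (l + 1) - dirac_matrix U u d l)) \<le> C"
  shows "cmod (da (l + 1) N - da l N) \<le> C" "cmod (db (l + 1) N - db l N) \<le> C"
proof -
  define A where "A = dirac_matrix U u d (l + 1) - dirac_matrix U u d l"
  have "cmod (A $ i $ j) \<le> C" for i j
  proof -
    have bl: "bounded_linear ((*v) A)" by (rule matrix_vector_mul_bounded_linear)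
    have "A $ i $ j = (A *v axis j 1) $ i" by (simp add: matrix_vector_mul_component axis_def inner_vec_def matrix_vector_mult_def if_distrib cong: if_cong)
    then have "cmod (A $ i $ j) \<le> norm (A *v axis j 1)" using component_le_norm_cart by (metis Finite_Cartesian_Product.norm_nth_le)
    also have "\<dots> \<le> onorm ((*v) A) * norm (axis j (1 :: complex))" by (rule onorm[OF bl])
    also have "norm (axis j (1 :: complex) :: complex^2) = 1"
    proof -
      have "norm (axis j (1 :: complex) :: complex^2) = sqrt (\<Sum>i\<in>UNIV. if i = j then 1 else 0)"
        unfolding norm_vec_def L2_set_def axis_def by (rule arg_cong[where f = sqrt], rule sum.cong) auto
      then show ?thesis by simp
    qed
    finally show ?thesis using assms unfolding A_def by simp
  qed
  then show "cmod (da (l + 1) N - da l N) \<le> C" "cmod (db (l + 1) N - db l N) \<le> C"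
    unfolding da_def db_def dirac_matrix_entry[symmetric] A_def by (metis vector_minus_component)+
qed

end

section \<open>The commutators\<close>

context podles
begin

text \<open>The estimates left after the bounded Clebsch-Gordan factors are removed:
  \<open>h1\<close> for the diagonal entries of the blocks, \<open>h2\<close> and \<open>h3\<close>
  for the off-diagonal ones in the raising and the lowering part, \<open>h4\<close> for the part
  that keeps the spin. There the diagonal entries cancel.\<close>

lemma bounded_commutator_xop:
  assumes bo: "block_operator D a b" and B: "0 \<le> B"
    and h1: "\<And>l N. l \<in> half_spins \<Longrightarrow> N \<in> {- 1 / 2, 1 / 2} \<Longrightarrow> cmod (a (l + 1) N - a l N) * \<bar>AN N (l + 1)\<bar> \<le> B"
    and h2: "\<And>l N. l \<in> half_spins \<Longrightarrow> N \<in> {- 1 / 2, 1 / 2} \<Longrightarrow>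
      cmod (b (l + 1) N * of_real (AN (- N) (l + 1)) - b l N * of_real (AN N (l + 1))) \<le> B"
    and h3: "\<And>l N. l \<in> half_spins \<Longrightarrow> N \<in> {- 1 / 2, 1 / 2} \<Longrightarrow>
      cmod (b l N * of_real (AN (- N) (l + 1)) - b (l + 1) N * of_real (AN N (l + 1))) \<le> B"
    and h4: "\<And>l N. l \<in> half_spins \<Longrightarrow> N \<in> {- 1 / 2, 1 / 2} \<Longrightarrow> cmod (b l N) * \<bar>BN (- N) l - BN N l\<bar> \<le> B"
  shows "bounded_commutator D (xop x)"
proof -
  interpret block_operator D a b by (rule bo)
  obtain K where K: "0 \<le> K"
    "\<And>l m N. (l, m, N) \<in> spinor_index \<Longrightarrow> (l + 1, m - idx x, N) \<in> spinor_index \<Longrightarrow>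
      \<bar>cminus x (l + 1) (m - idx x) * AN N (l + 1)\<bar> \<le> K"
    "\<And>l m N. (l, m, N) \<in> spinor_index \<Longrightarrow> (l, m - idx x, N) \<in> spinor_index \<Longrightarrow>
      \<bar>czero x l (m - idx x) * BN N l\<bar> \<le> K"
    "\<And>l m N. (l, m, N) \<in> spinor_index \<Longrightarrow> (l - 1, m - idx x, N) \<in> spinor_index \<Longrightarrow>
      \<bar>cplus x (l - 1) (m - idx x) * AN N l\<bar> \<le> K"
    using xop_weights[of x] by blast
  have cX: "0 \<le> cX" by (rule cX_ge(6))
  have KB: "0 \<le> K + cX * B" "K \<le> K + cX * B" "cX * B \<le> K + cX * B" using K(1) B cX by auto
  have mul: "cmod (z * of_real c) \<le> K + cX * B" if "cmod z \<le> B" "\<bar>c\<bar> \<le> cX" for z c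
  proof -
    have "cmod z * \<bar>c\<bar> \<le> B * cX" using that B by (intro mult_mono) auto
    then show ?thesis using K(1) by (simp add: norm_mult mult.commute)
  qed
  have "bounded_commutator D (wshift (\<lambda>(l, m, N). of_real (cminus x (l + 1) (m - idx x) * AN N (l + 1))) (\<lambda>(l, m, N). (l + 1, m + - idx x, N)))"
  proof (rule commutator_wshift[OF KB(1)])
    fix l m N assume I: "(l, m, N) \<in> spinor_index" and J: "(l + 1, m + - idx x, N) \<in> spinor_index"
    have J': "(l + 1, m - idx x, N) \<in> spinor_index" using J by simp
    note D = spinor_indexD(1,3)[OF I]
    have c: "\<bar>cminus x (l + 1) (m - idx x)\<bar> \<le> cX" by (rule cminus_bound[OF J']) (use I in simp)
    show "cmod (complex_of_real (cminus x (l + 1) (m - idx x) * AN N (l + 1))) \<le> K + cX * B"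
      using K(2)[OF I J'] KB unfolding norm_of_real by linarith
    have "cmod ((a l N - a (l + 1) N) * of_real (AN N (l + 1))) \<le> B"
      using h1[OF D] by (simp add: norm_mult norm_minus_commute)
    from mul[OF this c] show "cmod ((a l N - a (l + 1) N) * of_real (cminus x (l + 1) (m - idx x) * AN N (l + 1))) \<le> K + cX * B"
      by (simp only: of_real_mult ac_simps)
    from mul[OF h3[OF D] c]
    show "cmod (b l N * of_real (cminus x (l + 1) (m - idx x) * AN (- N) (l + 1))
      - b (l + 1) N * of_real (cminus x (l + 1) (m - idx x) * AN N (l + 1))) \<le> K + cX * B"
      by (simp only: of_real_mult left_diff_distrib right_diff_distrib ac_simps)
  qed
  moreover have "bounded_commutator D (wshift (\<lambda>(l, m, N). of_real (czero x l (m - idx x) * BN N l)) (\<lambda>(l, m, N). (l + 0, m + - idx x, N)))"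
  proof (rule commutator_wshift[OF KB(1)])
    fix l m N assume I: "(l, m, N) \<in> spinor_index" and J: "(l + 0, m + - idx x, N) \<in> spinor_index"
    have J': "(l, m - idx x, N) \<in> spinor_index" using J by simp
    note D = spinor_indexD(1,3)[OF I]
    have c: "\<bar>czero x l (m - idx x)\<bar> \<le> cX" by (rule czero_bound[OF J']) (use I in simp)
    show "cmod (complex_of_real (czero x l (m - idx x) * BN N l)) \<le> K + cX * B"
      using K(3)[OF I J'] KB unfolding norm_of_real by linarith
    show "cmod ((a l N - a (l + 0) N) * of_real (czero x l (m - idx x) * BN N l)) \<le> K + cX * B" using KB by simp
    have "cmod (b l N * of_real (BN (- N) l - BN N l)) \<le> B" using h4[OF D] by (simp only: norm_mult norm_of_real)
    from mul[OF this c]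
    show "cmod (b l N * of_real (czero x l (m - idx x) * BN (- N) l)
      - b (l + 0) N * of_real (czero x l (m - idx x) * BN N l)) \<le> K + cX * B"
      unfolding add_0_right by (simp only: of_real_mult of_real_diff left_diff_distrib right_diff_distrib ac_simps)
  qed
  moreover have "bounded_commutator D (wshift (\<lambda>(l, m, N). of_real (cplus x (l - 1) (m - idx x) * AN N l)) (\<lambda>(l, m, N). (l + - 1, m + - idx x, N)))"
  proof (rule commutator_wshift[OF KB(1)])
    fix l m N assume I: "(l, m, N) \<in> spinor_index" and J: "(l + - 1, m + - idx x, N) \<in> spinor_index"
    have J': "(l - 1, m - idx x, N) \<in> spinor_index" using J by simp
    note D = spinor_indexD(1,3)[OF J']
    have e: "l - 1 + 1 = l" "l + - 1 = l - 1" by simp_all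
    have c: "\<bar>cplus x (l - 1) (m - idx x)\<bar> \<le> cX" by (rule cplus_bound[OF J'])
    show "cmod (complex_of_real (cplus x (l - 1) (m - idx x) * AN N l)) \<le> K + cX * B"
      using K(4)[OF I J'] KB unfolding norm_of_real by linarith
    have "cmod ((a l N - a (l - 1) N) * of_real (AN N l)) \<le> B"
      using h1[OF D] unfolding e by (simp add: norm_mult)
    from mul[OF this c] show "cmod ((a l N - a (l + - 1) N) * of_real (cplus x (l - 1) (m - idx x) * AN N l)) \<le> K + cX * B"
      unfolding e by (simp only: of_real_mult ac_simps)
    from mul[OF h2[OF D, unfolded e] c]
    show "cmod (b l N * of_real (cplus x (l - 1) (m - idx x) * AN (- N) l)
      - b (l + - 1) N * of_real (cplus x (l - 1) (m - idx x) * AN N l)) \<le> K + cX * B"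
      unfolding e by (simp only: of_real_mult left_diff_distrib right_diff_distrib ac_simps)
  qed
  ultimately show ?thesis unfolding xop_def[abs_def] add_uminus_conv_diff add_0_right
    by (intro bounded_commutator_add lin)
qed

lemma bounded_commutator_fr:
  assumes D: "linear_operator D" and x: "\<And>x. bounded_commutator D (xop x)"
  shows "bounded_commutator D (fr a)"
proof (induction a rule: free_alg_induct)
  case (cst c)
  have "fr (cst c) = (\<lambda>\<xi>. c *\<^sub>C \<xi>)" by (rule ext) (simp add: fr_simps)
  then show ?case using bounded_commutator_scaleC[OF D] by simp
next
  case (gen x a)
  have "fr (gen x * a) = (\<lambda>\<xi>. xop x (fr a \<xi>))" by (rule ext) (simp add: fr_mult fr_simps)
  then show ?case using bounded_commutator_comp[OF fr_clinear xop_clinear x gen] by simp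
next
  case (add a b)
  have "fr (a + b) = (\<lambda>\<xi>. fr a \<xi> + fr b \<xi>)" by (rule ext) (simp add: fr_simps)
  then show ?case using bounded_commutator_add[OF D add] by simp
qed

text \<open>From \<open>x \<le> exp x\<close> the product \<open>l * q^(2l)\<close> is at most
  \<open>1 / (2 * k)\<close>; the factor \<open>3\<close> accounts for
  \<open>1 + l \<le> 3 * l\<close>.\<close>

lemma linear_times_powr_bound: "\<exists>K\<ge>0. \<forall>l\<ge>1 / 2. (1 + l) * q powr (2 * l) \<le> K"
proof (intro exI conjI allI impI)
  define k where "k = - ln q"
  have k: "0 < k" using q0 q1 by (simp add: k_def)
  show "0 \<le> 3 / (2 * k)" using k by simp
  fix l :: real assume l: "1 / 2 \<le> l"
  have e: "q powr (2 * l) = exp (- (2 * l * k))" using q0 by (simp add: powr_def k_def)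
  have "2 * l * k \<le> exp (2 * l * k)" using exp_ge_add_one_self[of "2 * l * k"] by linarith
  then have "2 * l * k * exp (- (2 * l * k)) \<le> exp (2 * l * k) * exp (- (2 * l * k))" by (rule mult_right_mono) simp
  also have "\<dots> = 1" by (simp flip: exp_add)
  finally have "2 * k * (l * q powr (2 * l)) \<le> 1" unfolding e by (simp only: ac_simps)
  then have "l * q powr (2 * l) \<le> 1 / (2 * k)" using k by (simp add: pos_le_divide_eq mult.commute)
  moreover have "(1 + l) * q powr (2 * l) \<le> (3 * l) * q powr (2 * l)" using l by (intro mult_right_mono) auto
  ultimately show "(1 + l) * q powr (2 * l) \<le> 3 / (2 * k)" by simp
qed

lemma commutator_case_i:
  assumes bl: "dirac_blocks D V u d" and t: "t \<noteq> 1"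
    and C: "\<And>l. l \<in> half_spins \<Longrightarrow> onorm ((*v) (dirac_matrix V u d (l + 1) - dirac_matrix V u d l)) < C"
  shows "bounded_commutator D (xop x)"
proof -
  interpret dirac_blocks D V u d by (rule bl)
  obtain c where c: "0 \<le> c" "\<And>l N. l \<in> half_spins \<Longrightarrow> N \<in> {- 1 / 2, 1 / 2} \<Longrightarrow> \<bar>AN N l\<bar> \<le> c"
    using alphaN_bound by blast
  obtain c1 where c1: "0 \<le> c1" "\<And>l N N'. l \<in> half_spins \<Longrightarrow> N \<in> {- 1 / 2, 1 / 2} \<Longrightarrow> N' \<in> {- 1 / 2, 1 / 2} \<Longrightarrow>
    \<bar>AN N l - AN N' l\<bar> \<le> c1 * q powr (2 * l)" using alphaN_diff_bound[OF t] by blast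
  obtain c2 where c2: "0 \<le> c2" "\<And>l N N'. l \<in> half_spins \<Longrightarrow> N \<in> {- 1 / 2, 1 / 2} \<Longrightarrow> N' \<in> {- 1 / 2, 1 / 2} \<Longrightarrow>
    \<bar>BN N l - BN N' l\<bar> \<le> c2 * q powr (2 * l)" using betaN_diff_bound by blast
  obtain E where E: "0 \<le> E" "\<And>l. 1 / 2 \<le> l \<Longrightarrow> (1 + l) * q powr (2 * l) \<le> E" using linear_times_powr_bound by blast
  have dd: "cmod (da (l + 1) N - da l N) \<le> C" "cmod (db (l + 1) N - db l N) \<le> C" if "l \<in> half_spins" for l N
    using entries_diff_le[OF less_imp_le[OF C[OF that]]] by blast+
  have half: "1 / 2 \<in> half_spins" unfolding half_spins_def by (auto intro!: exI[of _ 0])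
  have C0: "0 \<le> C" using dd(1)[OF half, of 0] norm_ge_zero order_trans by blast
  define K where "K = C + cmod (db (1 / 2) (1 / 2)) + cmod (db (1 / 2) (- 1 / 2))"
  have K0: "0 \<le> K" using C0 by (simp add: K_def)
  \<comment> \<open>Telescoping from \<open>l = 1 / 2\<close> with increments at most
    \<open>C\<close>; \<open>K\<close> contains the initial entries for both signs of
    \<open>N\<close>.\<close>
  have grow: "cmod (db l N) \<le> K * (1 + l)" if l: "l \<in> half_spins" and N: "N \<in> {- 1 / 2, 1 / 2}" for l N
  proof -
    obtain n :: nat where n: "l = real n + 1 / 2" using l unfolding half_spins_def by blast
    have "cmod (db (real n + 1 / 2) N) \<le> cmod (db (1 / 2) N) + real n * C"
    proof (induction n)
      case (Suc n)
      have h: "real n + 1 / 2 \<in> half_spins" unfolding half_spins_def by blast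
      have e: "real (Suc n) + 1 / 2 = real n + 1 / 2 + 1" by simp
      have "cmod (db (real n + 1 / 2 + 1) N) \<le> cmod (db (real n + 1 / 2) N) + C"
        using dd(2)[OF h, of N] norm_triangle_sub[of "db (real n + 1 / 2 + 1) N" "db (real n + 1 / 2) N"] by linarith
      then show ?case using Suc unfolding e by (simp add: algebra_simps)
    qed simp
    also have "cmod (db (1 / 2) N) \<le> K"
    proof -
      have "N = - 1 / 2 \<or> N = 1 / 2" using N by simp
      then show ?thesis unfolding K_def by (elim disjE; hypsubst) (use C0 in simp_all)
    qed
    also have "real n * C \<le> l * K"
      using C0 by (intro mult_mono) (simp_all add: n K_def)
    finally show ?thesis unfolding n by (simp add: algebra_simps)
  qed
  have mix: "cmod (db l N) * \<bar>z\<bar> \<le> K * e * E" if "l \<in> half_spins" "N \<in> {- 1 / 2, 1 / 2}" "\<bar>z\<bar> \<le> e * q powr (2 * l)" "0 \<le> e" for l N z e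
  proof -
    have "cmod (db l N) * \<bar>z\<bar> \<le> (K * (1 + l)) * (e * q powr (2 * l))"
      using grow[OF that(1,2)] that(3) by (intro mult_mono) (auto intro: order_trans[OF norm_ge_zero])
    also have "\<dots> = K * e * ((1 + l) * q powr (2 * l))" by (simp only: ac_simps)
    also have "\<dots> \<le> K * e * E" using E(2)[OF half_spins_ge[OF that(1)]] K0 that(4) by (intro mult_left_mono) auto
    finally show ?thesis .
  qed
  define B where "B = C * c + K * c1 * E + K * c2 * E"
  have nn: "0 \<le> C * c" "0 \<le> K * c1 * E" "0 \<le> K * c2 * E" using C0 c(1) K0 c1(1) c2(1) E(1) by simp_all
  have Cc: "cmod z * \<bar>r\<bar> \<le> C * c" if "cmod z \<le> C" "\<bar>r\<bar> \<le> c" for z r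
    using that C0 by (intro mult_mono) auto
  have ab: "cmod (db l N * complex_of_real (AN (- N) (l + 1) - AN N (l + 1))) \<le> K * c1 * E"
    if l: "l \<in> half_spins" and N: "N \<in> {- 1 / 2, 1 / 2}" for l N
  proof -
    have "\<bar>AN (- N) (l + 1) - AN N (l + 1)\<bar> \<le> c1 * q powr (2 * (l + 1))"
      by (rule c1(2)) (use half_spins_Suc[OF l] N in auto)
    also have "\<dots> \<le> c1 * q powr (2 * l)" using q0 q1 c1(1) by (intro mult_left_mono powr_mono') auto
    finally show ?thesis using mix[OF l N _ c1(1)] unfolding norm_mult norm_of_real by blast
  qed
  show ?thesis
  proof (rule bounded_commutator_xop[OF block_operator_axioms, where B = B])
    show "0 \<le> B" unfolding B_def using nn by linarith
    fix l N :: real assume l: "l \<in> half_spins" and N: "N \<in> {- 1 / 2, 1 / 2}"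
    have N': "- N \<in> {- 1 / 2, 1 / 2}" using N by auto
    note l' = half_spins_Suc[OF l]
    show "cmod (da (l + 1) N - da l N) * \<bar>AN N (l + 1)\<bar> \<le> B"
      using Cc[OF dd(1)[OF l] c(2)[OF l' N]] nn unfolding B_def by (meson add_increasing2 order_trans)
    have 1: "cmod ((db (l + 1) N - db l N) * of_real (AN M (l + 1))) \<le> C * c" if "M \<in> {- 1 / 2, 1 / 2}" for M
      using Cc[OF dd(2)[OF l] c(2)[OF l' that]] unfolding norm_mult norm_of_real .
    \<comment> \<open>The commutator splits into a bounded increment of the blocks times
      \<open>alphaN\<close>, and an entry of linear growth times a difference in \<open>N\<close>
      that decays exponentially.\<close>
    have eq1: "db (l + 1) N * complex_of_real (AN (- N) (l + 1)) - db l N * of_real (AN N (l + 1))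
      = (db (l + 1) N - db l N) * of_real (AN (- N) (l + 1)) + db l N * of_real (AN (- N) (l + 1) - AN N (l + 1))"
      by (simp add: algebra_simps)
    show "cmod (db (l + 1) N * complex_of_real (AN (- N) (l + 1)) - db l N * of_real (AN N (l + 1))) \<le> B"
      unfolding eq1
      using norm_triangle_ineq[of "(db (l + 1) N - db l N) * of_real (AN (- N) (l + 1))" "db l N * of_real (AN (- N) (l + 1) - AN N (l + 1))"]
        1[OF N'] ab[OF l N] nn unfolding B_def by linarith
    have eq2: "db l N * complex_of_real (AN (- N) (l + 1)) - db (l + 1) N * of_real (AN N (l + 1))
      = db l N * of_real (AN (- N) (l + 1) - AN N (l + 1)) - (db (l + 1) N - db l N) * of_real (AN N (l + 1))"
      by (simp add: algebra_simps)
    show "cmod (db l N * complex_of_real (AN (- N) (l + 1)) - db (l + 1) N * of_real (AN N (l + 1))) \<le> B"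
      unfolding eq2
      using norm_triangle_ineq4[of "db l N * of_real (AN (- N) (l + 1) - AN N (l + 1))" "(db (l + 1) N - db l N) * of_real (AN N (l + 1))"]
        1[OF N] ab[OF l N] nn unfolding B_def by linarith
    show "cmod (db l N) * \<bar>BN (- N) l - BN N l\<bar> \<le> B"
      using mix[OF l N c2(2)[OF l N' N] c2(1)] nn unfolding B_def by linarith
  qed
qed

text \<open>For the raising and lowering parts no cancellation is used: every product of an entry of
  order \<open>q^(-l)\<close> or \<open>q^(-l-1)\<close> with \<open>alphaN\<close> at
  \<open>l + 1\<close> is bounded by itself. Only the spin-preserving part relies on the difference
  of \<open>betaN\<close> in \<open>N\<close>.\<close>

lemma commutator_case_ii:
  assumes bl: "dirac_blocks D V u d" and t: "t = 1"
    and C: "\<And>l. l \<in> half_spins \<Longrightarrow> \<bar>d l\<bar> < C * q powr (- l) \<and> \<bar>u l\<bar> < C * q powr (- l)"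
  shows "bounded_commutator D (xop x)"
proof -
  interpret dirac_blocks D V u d by (rule bl)
  obtain c where c: "0 \<le> c" "\<And>l N. l \<in> half_spins \<Longrightarrow> N \<in> {- 1 / 2, 1 / 2} \<Longrightarrow> \<bar>AN N l\<bar> \<le> c * q powr l"
    using alphaN_bound_t1[OF t] by blast
  obtain c2 where c2: "0 \<le> c2" "\<And>l N N'. l \<in> half_spins \<Longrightarrow> N \<in> {- 1 / 2, 1 / 2} \<Longrightarrow> N' \<in> {- 1 / 2, 1 / 2} \<Longrightarrow>
    \<bar>BN N l - BN N' l\<bar> \<le> c2 * q powr (2 * l)" using betaN_diff_bound by blast
  have half: "1 / 2 \<in> half_spins" unfolding half_spins_def by (auto intro!: exI[of _ 0])
  have C0: "0 \<le> C"
  proof -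
    have "0 < C * q powr (- (1 / 2))" using C[OF half] by linarith
    moreover have "0 < q powr (- (1 / 2))" using q0 by simp
    ultimately show ?thesis by (simp add: zero_less_mult_iff)
  qed
  have e: "cmod (da l N) \<le> 2 * C * q powr (- l)" "cmod (db l N) \<le> 2 * C * q powr (- l)" if "l \<in> half_spins" for l N
    using entries_le[OF that, of N] C[OF that] by linarith+
  have mix: "cmod z * \<bar>r\<bar> \<le> 2 * C * k" if "cmod z \<le> 2 * C * q powr (- i)" "\<bar>r\<bar> \<le> k * q powr j" "i \<le> j" "0 \<le> k" for z r k i j
  proof -
    have "cmod z * \<bar>r\<bar> \<le> (2 * C * q powr (- i)) * (k * q powr j)"
      using that order_trans[OF norm_ge_zero that(1)] by (intro mult_mono) auto
    also have "\<dots> = 2 * C * k * (q powr (- i) * q powr j)" by (simp only: ac_simps)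
    also have "\<dots> = 2 * C * k * q powr (j - i)" by (simp flip: powr_add)
    also have "\<dots> \<le> 2 * C * k * 1" using powr_q_le1[of "j - i"] that C0 by (intro mult_left_mono) auto
    finally show ?thesis by simp
  qed
  define B where "B = 4 * C * c + 2 * C * c2"
  have nn: "0 \<le> C * c" "0 \<le> C * c2" using C0 c(1) c2(1) by simp_all
  show ?thesis
  proof (rule bounded_commutator_xop[OF block_operator_axioms, where B = B])
    show "0 \<le> B" unfolding B_def using nn by linarith
    fix l N :: real assume l: "l \<in> half_spins" and N: "N \<in> {- 1 / 2, 1 / 2}"
    have N': "- N \<in> {- 1 / 2, 1 / 2}" using N by auto
    note l' = half_spins_Suc[OF l]
    have le: "l \<le> l + 1" "l + 1 \<le> l + 1" "l \<le> 2 * l" using half_spins_ge[OF l] by simp_all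
    have "cmod (da (l + 1) N - da l N) * \<bar>AN N (l + 1)\<bar> \<le> (cmod (da (l + 1) N) + cmod (da l N)) * \<bar>AN N (l + 1)\<bar>"
      by (intro mult_right_mono norm_triangle_ineq4) simp
    also have "\<dots> = cmod (da (l + 1) N) * \<bar>AN N (l + 1)\<bar> + cmod (da l N) * \<bar>AN N (l + 1)\<bar>" by (rule distrib_right)
    also have "\<dots> \<le> 2 * C * c + 2 * C * c" by (intro add_mono mix[OF e(1)[OF l'] c(2)[OF l' N] le(2) c(1)] mix[OF e(1)[OF l] c(2)[OF l' N] le(1) c(1)])
    finally show "cmod (da (l + 1) N - da l N) * \<bar>AN N (l + 1)\<bar> \<le> B" using nn unfolding B_def by linarith
    have 1: "cmod (db (l + 1) N * of_real (AN M (l + 1))) \<le> 2 * C * c" "cmod (db l N * of_real (AN M (l + 1))) \<le> 2 * C * c"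
      if "M \<in> {- 1 / 2, 1 / 2}" for M
      unfolding norm_mult norm_of_real
      by (rule mix[OF e(2)[OF l'] c(2)[OF l' that] le(2) c(1)] mix[OF e(2)[OF l] c(2)[OF l' that] le(1) c(1)])+
    show "cmod (db (l + 1) N * complex_of_real (AN (- N) (l + 1)) - db l N * of_real (AN N (l + 1))) \<le> B"
      using norm_triangle_ineq4[of "db (l + 1) N * complex_of_real (AN (- N) (l + 1))" "db l N * of_real (AN N (l + 1))"]
        1(1)[OF N'] 1(2)[OF N] nn unfolding B_def by linarith
    show "cmod (db l N * complex_of_real (AN (- N) (l + 1)) - db (l + 1) N * of_real (AN N (l + 1))) \<le> B"
      using norm_triangle_ineq4[of "db l N * complex_of_real (AN (- N) (l + 1))" "db (l + 1) N * of_real (AN N (l + 1))"]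
        1(2)[OF N'] 1(1)[OF N] nn unfolding B_def by linarith
    have "cmod (db l N) * \<bar>BN (- N) l - BN N l\<bar> \<le> 2 * C * c2" by (rule mix[OF e(2)[OF l] c2(2)[OF l N' N] le(3) c2(1)])
    then show "cmod (db l N) * \<bar>BN (- N) l - BN N l\<bar> \<le> B" using nn unfolding B_def by linarith
  qed
qed

lemma equivariant_spectral_triple:
  assumes bl: "dirac_blocks D V u d" and eq: "equivariant_operator q D"
    and "filterlim (\<lambda>n. \<bar>u (real n + 1 / 2)\<bar>) at_top sequentially"
    and "filterlim (\<lambda>n. \<bar>d (real n + 1 / 2)\<bar>) at_top sequentially"
    and x: "\<And>x. bounded_commutator D (xop x)"
  shows "equivariant_spectral_triple q t D"
proof -
  interpret dirac_blocks D V u d by (rule bl)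
  have "compact_resolvent D" by (rule compact_resolvent[OF assms(3,4)])
  moreover have "bounded_commutator D (spinor_rep q t A)" if "A \<in> carrier QS" for A
    using that bounded_commutator_fr[OF lin x] by (auto simp: QS_simps spinor_rep_cls)
  ultimately show ?thesis
    unfolding equivariant_spectral_triple_def spectral_triple_def
    using star_algebra_QS star_representation_QS inj_on_QS self_adj equivariant_representation_spinor_rep
      \<W>_subset_Domain \<W>_invariant eq by blast
qed

end

theorem proposition5p1:
  fixes q t :: real and D :: "(spinor \<times> spinor) set"
  assumes "0 < q" and "q < 1" and "0 \<le> t" and "t \<le> 1"
    and "self_adjoint D"
    and "equivariant_operator q D"
    and "strongly_commute D (closure (casimir_operator q))"
  shows "(\<forall>l \<in> half_spins. \<forall>m \<in> weights l. \<W>\<^sub>l\<^sub>m l m \<subseteq> Domain D \<and> D `` \<W>\<^sub>l\<^sub>m l m \<subseteq> \<W>\<^sub>l\<^sub>m l m) \<and>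
    (\<exists>U d_up d_down. block_form D U d_up d_down) \<and>
    (\<forall>U d_up d_down. block_form D U d_up d_down \<longrightarrow>
      filterlim (\<lambda>n. \<bar>d_up (real n + 1 / 2)\<bar>) at_top sequentially \<longrightarrow>
      filterlim (\<lambda>n. \<bar>d_down (real n + 1 / 2)\<bar>) at_top sequentially \<longrightarrow>
      (t \<noteq> 1 \<and> (\<exists>C. \<forall>l \<in> half_spins.
          onorm ((*v) (dirac_matrix U d_up d_down (l + 1) - dirac_matrix U d_up d_down l)) < C)
       \<or> t = 1 \<and> (\<exists>C. \<forall>l \<in> half_spins.
          \<bar>d_down l\<bar> < C * q powr (- l) \<and> \<bar>d_up l\<bar> < C * q powr (- l))) \<longrightarrow>
      equivariant_spectral_triple q t D)"
proof -
  interpret podles q t using assms(1-4) by unfold_locales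
  obtain P Q where PQ: "spectral_measure P D" "spectral_measure Q (closure (casimir_operator q))"
    and c: "\<forall>M \<in> sets borel. \<forall>N \<in> sets borel. P M \<circ> Q N = Q N \<circ> P M"
    using assms(7) unfolding strongly_commute_def by blast
  interpret equivariant_dirac q t D P Q
  proof
    fix M N :: "real set" and x assume "M \<in> sets borel" "N \<in> sets borel"
    then have "P M \<circ> Q N = Q N \<circ> P M" using c by blast
    from fun_cong[OF this, of x] show "P M (Q N x) = Q N (P M x)" by simp
  qed (fact assms PQ)+
  have 2: "\<exists>U d_up d_down. block_form D U d_up d_down" by (rule block_form_exists)
  \<comment> \<open>\<open>block_matrix_pair\<close> exhibits an image inside the space for every
    vector, and single-valuedness of \<open>D\<close> excludes any other.\<close>
  have 1: "\<W>\<^sub>l\<^sub>m l m \<subseteq> Domain D \<and> D `` \<W>\<^sub>l\<^sub>m l m \<subseteq> \<W>\<^sub>l\<^sub>m l m" if "l \<in> half_spins" "m \<in> weights l" for l m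
    using block_matrix_pair[OF that] SP.G_unique unfolding \<W>\<^sub>l\<^sub>m_def by blast
  have 3: "equivariant_spectral_triple q t D"
    if b: "block_form D V u d" and lim: "filterlim (\<lambda>n. \<bar>u (real n + 1 / 2)\<bar>) at_top sequentially"
      "filterlim (\<lambda>n. \<bar>d (real n + 1 / 2)\<bar>) at_top sequentially"
      and C: "t \<noteq> 1 \<and> (\<exists>C. \<forall>l \<in> half_spins. onorm ((*v) (dirac_matrix V u d (l + 1) - dirac_matrix V u d l)) < C)
       \<or> t = 1 \<and> (\<exists>C. \<forall>l \<in> half_spins. \<bar>d l\<bar> < C * q powr (- l) \<and> \<bar>u l\<bar> < C * q powr (- l))" for V u d
  proof -
    have bl: "dirac_blocks D V u d" using assms(5) b by unfold_locales
    have "bounded_commutator D (xop x)" for x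
      using C
    proof (elim disjE conjE exE)
      fix C assume "t \<noteq> 1" "\<forall>l \<in> half_spins. onorm ((*v) (dirac_matrix V u d (l + 1) - dirac_matrix V u d l)) < C"
      then show ?thesis using commutator_case_i[OF bl] by blast
    next
      fix C assume "t = 1" "\<forall>l \<in> half_spins. \<bar>d l\<bar> < C * q powr (- l) \<and> \<bar>u l\<bar> < C * q powr (- l)"
      then show ?thesis using commutator_case_ii[OF bl] by blast
    qed
    then show ?thesis by (rule equivariant_spectral_triple[OF bl assms(6) lim])
  qed
  show ?thesis
    by (intro conjI ballI allI impI 2 3; (elim conjE; assumption)?; (use 1 in blast)?; assumption?)
qed

end
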